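(* Let $\{X_k,\;k\in\mathbb{Z}\}$ be a strictly stationary sequence of random variables, each uniformly distributed on $[0,1]$, which is associated. Assume condition (SI): for all $k\neq l\in\mathbb{Z}$, $X_k$ is stochastically increasing in $X_l$ and $X_l$ is stochastically increasing in $X_k$. Suppose that there exist constants $C>0$ and $\alpha>(5+\sqrt{17})/4$ such that $$\mathrm{cov}(X_0,X_k)\leqslant Ck^{-\alpha},\qquad k\in\mathbb{N}.$$ For $n\in\mathbb{N}$ define $$G_n(x)=\frac{1}{\sqrt{n}}\sum_{i=1}^n\left(\mathbb{I}\{X_i\leqslant x\}-\mathsf{P}(X_i\leqslant x)\right),\qquad x\in\mathbb{R}.$$ Then the random processes $G_n$ (restricted to $[0,1]$) converge weakly in the Skorokhod space $D([0,1])$ to a centered Gaussian process $G$ with covariance function $$\mathrm{cov}(G(x),G(y))=\sum_{k\in\mathbb{Z}}\mathrm{cov}\big(\mathbb{I}\{X_0\leqslant x\},\,\mathbb{I}\{X_k\leqslant y\}\big),\qquad x,y\in[0,1].$$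
   Context: A family of random variables $\{X_t,\;t\in T\}$ is called associated if for any finite $I,J\subset T$ and any bounded coordinate-wise nondecreasing functions $f:\mathbb{R}^{|I|}\to\mathbb{R}$, $g:\mathbb{R}^{|J|}\to\mathbb{R}$ one has $\mathrm{cov}(f(X_i,\,i\in I),\,g(X_j,\,j\in J))\geqslant 0$. For real random variables $X,Y$, $X$ is said to be stochastically increasing in $Y$ if $\mathsf{P}(X>x\mid Y=y)$ is a nondecreasing function of $y\in\mathbb{R}$ for every $x\in\mathbb{R}$. *)

theory Defs
  imports "HOL-Probability.Probability"
begin

definition cov :: "'a measure \<Rightarrow> ('a \<Rightarrow> real) \<Rightarrow> ('a \<Rightarrow> real) \<Rightarrow> real" where
  "cov M U V = (\<integral>\<omega>. U \<omega> * V \<omega> \<partial>M) - (\<integral>\<omega>. U \<omega> \<partial>M) * (\<integral>\<omega>. V \<omega> \<partial>M)"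

definition ind :: "bool \<Rightarrow> real" where
  "ind b = (if b then 1 else 0)"

definition strictly_stationary :: "'a measure \<Rightarrow> (int \<Rightarrow> 'a \<Rightarrow> real) \<Rightarrow> bool" where
  "strictly_stationary M X \<longleftrightarrow>
     (\<forall>I h. finite I \<longrightarrow>
        distr M (Pi\<^sub>M I (\<lambda>_. borel)) (\<lambda>\<omega>. \<lambda>i\<in>I. X (i + h) \<omega>)
      = distr M (Pi\<^sub>M I (\<lambda>_. borel)) (\<lambda>\<omega>. \<lambda>i\<in>I. X i \<omega>))"

definition coord_mono :: "int set \<Rightarrow> ((int \<Rightarrow> real) \<Rightarrow> real) \<Rightarrow> bool" where
  "coord_mono I f \<longleftrightarrow>
     (\<forall>x y. (\<forall>i\<in>I. x i \<le> y i) \<longrightarrow> f (restrict x I) \<le> f (restrict y I))"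

definition associated :: "'a measure \<Rightarrow> (int \<Rightarrow> 'a \<Rightarrow> real) \<Rightarrow> bool" where
  "associated M X \<longleftrightarrow>
     (\<forall>I J f g. finite I \<longrightarrow> finite J \<longrightarrow>
        f \<in> borel_measurable (Pi\<^sub>M I (\<lambda>_. borel)) \<longrightarrow>
        g \<in> borel_measurable (Pi\<^sub>M J (\<lambda>_. borel)) \<longrightarrow>
        bounded (range f) \<longrightarrow> bounded (range g) \<longrightarrow>
        coord_mono I f \<longrightarrow> coord_mono J g \<longrightarrow>
        cov M (\<lambda>\<omega>. f (\<lambda>i\<in>I. X i \<omega>)) (\<lambda>\<omega>. g (\<lambda>j\<in>J. X j \<omega>)) \<ge> 0)"

(* U is stochastically increasing in V: for every x, there is a version
   y \<mapsto> phi y of P(U > x | V = y) which is nondecreasing in y *)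
definition stoch_increasing :: "'a measure \<Rightarrow> ('a \<Rightarrow> real) \<Rightarrow> ('a \<Rightarrow> real) \<Rightarrow> bool" where
  "stoch_increasing M U V \<longleftrightarrow>
     (\<forall>x::real. \<exists>\<phi>::real \<Rightarrow> real. mono \<phi> \<and> \<phi> \<in> borel_measurable borel \<and>
        (\<forall>B\<in>sets borel.
           (\<integral>\<omega>. ind (U \<omega> > x) * ind (V \<omega> \<in> B) \<partial>M)
         = (\<integral>\<omega>. \<phi> (V \<omega>) * ind (V \<omega> \<in> B) \<partial>M)))"

definition cadlag01 :: "(real \<Rightarrow> real) \<Rightarrow> bool" where
  "cadlag01 f \<longleftrightarrow>
     (\<forall>t\<in>{0..<1}. (f \<longlongrightarrow> f t) (at_right t)) \<and>
     (\<forall>t\<in>{0<..1}. \<exists>l. (f \<longlongrightarrow> l) (at_left t))"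

definition time_changes :: "(real \<Rightarrow> real) set" where
  "time_changes = {r. strict_mono_on {0..1} r \<and> continuous_on {0..1} r \<and> r ` {0..1} = {0..1}}"

definition skorokhod_dist :: "(real \<Rightarrow> real) \<Rightarrow> (real \<Rightarrow> real) \<Rightarrow> real" where
  "skorokhod_dist f g = Inf {\<epsilon>. \<exists>r\<in>time_changes.
       (\<forall>t\<in>{0..1}. \<bar>r t - t\<bar> \<le> \<epsilon>) \<and> (\<forall>t\<in>{0..1}. \<bar>f t - g (r t)\<bar> \<le> \<epsilon>)}"

definition skorokhod_continuous :: "((real \<Rightarrow> real) \<Rightarrow> real) \<Rightarrow> bool" where
  "skorokhod_continuous h \<longleftrightarrow>
     (\<forall>f. cadlag01 f \<longrightarrow> (\<forall>\<epsilon>>0. \<exists>\<delta>>0. \<forall>g. cadlag01 g \<longrightarrow>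
         skorokhod_dist f g < \<delta> \<longrightarrow> \<bar>h g - h f\<bar> < \<epsilon>))"

definition weak_conv_D :: "'a measure \<Rightarrow> (nat \<Rightarrow> 'a \<Rightarrow> real \<Rightarrow> real) \<Rightarrow>
                           'b measure \<Rightarrow> ('b \<Rightarrow> real \<Rightarrow> real) \<Rightarrow> bool" where
  "weak_conv_D M Z N W \<longleftrightarrow>
     (\<forall>h. (\<exists>B. \<forall>f. cadlag01 f \<longrightarrow> \<bar>h f\<bar> \<le> B) \<longrightarrow> skorokhod_continuous h \<longrightarrow>
        (\<lambda>n. \<integral>\<omega>. h (Z n \<omega>) \<partial>M) \<longlonglongrightarrow> (\<integral>\<omega>. h (W \<omega>) \<partial>N))"

(* centered Gaussian process on [0,1] with covariance K: every finite linear
   combination is N(0, sum c_x c_y K x y) (degenerate allowed), via char. functions *)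
definition centered_gaussian_process ::
  "'b measure \<Rightarrow> ('b \<Rightarrow> real \<Rightarrow> real) \<Rightarrow> (real \<Rightarrow> real \<Rightarrow> real) \<Rightarrow> bool" where
  "centered_gaussian_process N W K \<longleftrightarrow>
     (\<forall>x\<in>{0..1}. (\<lambda>\<omega>. W \<omega> x) \<in> borel_measurable N) \<and>
     (\<forall>S c t. finite S \<longrightarrow> S \<subseteq> {0..1} \<longrightarrow>
        char (distr N borel (\<lambda>\<omega>. \<Sum>x\<in>S. c x * W \<omega> x)) t
        = complex_of_real (exp (- (t\<^sup>2 / 2) * (\<Sum>x\<in>S. \<Sum>y\<in>S. c x * c y * K x y))))"

definition emp_proc :: "'a measure \<Rightarrow> (int \<Rightarrow> 'a \<Rightarrow> real) \<Rightarrow> nat \<Rightarrow> 'a \<Rightarrow> real \<Rightarrow> real" where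
  "emp_proc M X n \<omega> x = (1 / sqrt (real n)) *
     (\<Sum>i=1..n. ind (X (int i) \<omega> \<le> x) - measure M {\<omega>'\<in>space M. X (int i) \<omega>' \<le> x})"

end

theory Submission
  imports Defs
begin

text \<open>For uniform variables, stochastic monotonicity gives
  \<open>cov (ind (X k \<le> x)) (ind (X l \<le> y)) \<le> 4 cov (X k) (X l)\<close>, so the indicator covariances decay like
  \<open>k powr (- \<alpha>)\<close>; in particular the limiting covariance converges and is Hoelder continuous. Newman's
  inequality for associated families bounds the distance between the characteristic function of a
  sum of blocks and the product of those of the blocks by such covariances. With blocks of length
  \<open>n powr (1/4)\<close> this yields the central limit theorem for linear combinations. With every second
  block of length \<open>n powr b\<close> it replaces a fourth moment inequality for increments, and chaining over
  dyadic levels gives asymptotic equicontinuity; a suitable \<open>b\<close> exists exactly when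
  \<open>2 \<alpha>\<^sup>2 - 5 \<alpha> + 1 > 0\<close>, that is \<open>\<alpha> > (5 + sqrt 17) / 4\<close>.\<close>

section \<open>Bounded random variables and characteristic functions\<close>

text \<open>Within a dyadic cell of length 2^(-l) the empirical process moves by at most its
  increment over the cell plus the drift sqrt n / 2^l, so chaining may stop when 2^l is of order
  sqrt n. A union bound over the 2^l increments of level l has to beat three errors, up to a factor
  2^(4 \<kappa> l): m powr (-p) from dependence between blocks of length m, (m^2 / n) 2^(-l
  \<theta>) from the size of a block, and 2^(-2 l \<theta>) from the squared variance. Here p <
  \<alpha> - 1, because a decay q = \<alpha> - p > 1 is spent on a sum over indices, and \<theta> <
  1 - 1/\<alpha>, because interpolating a covariance between the interval length and k powr
  (-\<alpha>) must leave a summable series. At 2^l = sqrt n and m = n powr b the first two errors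
  vanish iff 1 / (2 p) < b < (1 + \<theta>) / 4, so p (1 + \<theta>) > 2 is needed; at the endpoints
  this reads (\<alpha> - 1) (2 - 1/\<alpha>) > 2, the quadratic condition on \<alpha>. The third
  error needs \<theta> > 1/2, which already \<alpha> > 2 permits.\<close>

definition brv :: "'a measure \<Rightarrow> ('a \<Rightarrow> real) \<Rightarrow> bool" where
  "brv M f \<longleftrightarrow> f \<in> borel_measurable M \<and> (\<exists>B. \<forall>\<omega>. \<bar>f \<omega>\<bar> \<le> B)"

lemma brvI: "f \<in> borel_measurable M \<Longrightarrow> (\<And>\<omega>. \<bar>f \<omega>\<bar> \<le> B) \<Longrightarrow> brv M f"
  unfolding brv_def by blast

lemma brv_measurable [measurable_dest]: "brv M f \<Longrightarrow> f \<in> borel_measurable M"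
  unfolding brv_def by blast

lemma brv_const [simp]: "brv M (\<lambda>_. c)"
  by (rule brvI[where B="\<bar>c\<bar>"]) auto

lemma brv_add: assumes "brv M f" "brv M g" shows "brv M (\<lambda>\<omega>. f \<omega> + g \<omega>)"
proof -
  obtain A B where "\<And>\<omega>. \<bar>f \<omega>\<bar> \<le> A" "\<And>\<omega>. \<bar>g \<omega>\<bar> \<le> B" using assms unfolding brv_def by blast
  then have "\<bar>f \<omega> + g \<omega>\<bar> \<le> A + B" for \<omega> by (meson abs_triangle_ineq add_mono order_trans)
  then show ?thesis using assms by (intro brvI[where B="A+B"]) (auto simp: brv_def)
qed

lemma brv_mult: assumes "brv M f" "brv M g" shows "brv M (\<lambda>\<omega>. f \<omega> * g \<omega>)"
proof -
  obtain A B where *: "\<And>\<omega>. \<bar>f \<omega>\<bar> \<le> A" "\<And>\<omega>. \<bar>g \<omega>\<bar> \<le> B" using assms unfolding brv_def by blast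
  have "\<bar>f \<omega> * g \<omega>\<bar> \<le> A * B" for \<omega>
    unfolding abs_mult by (intro mult_mono) (use *[of \<omega>] in auto)
  then show ?thesis using assms by (intro brvI[where B="A*B"]) (auto simp: brv_def)
qed

lemma brv_minus: "brv M f \<Longrightarrow> brv M (\<lambda>\<omega>. - f \<omega>)"
  using brv_mult[of M "\<lambda>_. -1" f] by simp

lemma brv_diff: "brv M f \<Longrightarrow> brv M g \<Longrightarrow> brv M (\<lambda>\<omega>. f \<omega> - g \<omega>)"
  using brv_add[of M f "\<lambda>\<omega>. - g \<omega>"] brv_minus[of M g] by simp

lemma brv_divide: "brv M f \<Longrightarrow> brv M (\<lambda>\<omega>. f \<omega> / c)"
  using brv_mult[of M f "\<lambda>_. 1 / c"] by simp

lemma brv_sum: "(\<And>i. i \<in> A \<Longrightarrow> brv M (f i)) \<Longrightarrow> brv M (\<lambda>\<omega>. \<Sum>i\<in>A. f i \<omega>)"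
  by (induction A rule: infinite_finite_induct) (auto intro: brv_add)

lemma brv_power: "brv M f \<Longrightarrow> brv M (\<lambda>\<omega>. f \<omega> ^ k)"
  by (induction k) (auto intro: brv_mult)

lemma brv_cos: "f \<in> borel_measurable M \<Longrightarrow> brv M (\<lambda>\<omega>. cos (f \<omega>))"
  by (rule brvI[where B=1]) auto

lemma brv_sin: "f \<in> borel_measurable M \<Longrightarrow> brv M (\<lambda>\<omega>. sin (f \<omega>))"
  by (rule brvI[where B=1]) auto

lemma brv_ind: "Measurable.pred M P \<Longrightarrow> brv M (\<lambda>\<omega>. ind (P \<omega>))"
  by (rule brvI[where B=1]) (auto simp: ind_def)

lemmas brv_intros = brv_const brv_add brv_mult brv_minus brv_diff brv_divide brv_sum brv_power

lemma ind_simps [simp]: "ind True = 1" "ind False = 0"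
  by (auto simp: ind_def)

lemma ind_nonneg [simp]: "0 \<le> ind b" and ind_le_1 [simp]: "ind b \<le> 1" and abs_ind [simp]: "\<bar>ind b\<bar> = ind b"
  by (auto simp: ind_def)

lemma ind_measurable [measurable]: "Measurable.pred M P \<Longrightarrow> (\<lambda>\<omega>. ind (P \<omega>)) \<in> borel_measurable M"
  unfolding ind_def by measurable

lemma cov_commute: "cov M f g = cov M g f"
  by (simp add: cov_def mult.commute)

context prob_space
begin

lemma brv_integrable [intro]: "brv M f \<Longrightarrow> integrable M f"
  unfolding brv_def by (elim conjE exE) (rule integrable_const_bound, auto)

lemma cov_add_left: "brv M f \<Longrightarrow> brv M g \<Longrightarrow> brv M h \<Longrightarrow> cov M (\<lambda>\<omega>. f \<omega> + g \<omega>) h = cov M f h + cov M g h"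
  unfolding cov_def
  by (simp add: distrib_right brv_integrable brv_mult)

lemma cov_cmult_left: "cov M (\<lambda>\<omega>. c * f \<omega>) h = c * cov M f h"
  unfolding cov_def by (simp add: mult.assoc right_diff_distrib)

lemma cov_minus_left: "cov M (\<lambda>\<omega>. - f \<omega>) h = - cov M f h"
  using cov_cmult_left[of "-1" f h] by simp

lemma cov_diff_left: "brv M f \<Longrightarrow> brv M g \<Longrightarrow> brv M h \<Longrightarrow> cov M (\<lambda>\<omega>. f \<omega> - g \<omega>) h = cov M f h - cov M g h"
  using cov_add_left[of f "\<lambda>\<omega>. - g \<omega>" h] by (simp add: cov_minus_left brv_minus)

lemma cov_const_left [simp]: "cov M (\<lambda>_. c) h = 0"
  unfolding cov_def by (simp add: prob_space)

lemma cov_sum_left: "(\<And>i. i \<in> A \<Longrightarrow> brv M (f i)) \<Longrightarrow> brv M h \<Longrightarrow>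
    cov M (\<lambda>\<omega>. \<Sum>i\<in>A. f i \<omega>) h = (\<Sum>i\<in>A. cov M (f i) h)"
proof (induction A rule: infinite_finite_induct)
  case (insert x F)
  then show ?case by (simp add: cov_add_left brv_sum)
qed auto

lemma cov_cmult_right: "cov M h (\<lambda>\<omega>. c * f \<omega>) = c * cov M h f"
  by (simp add: cov_commute[of M h] cov_cmult_left)

lemma cov_minus_right: "cov M h (\<lambda>\<omega>. - f \<omega>) = - cov M h f"
  by (simp add: cov_commute[of M h] cov_minus_left)

lemma cov_diff_right: "brv M f \<Longrightarrow> brv M g \<Longrightarrow> brv M h \<Longrightarrow> cov M h (\<lambda>\<omega>. f \<omega> - g \<omega>) = cov M h f - cov M h g"
  by (simp add: cov_commute[of M h] cov_diff_left)

lemma cov_const_right [simp]: "cov M h (\<lambda>_. c) = 0"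
  by (simp add: cov_commute[of M h])

lemma cov_sum_right: "(\<And>i. i \<in> A \<Longrightarrow> brv M (f i)) \<Longrightarrow> brv M h \<Longrightarrow>
    cov M h (\<lambda>\<omega>. \<Sum>i\<in>A. f i \<omega>) = (\<Sum>i\<in>A. cov M h (f i))"
  by (simp add: cov_commute[of M h] cov_sum_left)

lemma cov_sum_sum:
  assumes "\<And>i. i \<in> A \<Longrightarrow> brv M (f i)" "\<And>j. j \<in> B \<Longrightarrow> brv M (g j)"
  shows "cov M (\<lambda>\<omega>. \<Sum>i\<in>A. f i \<omega>) (\<lambda>\<omega>. \<Sum>j\<in>B. g j \<omega>) = (\<Sum>i\<in>A. \<Sum>j\<in>B. cov M (f i) (g j))"
  using assms by (simp add: cov_sum_left cov_sum_right brv_sum)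

text \<open>Both the mean of the product and the product of the means are at most \<open>B\<close>
  times the first absolute moment of \<open>f\<close>, whence the factor 2. Indicators of short
  intervals therefore have small covariance with any bounded variable.\<close>

lemma abs_cov_le:
  assumes "brv M f" "brv M g" "\<And>\<omega>. \<bar>g \<omega>\<bar> \<le> B"
  shows "\<bar>cov M f g\<bar> \<le> 2 * B * (\<integral>\<omega>. \<bar>f \<omega>\<bar> \<partial>M)"
proof -
  have B: "0 \<le> B" using assms(3)[of undefined] by linarith
  have i: "integrable M (\<lambda>\<omega>. \<bar>f \<omega>\<bar>)" using assms by auto
  have "\<bar>\<integral>\<omega>. f \<omega> * g \<omega> \<partial>M\<bar> \<le> (\<integral>\<omega>. \<bar>f \<omega> * g \<omega>\<bar> \<partial>M)" by (rule integral_abs_bound)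
  also have "\<dots> \<le> (\<integral>\<omega>. B * \<bar>f \<omega>\<bar> \<partial>M)"
  proof (rule integral_mono)
    show "integrable M (\<lambda>\<omega>. \<bar>f \<omega> * g \<omega>\<bar>)" using assms by (intro integrable_abs brv_integrable brv_mult)
    show "\<bar>f \<omega> * g \<omega>\<bar> \<le> B * \<bar>f \<omega>\<bar>" for \<omega>
      using mult_left_mono[OF assms(3)[of \<omega>], of "\<bar>f \<omega>\<bar>"] by (simp add: abs_mult mult.commute)
  qed (use i in auto)
  finally have 1: "\<bar>\<integral>\<omega>. f \<omega> * g \<omega> \<partial>M\<bar> \<le> B * (\<integral>\<omega>. \<bar>f \<omega>\<bar> \<partial>M)" by simp
  have "\<bar>\<integral>\<omega>. g \<omega> \<partial>M\<bar> \<le> (\<integral>\<omega>. \<bar>g \<omega>\<bar> \<partial>M)" by (rule integral_abs_bound)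
  also have "\<dots> \<le> (\<integral>\<omega>. B \<partial>M)" using assms by (intro integral_mono) auto
  finally have g: "\<bar>\<integral>\<omega>. g \<omega> \<partial>M\<bar> \<le> B" by (simp add: prob_space)
  have "\<bar>\<integral>\<omega>. f \<omega> \<partial>M\<bar> \<le> (\<integral>\<omega>. \<bar>f \<omega>\<bar> \<partial>M)" by (rule integral_abs_bound)
  with g have 2: "\<bar>(\<integral>\<omega>. f \<omega> \<partial>M) * (\<integral>\<omega>. g \<omega> \<partial>M)\<bar> \<le> (\<integral>\<omega>. \<bar>f \<omega>\<bar> \<partial>M) * B"
    unfolding abs_mult by (intro mult_mono) auto
  show ?thesis using 1 2 unfolding cov_def by (simp add: algebra_simps)
qed

text \<open>The characteristic function at 1, kept in real and imaginary parts since association only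
  controls covariances of real functions.\<close>

definition cf :: "('a \<Rightarrow> real) \<Rightarrow> complex" where
  "cf U = Complex (\<integral>\<omega>. cos (U \<omega>) \<partial>M) (\<integral>\<omega>. sin (U \<omega>) \<partial>M)"

lemma integrable_cos [simp]: "(f :: 'a \<Rightarrow> real) \<in> borel_measurable M \<Longrightarrow> integrable M (\<lambda>\<omega>. cos (f \<omega>))"
  using brv_integrable[OF brv_cos] .

lemma integrable_sin [simp]: "(f :: 'a \<Rightarrow> real) \<in> borel_measurable M \<Longrightarrow> integrable M (\<lambda>\<omega>. sin (f \<omega>))"
  using brv_integrable[OF brv_sin] .

lemma cf_char:
  assumes [measurable]: "U \<in> borel_measurable M"
  shows "char (distr M borel U) t = cf (\<lambda>\<omega>. t * U \<omega>)"
proof -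
  have "char (distr M borel U) t = (CLINT \<omega>|M. iexp (t * U \<omega>))"
    unfolding char_def by (subst integral_distr) auto
  also have "\<dots> = cf (\<lambda>\<omega>. t * U \<omega>)"
  proof (rule complex_eqI)
    have i: "integrable M (\<lambda>\<omega>. iexp (t * U \<omega>))" by (rule integrable_iexp) auto
    have "Re (CLINT \<omega>|M. iexp (t * U \<omega>)) = (\<integral>\<omega>. Re (iexp (t * U \<omega>)) \<partial>M)"
      using i by (rule integral_Re[symmetric])
    then show "Re (CLINT \<omega>|M. iexp (t * U \<omega>)) = Re (cf (\<lambda>\<omega>. t * U \<omega>))" by (simp add: cf_def Re_exp)
    have "Im (CLINT \<omega>|M. iexp (t * U \<omega>)) = (\<integral>\<omega>. Im (iexp (t * U \<omega>)) \<partial>M)"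
      using i by (rule integral_Im[symmetric])
    then show "Im (CLINT \<omega>|M. iexp (t * U \<omega>)) = Im (cf (\<lambda>\<omega>. t * U \<omega>))" by (simp add: cf_def Im_exp)
  qed
  finally show ?thesis .
qed

lemma norm_cf_le_1:
  assumes "U \<in> borel_measurable M" shows "norm (cf U) \<le> 1"
proof -
  interpret D: real_distribution "distr M borel U" using assms by (rule real_distribution_distr)
  show ?thesis using D.cmod_char_le_1[of 1] cf_char[OF assms, of 1] by simp
qed

text \<open>By the addition theorems the real part of the difference is cov(cos, cos) - cov(sin,
  sin) and the imaginary part is cov(sin, cos) + cov(cos, sin); the four bounds add up.\<close>

lemma cf_add:
  assumes [measurable]: "S \<in> borel_measurable M" "U \<in> borel_measurable M"
    and "\<bar>cov M (\<lambda>\<omega>. cos (S \<omega>)) (\<lambda>\<omega>. cos (U \<omega>))\<bar> \<le> K" "\<bar>cov M (\<lambda>\<omega>. sin (S \<omega>)) (\<lambda>\<omega>. sin (U \<omega>))\<bar> \<le> K"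
     "\<bar>cov M (\<lambda>\<omega>. sin (S \<omega>)) (\<lambda>\<omega>. cos (U \<omega>))\<bar> \<le> K" "\<bar>cov M (\<lambda>\<omega>. cos (S \<omega>)) (\<lambda>\<omega>. sin (U \<omega>))\<bar> \<le> K"
  shows "norm (cf (\<lambda>\<omega>. S \<omega> + U \<omega>) - cf S * cf U) \<le> 4 * K"
proof -
  let ?c = "cov M"
  have e: "cf (\<lambda>\<omega>. S \<omega> + U \<omega>) - cf S * cf U =
    Complex (?c (\<lambda>\<omega>. cos (S \<omega>)) (\<lambda>\<omega>. cos (U \<omega>)) - ?c (\<lambda>\<omega>. sin (S \<omega>)) (\<lambda>\<omega>. sin (U \<omega>)))
      (?c (\<lambda>\<omega>. sin (S \<omega>)) (\<lambda>\<omega>. cos (U \<omega>)) + ?c (\<lambda>\<omega>. cos (S \<omega>)) (\<lambda>\<omega>. sin (U \<omega>)))"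
    by (rule complex_eqI)
      (auto simp: cf_def cov_def cos_add sin_add brv_integrable brv_mult brv_cos brv_sin)
  have n: "norm (Complex (a - b) (c + d)) \<le> 4 * K" if "\<bar>a\<bar> \<le> K" "\<bar>b\<bar> \<le> K" "\<bar>c\<bar> \<le> K" "\<bar>d\<bar> \<le> K" for a b c d
    using cmod_le[of "Complex (a - b) (c + d)"] that by simp
  show ?thesis unfolding e by (rule n) (use assms in auto)
qed

end

section \<open>Associated families\<close>

text \<open>The last clause says that both \<open>g - G\<close> and \<open>- g - G\<close> are
  nondecreasing. The majorant is taken nonincreasing because it will be a nonnegative combination of
  the functions \<open>ind (u \<le> x)\<close> of u.\<close>

definition dominated :: "(real \<Rightarrow> real) \<Rightarrow> (real \<Rightarrow> real) \<Rightarrow> bool" where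
  "dominated g G \<longleftrightarrow> g \<in> borel_measurable borel \<and> G \<in> borel_measurable borel \<and>
     bounded (range g) \<and> bounded (range G) \<and> (\<forall>u v. u \<le> v \<longrightarrow> \<bar>g u - g v\<bar> \<le> G u - G v)"

lemma bounded_range_real: "bounded (range f) \<longleftrightarrow> (\<exists>B. \<forall>x. \<bar>f x :: real\<bar> \<le> B)"
  by (auto simp: bounded_iff)

locale assoc_process = prob_space M for M :: "'a measure" +
  fixes X :: "int \<Rightarrow> 'a \<Rightarrow> real"
  assumes X_measurable [measurable]: "X k \<in> borel_measurable M"
    and assoc: "associated M X"
begin

lemma brv_X: "g \<in> borel_measurable borel \<Longrightarrow> bounded (range g) \<Longrightarrow> brv M (\<lambda>\<omega>. g (X i \<omega>))"
  by (auto simp: brv_def bounded_range_real)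

lemma brv_dominated:
  "dominated g G \<Longrightarrow> brv M (\<lambda>\<omega>. g (X i \<omega>))" "dominated g G \<Longrightarrow> brv M (\<lambda>\<omega>. G (X i \<omega>))"
  by (auto simp: dominated_def intro!: brv_X)

lemma brv_lipschitz:
  assumes "brv M f" "r \<in> borel_measurable borel" "\<And>x y. \<bar>r x - r y\<bar> \<le> \<bar>x - y :: real\<bar>"
  shows "brv M (\<lambda>\<omega>. r (f \<omega>))"
proof -
  obtain B where B: "\<And>\<omega>. \<bar>f \<omega>\<bar> \<le> B" and [measurable]: "f \<in> borel_measurable M" using assms(1) unfolding brv_def by blast
  have "\<bar>r (f \<omega>)\<bar> \<le> \<bar>r 0\<bar> + B" for \<omega> using assms(3)[of "f \<omega>" 0] B[of \<omega>] by linarith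
  then show ?thesis using assms(2) by (intro brvI[where B="\<bar>r 0\<bar> + B"]) auto
qed

text \<open>A 1-Lipschitz function of the sum of the \<open>g\<close>-values changes by at most the
  decrease of the sum of the \<open>G\<close>-values. Subtracting the latter makes it coordinatewise
  nondecreasing for either sign, so association applies.\<close>

lemma assoc_signed:
  assumes g: "dominated g G" and fin: "finite A" "finite B"
    and r: "r \<in> borel_measurable borel" "\<And>x y. \<bar>r x - r y\<bar> \<le> \<bar>x - y\<bar>"
    and q: "q \<in> borel_measurable borel" "\<And>x y. \<bar>q x - q y\<bar> \<le> \<bar>x - y\<bar>"
    and st: "\<bar>s\<bar> = 1" "\<bar>t\<bar> = (1::real)"
  shows "cov M (\<lambda>\<omega>. s * r (\<Sum>i\<in>A. g (X i \<omega>)) - (\<Sum>i\<in>A. G (X i \<omega>)))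
           (\<lambda>\<omega>. t * q (\<Sum>i\<in>B. g (X i \<omega>)) - (\<Sum>i\<in>B. G (X i \<omega>))) \<ge> 0"
proof -
  define h where "h A s r x = s * r (\<Sum>i\<in>A. g (x i)) - (\<Sum>i\<in>A. G (x i :: real))"
    for A :: "int set" and s :: real and r :: "real \<Rightarrow> real" and x :: "int \<Rightarrow> real"
  have [measurable]: "g \<in> borel_measurable borel" "G \<in> borel_measurable borel"
    using g by (auto simp: dominated_def)
  obtain b c where b: "\<And>x. \<bar>g x\<bar> \<le> b" and c: "\<And>x. \<bar>G x\<bar> \<le> c"
    using g by (auto simp: dominated_def bounded_range_real)
  have h: "h A s r \<in> borel_measurable (Pi\<^sub>M A (\<lambda>_. borel)) \<and> bounded (range (h A s r)) \<and> coord_mono A (h A s r)"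
    if fA: "finite A" and [measurable]: "r \<in> borel_measurable borel" and L: "\<And>x y. \<bar>r x - r y\<bar> \<le> \<bar>x - y\<bar>" and s: "\<bar>s\<bar> = 1"
    for A s r
  proof (intro conjI)
    show "h A s r \<in> borel_measurable (Pi\<^sub>M A (\<lambda>_. borel))"
      unfolding h_def by measurable
    have "\<bar>h A s r x\<bar> \<le> \<bar>r 0\<bar> + real (card A) * b + real (card A) * c" for x
    proof -
      have 1: "\<bar>\<Sum>i\<in>A. g (x i)\<bar> \<le> real (card A) * b"
        by (rule order_trans[OF sum_abs]) (use sum_bounded_above[of A "\<lambda>i. \<bar>g (x i)\<bar>" b] b in auto)
      have 2: "\<bar>\<Sum>i\<in>A. G (x i)\<bar> \<le> real (card A) * c"
        by (rule order_trans[OF sum_abs]) (use sum_bounded_above[of A "\<lambda>i. \<bar>G (x i)\<bar>" c] c in auto)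
      have "\<bar>s * r (\<Sum>i\<in>A. g (x i))\<bar> = \<bar>r (\<Sum>i\<in>A. g (x i))\<bar>" using s by (simp add: abs_mult)
      then have "\<bar>s * r (\<Sum>i\<in>A. g (x i))\<bar> \<le> \<bar>r 0\<bar> + real (card A) * b"
        using L[of "\<Sum>i\<in>A. g (x i)" 0] 1 by linarith
      with 2 show ?thesis unfolding h_def
        by (intro order_trans[OF abs_triangle_ineq4] add_mono)
    qed
    then show "bounded (range (h A s r))" unfolding bounded_range_real by blast
    show "coord_mono A (h A s r)"
      unfolding coord_mono_def
    proof (intro allI impI)
      fix x y :: "int \<Rightarrow> real" assume xy: "\<forall>i\<in>A. x i \<le> y i"
      have e: "h A s r (restrict z A) = h A s r z" for z unfolding h_def by simp
      have "\<bar>s * r (\<Sum>i\<in>A. g (x i)) - s * r (\<Sum>i\<in>A. g (y i))\<bar> = \<bar>r (\<Sum>i\<in>A. g (x i)) - r (\<Sum>i\<in>A. g (y i))\<bar>"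
        using s by (simp add: abs_mult flip: right_diff_distrib)
      also have "\<dots> \<le> \<bar>(\<Sum>i\<in>A. g (x i)) - (\<Sum>i\<in>A. g (y i))\<bar>" by (rule L)
      also have "\<dots> \<le> (\<Sum>i\<in>A. \<bar>g (x i) - g (y i)\<bar>)" by (simp add: sum_abs flip: sum_subtractf)
      also have "\<dots> \<le> (\<Sum>i\<in>A. G (x i) - G (y i))"
        using g xy by (intro sum_mono) (auto simp: dominated_def)
      also have "\<dots> = (\<Sum>i\<in>A. G (x i)) - (\<Sum>i\<in>A. G (y i))" by (simp add: sum_subtractf)
      finally show "h A s r (restrict x A) \<le> h A s r (restrict y A)" unfolding e by (simp add: h_def)
    qed
  qed
  have "cov M (\<lambda>\<omega>. h A s r (\<lambda>i\<in>A. X i \<omega>)) (\<lambda>\<omega>. h B t q (\<lambda>j\<in>B. X j \<omega>)) \<ge> 0"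
    using assoc h[OF fin(1) r st(1)] h[OF fin(2) q st(2)] fin unfolding associated_def by blast
  then show ?thesis unfolding h_def by simp
qed

text \<open>Newman's inequality. Expanding \<open>assoc_signed\<close> bilinearly gives one
  inequality for each pair of signs; adding those with equal signs, and those with opposite signs,
  cancels the mixed terms and leaves the two one-sided bounds.\<close>

lemma newman_cov:
  assumes g: "dominated g G" and fin: "finite A" "finite B"
    and r: "r \<in> borel_measurable borel" "\<And>x y. \<bar>r x - r y\<bar> \<le> \<bar>x - y\<bar>"
    and q: "q \<in> borel_measurable borel" "\<And>x y. \<bar>q x - q y\<bar> \<le> \<bar>x - y\<bar>"
  shows "\<bar>cov M (\<lambda>\<omega>. r (\<Sum>i\<in>A. g (X i \<omega>))) (\<lambda>\<omega>. q (\<Sum>i\<in>B. g (X i \<omega>)))\<bar>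
    \<le> (\<Sum>i\<in>A. \<Sum>j\<in>B. cov M (\<lambda>\<omega>. G (X i \<omega>)) (\<lambda>\<omega>. G (X j \<omega>)))"
proof -
  define R where "R = (\<lambda>\<omega>. r (\<Sum>i\<in>A. g (X i \<omega>)))"
  define Q where "Q = (\<lambda>\<omega>. q (\<Sum>i\<in>B. g (X i \<omega>)))"
  define F where "F = (\<lambda>\<omega>. \<Sum>i\<in>A. G (X i \<omega>))"
  define H where "H = (\<lambda>\<omega>. \<Sum>i\<in>B. G (X i \<omega>))"
  have b: "brv M R" "brv M Q" "brv M F" "brv M H"
    unfolding R_def Q_def F_def H_def
    by (intro brv_lipschitz[OF _ r] brv_lipschitz[OF _ q] brv_sum brv_dominated[OF g])+
  have c: "0 \<le> s * t * cov M R Q - s * cov M R H - t * cov M F Q + cov M F H" if "\<bar>s\<bar> = 1" "\<bar>t\<bar> = 1" for s t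
  proof -
    have "0 \<le> cov M (\<lambda>\<omega>. s * R \<omega> - F \<omega>) (\<lambda>\<omega>. t * Q \<omega> - H \<omega>)"
      using assoc_signed[OF g fin r q that] unfolding R_def Q_def F_def H_def .
    also have "\<dots> = s * t * cov M R Q - s * cov M R H - t * cov M F Q + cov M F H"
      by (simp add: cov_diff_left cov_diff_right cov_cmult_left cov_cmult_right b brv_intros algebra_simps)
    finally show ?thesis .
  qed
  have "cov M F H = (\<Sum>i\<in>A. \<Sum>j\<in>B. cov M (\<lambda>\<omega>. G (X i \<omega>)) (\<lambda>\<omega>. G (X j \<omega>)))"
    unfolding F_def H_def by (intro cov_sum_sum brv_dominated[OF g])
  then show ?thesis using c[of 1 1] c[of 1 "-1"] c[of "-1" 1] c[of "-1" "-1"] unfolding R_def Q_def by simp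
qed

lemma cov_dominated:
  assumes g: "dominated g G"
  shows "\<bar>cov M (\<lambda>\<omega>. g (X i \<omega>)) (\<lambda>\<omega>. g (X j \<omega>))\<bar> \<le> cov M (\<lambda>\<omega>. G (X i \<omega>)) (\<lambda>\<omega>. G (X j \<omega>))"
  using newman_cov[OF g, of "{i}" "{j}" "\<lambda>x. x" "\<lambda>x. x"] by simp

lemma abs_cos_diff_le: "\<bar>cos x - cos y\<bar> \<le> \<bar>x - y :: real\<bar>"
proof -
  have "\<bar>cos x - cos y\<bar> = 2 * (\<bar>sin ((x + y) / 2)\<bar> * \<bar>sin ((y - x) / 2)\<bar>)"
    by (simp add: cos_diff_cos abs_mult)
  also have "\<dots> \<le> 2 * (1 * \<bar>(y - x) / 2\<bar>)"
    by (intro mult_mono mult_left_mono abs_sin_x_le_abs_x) auto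
  finally show ?thesis by simp
qed

lemma abs_sin_diff_le: "\<bar>sin x - sin y\<bar> \<le> \<bar>x - y :: real\<bar>"
  using abs_cos_diff_le[of "x - pi/2" "y - pi/2"] by (simp add: cos_diff)

text \<open>Blocks are split off one at a time. The sum of the earlier blocks is again a sum over
  one finite index set, so Newman's inequality for cos and sin bounds the new error; the old error
  does not grow because the factor \<open>cf (U k)\<close> has modulus at most 1.\<close>

lemma cf_blocks:
  fixes Bl :: "nat \<Rightarrow> int set"
  assumes g: "dominated g G" and fin: "\<And>b. finite (Bl b)" and dis: "\<And>b c. b \<noteq> c \<Longrightarrow> Bl b \<inter> Bl c = {}"
  shows "norm (cf (\<lambda>\<omega>. \<Sum>b<k. \<Sum>i\<in>Bl b. g (X i \<omega>)) - (\<Prod>b<k. cf (\<lambda>\<omega>. \<Sum>i\<in>Bl b. g (X i \<omega>))))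
    \<le> 4 * (\<Sum>c<k. \<Sum>b<c. \<Sum>i\<in>Bl b. \<Sum>j\<in>Bl c. cov M (\<lambda>\<omega>. G (X i \<omega>)) (\<lambda>\<omega>. G (X j \<omega>)))"
proof (induction k)
  case 0
  have "cf (\<lambda>\<omega>. 0) = 1" by (rule complex_eqI) (auto simp: cf_def prob_space)
  then show ?case by simp
next
  case (Suc k)
  define U where "U b = (\<lambda>\<omega>. \<Sum>i\<in>Bl b. g (X i \<omega>))" for b
  define S where "S = (\<lambda>\<omega>. \<Sum>b<k. U b \<omega>)"
  define K where "K = (\<Sum>b<k. \<Sum>i\<in>Bl b. \<Sum>j\<in>Bl k. cov M (\<lambda>\<omega>. G (X i \<omega>)) (\<lambda>\<omega>. G (X j \<omega>)))"
  let ?A = "\<Union>b<k. Bl b"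
  have fA: "finite ?A" using fin by auto
  have S: "S = (\<lambda>\<omega>. \<Sum>i\<in>?A. g (X i \<omega>))"
    unfolding S_def U_def using fin dis by (subst sum.UNION_disjoint) auto
  have K: "K = (\<Sum>i\<in>?A. \<Sum>j\<in>Bl k. cov M (\<lambda>\<omega>. G (X i \<omega>)) (\<lambda>\<omega>. G (X j \<omega>)))"
    unfolding K_def using fin dis by (subst sum.UNION_disjoint) auto
  have meas [measurable]: "S \<in> borel_measurable M" "U b \<in> borel_measurable M" for b
    unfolding S U_def using g by (auto simp: dominated_def)
  have "norm (cf (\<lambda>\<omega>. S \<omega> + U k \<omega>) - cf S * cf (U k)) \<le> 4 * K"
    unfolding K
  proof (rule cf_add)
    have c: "\<bar>cov M (\<lambda>\<omega>. r (S \<omega>)) (\<lambda>\<omega>. q (U k \<omega>))\<bar> \<le> (\<Sum>i\<in>?A. \<Sum>j\<in>Bl k. cov M (\<lambda>\<omega>. G (X i \<omega>)) (\<lambda>\<omega>. G (X j \<omega>)))"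
      if "r = cos \<or> r = sin" "q = cos \<or> q = sin" for r q
      unfolding S U_def using that abs_cos_diff_le abs_sin_diff_le by (intro newman_cov[OF g fA fin]) auto
    show "\<bar>cov M (\<lambda>\<omega>. cos (S \<omega>)) (\<lambda>\<omega>. cos (U k \<omega>))\<bar> \<le> (\<Sum>i\<in>?A. \<Sum>j\<in>Bl k. cov M (\<lambda>\<omega>. G (X i \<omega>)) (\<lambda>\<omega>. G (X j \<omega>)))"
      by (rule c) auto
    show "\<bar>cov M (\<lambda>\<omega>. sin (S \<omega>)) (\<lambda>\<omega>. sin (U k \<omega>))\<bar> \<le> (\<Sum>i\<in>?A. \<Sum>j\<in>Bl k. cov M (\<lambda>\<omega>. G (X i \<omega>)) (\<lambda>\<omega>. G (X j \<omega>)))"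
      by (rule c) auto
    show "\<bar>cov M (\<lambda>\<omega>. sin (S \<omega>)) (\<lambda>\<omega>. cos (U k \<omega>))\<bar> \<le> (\<Sum>i\<in>?A. \<Sum>j\<in>Bl k. cov M (\<lambda>\<omega>. G (X i \<omega>)) (\<lambda>\<omega>. G (X j \<omega>)))"
      by (rule c) auto
    show "\<bar>cov M (\<lambda>\<omega>. cos (S \<omega>)) (\<lambda>\<omega>. sin (U k \<omega>))\<bar> \<le> (\<Sum>i\<in>?A. \<Sum>j\<in>Bl k. cov M (\<lambda>\<omega>. G (X i \<omega>)) (\<lambda>\<omega>. G (X j \<omega>)))"
      by (rule c) auto
  qed measurable
  moreover have "norm (cf S * cf (U k) - (\<Prod>b<k. cf (U b)) * cf (U k))
     \<le> 4 * (\<Sum>c<k. \<Sum>b<c. \<Sum>i\<in>Bl b. \<Sum>j\<in>Bl c. cov M (\<lambda>\<omega>. G (X i \<omega>)) (\<lambda>\<omega>. G (X j \<omega>)))"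
  proof -
    have "norm (cf S * cf (U k) - (\<Prod>b<k. cf (U b)) * cf (U k)) \<le> norm (cf S - (\<Prod>b<k. cf (U b))) * 1"
      unfolding left_diff_distrib[symmetric] norm_mult by (intro mult_left_mono norm_cf_le_1) auto
    then show ?thesis using Suc.IH unfolding S_def U_def by linarith
  qed
  ultimately have "norm (cf (\<lambda>\<omega>. S \<omega> + U k \<omega>) - (\<Prod>b<k. cf (U b)) * cf (U k))
     \<le> 4 * K + 4 * (\<Sum>c<k. \<Sum>b<c. \<Sum>i\<in>Bl b. \<Sum>j\<in>Bl c. cov M (\<lambda>\<omega>. G (X i \<omega>)) (\<lambda>\<omega>. G (X j \<omega>)))"
    by (rule norm_diff_triangle_le)
  then show ?case unfolding S_def K_def U_def by (simp add: mult.commute)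
qed

end

section \<open>Sums of weakly dependent blocks\<close>

lemma one_minus_cos_le: "2 - 2 * cos x \<le> (x::real)\<^sup>2"
proof -
  have "\<bar>sin (x/2)\<bar> \<le> \<bar>x/2\<bar>" by (rule abs_sin_x_le_abs_x)
  then have "(sin (x/2))\<^sup>2 \<le> (x/2)\<^sup>2" using abs_le_square_iff by blast
  moreover have "cos x = 1 - 2 * (sin (x/2))\<^sup>2" using cos_double_sin[of "x/2"] by simp
  ultimately show ?thesis by (simp add: power2_eq_square)
qed

text \<open>The cubic Taylor polynomial of exp (i x) has real part 1 - x^2/2, so its fourth order
  remainder already bounds the quadratic approximation of cos.\<close>

lemma cos_approx_4: "\<bar>cos x - (1 - x\<^sup>2/2)\<bar> \<le> x^4 / (24::real)"
proof -
  have "\<bar>Re (iexp x - (\<Sum>k\<le>3. (\<i> * x)^k / fact k))\<bar> \<le> \<bar>x\<bar>^4 / fact 4"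
    using abs_Re_le_cmod[of "iexp x - (\<Sum>k\<le>3. (\<i> * x)^k / fact k)"] iexp_approx1[of x 3] by simp
  moreover have "Re (iexp x - (\<Sum>k\<le>3. (\<i> * x)^k / fact k)) = cos x - (1 - x\<^sup>2/2)"
    by (simp add: Re_exp eval_nat_numeral fact_reduce atMost_Suc)
  ultimately show ?thesis by (simp add: fact_reduce eval_nat_numeral)
qed

lemma sin_approx_3: "\<bar>sin x - x\<bar> \<le> \<bar>x\<bar>^3 / (6::real)"
proof -
  have "\<bar>Im (iexp x - (\<Sum>k\<le>2. (\<i> * x)^k / fact k))\<bar> \<le> \<bar>x\<bar>^3 / fact 3"
    using abs_Im_le_cmod[of "iexp x - (\<Sum>k\<le>2. (\<i> * x)^k / fact k)"] iexp_approx1[of x 2] by simp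
  moreover have "Im (iexp x - (\<Sum>k\<le>2. (\<i> * x)^k / fact k)) = sin x - x"
    by (simp add: Im_exp eval_nat_numeral fact_reduce atMost_Suc)
  ultimately show ?thesis by (simp add: fact_reduce eval_nat_numeral)
qed

lemma exp_minus_le_quadratic:
  assumes "0 \<le> (x::real)" shows "exp (- x) \<le> 1 - x + x\<^sup>2/2"
proof -
  have "\<exists>t. \<bar>t\<bar> \<le> \<bar>- x\<bar> \<and> exp (-x) = (\<Sum>m<3. (-x) ^ m / fact m) + exp t / fact 3 * (-x) ^ 3"
    using Maclaurin_exp_le[of "-x" 3] by simp
  then obtain t where "exp (-x) = (\<Sum>m<3. (-x) ^ m / fact m) + exp t / fact 3 * (-x) ^ 3" by blast
  moreover have "exp t / fact 3 * (-x) ^ 3 \<le> 0"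
    using assms by (intro mult_nonneg_nonpos) (auto simp: power_odd_eq)
  ultimately show ?thesis by (simp add: eval_nat_numeral fact_reduce)
qed

context prob_space
begin

text \<open>Centering removes the linear term of sin, and
  \<open>\<bar>U \<omega>\<bar> \<le> \<beta>\<close> turns the third and fourth order remainders
  into multiples of the variance.\<close>

lemma cf_centered_approx:
  assumes [measurable]: "U \<in> borel_measurable M" and U: "\<And>\<omega>. \<bar>U \<omega>\<bar> \<le> \<beta>" and c: "(\<integral>\<omega>. U \<omega> \<partial>M) = 0"
    and v: "v = (\<integral>\<omega>. (U \<omega>)\<^sup>2 \<partial>M)"
  shows "\<bar>Re (cf U) - (1 - v/2)\<bar> \<le> \<beta>\<^sup>2 * v / 24" "\<bar>Im (cf U)\<bar> \<le> \<beta> * v / 6" "1 - v/2 \<le> Re (cf U)" "0 \<le> v" "v \<le> \<beta>\<^sup>2"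
proof -
  have b: "brv M U" by (rule brvI[OF _ U]) auto
  have i[simp]: "integrable M (\<lambda>\<omega>. (U \<omega>)^k)" "integrable M U" for k using b by (auto intro: brv_power)
  have i'[simp]: "integrable M (\<lambda>\<omega>. \<bar>U \<omega>\<bar>^k)" for k
    using integrable_abs[OF i(1)[of k]] by (simp add: power_abs)
  have sq: "(U \<omega>)\<^sup>2 \<le> \<beta>\<^sup>2" for \<omega> using power_mono[OF U[of \<omega>], of 2] by simp
  have "\<bar>Re (cf U) - (1 - v/2)\<bar> = \<bar>\<integral>\<omega>. cos (U \<omega>) - (1 - (U \<omega>)\<^sup>2/2) \<partial>M\<bar>"
    by (simp add: cf_def v prob_space)
  also have "\<dots> \<le> (\<integral>\<omega>. \<bar>cos (U \<omega>) - (1 - (U \<omega>)\<^sup>2/2)\<bar> \<partial>M)" by (rule integral_abs_bound)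
  also have "\<dots> \<le> (\<integral>\<omega>. \<beta>\<^sup>2 / 24 * (U \<omega>)\<^sup>2 \<partial>M)"
  proof (rule integral_mono)
    show "\<bar>cos (U \<omega>) - (1 - (U \<omega>)\<^sup>2/2)\<bar> \<le> \<beta>\<^sup>2 / 24 * (U \<omega>)\<^sup>2" for \<omega>
      using cos_approx_4[of "U \<omega>"] mult_right_mono[OF sq[of \<omega>], of "(U \<omega>)\<^sup>2"]
      by (simp add: power4_eq_xxxx power2_eq_square mult.assoc)
  qed auto
  finally show "\<bar>Re (cf U) - (1 - v/2)\<bar> \<le> \<beta>\<^sup>2 * v / 24" by (simp add: v)
  have "\<bar>Im (cf U)\<bar> = \<bar>\<integral>\<omega>. sin (U \<omega>) - U \<omega> \<partial>M\<bar>" by (simp add: cf_def c)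
  also have "\<dots> \<le> (\<integral>\<omega>. \<bar>sin (U \<omega>) - U \<omega>\<bar> \<partial>M)" by (rule integral_abs_bound)
  also have "\<dots> \<le> (\<integral>\<omega>. \<beta> / 6 * (U \<omega>)\<^sup>2 \<partial>M)"
  proof (rule integral_mono)
    show "\<bar>sin (U \<omega>) - U \<omega>\<bar> \<le> \<beta> / 6 * (U \<omega>)\<^sup>2" for \<omega>
      using sin_approx_3[of "U \<omega>"] mult_right_mono[OF U[of \<omega>], of "(U \<omega>)\<^sup>2"]
      by (simp add: power3_eq_cube power2_eq_square mult.assoc)
  qed auto
  finally show "\<bar>Im (cf U)\<bar> \<le> \<beta> * v / 6" by (simp add: v)
  have "1 - v/2 = (\<integral>\<omega>. 1 - (U \<omega>)\<^sup>2/2 \<partial>M)" by (simp add: v prob_space)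
  also have "\<dots> \<le> (\<integral>\<omega>. cos (U \<omega>) \<partial>M)"
  proof (rule integral_mono)
    show "1 - (U \<omega>)\<^sup>2/2 \<le> cos (U \<omega>)" for \<omega> using one_minus_cos_le[of "U \<omega>"] by simp
  qed auto
  finally show "1 - v/2 \<le> Re (cf U)" by (simp add: cf_def)
  show "0 \<le> v" unfolding v by simp
  have "v \<le> (\<integral>\<omega>. \<beta>\<^sup>2 \<partial>M)" unfolding v using sq by (intro integral_mono) auto
  then show "v \<le> \<beta>\<^sup>2" by (simp add: prob_space)
qed

text \<open>An exponential bound on the modulus can be multiplied over blocks without accumulating
  errors. The squared modulus is at most 1 - v + \<beta>^2 v / 2, where
  \<open>v \<le> \<beta>\<^sup>2\<close> absorbs the terms quadratic in v.\<close>

lemma norm_cf_centered_le: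
  assumes "U \<in> borel_measurable M" "\<And>\<omega>. \<bar>U \<omega>\<bar> \<le> \<beta>" "(\<integral>\<omega>. U \<omega> \<partial>M) = 0"
    "v = (\<integral>\<omega>. (U \<omega>)\<^sup>2 \<partial>M)" and \<beta>: "0 \<le> \<beta>" "\<beta> \<le> 1"
  shows "norm (cf U) \<le> exp (- v/2 + \<beta>\<^sup>2 * v/4)"
proof -
  note a = cf_centered_approx[OF assms(1-4)]
  have b2: "\<beta>\<^sup>2 \<le> 1" using \<beta> by (simp add: power_le_one)
  have v1: "v \<le> 1" using a(5) b2 by linarith
  define e where "e = \<beta>\<^sup>2 * v"
  have e0: "0 \<le> e" "e \<le> v" unfolding e_def using a(4) b2 by (auto intro: mult_left_le_one_le)
  have ve: "v * v \<le> e" unfolding e_def using a(4,5) by (intro mult_right_mono) auto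
  have re: "0 \<le> Re (cf U)" "Re (cf U) \<le> 1 - v/2 + e/24" using a(1,3) v1 unfolding e_def by linarith+
  have "(Re (cf U))\<^sup>2 \<le> (1 - v/2 + e/24)\<^sup>2" using re by (intro power_mono) auto
  also have "\<dots> = 1 - v + e/12 + (v/2 - e/24)\<^sup>2" by (simp add: power2_eq_square field_simps)
  also have "(v/2 - e/24)\<^sup>2 \<le> (v/2)\<^sup>2" using e0 by (intro power_mono) auto
  also have "(v/2)\<^sup>2 \<le> e/4" using ve by (simp add: power2_eq_square)
  finally have 1: "(Re (cf U))\<^sup>2 \<le> 1 - v + e/3" by simp
  have "(Im (cf U))\<^sup>2 \<le> (\<beta> * v / 6)\<^sup>2" using a(2) power_mono[OF a(2), of 2] by simp
  also have "\<dots> = e * v / 36" by (simp add: e_def power2_eq_square)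
  also have "\<dots> \<le> e / 36" using e0 v1 mult_left_mono[OF v1 e0(1)] by simp
  finally have "(norm (cf U))\<^sup>2 \<le> 1 + (- v + e/2)" using 1 e0 unfolding cmod_power2 by linarith
  also have "\<dots> \<le> exp (- v + e/2)" by (rule exp_ge_add_one_self)
  also have "\<dots> = (exp (- v/2 + e/4))\<^sup>2" by (simp add: power2_eq_square flip: exp_add)
  finally show ?thesis unfolding e_def by (rule power2_le_imp_le) auto
qed

text \<open>The additive counterpart of the modulus bound, for the central limit theorem: the errors
  \<beta> v of the blocks add up to \<beta> times the total variance.\<close>

lemma cf_centered_gauss:
  assumes "U \<in> borel_measurable M" "\<And>\<omega>. \<bar>U \<omega>\<bar> \<le> \<beta>" "(\<integral>\<omega>. U \<omega> \<partial>M) = 0"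
    "v = (\<integral>\<omega>. (U \<omega>)\<^sup>2 \<partial>M)" and \<beta>: "0 \<le> \<beta>" "\<beta> \<le> 1"
  shows "norm (cf U - exp (- v/2)) \<le> \<beta> * v"
proof -
  note a = cf_centered_approx[OF assms(1-4)]
  have bv: "0 \<le> \<beta> * v" using \<beta> a(4) by simp
  have b2: "\<beta>\<^sup>2 * v \<le> \<beta> * v" using \<beta> a(4)
    by (intro mult_right_mono) (auto simp: power2_eq_square mult_left_le_one_le)
  have vv: "v * v \<le> \<beta> * v" using mult_right_mono[OF a(5) a(4)] b2 by linarith
  have "\<bar>exp (-v/2) - (1 - v/2)\<bar> \<le> v * v / 8"
    using exp_minus_le_quadratic[of "v/2"] exp_ge_add_one_self[of "-v/2"] a(4)
    by (auto simp: abs_le_iff power2_eq_square)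
  moreover have "norm (cf U - exp (- v/2)) \<le> \<bar>Re (cf U) - exp (-v/2)\<bar> + \<bar>Im (cf U)\<bar>"
    using cmod_le[of "cf U - exp (- v/2)"] by (simp add: Re_exp Im_exp)
  ultimately show ?thesis using a(1,2) bv b2 vv by linarith
qed

text \<open>The role of a fourth moment is played by \<open>x\<^sup>2 - 2 + 2 cos x\<close>, which is of order
  \<open>min x\<^sup>4 x\<^sup>2\<close> and whose expectation only involves the variance and the characteristic function.\<close>

lemma block_sum_tail:
  fixes U :: "nat \<Rightarrow> 'a \<Rightarrow> real"
  assumes [measurable]: "\<And>b. U b \<in> borel_measurable M" and U: "\<And>b \<omega>. \<bar>U b \<omega>\<bar> \<le> \<beta>"
    and c: "\<And>b. (\<integral>\<omega>. U b \<omega> \<partial>M) = 0"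
    and S: "S = (\<lambda>\<omega>. \<Sum>b<k. U b \<omega>)"
    and V: "V = (\<Sum>b<k. \<integral>\<omega>. (U b \<omega>)\<^sup>2 \<partial>M)"
    and K: "norm (cf S - (\<Prod>b<k. cf (U b))) \<le> 4 * K" "(\<integral>\<omega>. (S \<omega>)\<^sup>2 \<partial>M) \<le> V + 2 * K"
  shows "prob {\<omega>\<in>space M. \<bar>S \<omega>\<bar> \<ge> 3} \<le> 10 * K + \<beta>\<^sup>2 * V + V\<^sup>2/4"
proof -
  have V0: "0 \<le> V" unfolding V by (intro sum_nonneg) simp
  have K0: "0 \<le> K" using order_trans[OF norm_ge_zero K(1)] by simp
  have \<beta>0: "0 \<le> \<beta>" using U[of 0 undefined] by linarith
  have bU: "brv M (U b)" for b by (rule brvI[OF _ U]) auto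
  have bS: "brv M S" unfolding S by (intro brv_sum bU)
  then have [measurable]: "S \<in> borel_measurable M" by measurable
  have [simp]: "integrable M (\<lambda>\<omega>. (S \<omega>)\<^sup>2)" using bS by (auto intro: brv_power)
  define \<phi> :: "real \<Rightarrow> real" where "\<phi> x = x\<^sup>2 - 2 + 2 * cos x" for x
  have \<phi>0: "0 \<le> \<phi> x" for x using one_minus_cos_le[of x] by (simp add: \<phi>_def)
  have \<phi>2: "\<phi> x \<le> x\<^sup>2" for x using cos_le_one[of x] unfolding \<phi>_def by linarith
  \<comment> \<open>Since cos is at least -1, the value is at least 9 - 2 - 2 = 5; 3 is just a round
    number above sqrt 5.\<close>
  have \<phi>3: "1 \<le> \<phi> x" if "\<bar>x\<bar> \<ge> 3" for x
  proof -
    have "3\<^sup>2 \<le> \<bar>x\<bar>\<^sup>2" using that by (intro power_mono) auto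
    then have "9 \<le> x\<^sup>2" by simp
    then show ?thesis using cos_ge_minus_one[of x] unfolding \<phi>_def by linarith
  qed
  have [simp]: "integrable M (\<lambda>\<omega>. \<phi> (S \<omega>))" unfolding \<phi>_def by simp
  have "prob {\<omega>\<in>space M. \<bar>S \<omega>\<bar> \<ge> 3} = (\<integral>\<omega>. indicator {\<omega>\<in>space M. \<bar>S \<omega>\<bar> \<ge> 3} \<omega> \<partial>M)"
    by simp
  also have "\<dots> \<le> (\<integral>\<omega>. \<phi> (S \<omega>) \<partial>M)"
  proof (rule integral_mono)
    show "integrable M (indicator {\<omega>\<in>space M. \<bar>S \<omega>\<bar> \<ge> 3} :: 'a \<Rightarrow> real)"
      by (intro integrable_real_indicator) (auto simp: emeasure_eq_measure)
  qed (use \<phi>0 \<phi>3 in \<open>auto simp: indicator_def\<close>)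
  also have "\<dots> \<le> 10 * K + \<beta>\<^sup>2 * V + V\<^sup>2/4"
  proof (cases "\<beta> \<le> 1")
    case True
    define x where "x = V/2 - \<beta>\<^sup>2 * V/4"
    define e where "e = \<beta>\<^sup>2 * V"
    have e: "0 \<le> e" "e \<le> V" unfolding e_def using \<beta>0 True V0 by (auto intro: mult_left_le_one_le simp: power_le_one)
    have x: "0 \<le> x" "x \<le> V/2" unfolding x_def e_def[symmetric] using e by auto
    have "norm (\<Prod>b<k. cf (U b)) \<le> (\<Prod>b<k. exp (- (\<integral>\<omega>. (U b \<omega>)\<^sup>2 \<partial>M)/2 + \<beta>\<^sup>2 * (\<integral>\<omega>. (U b \<omega>)\<^sup>2 \<partial>M)/4))"
      unfolding prod_norm[symmetric] using U c \<beta>0 True by (intro prod_mono conjI norm_cf_centered_le) auto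
    also have "\<dots> = exp (- x)"
      unfolding x_def V by (simp add: exp_sum[symmetric] sum_subtractf sum_divide_distrib sum_distrib_left)
    also have "\<dots> \<le> 1 - x + x\<^sup>2/2" by (rule exp_minus_le_quadratic[OF x(1)])
    also have "x\<^sup>2 \<le> (V/2)\<^sup>2" using x by (intro power_mono) auto
    finally have p: "norm (\<Prod>b<k. cf (U b)) \<le> 1 - V/2 + e/4 + V\<^sup>2/8"
      by (simp add: x_def e_def power2_eq_square)
    have "(\<integral>\<omega>. \<phi> (S \<omega>) \<partial>M) = (\<integral>\<omega>. (S \<omega>)\<^sup>2 \<partial>M) - 2 + 2 * Re (cf S)"
      unfolding \<phi>_def by (simp add: cf_def prob_space)
    also have "Re (cf S) \<le> norm (\<Prod>b<k. cf (U b)) + 4 * K"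
      using complex_Re_le_cmod[of "cf S"] norm_triangle_sub[of "cf S" "\<Prod>b<k. cf (U b)"] K(1) by linarith
    finally have "(\<integral>\<omega>. \<phi> (S \<omega>) \<partial>M) \<le> (\<integral>\<omega>. (S \<omega>)\<^sup>2 \<partial>M) - 2 + 2 * (norm (\<Prod>b<k. cf (U b)) + 4 * K)" by simp
    \<comment> \<open>The variance V cancels between the second moment and the characteristic
      function. The coefficient 10 is 2 from the second moment plus twice the 4 from the
      characteristic function.\<close>
    then show ?thesis using p K(2) V0 e unfolding e_def[symmetric] by argo
  next
    \<comment> \<open>Expansions in \<beta> are useless here, but
      \<open>V \<le> \<beta>\<^sup>2 * V\<close>, and the second moment of \<open>S\<close> alone
      gives the bound.\<close>
    case False
    have "(\<integral>\<omega>. \<phi> (S \<omega>) \<partial>M) \<le> (\<integral>\<omega>. (S \<omega>)\<^sup>2 \<partial>M)"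
      by (intro integral_mono) (auto intro: \<phi>2)
    moreover have "V \<le> \<beta>\<^sup>2 * V" using False V0 by (simp add: mult_le_cancel_right1)
    moreover have "0 \<le> V\<^sup>2 / 4" by simp
    ultimately show ?thesis using K K0 by linarith
  qed
  finally show ?thesis .
qed

text \<open>Three comparisons are chained: \<open>cf S\<close> with the product over the blocks (4
  K), the product with the Gaussian of variance V, factor by factor since all factors have modulus
  at most 1 (\<beta> V), and V with v, using that exp (-x) is 1-Lipschitz for x \<ge> 0 (K).\<close>

lemma block_sum_gauss:
  fixes U :: "nat \<Rightarrow> 'a \<Rightarrow> real"
  assumes [measurable]: "\<And>b. U b \<in> borel_measurable M" and U: "\<And>b \<omega>. \<bar>U b \<omega>\<bar> \<le> \<beta>" and \<beta>: "\<beta> \<le> 1"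
    and c: "\<And>b. (\<integral>\<omega>. U b \<omega> \<partial>M) = 0"
    and V: "V = (\<Sum>b<k. \<integral>\<omega>. (U b \<omega>)\<^sup>2 \<partial>M)"
    and K: "norm (cf S - (\<Prod>b<k. cf (U b))) \<le> 4 * K" "\<bar>v - V\<bar> \<le> 2 * K" and v: "0 \<le> v"
  shows "norm (cf S - exp (- v/2)) \<le> 5 * K + \<beta> * V"
proof -
  have \<beta>0: "0 \<le> \<beta>" using U[of 0 undefined] by linarith
  have V0: "0 \<le> V" unfolding V by (intro sum_nonneg) simp
  have e1: "\<bar>exp (- a) - exp (- b)\<bar> \<le> \<bar>a - b\<bar>" if "0 \<le> a" "0 \<le> b" for a b :: real
  proof -
    have *: "exp (- a) - exp (- b) \<le> b - a" if "0 \<le> a" "a \<le> b" for a b :: real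
    proof -
      have "exp (- a) - exp (- b) = exp (- a) * (1 - exp (-(b - a)))" by (simp add: algebra_simps flip: exp_add)
      also have "\<dots> \<le> 1 * (b - a)" using that exp_ge_add_one_self[of "a-b"] by (intro mult_mono) (simp_all add: algebra_simps)
      finally show ?thesis by simp
    qed
    show ?thesis using *[of a b] *[of b a] that by (cases "a \<le> b") (auto simp: abs_if)
  qed
  have E: "complex_of_real (exp (- V/2)) = (\<Prod>b<k. complex_of_real (exp (- (\<integral>\<omega>. (U b \<omega>)\<^sup>2 \<partial>M)/2)))"
    unfolding V by (simp add: sum_divide_distrib exp_sum flip: of_real_prod sum_negf)
  have "norm ((\<Prod>b<k. cf (U b)) - exp (- V/2)) \<le> (\<Sum>b<k. norm (cf (U b) - exp (- (\<integral>\<omega>. (U b \<omega>)\<^sup>2 \<partial>M)/2)))"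
    unfolding E by (rule norm_prod_diff) (auto simp: norm_cf_le_1)
  also have "\<dots> \<le> (\<Sum>b<k. \<beta> * (\<integral>\<omega>. (U b \<omega>)\<^sup>2 \<partial>M))"
    using U c \<beta>0 \<beta> by (intro sum_mono cf_centered_gauss) auto
  also have "\<dots> = \<beta> * V" by (simp add: V sum_distrib_left)
  finally have 1: "norm ((\<Prod>b<k. cf (U b)) - exp (- V/2)) \<le> \<beta> * V" .
  have "norm (complex_of_real (exp (- V/2)) - exp (- v/2)) = \<bar>exp (- (V/2)) - exp (- (v/2))\<bar>"
    by (simp flip: of_real_diff)
  also have "\<dots> \<le> \<bar>V/2 - v/2\<bar>" using V0 v by (intro e1) auto
  also have "\<dots> \<le> K" using K(2) by linarith
  finally have "norm (cf S - exp (- v/2)) \<le> 4 * K + (\<beta> * V + K)"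
    by (intro norm_diff_triangle_le[OF K(1)] norm_diff_triangle_le[OF 1])
  then show ?thesis by linarith
qed

end

section \<open>Stochastically increasing uniform variables\<close>

text \<open>A uniform variable lies in [0, 1] only almost surely; composing with \<open>clip\<close>
  yields a variable bounded everywhere, as \<open>brv\<close> demands.\<close>

definition clip :: "real \<Rightarrow> real" where "clip v = max 0 (min 1 v)"

lemma clip_measurable [measurable]: "clip \<in> borel_measurable borel"
  unfolding clip_def by measurable

lemma clip_bounds [simp]: "0 \<le> clip v" "clip v \<le> 1" "\<bar>clip v\<bar> \<le> 1"
  by (auto simp: clip_def)

lemma clip_id: "v \<in> {0..1} \<Longrightarrow> clip v = v"
  by (auto simp: clip_def)

lemma mono_clip: "mono clip"
  by (auto simp: clip_def mono_def)

text \<open>A Riemann sum for the layer-cake formula: v is the integral of ind (v > y) over y in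
  [0, 1]. Being an average of indicators, it carries identities and inequalities for the events V >
  y over to V itself.\<close>

definition stair :: "nat \<Rightarrow> real \<Rightarrow> real" where
  "stair N v = (\<Sum>j<N. ind (v > real j / real N)) / real N"

lemma stair_measurable [measurable]: "stair N \<in> borel_measurable borel"
  unfolding stair_def by measurable

lemma stair_bounds: "0 \<le> stair N v" "stair N v \<le> 1"
proof -
  show "0 \<le> stair N v" unfolding stair_def by (intro divide_nonneg_nonneg sum_nonneg) auto
  have "(\<Sum>j<N. ind (v > real j / real N)) \<le> (\<Sum>j<N. 1)" by (intro sum_mono) auto
  then show "stair N v \<le> 1" unfolding stair_def by (cases "N = 0") (auto simp: divide_le_eq)
qed

lemma stair_eq: assumes N: "N > 0" shows "stair N v = \<lceil>real N * clip v\<rceil> / real N"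
proof -
  have le: "\<lceil>real N * clip v\<rceil> \<le> int N" using mult_left_mono[OF clip_bounds(2)[of v], of "real N"] by (simp add: ceiling_le_iff)
  have "v > real j / real N \<longleftrightarrow> j < nat \<lceil>real N * clip v\<rceil>" if "j < N" for j
  proof -
    have "j < nat \<lceil>real N * clip v\<rceil> \<longleftrightarrow> int j < \<lceil>real N * clip v\<rceil>" by linarith
    also have "\<dots> \<longleftrightarrow> real j < real N * clip v" by (simp add: less_ceiling_iff)
    also have "\<dots> \<longleftrightarrow> real j / real N < clip v" using N by (simp add: divide_less_eq mult.commute)
    also have "\<dots> \<longleftrightarrow> real j / real N < v"
    proof -
      have "0 \<le> real j / real N" "real j / real N < 1" using that by (auto simp: divide_less_eq)
      then show ?thesis unfolding clip_def by linarith
    qed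
    finally show ?thesis ..
  qed
  then have "(\<Sum>j<N. ind (v > real j / real N)) = (\<Sum>j<N. ind (j < nat \<lceil>real N * clip v\<rceil>))"
    by (intro sum.cong) auto
  also have "\<dots> = real (card {j \<in> {..<N}. j < nat \<lceil>real N * clip v\<rceil>})"
    by (simp add: ind_def sum.If_cases Int_def)
  also have "{j \<in> {..<N}. j < nat \<lceil>real N * clip v\<rceil>} = {..<nat \<lceil>real N * clip v\<rceil>}" using le by auto
  also have "real (card \<dots>) = \<lceil>real N * clip v\<rceil>"
  proof -
    have "0 \<le> \<lceil>real N * clip v\<rceil>" using clip_bounds(1)[of v] mult_nonneg_nonneg[of "real N" "clip v"] by linarith
    then show ?thesis by simp
  qed
  finally show ?thesis unfolding stair_def by simp
qed

lemma stair_tendsto: "(\<lambda>N. stair N v) \<longlonglongrightarrow> clip v"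
proof (rule real_tendsto_sandwich[where f="\<lambda>_. clip v" and h="\<lambda>N. clip v + 1 / real N"])
  show "\<forall>\<^sub>F N in sequentially. clip v \<le> stair N v"
  proof (rule eventually_mono[OF eventually_gt_at_top[of 0]])
    fix N :: nat assume N: "0 < N"
    have "real N * clip v \<le> \<lceil>real N * clip v\<rceil>" by linarith
    then show "clip v \<le> stair N v" unfolding stair_eq[OF N] using N by (simp add: field_simps)
  qed
  show "\<forall>\<^sub>F N in sequentially. stair N v \<le> clip v + 1 / real N"
  proof (rule eventually_mono[OF eventually_gt_at_top[of 0]])
    fix N :: nat assume N: "0 < N"
    have "\<lceil>real N * clip v\<rceil> \<le> real N * clip v + 1" by linarith
    then show "stair N v \<le> clip v + 1 / real N" unfolding stair_eq[OF N] using N by (simp add: field_simps)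
  qed
  have "(\<lambda>N. clip v + 1 / real N) \<longlonglongrightarrow> clip v + 0" by (intro tendsto_intros lim_1_over_n)
  then show "(\<lambda>N. clip v + 1 / real N) \<longlonglongrightarrow> clip v" by simp
qed auto

context prob_space
begin

lemma brv_clip: "V \<in> borel_measurable M \<Longrightarrow> brv M (\<lambda>\<omega>. clip (V \<omega>))"
  by (rule brvI[where B=1]) auto

lemma integral_stair_tendsto:
  assumes W: "brv M W" and [measurable]: "V \<in> borel_measurable M"
  shows "(\<lambda>N. \<integral>\<omega>. W \<omega> * stair N (V \<omega>) \<partial>M) \<longlonglongrightarrow> (\<integral>\<omega>. W \<omega> * clip (V \<omega>) \<partial>M)"
proof (rule integral_dominated_convergence[where w="\<lambda>\<omega>. \<bar>W \<omega>\<bar>"])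
  show "integrable M (\<lambda>\<omega>. \<bar>W \<omega>\<bar>)" using W by auto
  have [measurable]: "W \<in> borel_measurable M" using W by (rule brv_measurable)
  show "(\<lambda>\<omega>. W \<omega> * clip (V \<omega>)) \<in> borel_measurable M" "\<And>i. (\<lambda>\<omega>. W \<omega> * stair i (V \<omega>)) \<in> borel_measurable M"
    by measurable
  show "AE \<omega> in M. (\<lambda>N. W \<omega> * stair N (V \<omega>)) \<longlonglongrightarrow> W \<omega> * clip (V \<omega>)"
    by (intro AE_I2 tendsto_intros stair_tendsto)
  show "AE \<omega> in M. norm (W \<omega> * stair i (V \<omega>)) \<le> \<bar>W \<omega>\<bar>" for i
    by (intro AE_I2) (auto simp: abs_mult stair_bounds intro!: mult_left_le)
qed

lemma cov_stair_tendsto: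
  assumes W: "brv M W" and V: "V \<in> borel_measurable M"
  shows "(\<lambda>N. cov M W (\<lambda>\<omega>. stair N (V \<omega>))) \<longlonglongrightarrow> cov M W (\<lambda>\<omega>. clip (V \<omega>))"
  unfolding cov_def using integral_stair_tendsto[OF W V] integral_stair_tendsto[OF brv_const[of M 1] V]
  by (intro tendsto_intros) auto

lemma cov_stair:
  assumes W: "brv M W" and [measurable]: "V \<in> borel_measurable M"
  shows "cov M W (\<lambda>\<omega>. stair N (V \<omega>)) = (\<Sum>j<N. cov M W (\<lambda>\<omega>. ind (V \<omega> > real j / real N))) / real N"
proof -
  have "cov M W (\<lambda>\<omega>. stair N (V \<omega>)) = cov M W (\<lambda>\<omega>. (1 / real N) * (\<Sum>j<N. ind (V \<omega> > real j / real N)))"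
    by (simp add: stair_def)
  also have "\<dots> = (1 / real N) * (\<Sum>j<N. cov M W (\<lambda>\<omega>. ind (V \<omega> > real j / real N)))"
    unfolding cov_cmult_right by (subst cov_sum_right) (auto intro!: brv_ind W)
  finally show ?thesis by simp
qed

section \<open>Integrals against a uniform variable\<close>

lemma uniform_integral:
  fixes V :: "'a \<Rightarrow> real"
  assumes [measurable]: "V \<in> borel_measurable M" "h \<in> borel_measurable borel"
    and D: "distr M borel V = uniform_measure lborel {0..1}"
  shows "(\<integral>\<omega>. h (V \<omega>) \<partial>M) = (LBINT x. indicator {0..1} x * (h x :: real))"
proof -
  have "(\<integral>\<omega>. h (V \<omega>) \<partial>M) = integral\<^sup>L (distr M borel V) h" by (subst integral_distr) auto
  also have "\<dots> = integral\<^sup>L (density lborel (\<lambda>x. ennreal (indicator {0..1} x))) h"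
    unfolding D uniform_measure_def by (intro arg_cong2[where f="integral\<^sup>L"] arg_cong2[where f=density] refl ext) (auto simp: indicator_def emeasure_lborel_Icc)
  also have "\<dots> = (LBINT x. indicator {0..1} x * h x)"
    by (subst integral_density) auto
  finally show ?thesis .
qed

lemma uniform_AE:
  fixes V :: "'a \<Rightarrow> real"
  assumes [measurable]: "V \<in> borel_measurable M" and D: "distr M borel V = uniform_measure lborel {0..1}"
  shows "AE \<omega> in M. V \<omega> \<in> {0..1}"
proof -
  have "AE x in distr M borel V. x \<in> {0..1}" unfolding D by (rule AE_uniform_measureI) auto
  then show ?thesis by (subst (asm) AE_distr_iff) auto
qed

lemma uniform_integral_interval:
  assumes V: "V \<in> borel_measurable M" and D: "distr M borel V = uniform_measure lborel {0..1}"
    and ab: "0 \<le> a" "a \<le> b" "b \<le> 1"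
  shows "(\<integral>\<omega>. ind (V \<omega> \<in> {a<..b}) \<partial>M) = b - a" "(\<integral>\<omega>. V \<omega> * ind (V \<omega> \<in> {a<..b}) \<partial>M) = (b\<^sup>2 - a\<^sup>2) / 2"
proof -
  have ae: "AE x in lborel. (x::real) \<noteq> a" by (rule AE_lborel_singleton)
  have "(\<integral>\<omega>. ind (V \<omega> \<in> {a<..b}) \<partial>M) = (LBINT x. indicator {0..1} x * ind (x \<in> {a<..b}))"
    by (rule uniform_integral[OF V _ D]) measurable
  also have "\<dots> = (LBINT x. indicator {a..b} x *\<^sub>R 1)"
    by (intro integral_cong_AE) (use ae ab in \<open>auto simp: indicator_def ind_def elim!: AE_mp\<close>)
  also have "\<dots> = b - a" using ab by simp
  finally show "(\<integral>\<omega>. ind (V \<omega> \<in> {a<..b}) \<partial>M) = b - a" .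
  have "(\<integral>\<omega>. V \<omega> * ind (V \<omega> \<in> {a<..b}) \<partial>M) = (LBINT x. indicator {0..1} x * (x * ind (x \<in> {a<..b})))"
    by (rule uniform_integral[OF V _ D]) measurable
  also have "\<dots> = (LBINT x. indicator {a..b} x *\<^sub>R x)"
    by (intro integral_cong_AE) (use ae ab in \<open>auto simp: indicator_def ind_def elim!: AE_mp\<close>)
  also have "\<dots> = b\<^sup>2/2 - a\<^sup>2/2"
  proof -
    have "((\<lambda>x. x\<^sup>2/2) has_vector_derivative x) (at x within {a..b})" for x :: real
      unfolding has_real_derivative_iff_has_vector_derivative[symmetric] by (auto intro!: derivative_eq_intros)
    then show ?thesis
      by (intro integral_FTC_atLeastAtMost[OF ab(2), of "\<lambda>x. x\<^sup>2/2" "\<lambda>x. x"]) (auto intro!: continuous_intros)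
  qed
  finally show "(\<integral>\<omega>. V \<omega> * ind (V \<omega> \<in> {a<..b}) \<partial>M) = (b\<^sup>2 - a\<^sup>2) / 2" by (simp add: diff_divide_distrib)
qed

text \<open>On each side of \<open>y\<close> the weight \<open>w\<close> below is \<open>V\<close> minus the conditional mean of \<open>V\<close>, so a
  nondecreasing regression function has a nonnegative covariance with it.\<close>

lemma regression_half:
  assumes V [measurable]: "V \<in> borel_measurable M" and D: "distr M borel V = uniform_measure lborel {0..1}"
    and W: "brv M W" and \<phi>: "mono \<phi>" "\<phi> \<in> borel_measurable borel"
    and eq: "\<And>B. B \<in> sets borel \<Longrightarrow> (\<integral>\<omega>. W \<omega> * ind (V \<omega> \<in> B) \<partial>M) = (\<integral>\<omega>. \<phi> (V \<omega>) * ind (V \<omega> \<in> B) \<partial>M)"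
    and y: "0 \<le> y" "y \<le> 1"
  shows "cov M W (\<lambda>\<omega>. ind (V \<omega> > y)) \<le> 2 * cov M W (\<lambda>\<omega>. clip (V \<omega>))"
proof -
  note [measurable] = \<phi>(2)
  note ae = uniform_AE[OF V D]
  \<comment> \<open>A monotone \<phi> may be unbounded on the line. Clipping its argument bounds it
    by its values at 0 and 1 and changes \<phi> (V) only on a null set.\<close>
  define \<psi> where "\<psi> v = \<phi> (clip v)" for v
  have [measurable]: "\<psi> \<in> borel_measurable borel" unfolding \<psi>_def by measurable
  have \<psi>m: "mono \<psi>" unfolding \<psi>_def using \<phi>(1) mono_clip by (auto simp: mono_def)
  have b\<psi>: "brv M (\<lambda>\<omega>. \<psi> (V \<omega>))"
  proof (rule brvI[where B="\<bar>\<phi> 0\<bar> + \<bar>\<phi> 1\<bar>"])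
    show "\<bar>\<psi> (V \<omega>)\<bar> \<le> \<bar>\<phi> 0\<bar> + \<bar>\<phi> 1\<bar>" for \<omega>
      using monoD[OF \<phi>(1) clip_bounds(1)[of "V \<omega>"]] monoD[OF \<phi>(1) clip_bounds(2)[of "V \<omega>"]] unfolding \<psi>_def by linarith
  qed measurable
  have [measurable]: "W \<in> borel_measurable M" using W by (rule brv_measurable)
  have eq': "(\<integral>\<omega>. W \<omega> * ind (V \<omega> \<in> B) \<partial>M) = (\<integral>\<omega>. \<psi> (V \<omega>) * ind (V \<omega> \<in> B) \<partial>M)" if [measurable]: "B \<in> sets borel" for B
    unfolding eq[OF that] by (intro integral_cong_AE) (use ae in \<open>auto simp: \<psi>_def clip_id elim!: AE_mp\<close>)
  \<comment> \<open>The regression identity is given for indicators of V only. Through staircases,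
    and in the limit \<open>e2\<close>, it extends to \<open>clip (V \<omega>)\<close> as a test
    function.\<close>
  have e1: "(\<integral>\<omega>. W \<omega> * stair N (V \<omega>) \<partial>M) = (\<integral>\<omega>. \<psi> (V \<omega>) * stair N (V \<omega>) \<partial>M)" for N
  proof -
    have s: "(\<integral>\<omega>. Z \<omega> * stair N (V \<omega>) \<partial>M) = (\<Sum>j<N. \<integral>\<omega>. Z \<omega> * ind (V \<omega> \<in> {real j / real N <..}) \<partial>M) / real N"
      if "brv M Z" for Z
    proof -
      have "(\<integral>\<omega>. Z \<omega> * stair N (V \<omega>) \<partial>M) = (\<integral>\<omega>. (\<Sum>j<N. Z \<omega> * ind (V \<omega> \<in> {real j / real N <..})) / real N \<partial>M)"
        by (simp add: stair_def sum_distrib_left)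
      also have "\<dots> = (\<Sum>j<N. \<integral>\<omega>. Z \<omega> * ind (V \<omega> \<in> {real j / real N <..}) \<partial>M) / real N"
        unfolding integral_divide_zero
        by (subst Bochner_Integration.integral_sum) (auto intro!: brv_integrable brv_mult brv_ind that)
      finally show ?thesis .
    qed
    have "(\<integral>\<omega>. W \<omega> * ind (V \<omega> \<in> {a<..}) \<partial>M) = (\<integral>\<omega>. \<psi> (V \<omega>) * ind (V \<omega> \<in> {a<..}) \<partial>M)" for a by (rule eq') simp
    then show ?thesis unfolding s[OF W] s[OF b\<psi>] by (simp only:)
  qed
  have e2: "(\<integral>\<omega>. W \<omega> * clip (V \<omega>) \<partial>M) = (\<integral>\<omega>. \<psi> (V \<omega>) * clip (V \<omega>) \<partial>M)"
    using LIMSEQ_unique[OF integral_stair_tendsto[OF W V]] integral_stair_tendsto[OF b\<psi> V] unfolding e1 by blast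
  \<comment> \<open>The subtracted term is y/2 on the left of y and (y + 1)/2 on the right, the
    midpoints of [0, y] and [y, 1].\<close>
  define w where "w v = clip v - y/2 - ind (v > y) / 2" for v
  have bw: "brv M (\<lambda>\<omega>. w (V \<omega>))" unfolding w_def
    by (intro brv_intros brv_clip brv_ind V) measurable
  have bi: "brv M (\<lambda>\<omega>. ind (V \<omega> > y))" by (rule brv_ind) measurable
  have W_w: "(\<integral>\<omega>. Z \<omega> * w (V \<omega>) \<partial>M) = (\<integral>\<omega>. Z \<omega> * clip (V \<omega>) \<partial>M) - y/2 * (\<integral>\<omega>. Z \<omega> * ind (V \<omega> \<in> UNIV) \<partial>M)
      - 1/2 * (\<integral>\<omega>. Z \<omega> * ind (V \<omega> \<in> {y<..}) \<partial>M)" if Z: "brv M Z" for Z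
  proof -
    have "(\<integral>\<omega>. Z \<omega> * w (V \<omega>) \<partial>M) = (\<integral>\<omega>. Z \<omega> * clip (V \<omega>) - y/2 * (Z \<omega> * ind (V \<omega> \<in> UNIV)) - 1/2 * (Z \<omega> * ind (V \<omega> \<in> {y<..})) \<partial>M)"
      by (intro Bochner_Integration.integral_cong) (auto simp: w_def algebra_simps)
    also have "\<dots> = (\<integral>\<omega>. Z \<omega> * clip (V \<omega>) \<partial>M) - y/2 * (\<integral>\<omega>. Z \<omega> * ind (V \<omega> \<in> UNIV) \<partial>M)
      - 1/2 * (\<integral>\<omega>. Z \<omega> * ind (V \<omega> \<in> {y<..}) \<partial>M)"
    proof -
      have i: "integrable M (\<lambda>\<omega>. Z \<omega> * clip (V \<omega>))" "integrable M (\<lambda>\<omega>. y/2 * (Z \<omega> * ind (V \<omega> \<in> UNIV)))"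
        "integrable M (\<lambda>\<omega>. 1/2 * (Z \<omega> * ind (V \<omega> \<in> {y<..})))"
        by (intro brv_integrable brv_intros brv_clip brv_ind Z V, measurable?)+
      show ?thesis
        unfolding Bochner_Integration.integral_diff[OF Bochner_Integration.integrable_diff[OF i(1,2)] i(3)]
          Bochner_Integration.integral_diff[OF i(1,2)] integral_mult_right_zero ..
    qed
    finally show ?thesis .
  qed
  \<comment> \<open>The part of the weight that lives on one of the two cells. Cells are open on the
    left, so the decomposition of w misses V = 0, a null event.\<close>
  define A where "A a b \<omega> = ind (V \<omega> \<in> {a<..b}) * (clip (V \<omega>) - (a+b)/2)" for a b \<omega>
  have bA: "brv M (A a b)" for a b unfolding A_def by (intro brv_intros brv_clip brv_ind V) measurable
  have I1: "(\<integral>\<omega>. A a b \<omega> \<partial>M) = 0" if ab: "0 \<le> a" "a \<le> b" "b \<le> 1" for a b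
  proof -
    have bi: "brv M (\<lambda>\<omega>. ind (V \<omega> \<in> {a<..b}))" by (rule brv_ind) measurable
    have i: "integrable M (\<lambda>\<omega>. clip (V \<omega>) * ind (V \<omega> \<in> {a<..b}))" "integrable M (\<lambda>\<omega>. (a+b)/2 * ind (V \<omega> \<in> {a<..b}))"
      by (intro brv_integrable brv_intros brv_clip bi V)+
    have "(\<integral>\<omega>. A a b \<omega> \<partial>M) = (\<integral>\<omega>. clip (V \<omega>) * ind (V \<omega> \<in> {a<..b}) - (a+b)/2 * ind (V \<omega> \<in> {a<..b}) \<partial>M)"
      by (intro Bochner_Integration.integral_cong) (auto simp: A_def algebra_simps)
    also have "\<dots> = (\<integral>\<omega>. clip (V \<omega>) * ind (V \<omega> \<in> {a<..b}) \<partial>M) - (a+b)/2 * (\<integral>\<omega>. ind (V \<omega> \<in> {a<..b}) \<partial>M)"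
      unfolding Bochner_Integration.integral_diff[OF i] integral_mult_right_zero ..
    also have "(\<integral>\<omega>. clip (V \<omega>) * ind (V \<omega> \<in> {a<..b}) \<partial>M) = (\<integral>\<omega>. V \<omega> * ind (V \<omega> \<in> {a<..b}) \<partial>M)"
      by (intro integral_cong_AE) (use ae in \<open>auto simp: clip_id elim!: AE_mp\<close>)
    finally show ?thesis unfolding uniform_integral_interval[OF V D ab] by (simp add: power2_eq_square field_simps)
  qed
  have split: "w (V \<omega>) = A 0 y \<omega> + A y 1 \<omega>"
    if "V \<omega> \<in> {0<..1}" for \<omega> using that y by (auto simp: w_def A_def ind_def field_simps)
  have ae0: "AE \<omega> in M. V \<omega> \<in> {0<..1}"
  proof -
    have "(\<integral>\<omega>. ind (V \<omega> \<in> {0<..1}) \<partial>M) = 1" using uniform_integral_interval(1)[OF V D, of 0 1] by simp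
    moreover have "(\<integral>\<omega>. ind (V \<omega> \<in> {0<..1}) \<partial>M) = prob {\<omega>\<in>space M. V \<omega> \<in> {0<..1}}"
    proof -
      have "(\<integral>\<omega>. ind (V \<omega> \<in> {0<..1}) \<partial>M) = (\<integral>\<omega>. indicator {\<omega>\<in>space M. V \<omega> \<in> {0<..1}} \<omega> \<partial>M)"
        by (intro Bochner_Integration.integral_cong) (auto simp: ind_def indicator_def)
      then show ?thesis by simp
    qed
    ultimately have "prob {\<omega>\<in>space M. V \<omega> \<in> {0<..1}} = 1" by simp
    then show ?thesis by (subst (asm) prob_Collect_eq_1) auto
  qed
  let ?L = "\<lambda>\<omega>. \<psi> (y/2) * A 0 y \<omega> + \<psi> ((y+1)/2) * A y 1 \<omega>"
  have bL: "brv M ?L" by (intro brv_intros bA)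
  have "0 = (\<integral>\<omega>. ?L \<omega> \<partial>M)" using I1[of 0 y] I1[of y 1] y by (simp add: brv_integrable bA brv_intros)
  also have "\<dots> \<le> (\<integral>\<omega>. \<psi> (V \<omega>) * w (V \<omega>) \<partial>M)"
  proof (rule integral_mono_AE)
    show "AE \<omega> in M. ?L \<omega> \<le> \<psi> (V \<omega>) * w (V \<omega>)"
      using ae0
    proof (rule AE_mp, intro AE_I2 impI)
      fix \<omega> assume v: "V \<omega> \<in> {0<..1}"
      \<comment> \<open>Chebyshev's argument: (\<psi> x - \<psi> c) and (x - c) have the same sign.
        It is used with c the midpoint of the cell, whose weight integrates to zero.\<close>
      have ch: "\<psi> c * (x - c) \<le> \<psi> x * (x - c)" for c x
        using monoD[OF \<psi>m, of c x] monoD[OF \<psi>m, of x c]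
        by (cases "c \<le> x") (auto intro: mult_right_mono mult_right_mono_neg)
      have cv: "clip (V \<omega>) = V \<omega>" using v by (intro clip_id) auto
      show "?L \<omega> \<le> \<psi> (V \<omega>) * w (V \<omega>)"
        unfolding split[OF v] using ch[of "y/2" "V \<omega>"] ch[of "(y+1)/2" "V \<omega>"] v y
        by (cases "V \<omega> \<le> y") (auto simp: ind_def A_def cv)
    qed
  qed (intro brv_integrable bL brv_mult b\<psi> bw)+
  also have "\<dots> = (\<integral>\<omega>. W \<omega> * w (V \<omega>) \<partial>M)" unfolding W_w[OF b\<psi>] W_w[OF W] e2 by (subst (1 2) eq') auto
  finally have 1: "0 \<le> (\<integral>\<omega>. W \<omega> * w (V \<omega>) \<partial>M)" .
  have "(\<integral>\<omega>. w (V \<omega>) \<partial>M) = (\<integral>\<omega>. A 0 y \<omega> + A y 1 \<omega> \<partial>M)"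
  proof (rule integral_cong_AE)
    show "AE \<omega> in M. w (V \<omega>) = A 0 y \<omega> + A y 1 \<omega>" using ae0 by eventually_elim (rule split)
  qed (intro brv_measurable bw brv_add bA)+
  also have "\<dots> = 0" using I1[of 0 y] I1[of y 1] y by (simp add: brv_integrable bA)
  finally have "0 \<le> cov M W (\<lambda>\<omega>. w (V \<omega>))" using 1 unfolding cov_def by simp
  \<comment> \<open>The indicator enters w with weight 1/2; this is the factor 2 of the
    conclusion.\<close>
  also have "cov M W (\<lambda>\<omega>. w (V \<omega>)) = cov M W (\<lambda>\<omega>. clip (V \<omega>)) - (1/2) * cov M W (\<lambda>\<omega>. ind (V \<omega> > y))"
  proof -
    have "cov M W (\<lambda>\<omega>. w (V \<omega>)) = cov M W (\<lambda>\<omega>. (clip (V \<omega>) - y/2) - (1/2) * ind (V \<omega> > y))" by (simp add: w_def)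
    then show ?thesis
      by (simp only: cov_diff_right[OF _ _ W] cov_cmult_right cov_const_right brv_intros brv_clip bi V brv_mult[OF brv_const bi])
  qed
  finally show ?thesis by simp
qed

text \<open>Each indicator is exchanged for its variable at the cost of a factor 2. The first
  exchange is \<open>regression_half\<close> for U given V. For the second, V is written as an
  average of indicators \<open>ind (V \<omega> > y)\<close>, and \<open>regression_half\<close> is
  applied to each of them given U.\<close>

lemma cov_indicator_le:
  assumes U [measurable]: "U \<in> borel_measurable M" and DU: "distr M borel U = uniform_measure lborel {0..1}"
    and V [measurable]: "V \<in> borel_measurable M" and DV: "distr M borel V = uniform_measure lborel {0..1}"
    and UV: "stoch_increasing M U V" and VU: "stoch_increasing M V U"
    and x: "0 \<le> x" "x \<le> 1" and y: "0 \<le> y" "y \<le> 1"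
  shows "cov M (\<lambda>\<omega>. ind (U \<omega> \<le> x)) (\<lambda>\<omega>. ind (V \<omega> \<le> y)) \<le> 4 * cov M U V"
proof -
  have half: "cov M (\<lambda>\<omega>. ind (U \<omega> > x)) (\<lambda>\<omega>. ind (V \<omega> > y)) \<le> 2 * cov M (\<lambda>\<omega>. ind (U \<omega> > x)) (\<lambda>\<omega>. clip (V \<omega>))"
    if [measurable]: "U \<in> borel_measurable M" "V \<in> borel_measurable M" and DV: "distr M borel V = uniform_measure lborel {0..1}"
      and UV: "stoch_increasing M U V" and y: "0 \<le> y" "y \<le> 1" for U V x y
  proof -
    obtain \<phi> where "mono \<phi>" "\<phi> \<in> borel_measurable borel" "\<And>B. B \<in> sets borel \<Longrightarrow>
        (\<integral>\<omega>. ind (U \<omega> > x) * ind (V \<omega> \<in> B) \<partial>M) = (\<integral>\<omega>. \<phi> (V \<omega>) * ind (V \<omega> \<in> B) \<partial>M)"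
      using UV unfolding stoch_increasing_def by blast
    then show ?thesis by (intro regression_half[OF _ DV] brv_ind y) auto
  qed
  let ?u = "\<lambda>\<omega>. ind (U \<omega> > x)" and ?v = "\<lambda>\<omega>. ind (V \<omega> > y)"
  have bu: "brv M ?u" and bv: "brv M ?v" by (auto intro!: brv_ind)
  have cU: "brv M (\<lambda>\<omega>. clip (U \<omega>))" and cV: "brv M (\<lambda>\<omega>. clip (V \<omega>))" by (auto intro!: brv_clip)
  have "cov M ?u (\<lambda>\<omega>. stair N (V \<omega>)) \<le> 2 * cov M (\<lambda>\<omega>. clip (U \<omega>)) (\<lambda>\<omega>. stair N (V \<omega>))" for N
  proof -
    have "cov M ?u (\<lambda>\<omega>. ind (V \<omega> > real j / real N)) \<le> 2 * cov M (\<lambda>\<omega>. clip (U \<omega>)) (\<lambda>\<omega>. ind (V \<omega> > real j / real N))" for j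
      using half[OF V U DU VU x, of "real j / real N"] by (simp add: cov_commute)
    then have "(\<Sum>j<N. cov M ?u (\<lambda>\<omega>. ind (V \<omega> > real j / real N))) \<le> 2 * (\<Sum>j<N. cov M (\<lambda>\<omega>. clip (U \<omega>)) (\<lambda>\<omega>. ind (V \<omega> > real j / real N)))"
      unfolding sum_distrib_left by (intro sum_mono)
    then show ?thesis unfolding cov_stair[OF bu V] cov_stair[OF cU V]
      using divide_right_mono[of _ _ "real N"] by fastforce
  qed
  then have 2: "cov M ?u (\<lambda>\<omega>. clip (V \<omega>)) \<le> 2 * cov M (\<lambda>\<omega>. clip (U \<omega>)) (\<lambda>\<omega>. clip (V \<omega>))"
    by (intro LIMSEQ_le[OF cov_stair_tendsto[OF bu V] tendsto_mult_left[OF cov_stair_tendsto[OF cU V]]]) auto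
  have "cov M (\<lambda>\<omega>. ind (U \<omega> \<le> x)) (\<lambda>\<omega>. ind (V \<omega> \<le> y)) = cov M (\<lambda>\<omega>. 1 - ?u \<omega>) (\<lambda>\<omega>. 1 - ?v \<omega>)"
    by (intro arg_cong2[where f="cov M"] ext) (auto simp: ind_def)
  also have "\<dots> = cov M ?u ?v" by (simp add: cov_diff_left cov_diff_right bu bv brv_intros)
  also have "\<dots> \<le> 2 * cov M ?u (\<lambda>\<omega>. clip (V \<omega>))" by (rule half[OF U V DV UV y])
  also have "\<dots> \<le> 4 * cov M (\<lambda>\<omega>. clip (U \<omega>)) (\<lambda>\<omega>. clip (V \<omega>))" using 2 by simp
  also have "cov M (\<lambda>\<omega>. clip (U \<omega>)) (\<lambda>\<omega>. clip (V \<omega>)) = cov M U V"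
  proof -
    have "AE \<omega> in M. clip (U \<omega>) = U \<omega>" "AE \<omega> in M. clip (V \<omega>) = V \<omega>"
      using uniform_AE[OF U DU] uniform_AE[OF V DV] by (auto simp: clip_id elim!: AE_mp)
    then show ?thesis unfolding cov_def
      by (intro arg_cong2[where f="(-)"] arg_cong2[where f="(*)"] integral_cong_AE) (auto elim!: AE_mp)
  qed
  finally show ?thesis .
qed

end

section \<open>Weak convergence from characteristic functions\<close>

text \<open>Conjugation inverts on the unit circle, so on the torus these are the characters with a
  coefficient; the two exponent vectors stand for positive and negative frequencies.\<close>

definition monom_torus :: "nat \<Rightarrow> complex \<Rightarrow> (nat \<Rightarrow> nat) \<Rightarrow> (nat \<Rightarrow> nat) \<Rightarrow> (nat \<Rightarrow> complex) \<Rightarrow> complex" where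
  "monom_torus d a k l u = a * (\<Prod>i<d. u i ^ k i * cnj (u i) ^ l i)"

inductive trig_poly :: "nat \<Rightarrow> ((nat \<Rightarrow> complex) \<Rightarrow> real) \<Rightarrow> bool" for d where
  monom: "trig_poly d (\<lambda>u. Re (monom_torus d a k l u))"
| add: "trig_poly d f \<Longrightarrow> trig_poly d g \<Longrightarrow> trig_poly d (\<lambda>u. f u + g u)"

text \<open>The identity Re z Re w = Re (z w / 2) + Re (z cnj w / 2) keeps a product of real parts a
  sum of real parts of monomials. This makes the trigonometric polynomials an algebra.\<close>

lemma trig_poly_monom_mult: "trig_poly d g \<Longrightarrow> trig_poly d (\<lambda>u. Re (monom_torus d a k l u) * g u)"
proof (induction rule: trig_poly.induct)
  case (monom b p q)
  have 1: "monom_torus d a k l u * monom_torus d b p q u / 2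
      = monom_torus d (a * b / 2) (\<lambda>i. k i + p i) (\<lambda>i. l i + q i) u" for u
    by (simp add: monom_torus_def power_add prod.distrib mult_ac)
  have 2: "monom_torus d a k l u * cnj (monom_torus d b p q u) / 2
      = monom_torus d (a * cnj b / 2) (\<lambda>i. k i + q i) (\<lambda>i. l i + p i) u" for u
    by (simp add: monom_torus_def power_add prod.distrib mult_ac)
  have "Re z * Re w = Re (z * w / 2) + Re (z * cnj w / 2)" for z w by (simp add: field_simps)
  then have 3: "Re (monom_torus d a k l u) * Re (monom_torus d b p q u) =
      Re (monom_torus d (a * b / 2) (\<lambda>i. k i + p i) (\<lambda>i. l i + q i) u) +
      Re (monom_torus d (a * cnj b / 2) (\<lambda>i. k i + q i) (\<lambda>i. l i + p i) u)" for u
    unfolding 1[symmetric] 2[symmetric] .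
  show ?case unfolding 3 by (intro trig_poly.intros)
next
  case (add f g)
  then show ?case using trig_poly.add by (simp add: distrib_left)
qed

lemma trig_poly_mult: "trig_poly d f \<Longrightarrow> trig_poly d g \<Longrightarrow> trig_poly d (\<lambda>u. f u * g u)"
proof (induction rule: trig_poly.induct)
  case (monom a k l) then show ?case by (rule trig_poly_monom_mult)
next
  case (add f h) then show ?case using trig_poly.add by (simp add: distrib_right)
qed

lemma trig_poly_const: "trig_poly d (\<lambda>u. c)"
  using trig_poly.monom[of d "complex_of_real c" "\<lambda>_. 0" "\<lambda>_. 0"] by (simp add: monom_torus_def)

lemma trig_poly_coord:
  assumes "i < d" shows "trig_poly d (\<lambda>u. Re (a * u i))"
proof -
  have "(\<Prod>j<d. u j ^ (if j = i then 1 else 0)) = u i" for u :: "nat \<Rightarrow> complex"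
    using assms by (subst prod.remove[of _ i]) auto
  then show ?thesis using trig_poly.monom[of d a "\<lambda>j. if j = i then 1 else 0" "\<lambda>_. 0"] by (simp add: monom_torus_def)
qed

lemma continuous_on_eval [continuous_intros]: "continuous_on S (\<lambda>u. u i)"
  using continuous_on_product_coordinates[of i] continuous_on_subset by blast

lemma continuous_trig_poly: "trig_poly d f \<Longrightarrow> continuous_on S f"
  by (induction rule: trig_poly.induct) (auto simp: monom_torus_def intro!: continuous_intros)

text \<open>The coordinates from d on are pinned to 1. The set is then a product of compact sets,
  and two of its points can only differ in one of the first d coordinates.\<close>

definition torus :: "nat \<Rightarrow> (nat \<Rightarrow> complex) set" where
  "torus d = {u. \<forall>i. u i \<in> (if i < d then sphere 0 1 else {1})}"

lemma compact_torus: "compact (torus d)"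
proof -
  have "compactin (product_topology (\<lambda>_. euclidean) UNIV) (PiE UNIV (\<lambda>i. if i < d then sphere (0::complex) 1 else {1}))"
    unfolding compactin_PiE by auto
  moreover have "PiE UNIV (\<lambda>i. if i < d then sphere (0::complex) 1 else {1}) = torus d"
    by (auto simp: torus_def PiE_def Pi_def split: if_splits)
  ultimately show ?thesis by (simp add: euclidean_product_topology)
qed

text \<open>Stone-Weierstrass: points are separated by the real and imaginary parts of the
  coordinates, the latter being the real part of - \<i> u.\<close>

lemma trig_poly_approx:
  assumes "continuous_on (torus d) f" "0 < e"
  shows "\<exists>g. trig_poly d g \<and> (\<forall>u\<in>torus d. \<bar>f u - g u\<bar> < e)"
proof (rule Stone_Weierstrass_HOL[OF compact_torus _ _ _ _ _ assms])
  fix u v assume uv: "u \<in> torus d \<and> v \<in> torus d \<and> u \<noteq> v"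
  then obtain i where i: "u i \<noteq> v i" by auto
  have "u i \<in> (if i < d then sphere 0 1 else {1})" "v i \<in> (if i < d then sphere 0 1 else {1})"
    using uv unfolding torus_def by blast+
  with i have "i < d" by (auto split: if_splits)
  from i have "Re (1 * u i) \<noteq> Re (1 * v i) \<or> Re (-\<i> * u i) \<noteq> Re (-\<i> * v i)" by (auto simp: complex_eq_iff)
  then show "\<exists>f. trig_poly d f \<and> f u \<noteq> f v"
    using trig_poly_coord[OF \<open>i < d\<close>, of 1] trig_poly_coord[OF \<open>i < d\<close>, of "-\<i>"] by blast
qed (auto intro: trig_poly_const continuous_trig_poly trig_poly.add trig_poly_mult)

section \<open>Folding Euclidean space onto the torus and back\<close>

text \<open>A vector becomes a vector of phases at scale L. On the cube with coordinates of size at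
  most L the phases stay within [-1, 1], where they can be read back.\<close>

definition wrap :: "nat \<Rightarrow> real \<Rightarrow> (nat \<Rightarrow> real) \<Rightarrow> nat \<Rightarrow> complex" where
  "wrap d L z i = (if i < d then cis (z i / L) else 1)"

lemma wrap_in_torus: "wrap d L z \<in> torus d"
  by (auto simp: wrap_def torus_def)

text \<open>A monomial of phases is a combination of cos and sin of one linear form, so its
  expectation is determined by the characteristic function of that form.\<close>

lemma monom_torus_wrap:
  "Re (monom_torus d a k l (wrap d L z)) =
    Re a * cos (\<Sum>i<d. (real (k i) - real (l i)) / L * z i) - Im a * sin (\<Sum>i<d. (real (k i) - real (l i)) / L * z i)"
proof -
  have "(\<Prod>i<n. cis (z i / L) ^ k i * cnj (cis (z i / L)) ^ l i) = cis (\<Sum>i<n. (real (k i) - real (l i)) / L * z i)" for n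
  proof (induction n)
    case (Suc n)
    have "cis (z n / L) ^ k n * cnj (cis (z n / L)) ^ l n = cis ((real (k n) - real (l n)) / L * z n)"
      unfolding cis_cnj Complex.DeMoivre cis_mult
      by (rule arg_cong[where f=cis]) (simp add: algebra_simps diff_divide_distrib)
    then show ?case using Suc by (simp add: cis_mult add.commute)
  qed simp
  moreover have "(\<Prod>i<d. wrap d L z i ^ k i * cnj (wrap d L z i) ^ l i) = (\<Prod>i<d. cis (z i / L) ^ k i * cnj (cis (z i / L)) ^ l i)"
    by (intro prod.cong) (auto simp: wrap_def)
  ultimately show ?thesis by (simp add: monom_torus_def)
qed

lemma trig_poly_wrap_measurable:
  "trig_poly d p \<Longrightarrow> (\<And>i. i < d \<Longrightarrow> (\<lambda>\<omega>. \<zeta> \<omega> i) \<in> borel_measurable M) \<Longrightarrow> (\<lambda>\<omega>. p (wrap d L (\<zeta> \<omega>))) \<in> borel_measurable M"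
proof (induction rule: trig_poly.induct)
  case (monom a k l)
  have [measurable]: "(\<lambda>\<omega>. \<Sum>i<d. (real (k i) - real (l i)) / L * \<zeta> \<omega> i) \<in> borel_measurable M"
    using monom by (intro borel_measurable_sum borel_measurable_times) auto
  show ?case unfolding monom_torus_wrap by measurable
qed auto

lemma trig_poly_bounded: "trig_poly d p \<Longrightarrow> \<exists>B. \<forall>z. \<bar>p (wrap d L z)\<bar> \<le> B"
proof (induction rule: trig_poly.induct)
  case (monom a k l)
  have "\<bar>Re (monom_torus d a k l (wrap d L z))\<bar> \<le> \<bar>Re a\<bar> * 1 + \<bar>Im a\<bar> * 1" for z
    unfolding monom_torus_wrap
    by (rule order_trans[OF abs_triangle_ineq4]) (auto simp: abs_mult intro!: add_mono mult_left_le)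
  then show ?case by blast
next
  case (add f g)
  then obtain A B where "\<forall>z. \<bar>f (wrap d L z)\<bar> \<le> A" "\<forall>z. \<bar>g (wrap d L z)\<bar> \<le> B" by blast
  then have "\<bar>f (wrap d L z) + g (wrap d L z)\<bar> \<le> A + B" for z by (meson abs_triangle_ineq add_mono order_trans)
  then show ?case by blast
qed

text \<open>Where all real parts are positive, arctan (Im / Re) recovers the phases. The product is
  a continuous cutoff: it equals 1 when all real parts are at least 1/2 and 0 as soon as one of them
  is not positive, where arctan would jump.\<close>

definition unwrap :: "nat \<Rightarrow> real \<Rightarrow> ((nat \<Rightarrow> real) \<Rightarrow> real) \<Rightarrow> (nat \<Rightarrow> complex) \<Rightarrow> real" where
  "unwrap d L \<phi> u = \<phi> (\<lambda>i. if i < d then L * arctan (Im (u i) / Re (u i)) else 0) * (\<Prod>i<d. max 0 (min 1 (2 * Re (u i))))"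

lemma abs_unwrap_le:
  assumes B: "\<And>z. \<bar>\<phi> z\<bar> \<le> B"
  shows "\<bar>unwrap d L \<phi> u\<bar> \<le> B" "i < d \<Longrightarrow> \<bar>unwrap d L \<phi> u\<bar> \<le> B * max 0 (min 1 (2 * Re (u i)))"
proof -
  have B0: "0 \<le> B" using B[of undefined] by linarith
  have p: "\<bar>\<Prod>i\<in>A. max 0 (min 1 (2 * Re (u i)))\<bar> \<le> 1" for A :: "nat set"
    unfolding abs_prod by (intro prod_le_1) auto
  show "\<bar>unwrap d L \<phi> u\<bar> \<le> B"
    unfolding unwrap_def abs_mult using mult_mono[OF B p B0 abs_ge_zero] by simp
  assume i: "i < d"
  have "(\<Prod>i<d. max 0 (min 1 (2 * Re (u i)))) = max 0 (min 1 (2 * Re (u i))) * (\<Prod>i\<in>{..<d}-{i}. max 0 (min 1 (2 * Re (u i))))"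
    using i by (intro prod.remove) auto
  also have "\<bar>\<dots>\<bar> \<le> max 0 (min 1 (2 * Re (u i))) * 1"
    unfolding abs_mult by (intro mult_mono p) auto
  finally show "\<bar>unwrap d L \<phi> u\<bar> \<le> B * max 0 (min 1 (2 * Re (u i)))"
    unfolding unwrap_def abs_mult by (intro mult_mono B B0) auto
qed

text \<open>On the open set of positive real parts this is a composition of continuous maps. At any
  other point one cutoff factor tends to 0 while \<phi> stays bounded, so the function tends to its
  value 0.\<close>

lemma continuous_unwrap:
  assumes \<phi>: "continuous_on UNIV \<phi>" and B: "\<And>z. \<bar>\<phi> z\<bar> \<le> B"
  shows "continuous_on UNIV (unwrap d L \<phi>)"
proof -
  define W where "W = {u :: nat \<Rightarrow> complex. \<forall>i<d. Re (u i) > 0}"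
  have W: "open W"
  proof -
    have "W = (\<Inter>i\<in>{..<d}. {u. Re (u i) > 0})" by (auto simp: W_def)
    moreover have "open {u :: nat \<Rightarrow> complex. Re (u i) > 0}" for i
      by (intro open_Collect_less continuous_intros)
    ultimately show ?thesis by auto
  qed
  have "continuous_on W (unwrap d L \<phi>)"
  proof -
    have "continuous_on W (\<lambda>u i. if i < d then L * arctan (Im (u i) / Re (u i)) else 0)"
    proof (rule continuous_on_coordinatewise_then_product)
      show "continuous_on W (\<lambda>u. if i < d then L * arctan (Im (u i) / Re (u i)) else 0)" for i
        by (cases "i < d") (auto simp: W_def intro!: continuous_intros)
    qed
    from continuous_on_compose2[OF \<phi> this]
    have "continuous_on W (\<lambda>u. \<phi> (\<lambda>i. if i < d then L * arctan (Im (u i) / Re (u i)) else 0))" by auto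
    then show ?thesis unfolding unwrap_def by (intro continuous_on_mult continuous_intros)
  qed
  then have 1: "isCont (unwrap d L \<phi>) u" if "u \<in> W" for u
    using that W continuous_on_eq_continuous_at by blast
  have 2: "isCont (unwrap d L \<phi>) u" if "u \<notin> W" for u
  proof -
    from that obtain i where i: "i < d" "Re (u i) \<le> 0" by (auto simp: W_def not_less)
    have "isCont (\<lambda>u. B * max 0 (min 1 (2 * Re (u i)))) u"
      by (rule continuous_on_interior[of UNIV]) (auto intro!: continuous_intros)
    then have "((\<lambda>u. B * max 0 (min 1 (2 * Re (u i)))) \<longlongrightarrow> 0) (at u)"
      using i unfolding isCont_def by simp
    then have "(unwrap d L \<phi> \<longlongrightarrow> 0) (at u)"
      by (rule Lim_null_comparison[rotated]) (use abs_unwrap_le(2)[where \<phi>=\<phi>, OF B i(1)] in auto)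
    moreover have "unwrap d L \<phi> u = 0" using abs_unwrap_le(2)[where \<phi>=\<phi> and u=u and L=L, OF B i(1)] i by simp
    ultimately show ?thesis unfolding isCont_def by simp
  qed
  show ?thesis using 1 2 by (intro continuous_at_imp_continuous_on) blast
qed

lemma unwrap_wrap:
  assumes A: "A > 0" and z: "\<And>i. i < d \<Longrightarrow> \<bar>z i\<bar> \<le> A" and dep: "\<And>z z'. (\<And>i. i < d \<Longrightarrow> z i = z' i) \<Longrightarrow> \<phi> z = \<phi> z'"
  shows "unwrap d A \<phi> (wrap d A z) = \<phi> z"
proof -
  have r: "\<bar>z i / A\<bar> \<le> 1" if "i < d" for i
    using z[OF that] A by (subst abs_divide) (simp add: divide_le_eq)
  have c: "1/2 \<le> cos (z i / A)" if "i < d" for i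
  proof -
    \<comment> \<open>As pi > 3, a phase of size at most 1 is below pi/3, where cos is at least 1/2
      and the cutoff factor equals 1.\<close>
    have "\<bar>z i / A\<bar> \<le> pi/3" using r[OF that] pi_gt3 by linarith
    then have "cos (pi/3) \<le> cos \<bar>z i / A\<bar>" using pi_gt3 by (intro cos_monotone_0_pi_le abs_ge_zero) linarith+
    then show ?thesis unfolding cos_abs_real cos_60 .
  qed
  have p: "(\<Prod>i<d. max 0 (min 1 (2 * Re (wrap d A z i)))) = 1"
  proof (rule prod.neutral, intro ballI)
    fix i assume "i \<in> {..<d}"
    then show "max 0 (min 1 (2 * Re (wrap d A z i))) = 1" using c[of i] by (simp add: wrap_def)
  qed
  have t: "A * arctan (Im (wrap d A z i) / Re (wrap d A z i)) = z i" if i: "i < d" for i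
  proof -
    have "arctan (tan (z i / A)) = z i / A"
      using r[OF i] pi_gt3 by (intro arctan_tan) linarith+
    then show ?thesis using A i by (simp add: wrap_def tan_def)
  qed
  have "\<phi> (\<lambda>i. if i < d then A * arctan (Im (wrap d A z i) / Re (wrap d A z i)) else 0) = \<phi> z"
    by (rule dep) (simp add: t)
  then show ?thesis unfolding unwrap_def p by simp
qed

text \<open>Unless some coordinate exceeds A, unwrapping recovers \<phi> exactly and only the
  approximation error e remains. On the exceptional event both \<phi> and its unwrapped version are
  bounded by B, which costs 2 B.\<close>

lemma (in prob_space) trig_poly_error:
  fixes \<zeta> :: "'a \<Rightarrow> nat \<Rightarrow> real"
  assumes meas: "\<And>i. (\<lambda>\<omega>. \<zeta> \<omega> i) \<in> borel_measurable M"
    and \<phi>: "continuous_on UNIV \<phi>" "\<And>z. \<bar>\<phi> z\<bar> \<le> B" "\<And>z z'. (\<And>i. i < d \<Longrightarrow> z i = z' i) \<Longrightarrow> \<phi> z = \<phi> z'"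
    and A: "A > 0" and tight: "\<And>i. i < d \<Longrightarrow> prob {\<omega>\<in>space M. \<bar>\<zeta> \<omega> i\<bar> > A} \<le> \<delta>"
    and p: "trig_poly d p" "\<And>u. u \<in> torus d \<Longrightarrow> \<bar>unwrap d A \<phi> u - p u\<bar> < e"
  shows "\<bar>(\<integral>\<omega>. \<phi> (\<zeta> \<omega>) \<partial>M) - (\<integral>\<omega>. p (wrap d A (\<zeta> \<omega>)) \<partial>M)\<bar> \<le> e + 2 * B * (real d * \<delta>)"
proof -
  have [measurable]: "\<zeta> \<in> borel_measurable M" using meas by (rule measurable_coordinatewise_then_product)
  have [measurable]: "\<phi> \<in> borel_measurable borel" using \<phi>(1) by (rule borel_measurable_continuous_onI)
  have B0: "0 \<le> B" using \<phi>(2)[of undefined] by linarith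
  have [measurable]: "(\<lambda>\<omega>. \<zeta> \<omega> i) \<in> borel_measurable M" for i by (rule meas)
  obtain B' where B': "\<And>z. \<bar>p (wrap d A z)\<bar> \<le> B'" using trig_poly_bounded[OF p(1)] by blast
  have i1: "integrable M (\<lambda>\<omega>. \<phi> (\<zeta> \<omega>))" by (intro brv_integrable brvI[where B=B] \<phi>(2)) measurable
  have i2: "integrable M (\<lambda>\<omega>. p (wrap d A (\<zeta> \<omega>)))"
    by (intro brv_integrable brvI[where B=B'] B' trig_poly_wrap_measurable p(1) meas)
  define E where "E = {\<omega>\<in>space M. \<exists>i<d. \<bar>\<zeta> \<omega> i\<bar> > A}"
  have [measurable]: "E \<in> events" unfolding E_def by measurable
  have "E = (\<Union>i<d. {\<omega>\<in>space M. \<bar>\<zeta> \<omega> i\<bar> > A})" by (auto simp: E_def)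
  then have "prob E \<le> (\<Sum>i<d. prob {\<omega>\<in>space M. \<bar>\<zeta> \<omega> i\<bar> > A})"
    by (simp only:, intro finite_measure_subadditive_finite) auto
  also have "\<dots> \<le> real d * \<delta>" using sum_bounded_above[of "{..<d}" "\<lambda>i. prob {\<omega>\<in>space M. \<bar>\<zeta> \<omega> i\<bar> > A}" \<delta>] tight by auto
  finally have pE: "prob E \<le> real d * \<delta>" .
  have ptw: "\<bar>\<phi> (\<zeta> \<omega>) - p (wrap d A (\<zeta> \<omega>))\<bar> \<le> e + 2 * B * indicator E \<omega>" if "\<omega> \<in> space M" for \<omega>
  proof -
    have 1: "\<bar>unwrap d A \<phi> (wrap d A (\<zeta> \<omega>)) - p (wrap d A (\<zeta> \<omega>))\<bar> < e" by (intro p(2) wrap_in_torus)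
    show ?thesis
    proof (cases "\<omega> \<in> E")
      case True
      then show ?thesis using 1 abs_unwrap_le(1)[where \<phi>=\<phi>, OF \<phi>(2), where d=d and L=A and u="wrap d A (\<zeta> \<omega>)"] \<phi>(2)[of "\<zeta> \<omega>"] by simp
    next
      case False
      then have "unwrap d A \<phi> (wrap d A (\<zeta> \<omega>)) = \<phi> (\<zeta> \<omega>)"
        using that by (intro unwrap_wrap A \<phi>(3)) (force simp: E_def)+
      then show ?thesis using 1 False by simp
    qed
  qed
  have "\<bar>(\<integral>\<omega>. \<phi> (\<zeta> \<omega>) \<partial>M) - (\<integral>\<omega>. p (wrap d A (\<zeta> \<omega>)) \<partial>M)\<bar> = \<bar>\<integral>\<omega>. \<phi> (\<zeta> \<omega>) - p (wrap d A (\<zeta> \<omega>)) \<partial>M\<bar>"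
    by (simp add: i1 i2)
  also have "\<dots> \<le> (\<integral>\<omega>. \<bar>\<phi> (\<zeta> \<omega>) - p (wrap d A (\<zeta> \<omega>))\<bar> \<partial>M)" by (rule integral_abs_bound)
  also have "\<dots> \<le> (\<integral>\<omega>. e + 2 * B * indicator E \<omega> \<partial>M)"
    by (intro integral_mono ptw) (auto intro!: integrable_abs Bochner_Integration.integrable_diff i1 i2 integrable_real_mult_indicator simp: emeasure_eq_measure)
  also have "\<dots> = e + 2 * B * prob E" by (simp add: prob_space emeasure_eq_measure)
  finally show ?thesis using mult_left_mono[OF pE, of "2 * B"] B0 by linarith
qed

lemma (in prob_space) integral_monom_torus:
  fixes \<eta> :: "'a \<Rightarrow> nat \<Rightarrow> real"
  assumes m: "\<And>i. (\<lambda>\<omega>. \<eta> \<omega> i) \<in> borel_measurable M"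
  shows "(\<integral>\<omega>. Re (monom_torus d a k l (wrap d A (\<eta> \<omega>))) \<partial>M) =
    Re (a * cf (\<lambda>\<omega>. \<Sum>i<d. (real (k i) - real (l i)) / A * \<eta> \<omega> i))"
proof -
  define T where "T \<omega> = (\<Sum>i<d. (real (k i) - real (l i)) / A * \<eta> \<omega> i)" for \<omega>
  have [measurable]: "T \<in> borel_measurable M"
    unfolding T_def using m by (intro borel_measurable_sum borel_measurable_times) auto
  show ?thesis unfolding monom_torus_wrap cf_def T_def[symmetric] by simp
qed

lemma (in prob_space) integrable_trig_poly:
  fixes \<eta> :: "'a \<Rightarrow> nat \<Rightarrow> real"
  assumes "trig_poly d f" and m: "\<And>i. (\<lambda>\<omega>. \<eta> \<omega> i) \<in> borel_measurable M"
  shows "integrable M (\<lambda>\<omega>. f (wrap d A (\<eta> \<omega>)))"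
proof -
  obtain B where "\<And>z. \<bar>f (wrap d A z)\<bar> \<le> B" using trig_poly_bounded[OF assms(1)] by blast
  then show ?thesis using assms by (intro brv_integrable brvI[where B=B] trig_poly_wrap_measurable)
qed

text \<open>A multivariate continuity theorem. Tightness confines both laws to a cube up to
  \<delta>, the cube is wrapped onto the torus, \<phi> is replaced by a trigonometric polynomial,
  and for the polynomial the convergence of the characteristic functions is exactly what is
  needed.\<close>

theorem weak_conv_of_char:
  fixes M :: "'a measure" and N :: "'b measure" and \<zeta> :: "nat \<Rightarrow> 'a \<Rightarrow> nat \<Rightarrow> real" and \<xi> :: "'b \<Rightarrow> nat \<Rightarrow> real"
    and \<phi> :: "(nat \<Rightarrow> real) \<Rightarrow> real"
  assumes "prob_space M" "prob_space N"
    and mM: "\<And>n i. (\<lambda>\<omega>. \<zeta> n \<omega> i) \<in> borel_measurable M" and mN: "\<And>i. (\<lambda>\<omega>. \<xi> \<omega> i) \<in> borel_measurable N"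
    and ch: "\<And>c. (\<lambda>n. prob_space.cf M (\<lambda>\<omega>. \<Sum>i<d. c i * \<zeta> n \<omega> i)) \<longlonglongrightarrow> prob_space.cf N (\<lambda>\<omega>. \<Sum>i<d. c i * \<xi> \<omega> i)"
    and tight: "\<And>\<delta> :: real. \<delta> > 0 \<Longrightarrow> \<exists>A>0. \<forall>i<d. (\<forall>n. measure M {\<omega>\<in>space M. \<bar>\<zeta> n \<omega> i\<bar> > A} \<le> \<delta>) \<and> measure N {\<omega>\<in>space N. \<bar>\<xi> \<omega> i\<bar> > A} \<le> \<delta>"
    and \<phi>: "continuous_on UNIV \<phi>" "\<And>z. \<bar>\<phi> z\<bar> \<le> B" "\<And>z z'. (\<And>i. i < d \<Longrightarrow> z i = z' i) \<Longrightarrow> \<phi> z = \<phi> z'"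
  shows "(\<lambda>n. \<integral>\<omega>. \<phi> (\<zeta> n \<omega>) \<partial>M) \<longlonglongrightarrow> (\<integral>\<omega>. \<phi> (\<xi> \<omega>) \<partial>N)"
proof -
  interpret M: prob_space M by fact
  interpret N: prob_space N by fact
  have B0: "0 \<le> B" using \<phi>(2)[of undefined] by linarith
  have poly: "(\<lambda>n. \<integral>\<omega>. p (wrap d A (\<zeta> n \<omega>)) \<partial>M) \<longlonglongrightarrow> (\<integral>\<omega>. p (wrap d A (\<xi> \<omega>)) \<partial>N)"
    if "trig_poly d p" for p A using that
  proof (induction rule: trig_poly.induct)
    case (monom a k l)
    show ?case unfolding M.integral_monom_torus[OF mM] N.integral_monom_torus[OF mN] by (intro tendsto_intros ch)
  next
    case (add f g)
    show ?case
      unfolding Bochner_Integration.integral_add[OF M.integrable_trig_poly[OF add(1) mM] M.integrable_trig_poly[OF add(2) mM]]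
        Bochner_Integration.integral_add[OF N.integrable_trig_poly[OF add(1) mN] N.integrable_trig_poly[OF add(2) mN]]
      by (intro tendsto_add add)
  qed
  show ?thesis
  proof (rule LIMSEQ_I)
    fix r :: real assume r: "0 < r"
    \<comment> \<open>Adding 1 to both factors keeps D positive when B or d vanishes; with this
      \<delta> the tail error is at most r/8.\<close>
    define D where "D = (B + 1) * (real d + 1)"
    have D: "D > 0" "B * real d \<le> D" using B0 by (auto simp: D_def intro!: mult_mono)
    define \<delta> where "\<delta> = r / (16 * D)"
    have \<delta>: "\<delta> > 0" using r D by (simp add: \<delta>_def)
    have "2 * B * (real d * \<delta>) = (B * real d) * (r / (8 * D))" by (simp add: \<delta>_def)
    also have "\<dots> \<le> D * (r / (8 * D))" using D r by (intro mult_right_mono) auto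
    also have "\<dots> = r / 8" using D by simp
    finally have bd: "2 * B * (real d * \<delta>) \<le> r / 8" .
    obtain A where A: "A > 0" "\<And>n i. i < d \<Longrightarrow> measure M {\<omega>\<in>space M. \<bar>\<zeta> n \<omega> i\<bar> > A} \<le> \<delta>" "\<And>i. i < d \<Longrightarrow> measure N {\<omega>\<in>space N. \<bar>\<xi> \<omega> i\<bar> > A} \<le> \<delta>"
      using tight[OF \<delta>] by blast
    have "continuous_on (torus d) (unwrap d A \<phi>)"
      using continuous_unwrap[OF \<phi>(1,2)] continuous_on_subset by blast
    from trig_poly_approx[OF this, of "r/8"] r obtain p where "trig_poly d p" "\<forall>u\<in>torus d. \<bar>unwrap d A \<phi> u - p u\<bar> < r / 8"
      by auto
    then have p: "trig_poly d p" "\<And>u. u \<in> torus d \<Longrightarrow> \<bar>unwrap d A \<phi> u - p u\<bar> < r / 8" by auto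
    have eN: "\<bar>(\<integral>\<omega>. \<phi> (\<xi> \<omega>) \<partial>N) - (\<integral>\<omega>. p (wrap d A (\<xi> \<omega>)) \<partial>N)\<bar> \<le> r / 8 + 2 * B * (real d * \<delta>)"
      by (rule N.trig_poly_error) (fact mN \<phi> A p)+
    have eM: "\<bar>(\<integral>\<omega>. \<phi> (\<zeta> n \<omega>) \<partial>M) - (\<integral>\<omega>. p (wrap d A (\<zeta> n \<omega>)) \<partial>M)\<bar> \<le> r / 8 + 2 * B * (real d * \<delta>)" for n
      by (rule M.trig_poly_error) (fact mM \<phi> A p)+
    obtain n0 where n0: "\<And>n. n \<ge> n0 \<Longrightarrow> \<bar>(\<integral>\<omega>. p (wrap d A (\<zeta> n \<omega>)) \<partial>M) - (\<integral>\<omega>. p (wrap d A (\<xi> \<omega>)) \<partial>N)\<bar> < r / 4"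
      using LIMSEQ_D[OF poly[OF p(1), of A], of "r/4"] r by auto
    show "\<exists>no. \<forall>n\<ge>no. norm ((\<integral>\<omega>. \<phi> (\<zeta> n \<omega>) \<partial>M) - (\<integral>\<omega>. \<phi> (\<xi> \<omega>) \<partial>N)) < r"
    proof (intro exI allI impI)
      fix n assume "n \<ge> n0"
      from n0[OF \<open>n \<ge> n0\<close>] show "norm ((\<integral>\<omega>. \<phi> (\<zeta> n \<omega>) \<partial>M) - (\<integral>\<omega>. \<phi> (\<xi> \<omega>) \<partial>N)) < r"
        using eM[of n] eN bd r unfolding real_norm_def by linarith
    qed
  qed
qed

section \<open>Convergence in the Skorokhod space\<close>

definition gridfun :: "nat \<Rightarrow> (nat \<Rightarrow> real) \<Rightarrow> real \<Rightarrow> real" where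
  "gridfun m z x = z (nat \<lfloor>2^m * x\<rfloor>)"

text \<open>Padding by zero leaves only 2^m + 1 live coordinates, so that the grid vector is
  unchanged by truncation to finitely many coordinates.\<close>

definition sample :: "nat \<Rightarrow> (real \<Rightarrow> real) \<Rightarrow> nat \<Rightarrow> real" where
  "sample m f i = (if i \<le> 2^m then f (real i / 2^m) else 0)"

definition step :: "nat \<Rightarrow> (real \<Rightarrow> real) \<Rightarrow> real \<Rightarrow> real" where
  "step m f = gridfun m (sample m f)"

lemma nat_floor_le: "(x :: real) \<in> {0..1} \<Longrightarrow> nat \<lfloor>2^m * x\<rfloor> \<le> 2^m"
proof -
  assume x: "x \<in> {0..1}"
  have "2^m * x \<le> 2^m" using x mult_left_le[of x "2^m"] by simp
  then have "\<lfloor>2^m * x\<rfloor> \<le> \<lfloor>real_of_int (2^m)\<rfloor>" by (intro floor_mono) simp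
  then have "\<lfloor>2^m * x\<rfloor> \<le> 2^m" unfolding floor_of_int .
  then show ?thesis by (simp add: nat_le_iff)
qed

lemma step_eq: "x \<in> {0..1} \<Longrightarrow> step m f x = f (\<lfloor>2^m * x\<rfloor> / 2^m)"
  using nat_floor_le[of x m] by (simp add: step_def gridfun_def sample_def of_nat_nat)

lemma cadlag_gridfun: "cadlag01 (gridfun m z)"
  unfolding cadlag01_def
proof (intro conjI ballI)
  fix t :: real assume t: "t \<in> {0..<1}"
  define b where "b = (\<lfloor>2^m * t\<rfloor> + 1) / 2^m"
  have "t < b" unfolding b_def by (simp add: pos_less_divide_eq mult.commute)
  then have "\<forall>\<^sub>F y in at_right t. y \<in> {t<..<b}" by (rule eventually_at_right_real)
  then have "\<forall>\<^sub>F y in at_right t. gridfun m z y = gridfun m z t"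
  proof (rule eventually_mono)
    fix y assume y: "y \<in> {t<..<b}"
    have "2^m * t < 2^m * y" using y by simp
    moreover have "2^m * y < \<lfloor>2^m * t\<rfloor> + 1" using y by (simp add: b_def pos_less_divide_eq mult.commute)
    ultimately have "\<lfloor>2^m * y\<rfloor> = \<lfloor>2^m * t\<rfloor>" by linarith
    then show "gridfun m z y = gridfun m z t" by (simp add: gridfun_def)
  qed
  then show "(gridfun m z \<longlongrightarrow> gridfun m z t) (at_right t)" by (rule tendsto_eventually)
next
  fix t :: real assume t: "t \<in> {0<..1}"
  \<comment> \<open>The largest grid point strictly below t. The ceiling minus one is right also
    when t itself is a grid point, where the function may jump.\<close>
  define b where "b = (\<lceil>2^m * t\<rceil> - 1) / 2^m"
  have "b < t" unfolding b_def by (simp add: pos_divide_less_eq mult.commute) linarith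
  then have "\<forall>\<^sub>F y in at_left t. y \<in> {b<..<t}" by (rule eventually_at_left_real)
  then have "\<forall>\<^sub>F y in at_left t. gridfun m z y = z (nat (\<lceil>2^m * t\<rceil> - 1))"
  proof (rule eventually_mono)
    fix y assume y: "y \<in> {b<..<t}"
    have "2^m * y < 2^m * t" using y by simp
    moreover have "\<lceil>2^m * t\<rceil> - 1 < 2^m * y" using y by (simp add: b_def pos_divide_less_eq mult.commute)
    ultimately have "\<lfloor>2^m * y\<rfloor> = \<lceil>2^m * t\<rceil> - 1" by linarith
    then show "gridfun m z y = z (nat (\<lceil>2^m * t\<rceil> - 1))" by (simp add: gridfun_def)
  qed
  then show "\<exists>l. (gridfun m z \<longlongrightarrow> l) (at_left t)" using tendsto_eventually by blast
qed

lemma cadlag_step: "cadlag01 (step m f)"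
  unfolding step_def by (rule cadlag_gridfun)

lemma skorokhod_dist_le:
  assumes "r \<in> time_changes" "\<And>t. t \<in> {0..1} \<Longrightarrow> \<bar>r t - t\<bar> \<le> e" "\<And>t. t \<in> {0..1} \<Longrightarrow> \<bar>f t - g (r t)\<bar> \<le> e"
  shows "skorokhod_dist f g \<le> e"
  unfolding skorokhod_dist_def
proof (rule cInf_lower)
  show "bdd_below {e. \<exists>r\<in>time_changes. (\<forall>t\<in>{0..1}. \<bar>r t - t\<bar> \<le> e) \<and> (\<forall>t\<in>{0..1}. \<bar>f t - g (r t)\<bar> \<le> e)}"
  proof (rule bdd_belowI[where m=0])
    fix e assume "e \<in> {e. \<exists>r\<in>time_changes. (\<forall>t\<in>{0..1}. \<bar>r t - t\<bar> \<le> e) \<and> (\<forall>t\<in>{0..1}. \<bar>f t - g (r t)\<bar> \<le> e)}"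
    then obtain r where "\<forall>t\<in>{0..1}. \<bar>r t - t\<bar> \<le> e" by blast
    then have "\<bar>r 0 - 0\<bar> \<le> e" by (rule bspec) simp
    then show "0 \<le> e" by linarith
  qed
qed (use assms in blast)

lemma skorokhod_dist_sup_le:
  assumes "\<And>t. t \<in> {0..1} \<Longrightarrow> \<bar>f t - g t\<bar> \<le> e" shows "skorokhod_dist f g \<le> e"
proof (rule skorokhod_dist_le)
  show "(\<lambda>t. t) \<in> time_changes" by (auto simp: time_changes_def strict_mono_on_def)
  have "0 \<le> e" using assms[of 0] by simp
  then show "\<bar>t - t\<bar> \<le> e" for t :: real by simp
qed (use assms in auto)

lemma skorokhod_continuous_sup:
  assumes "skorokhod_continuous h" "cadlag01 f" "e > 0"
  obtains \<delta> where "\<delta> > 0" "\<And>g. cadlag01 g \<Longrightarrow> (\<And>t. t \<in> {0..1} \<Longrightarrow> \<bar>f t - g t\<bar> \<le> \<delta>) \<Longrightarrow> \<bar>h g - h f\<bar> < e"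
proof -
  obtain \<delta> where \<delta>: "\<delta> > 0" "\<forall>g. cadlag01 g \<longrightarrow> skorokhod_dist f g < \<delta> \<longrightarrow> \<bar>h g - h f\<bar> < e"
    using assms unfolding skorokhod_continuous_def by blast
  show thesis
  proof (rule that[of "\<delta>/2"])
    fix g assume "cadlag01 g" and s: "\<And>t. t \<in> {0..1} \<Longrightarrow> \<bar>f t - g t\<bar> \<le> \<delta>/2"
    have "skorokhod_dist f g \<le> \<delta>/2" by (rule skorokhod_dist_sup_le) (rule s)
    then show "\<bar>h g - h f\<bar> < e" using \<delta> \<open>cadlag01 g\<close> by auto
  qed (use \<delta> in simp)
qed

text \<open>Functions that agree on [0, 1] are arbitrarily close to each other in the sense of
  continuity at f. Taking \<bar>h g - h f\<bar> itself as the tolerance gives the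
  contradiction.\<close>

lemma skorokhod_continuous_cong:
  assumes "skorokhod_continuous h" "cadlag01 f" "cadlag01 g" "\<And>t. t \<in> {0..1} \<Longrightarrow> f t = g t"
  shows "h f = h g"
proof (rule ccontr)
  assume "h f \<noteq> h g"
  then have e: "\<bar>h g - h f\<bar> > 0" by simp
  obtain \<delta> where "\<delta> > 0" "\<And>g. cadlag01 g \<Longrightarrow> (\<And>t. t \<in> {0..1} \<Longrightarrow> \<bar>f t - g t\<bar> \<le> \<delta>) \<Longrightarrow> \<bar>h g - h f\<bar> < \<bar>h g - h f\<bar>"
    using skorokhod_continuous_sup[OF assms(1,2) e] assms(3,4) by (metis abs_zero diff_self less_eq_real_def less_irrefl)
  then show False using assms(3,4) by (metis abs_zero diff_self less_eq_real_def less_irrefl)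
qed

lemma eventually_coords_close:
  fixes z :: "nat \<Rightarrow> real" assumes "\<delta> > 0"
  shows "\<forall>\<^sub>F z' in at z. \<forall>i\<in>{..n}. \<bar>z' i - z i\<bar> < \<delta>"
proof (rule eventually_ball_finite[OF finite_atMost], intro ballI)
  fix i
  have "isCont (\<lambda>z :: nat \<Rightarrow> real. z i) z"
    using continuous_on_product_coordinates[of i] by (rule continuous_on_interior) simp
  then have "((\<lambda>z'. z' i) \<longlongrightarrow> z i) (at z)" unfolding isCont_def .
  then show "\<forall>\<^sub>F z' in at z. \<bar>z' i - z i\<bar> < \<delta>" using assms tendstoD[of "\<lambda>z'. z' i" "z i" "at z" \<delta>] by (simp add: dist_real_def)
qed

text \<open>On [0, 1] the step function reads only finitely many coordinates, so closeness in the
  product topology gives uniform closeness of the step functions.\<close>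

lemma continuous_gridfun:
  assumes h: "skorokhod_continuous h" shows "continuous_on UNIV (\<lambda>z. h (gridfun m z))"
proof (intro continuous_at_imp_continuous_on ballI)
  fix z :: "nat \<Rightarrow> real"
  show "isCont (\<lambda>z. h (gridfun m z)) z"
    unfolding isCont_def
  proof (rule tendstoI)
    fix e :: real assume "0 < e"
    from skorokhod_continuous_sup[OF h cadlag_gridfun this] obtain \<delta> where \<delta>: "\<delta> > 0"
      "\<And>g. cadlag01 g \<Longrightarrow> (\<And>t. t \<in> {0..1} \<Longrightarrow> \<bar>gridfun m z t - g t\<bar> \<le> \<delta>) \<Longrightarrow> \<bar>h g - h (gridfun m z)\<bar> < e" by blast
    show "\<forall>\<^sub>F z' in at z. dist (h (gridfun m z')) (h (gridfun m z)) < e"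
    proof (rule eventually_mono[OF eventually_coords_close[OF \<delta>(1), where z=z and n="2^m"]])
      fix z' assume c: "\<forall>i\<in>{..2^m}. \<bar>z' i - z i\<bar> < \<delta>"
      have "\<bar>gridfun m z t - gridfun m z' t\<bar> \<le> \<delta>" if "t \<in> {0..1}" for t
        using c nat_floor_le[OF that, of m] unfolding gridfun_def by (fastforce simp: abs_minus_commute less_imp_le)
      then show "dist (h (gridfun m z')) (h (gridfun m z)) < e"
        using \<delta>(2)[OF cadlag_gridfun] by (simp add: dist_real_def)
    qed
  qed
qed

lemma sample_measurable:
  assumes "\<And>x. x \<in> {0..1} \<Longrightarrow> (\<lambda>\<omega>. Z \<omega> x) \<in> borel_measurable M"
  shows "(\<lambda>\<omega>. sample m (Z \<omega>) i) \<in> borel_measurable M"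
proof (cases "i \<le> 2^m")
  case True
  then have "real i / 2^m \<in> {0..1}" by (simp add: divide_le_eq)
  then show ?thesis using assms True by (simp add: sample_def)
qed (simp add: sample_def)

text \<open>The functional is a continuous function of the grid vector. Measurability of \<omega>
  being the only issue, no sigma-algebra on the path space enters.\<close>

lemma step_measurable:
  assumes h: "skorokhod_continuous h" and Z: "\<And>x. x \<in> {0..1} \<Longrightarrow> (\<lambda>\<omega>. Z \<omega> x) \<in> borel_measurable M"
  shows "(\<lambda>\<omega>. h (step m (Z \<omega>))) \<in> borel_measurable M"
proof -
  have "(\<lambda>\<omega>. sample m (Z \<omega>)) \<in> borel_measurable M"
    by (rule measurable_coordinatewise_then_product) (rule sample_measurable[OF Z])
  from measurable_compose[OF this borel_measurable_continuous_onI[OF continuous_gridfun[OF h, of m]]]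
  show ?thesis unfolding step_def .
qed

text \<open>The functions min 1 (j dist (z, - U)) increase to the indicator of U. One j already
  brings the limiting integral above c, and staying below the indicator transfers this to the
  measures of U along the sequence.\<close>

lemma open_portmanteau:
  fixes M :: "'a measure" and N :: "'b measure" and \<zeta> :: "nat \<Rightarrow> 'a \<Rightarrow> nat \<Rightarrow> real" and \<xi> :: "'b \<Rightarrow> nat \<Rightarrow> real"
  assumes "prob_space M" "prob_space N"
    and [measurable]: "\<And>n. \<zeta> n \<in> borel_measurable M" "\<xi> \<in> borel_measurable N"
    and conv: "\<And>\<phi> :: (nat \<Rightarrow> real) \<Rightarrow> real. continuous_on UNIV \<phi> \<Longrightarrow> (\<And>z. \<bar>\<phi> z\<bar> \<le> 1) \<Longrightarrow>
      (\<lambda>n. \<integral>\<omega>. \<phi> (\<zeta> n \<omega>) \<partial>M) \<longlonglongrightarrow> (\<integral>\<omega>. \<phi> (\<xi> \<omega>) \<partial>N)"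
    and U: "open U" and lt: "c < measure N {\<omega>\<in>space N. \<xi> \<omega> \<in> U}"
  shows "\<forall>\<^sub>F n in sequentially. c < measure M {\<omega>\<in>space M. \<zeta> n \<omega> \<in> U}"
proof (cases "U = UNIV")
  \<comment> \<open>Treated apart because \<open>infdist\<close> to the empty complement is 0 by
    convention.\<close>
  case True
  interpret M: prob_space M by fact
  interpret N: prob_space N by fact
  have "measure N {\<omega>\<in>space N. \<xi> \<omega> \<in> U} = 1" using True by (simp add: N.prob_space)
  then show ?thesis using lt True by (simp add: M.prob_space)
next
  case False
  interpret M: prob_space M by fact
  interpret N: prob_space N by fact
  have [measurable]: "U \<in> sets borel" using U by simp
  define \<phi> where "\<phi> j z = min 1 (real j * infdist z (- U))" for j z
  have cont: "continuous_on UNIV (\<phi> j)" for j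
    unfolding \<phi>_def by (intro continuous_intros)
  have bd: "0 \<le> \<phi> j z" "\<phi> j z \<le> 1" for j z unfolding \<phi>_def by (auto simp: infdist_nonneg)
  have abd: "\<bar>\<phi> j z\<bar> \<le> 1" for j z using bd[of j z] by simp
  have [measurable]: "\<phi> j \<in> borel_measurable borel" for j using cont by (rule borel_measurable_continuous_onI)
  have le: "\<phi> j z \<le> indicator U z" for j z
    using bd[of j z] by (cases "z \<in> U") (auto simp: \<phi>_def)
  have lim: "(\<lambda>j. \<phi> j z) \<longlonglongrightarrow> indicator U z" for z
  proof (cases "z \<in> U")
    case True
    have "infdist z (- U) > 0"
    proof -
      have "infdist z (- U) \<noteq> 0" using True False U in_closed_iff_infdist_zero[of "- U" z] by auto
      then show ?thesis using infdist_nonneg[of z "- U"] by linarith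
    qed
    then obtain j0 where j0: "1 \<le> real j0 * infdist z (- U)"
      by (meson less_imp_le reals_Archimedean3)
    have "\<forall>\<^sub>F j in sequentially. \<phi> j z = 1"
    proof (rule eventually_mono[OF eventually_ge_at_top[of j0]])
      fix j assume "j0 \<le> j"
      then have "real j0 * infdist z (- U) \<le> real j * infdist z (- U)" by (intro mult_right_mono infdist_nonneg) auto
      then show "\<phi> j z = 1" using j0 by (simp add: \<phi>_def)
    qed
    then show ?thesis using True by (simp add: tendsto_eventually)
  next
    case False
    then have "\<phi> j z = 0" for j by (simp add: \<phi>_def)
    then show ?thesis using False by simp
  qed
  have "(\<lambda>j. \<integral>\<omega>. \<phi> j (\<xi> \<omega>) \<partial>N) \<longlonglongrightarrow> (\<integral>\<omega>. (indicator U (\<xi> \<omega>) :: real) \<partial>N)"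
    by (rule integral_dominated_convergence[where w="\<lambda>_. 1"]) (use lim abd in \<open>auto\<close>)
  also have "(\<integral>\<omega>. (indicator U (\<xi> \<omega>) :: real) \<partial>N) = measure N {\<omega>\<in>space N. \<xi> \<omega> \<in> U}"
  proof -
    have "(\<integral>\<omega>. (indicator U (\<xi> \<omega>) :: real) \<partial>N) = (\<integral>\<omega>. indicator {\<omega>\<in>space N. \<xi> \<omega> \<in> U} \<omega> \<partial>N)"
      by (intro Bochner_Integration.integral_cong) (auto simp: indicator_def)
    then show ?thesis by simp
  qed
  finally have "\<forall>\<^sub>F j in sequentially. c < (\<integral>\<omega>. \<phi> j (\<xi> \<omega>) \<partial>N)" using lt by (rule order_tendstoD)
  then obtain j where j: "c < (\<integral>\<omega>. \<phi> j (\<xi> \<omega>) \<partial>N)" by (auto simp: eventually_sequentially)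
  have "\<forall>\<^sub>F n in sequentially. c < (\<integral>\<omega>. \<phi> j (\<zeta> n \<omega>) \<partial>M)"
    using conv[OF cont[of j] abd[of j]] j by (rule order_tendstoD)
  then show ?thesis
  proof (rule eventually_mono)
    fix n assume n: "c < (\<integral>\<omega>. \<phi> j (\<zeta> n \<omega>) \<partial>M)"
    also have "(\<integral>\<omega>. \<phi> j (\<zeta> n \<omega>) \<partial>M) \<le> (\<integral>\<omega>. indicator {\<omega>\<in>space M. \<zeta> n \<omega> \<in> U} \<omega> \<partial>M)"
    proof (rule integral_mono)
      show "integrable M (\<lambda>\<omega>. \<phi> j (\<zeta> n \<omega>))" by (intro M.brv_integrable brvI[where B=1] abd) measurable
      show "integrable M (indicator {\<omega>\<in>space M. \<zeta> n \<omega> \<in> U} :: 'a \<Rightarrow> real)"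
        by (intro integrable_real_indicator) (auto simp: M.emeasure_eq_measure)
      show "\<phi> j (\<zeta> n \<omega>) \<le> indicator {\<omega>\<in>space M. \<zeta> n \<omega> \<in> U} \<omega>" if "\<omega> \<in> space M" for \<omega>
        using le[of j "\<zeta> n \<omega>"] that by (simp add: indicator_def)
    qed
    finally show "c < measure M {\<omega>\<in>space M. \<zeta> n \<omega> \<in> U}" by simp
  qed
qed

text \<open>The limit need not be supported by a separable set: continuity of \<open>h\<close> is used only through
  the open sets \<open>O m \<delta>\<close> of grid vectors near which \<open>h\<close> oscillates by at most \<open>\<epsilon>\<close>.\<close>

theorem weak_conv_D_criterion:
  fixes M :: "'a measure" and N :: "'b measure"
  assumes pM: "prob_space M" and pN: "prob_space N"
    and cZ: "\<And>n \<omega>. cadlag01 (Z n \<omega>)" and cW: "\<And>\<omega>. cadlag01 (W \<omega>)"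
    and mZ: "\<And>n x. x \<in> {0..1} \<Longrightarrow> (\<lambda>\<omega>. Z n \<omega> x) \<in> borel_measurable M"
    and mW: "\<And>x. x \<in> {0..1} \<Longrightarrow> (\<lambda>\<omega>. W \<omega> x) \<in> borel_measurable N"
    and mh: "\<And>h n. skorokhod_continuous h \<Longrightarrow> (\<lambda>\<omega>. h (Z n \<omega>)) \<in> borel_measurable M"
    and fidi: "\<And>m c. (\<lambda>n. prob_space.cf M (\<lambda>\<omega>. \<Sum>i<Suc (2^m). c i * Z n \<omega> (real i / 2^m)))
        \<longlonglongrightarrow> prob_space.cf N (\<lambda>\<omega>. \<Sum>i<Suc (2^m). c i * W \<omega> (real i / 2^m))"
    and tight: "\<And>x \<delta> :: real. x \<in> {0..1} \<Longrightarrow> \<delta> > 0 \<Longrightarrow> \<exists>A>0. (\<forall>n. measure M {\<omega>\<in>space M. \<bar>Z n \<omega> x\<bar> > A} \<le> \<delta>)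
        \<and> measure N {\<omega>\<in>space N. \<bar>W \<omega> x\<bar> > A} \<le> \<delta>"
    and equi: "\<And>\<epsilon> :: real. \<epsilon> > 0 \<Longrightarrow> \<exists>m0. \<forall>m\<ge>m0. \<exists>n0. \<forall>n\<ge>n0. \<exists>A\<in>sets M. measure M A \<le> \<epsilon> \<and>
        (\<forall>\<omega>\<in>space M - A. \<forall>x\<in>{0..1}. \<bar>Z n \<omega> x - step m (Z n \<omega>) x\<bar> \<le> \<epsilon>)"
    and unif: "\<And>\<omega> e :: real. e > 0 \<Longrightarrow> \<exists>m0. \<forall>m\<ge>m0. \<forall>x\<in>{0..1}. \<bar>W \<omega> x - step m (W \<omega>) x\<bar> \<le> e"
  shows "weak_conv_D M Z N W"
  unfolding weak_conv_D_def
proof (intro allI impI)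
  fix h :: "(real \<Rightarrow> real) \<Rightarrow> real"
  assume "\<exists>B. \<forall>f. cadlag01 f \<longrightarrow> \<bar>h f\<bar> \<le> B" and h: "skorokhod_continuous h"
  then obtain B where B: "\<And>f. cadlag01 f \<Longrightarrow> \<bar>h f\<bar> \<le> B" by blast
  interpret M: prob_space M by fact
  interpret N: prob_space N by fact
  have B0: "0 \<le> B" using B[OF cadlag_gridfun] abs_ge_zero order_trans by blast
  let ?\<zeta> = "\<lambda>m n \<omega>. sample m (Z n \<omega>)" and ?\<xi> = "\<lambda>m \<omega>. sample m (W \<omega>)"
  have m\<zeta>: "(\<lambda>\<omega>. ?\<zeta> m n \<omega> i) \<in> borel_measurable M" for m n i by (rule sample_measurable[OF mZ])
  have m\<xi>: "(\<lambda>\<omega>. ?\<xi> m \<omega> i) \<in> borel_measurable N" for m i by (rule sample_measurable[OF mW])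
  have m\<zeta>' [measurable]: "?\<zeta> m n \<in> borel_measurable M" for m n
    by (rule measurable_coordinatewise_then_product) (rule m\<zeta>)
  have m\<xi>' [measurable]: "?\<xi> m \<in> borel_measurable N" for m
    by (rule measurable_coordinatewise_then_product) (rule m\<xi>)
  have hZ [measurable]: "(\<lambda>\<omega>. h (Z n \<omega>)) \<in> borel_measurable M" for n by (rule mh[OF h])
  have hsZ [measurable]: "(\<lambda>\<omega>. h (step m (Z n \<omega>))) \<in> borel_measurable M" for m n by (rule step_measurable[OF h mZ])
  have hsW [measurable]: "(\<lambda>\<omega>. h (step m (W \<omega>))) \<in> borel_measurable N" for m by (rule step_measurable[OF h mW])
  have iZ: "integrable M (\<lambda>\<omega>. h (Z n \<omega>))" "integrable M (\<lambda>\<omega>. h (step m (Z n \<omega>)))" for m n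
    by (auto intro!: M.brv_integrable brvI[where B=B] B cZ cadlag_step)

  have conv: "(\<lambda>n. \<integral>\<omega>. \<phi> (?\<zeta> m n \<omega>) \<partial>M) \<longlonglongrightarrow> (\<integral>\<omega>. \<phi> (?\<xi> m \<omega>) \<partial>N)"
    if c: "continuous_on UNIV \<phi>" and b: "\<And>z. \<bar>\<phi> z\<bar> \<le> b" for m b and \<phi> :: "(nat \<Rightarrow> real) \<Rightarrow> real"
  proof -
    \<comment> \<open>Truncation makes \<phi> depend on finitely many coordinates only, as the
      continuity theorem requires, and it does not change sampled vectors.\<close>
    define tr where "tr z i = (if i < Suc (2^m) then z i else 0)" for z :: "nat \<Rightarrow> real" and i
    have tr: "tr (sample m f) = sample m f" for f by (auto simp: tr_def sample_def)
    have "continuous_on UNIV tr"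
    proof (rule continuous_on_coordinatewise_then_product)
      show "continuous_on UNIV (\<lambda>z. tr z i)" for i by (cases "i < Suc (2^m)") (auto simp: tr_def)
    qed
    from continuous_on_compose2[OF c this] have ct: "continuous_on UNIV (\<lambda>z. \<phi> (tr z))" by simp
    have "(\<lambda>n. \<integral>\<omega>. \<phi> (tr (?\<zeta> m n \<omega>)) \<partial>M) \<longlonglongrightarrow> (\<integral>\<omega>. \<phi> (tr (?\<xi> m \<omega>)) \<partial>N)"
    proof (rule weak_conv_of_char[OF pM pN m\<zeta> m\<xi> _ _ ct b])
      have e: "(\<Sum>i<Suc (2^m). c i * sample m f i) = (\<Sum>i<Suc (2^m). c i * f (real i / 2^m))" for c f
        by (intro sum.cong) (auto simp: sample_def)
      show "(\<lambda>n. M.cf (\<lambda>\<omega>. \<Sum>i<Suc (2^m). c i * ?\<zeta> m n \<omega> i)) \<longlonglongrightarrow> N.cf (\<lambda>\<omega>. \<Sum>i<Suc (2^m). c i * ?\<xi> m \<omega> i)" for c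
        unfolding e by (rule fidi)
      show "\<phi> (tr z) = \<phi> (tr z')" if "\<And>i. i < Suc (2^m) \<Longrightarrow> z i = z' i" for z z'
      proof -
        have "tr z = tr z'" using that by (auto simp: tr_def)
        then show ?thesis by simp
      qed
      fix \<delta> :: real assume \<delta>: "\<delta> > 0"
      have "\<forall>i. \<exists>A. i \<le> 2^m \<longrightarrow> A > 0 \<and> (\<forall>n. measure M {\<omega>\<in>space M. \<bar>Z n \<omega> (real i / 2^m)\<bar> > A} \<le> \<delta>)
        \<and> measure N {\<omega>\<in>space N. \<bar>W \<omega> (real i / 2^m)\<bar> > A} \<le> \<delta>"
        using tight[OF _ \<delta>] by (auto simp: divide_le_eq)
      from choice[OF this] obtain A where "\<forall>i. i \<le> 2^m \<longrightarrow> A i > 0 \<and> (\<forall>n. measure M {\<omega>\<in>space M. \<bar>Z n \<omega> (real i / 2^m)\<bar> > A i} \<le> \<delta>)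
        \<and> measure N {\<omega>\<in>space N. \<bar>W \<omega> (real i / 2^m)\<bar> > A i} \<le> \<delta>" ..
      then have A: "\<And>i. i \<le> 2^m \<Longrightarrow> A i > 0 \<and> (\<forall>n. measure M {\<omega>\<in>space M. \<bar>Z n \<omega> (real i / 2^m)\<bar> > A i} \<le> \<delta>)
        \<and> measure N {\<omega>\<in>space N. \<bar>W \<omega> (real i / 2^m)\<bar> > A i} \<le> \<delta>" by blast
      define a where "a = Max (A ` {..2^m})"
      have aA: "A i \<le> a" if "i \<le> 2^m" for i unfolding a_def using that by (intro Max_ge) auto
      have "a > 0" using A[of 0] aA[of 0] by auto
      moreover have "measure M {\<omega>\<in>space M. \<bar>?\<zeta> m n \<omega> i\<bar> > a} \<le> \<delta>" if "i < Suc (2^m)" for n i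
      proof -
        have i: "i \<le> 2^m" using that by simp
        have x: "real i / 2^m \<in> {0..1}" using i by (simp add: divide_le_eq)
        note [measurable] = mZ[OF x]
        have "measure M {\<omega>\<in>space M. \<bar>?\<zeta> m n \<omega> i\<bar> > a} \<le> measure M {\<omega>\<in>space M. \<bar>Z n \<omega> (real i / 2^m)\<bar> > A i}"
          using aA[OF i] i by (intro M.finite_measure_mono) (auto simp: sample_def)
        then show ?thesis using A[OF i] by (meson order_trans)
      qed
      moreover have "measure N {\<omega>\<in>space N. \<bar>?\<xi> m \<omega> i\<bar> > a} \<le> \<delta>" if "i < Suc (2^m)" for i
      proof -
        have i: "i \<le> 2^m" using that by simp
        have x: "real i / 2^m \<in> {0..1}" using i by (simp add: divide_le_eq)
        note [measurable] = mW[OF x]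
        have "measure N {\<omega>\<in>space N. \<bar>?\<xi> m \<omega> i\<bar> > a} \<le> measure N {\<omega>\<in>space N. \<bar>W \<omega> (real i / 2^m)\<bar> > A i}"
          using aA[OF i] i by (intro N.finite_measure_mono) (auto simp: sample_def)
        then show ?thesis using A[OF i] by (meson order_trans)
      qed
      ultimately show "\<exists>A>0. \<forall>i<Suc (2^m). (\<forall>n. measure M {\<omega>\<in>space M. \<bar>?\<zeta> m n \<omega> i\<bar> > A} \<le> \<delta>)
          \<and> measure N {\<omega>\<in>space N. \<bar>?\<xi> m \<omega> i\<bar> > A} \<le> \<delta>" by blast
    qed
    then show ?thesis unfolding tr .
  qed

  have limW: "(\<lambda>m. h (step m (W \<omega>))) \<longlonglongrightarrow> h (W \<omega>)" for \<omega>
  proof (rule LIMSEQ_I)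
    fix e :: real assume "0 < e"
    from skorokhod_continuous_sup[OF h cW this] obtain \<delta> where \<delta>: "\<delta> > 0"
      "\<And>g. cadlag01 g \<Longrightarrow> (\<And>t. t \<in> {0..1} \<Longrightarrow> \<bar>W \<omega> t - g t\<bar> \<le> \<delta>) \<Longrightarrow> \<bar>h g - h (W \<omega>)\<bar> < e" by blast
    from unif[OF \<delta>(1), of \<omega>] obtain m0 where m0: "\<And>m x. m \<ge> m0 \<Longrightarrow> x \<in> {0..1} \<Longrightarrow> \<bar>W \<omega> x - step m (W \<omega>) x\<bar> \<le> \<delta>" by blast
    show "\<exists>m0. \<forall>m\<ge>m0. norm (h (step m (W \<omega>)) - h (W \<omega>)) < e"
      unfolding real_norm_def by (intro exI[of _ m0] allI impI \<delta>(2) cadlag_step m0)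
  qed
  have EW: "(\<lambda>m. \<integral>\<omega>. h (step m (W \<omega>)) \<partial>N) \<longlonglongrightarrow> (\<integral>\<omega>. h (W \<omega>) \<partial>N)"
  proof (rule integral_dominated_convergence[where w="\<lambda>_. B"])
    show "(\<lambda>\<omega>. h (W \<omega>)) \<in> borel_measurable N"
      by (rule borel_measurable_LIMSEQ_real[OF limW]) measurable
  qed (use limW B cadlag_step in auto)

  show "(\<lambda>n. \<integral>\<omega>. h (Z n \<omega>) \<partial>M) \<longlonglongrightarrow> (\<integral>\<omega>. h (W \<omega>) \<partial>N)"
  proof (rule LIMSEQ_I)
    fix r :: real assume r: "0 < r"
    define \<epsilon> where "\<epsilon> = r / (8 * (B + 1))"
    have \<epsilon>: "\<epsilon> > 0" using r B0 by (simp add: \<epsilon>_def)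
    \<comment> \<open>The budget: one \<epsilon> for the oscillation of h, 4 B \<epsilon> for a bad
      event of measure at most 2 \<epsilon>, one \<epsilon> for the convergence of the steps at
      level m, and one for passing from the step of W to W.\<close>
    have r\<epsilon>: "3 * \<epsilon> + 4 * B * \<epsilon> < r"
    proof -
      have "3 * \<epsilon> + 4 * B * \<epsilon> \<le> 4 * ((B + 1) * \<epsilon>)" using \<epsilon> by (simp add: algebra_simps)
      also have "(B + 1) * \<epsilon> = r / 8" using B0 by (simp add: \<epsilon>_def field_simps)
      finally show ?thesis using r by simp
    qed
    define cl where "cl m z d g \<longleftrightarrow> cadlag01 g \<and> (\<forall>t\<in>{0..1}. \<bar>gridfun m z t - g t\<bar> \<le> d)" for m z d g
    \<comment> \<open>The strict inequality d > \<delta> makes these sets open: displacing z by less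
      than s costs s of the radius, and with s = (d - \<delta>)/2 the radius stays above
      \<delta>.\<close>
    define U where "U m \<delta> = {z. \<exists>d>\<delta>. \<forall>g g'. cl m z d g \<longrightarrow> cl m z d g' \<longrightarrow> \<bar>h g - h g'\<bar> \<le> \<epsilon>}" for m \<delta>
    have oU: "open (U m \<delta>)" for m \<delta>
      unfolding open_subopen[of "U m \<delta>"]
    proof
      fix z assume "z \<in> U m \<delta>"
      then obtain d where d: "d > \<delta>" "\<forall>g g'. cl m z d g \<longrightarrow> cl m z d g' \<longrightarrow> \<bar>h g - h g'\<bar> \<le> \<epsilon>" unfolding U_def by blast
      define s where "s = (d - \<delta>) / 2"
      have s: "s > 0" using d by (simp add: s_def)
      define T where "T = {z'. \<forall>i\<in>{..2^m}. \<bar>z' i - z i\<bar> < s}"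
      have "open T"
      proof -
        have "T = (\<Inter>i\<in>{..2^m}. {z'. \<bar>z' i - z i\<bar> < s})" by (auto simp: T_def)
        moreover have "open {z' :: nat \<Rightarrow> real. \<bar>z' i - z i\<bar> < s}" for i
          by (intro open_Collect_less continuous_intros)
        ultimately show ?thesis by auto
      qed
      moreover have "z \<in> T" using s by (simp add: T_def)
      moreover have "T \<subseteq> U m \<delta>"
      proof
        fix z' assume z': "z' \<in> T"
        have "cl m z d g" if g: "cl m z' (d - s) g" for g
          unfolding cl_def
        proof (intro conjI ballI)
          show "cadlag01 g" using g by (simp add: cl_def)
          fix t :: real assume t: "t \<in> {0..1}"
          have "\<bar>gridfun m z' t - gridfun m z t\<bar> < s" using z' nat_floor_le[OF t, of m] by (simp add: T_def gridfun_def)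
          moreover have "\<bar>gridfun m z' t - g t\<bar> \<le> d - s" using g t by (simp add: cl_def)
          ultimately show "\<bar>gridfun m z t - g t\<bar> \<le> d" by linarith
        qed
        moreover have "d - s > \<delta>" using d by (simp add: s_def field_simps)
        ultimately show "z' \<in> U m \<delta>" using d unfolding U_def by blast
      qed
      ultimately show "\<exists>T. open T \<and> z \<in> T \<and> T \<subseteq> U m \<delta>" by blast
    qed
    have [measurable]: "U m \<delta> \<in> sets borel" for m \<delta> using oU by simp
    \<comment> \<open>Here k is both the starting level and the reciprocal of a radius, which makes
      E increasing. It exhausts the space because each path of W is the uniform limit of its steps
      and h is continuous there.\<close>
    define E where "E k = {\<omega>\<in>space N. \<forall>m\<in>{k..}. ?\<xi> m \<omega> \<in> U m (1 / real (Suc k))}" for k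
    have Em [measurable]: "E k \<in> sets N" for k unfolding E_def by measurable
    have "incseq E"
    proof (rule incseq_SucI)
      fix k
      have "U m (1 / real (Suc k)) \<subseteq> U m (1 / real (Suc (Suc k)))" for m
      proof -
        have le: "1 / real (Suc (Suc k)) \<le> 1 / real (Suc k)" by (simp add: frac_le)
        show ?thesis unfolding U_def using le by (blast intro: order.strict_trans1)
      qed
      then show "E k \<subseteq> E (Suc k)" unfolding E_def by force
    qed
    moreover have "(\<Union>k. E k) = space N"
    proof (rule antisym)
      show "space N \<subseteq> (\<Union>k. E k)"
      proof
        fix \<omega> assume \<omega>: "\<omega> \<in> space N"
        have "\<epsilon> / 2 > 0" using \<epsilon> by simp
        from skorokhod_continuous_sup[OF h cW this] obtain \<delta> where \<delta>: "\<delta> > 0"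
          "\<And>g. cadlag01 g \<Longrightarrow> (\<And>t. t \<in> {0..1} \<Longrightarrow> \<bar>W \<omega> t - g t\<bar> \<le> \<delta>) \<Longrightarrow> \<bar>h g - h (W \<omega>)\<bar> < \<epsilon> / 2" by blast
        have \<delta>2: "\<delta> / 2 > 0" using \<delta> by simp
        from unif[OF \<delta>2, of \<omega>] obtain m0 where m0: "\<And>m x. m \<ge> m0 \<Longrightarrow> x \<in> {0..1} \<Longrightarrow> \<bar>W \<omega> x - step m (W \<omega>) x\<bar> \<le> \<delta> / 2" by blast
        obtain k1 where k1: "1 / real (Suc k1) < \<delta> / 2" using reals_Archimedean[OF \<delta>2] by (auto simp: inverse_eq_divide)
        define k where "k = max m0 k1"
        have "1 / real (Suc k) \<le> 1 / real (Suc k1)" by (simp add: k_def frac_le)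
        then have k: "1 / real (Suc k) < \<delta> / 2" using k1 by linarith
        have "?\<xi> m \<omega> \<in> U m (1 / real (Suc k))" if m: "m \<ge> k" for m
        proof -
          have *: "\<bar>h g - h (W \<omega>)\<bar> < \<epsilon> / 2" if "cl m (?\<xi> m \<omega>) (\<delta>/2) g" for g
          proof (rule \<delta>(2))
            show "cadlag01 g" using that by (simp add: cl_def)
            fix t :: real assume t: "t \<in> {0..1}"
            have "\<bar>W \<omega> t - step m (W \<omega>) t\<bar> \<le> \<delta> / 2" using m t by (intro m0) (auto simp: k_def)
            moreover have "\<bar>step m (W \<omega>) t - g t\<bar> \<le> \<delta> / 2" using that t by (simp add: cl_def step_def)
            ultimately show "\<bar>W \<omega> t - g t\<bar> \<le> \<delta>" by linarith
          qed
          have "\<bar>h g - h g'\<bar> \<le> \<epsilon>" if "cl m (?\<xi> m \<omega>) (\<delta>/2) g" "cl m (?\<xi> m \<omega>) (\<delta>/2) g'" for g g'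
            using *[OF that(1)] *[OF that(2)] by linarith
          then show ?thesis using k unfolding U_def by blast
        qed
        then show "\<omega> \<in> (\<Union>k. E k)" using \<omega> unfolding E_def by auto
      qed
    qed (auto simp: E_def)
    moreover have "range E \<subseteq> sets N" using Em by blast
    ultimately have "(\<lambda>k. measure N (E k)) \<longlonglongrightarrow> 1"
      using N.finite_Lim_measure_incseq[of E] by (simp only: N.prob_space)
    then have "\<forall>\<^sub>F k in sequentially. 1 - \<epsilon> < measure N (E k)" using \<epsilon> by (intro order_tendstoD) auto
    then obtain k where k: "1 - \<epsilon> < measure N (E k)" by (auto simp: eventually_sequentially)
    \<comment> \<open>With \<eta> at most 1 / (k + 1) < d, the path \<open>Z n \<omega>\<close> lies
      outside the exceptional set in the ball around its own grid vector on which h oscillates by at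
      most \<epsilon>; with \<eta> \<le> \<epsilon> that set is small.\<close>
    define \<eta> where "\<eta> = min \<epsilon> (1 / real (Suc k))"
    have \<eta>: "\<eta> > 0" using \<epsilon> by (simp add: \<eta>_def)
    obtain m0 where m0: "\<And>m. m \<ge> m0 \<Longrightarrow> \<exists>n0. \<forall>n\<ge>n0. \<exists>A\<in>sets M. measure M A \<le> \<eta> \<and>
        (\<forall>\<omega>\<in>space M - A. \<forall>x\<in>{0..1}. \<bar>Z n \<omega> x - step m (Z n \<omega>) x\<bar> \<le> \<eta>)" using equi[OF \<eta>] by blast
    obtain m1 where m1: "\<And>m. m \<ge> m1 \<Longrightarrow> \<bar>(\<integral>\<omega>. h (step m (W \<omega>)) \<partial>N) - (\<integral>\<omega>. h (W \<omega>) \<partial>N)\<bar> < \<epsilon>"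
      using LIMSEQ_D[OF EW \<epsilon>] by auto
    define m where "m = max k (max m0 m1)"
    have "m0 \<le> m" by (simp add: m_def)
    from m0[OF this] obtain n0 where n0: "\<forall>n\<ge>n0. \<exists>A\<in>sets M. measure M A \<le> \<eta> \<and>
        (\<forall>\<omega>\<in>space M - A. \<forall>x\<in>{0..1}. \<bar>Z n \<omega> x - step m (Z n \<omega>) x\<bar> \<le> \<eta>)" ..
    have "measure N (E k) \<le> measure N {\<omega>\<in>space N. ?\<xi> m \<omega> \<in> U m (1 / real (Suc k))}"
      by (intro N.finite_measure_mono) (auto simp: E_def m_def)
    then have "1 - \<epsilon> < measure N {\<omega>\<in>space N. ?\<xi> m \<omega> \<in> U m (1 / real (Suc k))}" using k by linarith
    have "\<forall>\<^sub>F n in sequentially. 1 - \<epsilon> < measure M {\<omega>\<in>space M. ?\<zeta> m n \<omega> \<in> U m (1 / real (Suc k))}"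
      by (rule open_portmanteau[OF pM pN m\<zeta>' m\<xi>' _ oU]) (fact conv, fact)
    then obtain n1 where n1: "\<And>n. n \<ge> n1 \<Longrightarrow> 1 - \<epsilon> < measure M {\<omega>\<in>space M. ?\<zeta> m n \<omega> \<in> U m (1 / real (Suc k))}"
      by (auto simp: eventually_sequentially)
    have "(\<lambda>n. \<integral>\<omega>. h (step m (Z n \<omega>)) \<partial>M) \<longlonglongrightarrow> (\<integral>\<omega>. h (step m (W \<omega>)) \<partial>N)"
      unfolding step_def by (rule conv[OF continuous_gridfun[OF h]]) (rule B[OF cadlag_gridfun])
    from LIMSEQ_D[OF this \<epsilon>] obtain n2 where n2: "\<And>n. n \<ge> n2 \<Longrightarrow> \<bar>(\<integral>\<omega>. h (step m (Z n \<omega>)) \<partial>M) - (\<integral>\<omega>. h (step m (W \<omega>)) \<partial>N)\<bar> < \<epsilon>"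
      by auto
    show "\<exists>no. \<forall>n\<ge>no. norm ((\<integral>\<omega>. h (Z n \<omega>) \<partial>M) - (\<integral>\<omega>. h (W \<omega>) \<partial>N)) < r"
    proof (intro exI allI impI)
      fix n assume n: "n \<ge> max n0 (max n1 n2)"
      from n0 n obtain A where A [measurable]: "A \<in> sets M" and pA: "measure M A \<le> \<eta>"
        and cA: "\<And>\<omega> x. \<omega> \<in> space M - A \<Longrightarrow> x \<in> {0..1} \<Longrightarrow> \<bar>Z n \<omega> x - step m (Z n \<omega>) x\<bar> \<le> \<eta>" by auto
      define G where "G = {\<omega>\<in>space M. ?\<zeta> m n \<omega> \<in> U m (1 / real (Suc k))}"
      have [measurable]: "G \<in> sets M" unfolding G_def by measurable
      have pG: "measure M (space M - G) \<le> \<epsilon>" using n1[of n] n M.prob_compl[of G] by (auto simp: G_def)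
      define Bad where "Bad = A \<union> (space M - G)"
      have [measurable]: "Bad \<in> sets M" unfolding Bad_def by measurable
      have "measure M Bad \<le> measure M A + measure M (space M - G)" unfolding Bad_def by (intro measure_Un_le) auto
      then have pB: "measure M Bad \<le> 2 * \<epsilon>" using pA pG by (simp add: \<eta>_def)
      have ptw: "\<bar>h (Z n \<omega>) - h (step m (Z n \<omega>))\<bar> \<le> \<epsilon> + 2 * B * indicator Bad \<omega>" if \<omega>: "\<omega> \<in> space M" for \<omega>
      proof (cases "\<omega> \<in> Bad")
        case True
        then show ?thesis using B[OF cZ[of n \<omega>]] B[OF cadlag_step[of m "Z n \<omega>"]] \<epsilon> by simp
      next
        case False
        then have "?\<zeta> m n \<omega> \<in> U m (1 / real (Suc k))" using \<omega> by (auto simp: Bad_def G_def)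
        then obtain d where d: "d > 1 / real (Suc k)" "\<And>g g'. cl m (?\<zeta> m n \<omega>) d g \<Longrightarrow> cl m (?\<zeta> m n \<omega>) d g' \<Longrightarrow> \<bar>h g - h g'\<bar> \<le> \<epsilon>"
          unfolding U_def by blast
        have "d > 0" using d(1) by (meson less_trans of_nat_0_less_iff zero_less_Suc zero_less_divide_1_iff)
        have c1: "cl m (?\<zeta> m n \<omega>) d (Z n \<omega>)"
          unfolding cl_def
        proof (intro conjI ballI cZ)
          fix t :: real assume "t \<in> {0..1}"
          then have "\<bar>Z n \<omega> t - step m (Z n \<omega>) t\<bar> \<le> \<eta>" using False \<omega> by (intro cA) (auto simp: Bad_def)
          then show "\<bar>gridfun m (?\<zeta> m n \<omega>) t - Z n \<omega> t\<bar> \<le> d" using d(1) unfolding step_def \<eta>_def by linarith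
        qed
        have c2: "cl m (?\<zeta> m n \<omega>) d (step m (Z n \<omega>))"
          unfolding cl_def using \<open>d > 0\<close> by (simp add: step_def cadlag_gridfun)
        show ?thesis using d(2)[OF c1 c2] False by simp
      qed
      have "\<bar>(\<integral>\<omega>. h (Z n \<omega>) \<partial>M) - (\<integral>\<omega>. h (step m (Z n \<omega>)) \<partial>M)\<bar> = \<bar>\<integral>\<omega>. h (Z n \<omega>) - h (step m (Z n \<omega>)) \<partial>M\<bar>"
        by (simp add: iZ)
      also have "\<dots> \<le> (\<integral>\<omega>. \<bar>h (Z n \<omega>) - h (step m (Z n \<omega>))\<bar> \<partial>M)" by (rule integral_abs_bound)
      also have "\<dots> \<le> (\<integral>\<omega>. \<epsilon> + 2 * B * indicator Bad \<omega> \<partial>M)"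
        by (intro integral_mono ptw) (auto intro!: integrable_abs Bochner_Integration.integrable_diff iZ integrable_real_mult_indicator simp: M.emeasure_eq_measure)
      also have "\<dots> = \<epsilon> + 2 * B * measure M Bad" by (simp add: M.prob_space M.emeasure_eq_measure)
      also have "\<dots> \<le> \<epsilon> + 2 * B * (2 * \<epsilon>)" using pB B0 by (intro add_left_mono mult_left_mono) auto
      finally have 1: "\<bar>(\<integral>\<omega>. h (Z n \<omega>) \<partial>M) - (\<integral>\<omega>. h (step m (Z n \<omega>)) \<partial>M)\<bar> \<le> \<epsilon> + 4 * B * \<epsilon>" by simp
      have "m \<ge> m1" by (simp add: m_def)
      have tri: "\<bar>x - w\<bar> < r" if "\<bar>x - y\<bar> \<le> k" "\<bar>y - z\<bar> < \<epsilon>" "\<bar>z - w\<bar> < \<epsilon>" "k + 2 * \<epsilon> < r" for x y z w k :: real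
        using that by linarith
      then show "norm ((\<integral>\<omega>. h (Z n \<omega>) \<partial>M) - (\<integral>\<omega>. h (W \<omega>) \<partial>N)) < r"
        unfolding real_norm_def using n r\<epsilon> \<open>m \<ge> m1\<close> by (intro tri[OF 1 n2 m1]; linarith)
    qed
  qed
qed

section \<open>Counting paths\<close>

text \<open>On [0, 1] the empirical path has this form with a = 1 / sqrt n and b = sqrt n. The
  section serves the measurability of h along such paths: their steps need not converge uniformly,
  since jumps lie off the grid, but they do converge in the Skorokhod distance.\<close>

definition count_path :: "real \<Rightarrow> real \<Rightarrow> 'i set \<Rightarrow> ('i \<Rightarrow> real) \<Rightarrow> real \<Rightarrow> real" where
  "count_path a b I v x = a * (\<Sum>i\<in>I. ind (v i \<le> x)) - b * x"

definition tent :: "real \<Rightarrow> real \<Rightarrow> real \<Rightarrow> real" where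
  "tent \<delta> u t = max 0 (1 - \<bar>t - u\<bar> / \<delta>)"

lemma tent_bounds: "\<delta> > 0 \<Longrightarrow> 0 \<le> tent \<delta> u t" "\<delta> > 0 \<Longrightarrow> tent \<delta> u t \<le> 1"
  by (auto simp: tent_def)

lemma tent_lipschitz: assumes "\<delta> > 0" shows "\<bar>tent \<delta> u s - tent \<delta> u t\<bar> \<le> \<bar>s - t\<bar> / \<delta>"
proof -
  have "\<bar>\<bar>s - u\<bar> / \<delta> - \<bar>t - u\<bar> / \<delta>\<bar> \<le> \<bar>s - t\<bar> / \<delta>"
    unfolding diff_divide_distrib[symmetric] abs_divide using assms by (simp add: divide_le_cancel)
  moreover have "\<bar>p - q\<bar> \<le> k \<Longrightarrow> \<bar>max 0 (1 - p) - max 0 (1 - q)\<bar> \<le> k" for p q k :: real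
    by (auto simp: max_def abs_if split: if_splits)
  ultimately show ?thesis unfolding tent_def by blast
qed

lemma tent_self [simp]: "tent \<delta> u u = 1" by (simp add: tent_def)

lemma tent_zero: "\<delta> > 0 \<Longrightarrow> \<delta> \<le> \<bar>t - u\<bar> \<Longrightarrow> tent \<delta> u t = 0"
  by (simp add: tent_def)

lemma continuous_tent [continuous_intros]: "\<delta> > 0 \<Longrightarrow> continuous_on S (tent \<delta> u)"
  unfolding tent_def[abs_def] by (intro continuous_intros) auto

definition ceil_grid :: "nat \<Rightarrow> real \<Rightarrow> real" where "ceil_grid m u = \<lceil>2^m * u\<rceil> / 2^m"

lemma ceil_grid_bounds: "u \<le> ceil_grid m u" "ceil_grid m u - u \<le> 1 / 2^m"
proof -
  have e: "ceil_grid m u - u = (\<lceil>2^m * u\<rceil> - 2^m * u) / 2^m" by (simp add: ceil_grid_def diff_divide_distrib)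
  have "0 \<le> \<lceil>2^m * u\<rceil> - 2^m * u" "\<lceil>2^m * u\<rceil> - 2^m * u \<le> 1" by linarith+
  then have "0 \<le> ceil_grid m u - u" "ceil_grid m u - u \<le> 1 / 2^m"
    unfolding e by (intro divide_nonneg_nonneg divide_right_mono; simp)+
  then show "u \<le> ceil_grid m u" "ceil_grid m u - u \<le> 1 / 2^m" by auto
qed

lemma finite_separation:
  assumes "finite D" "D \<subseteq> {0<..<1::real}"
  obtains \<delta> where "\<delta> > 0" "\<And>u. u \<in> D \<Longrightarrow> \<delta> \<le> u" "\<And>u. u \<in> D \<Longrightarrow> \<delta> \<le> 1 - u" "\<And>u w. u \<in> D \<Longrightarrow> w \<in> D \<Longrightarrow> u \<noteq> w \<Longrightarrow> \<delta> \<le> \<bar>u - w\<bar>"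
proof -
  define S where "S = insert 1 (D \<union> (\<lambda>u. 1 - u) ` D \<union> (\<lambda>(u,w). \<bar>u - w\<bar>) ` {(u,w). u \<in> D \<and> w \<in> D \<and> u \<noteq> w})"
  have "finite {(u,w). u \<in> D \<and> w \<in> D \<and> u \<noteq> w}"
    by (rule finite_subset[of _ "D \<times> D"]) (use assms in auto)
  then have fS: "finite S" unfolding S_def using assms(1) by auto
  have "\<forall>s\<in>S. 0 < s" using assms(2) by (auto simp: S_def)
  then have "0 < Min S" using fS by (subst Min_gr_iff) (auto simp: S_def)
  moreover have "Min S \<le> s" if "s \<in> S" for s using fS that by (rule Min_le)
  ultimately show thesis by (intro that[of "Min S"]) (auto simp: S_def)
qed

text \<open>The time change adds to t one tent per jump u in (0, 1), of height
  \<open>ceil_grid m u - u\<close> and half width \<delta>. Tents vanish at the other jumps and at 0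
  and 1, so each jump is carried exactly to the next grid point, where the step function makes
  it.\<close>

lemma count_path_step_close:
  fixes v :: "'i \<Rightarrow> real"
  assumes D: "D = v ` I \<inter> {0<..<1}" "finite I" and \<delta>: "\<delta> > 0" "\<And>u. u \<in> D \<Longrightarrow> \<delta> \<le> u" "\<And>u. u \<in> D \<Longrightarrow> \<delta> \<le> 1 - u"
      "\<And>u w. u \<in> D \<Longrightarrow> w \<in> D \<Longrightarrow> u \<noteq> w \<Longrightarrow> \<delta> \<le> \<bar>u - w\<bar>"
    and m: "real (card D) / 2^m < \<delta>"
  shows "skorokhod_dist (count_path a b I v) (step m (count_path a b I v)) \<le> (1 + \<bar>b\<bar>) * ((real (card D) + 1) / 2^m)"
proof -
  have fD: "finite D" using D by simp
  define c where "c u = ceil_grid m u - u" for u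
  have c: "0 \<le> c u" "c u \<le> 1 / 2^m" "\<bar>c u\<bar> \<le> 1 / 2^m" for u using ceil_grid_bounds[where u=u and m=m] by (auto simp: c_def)
  define r where "r t = t + (\<Sum>u\<in>D. c u * tent \<delta> u t)" for t
  have near: "\<bar>r t - t\<bar> \<le> real (card D) / 2^m" for t
  proof -
    have "\<bar>r t - t\<bar> \<le> (\<Sum>u\<in>D. \<bar>c u * tent \<delta> u t\<bar>)" unfolding r_def by (simp add: sum_abs)
    also have "\<dots> \<le> (\<Sum>u\<in>D. 1 / 2^m * 1)"
      unfolding abs_mult using c tent_bounds[OF \<delta>(1)] by (intro sum_mono mult_mono) auto
    finally show ?thesis by simp
  qed
  \<comment> \<open>Each tent has slope at most 2^(-m) / \<delta>. The card D tents together have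
    slope below 1, so they cannot undo the slope 1 of t.\<close>
  have less: "r s < r t" if "s < t" for s t
  proof -
    have "\<bar>\<Sum>u\<in>D. c u * (tent \<delta> u t - tent \<delta> u s)\<bar> \<le> (\<Sum>u\<in>D. \<bar>c u * (tent \<delta> u t - tent \<delta> u s)\<bar>)" by (rule sum_abs)
    also have "\<dots> \<le> (\<Sum>u\<in>D. 1 / 2^m * (\<bar>t - s\<bar> / \<delta>))"
      unfolding abs_mult using c by (intro sum_mono mult_mono tent_lipschitz[OF \<delta>(1)]) auto
    also have "\<dots> = (real (card D) / 2^m) * ((t - s) / \<delta>)" using that by simp
    also have "\<dots> < \<delta> * ((t - s) / \<delta>)" using m that \<delta>(1) by (intro mult_strict_right_mono) auto
    also have "\<dots> = t - s" using \<delta>(1) by simp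
    finally have "\<bar>\<Sum>u\<in>D. c u * (tent \<delta> u t - tent \<delta> u s)\<bar> < t - s" .
    moreover have "r t - r s = (t - s) + (\<Sum>u\<in>D. c u * (tent \<delta> u t - tent \<delta> u s))"
      by (simp add: r_def right_diff_distrib sum_subtractf)
    ultimately show ?thesis by linarith
  qed
  have r0: "r 0 = 0"
  proof -
    have "(\<Sum>u\<in>D. c u * tent \<delta> u 0) = 0"
      by (intro sum.neutral ballI) (use \<delta> in \<open>fastforce intro!: tent_zero\<close>)
    then show ?thesis by (simp add: r_def)
  qed
  have r1: "r 1 = 1"
  proof -
    have "(\<Sum>u\<in>D. c u * tent \<delta> u 1) = 0"
      by (intro sum.neutral ballI) (use \<delta> in \<open>fastforce intro!: tent_zero\<close>)
    then show ?thesis by (simp add: r_def)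
  qed
  have cont: "continuous_on {0..1} r" unfolding r_def[abs_def] by (intro continuous_intros \<delta>(1))
  have mono: "r s \<le> r t" if "s \<le> t" for s t using less[of s t] that by (cases "s = t") auto
  have rt: "r \<in> time_changes"
    unfolding time_changes_def
  proof (intro CollectI conjI)
    show "strict_mono_on {0..1} r" using less by (auto simp: strict_mono_on_def)
    show "continuous_on {0..1} r" by (rule cont)
    show "r ` {0..1} = {0..1}"
    proof
      show "r ` {0..1} \<subseteq> {0..1}" using mono[of 0] mono[of _ 1] r0 r1 by auto
      show "{0..1} \<subseteq> r ` {0..1}"
      proof
        fix y :: real assume "y \<in> {0..1}"
        then show "y \<in> r ` {0..1}" using IVT'[of r 0 y 1] cont r0 r1 by auto
      qed
    qed
  qed
  have rv: "r (v i) = ceil_grid m (v i)" if i: "i \<in> I" and v: "v i \<in> {0..1}" for i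
  proof (cases "v i \<in> D")
    case True
    have "(\<Sum>u\<in>D. c u * tent \<delta> u (v i)) = c (v i) * tent \<delta> (v i) (v i) + (\<Sum>u\<in>D-{v i}. c u * tent \<delta> u (v i))"
      using True fD by (rule sum.remove[rotated])
    also have "(\<Sum>u\<in>D-{v i}. c u * tent \<delta> u (v i)) = 0"
      by (intro sum.neutral ballI) (use \<delta> True in \<open>auto intro!: tent_zero\<close>)
    finally show ?thesis by (simp add: r_def c_def)
  next
    case False
    then have "v i = 0 \<or> v i = 1" using i v D by auto
    then show ?thesis using r0 r1 by (auto simp: ceil_grid_def)
  qed
  \<comment> \<open>The counting parts agree exactly: v i \<le> floor of r t on the grid iff the
    ceiling of v i is at most r t, and that ceiling is r (v i). Only the drift term differs.\<close>
  have dsq: "count_path a b I v t - step m (count_path a b I v) (r t) = b * (\<lfloor>2^m * r t\<rfloor> / 2^m - t)"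
    if t: "t \<in> {0..1}" for t
  proof -
    have rt01: "r t \<in> {0..1}" using mono[of 0 t] mono[of t 1] r0 r1 t by auto
    define w where "w = \<lfloor>2^m * r t\<rfloor> / 2^m"
    have w: "0 \<le> w" "w \<le> r t"
    proof -
      have "0 \<le> 2^m * r t" using rt01 by simp
      then show "0 \<le> w" by (simp add: w_def)
      have "\<lfloor>2^m * r t\<rfloor> \<le> 2^m * r t" by linarith
      then show "w \<le> r t" by (simp add: w_def field_simps)
    qed
    have "(v i \<le> t) = (v i \<le> w)" if i: "i \<in> I" for i
    proof (cases "v i \<in> {0..1}")
      case False
      then show ?thesis using t w rt01 by auto
    next
      case True
      have "v i \<le> w \<longleftrightarrow> 2^m * v i \<le> \<lfloor>2^m * r t\<rfloor>" by (simp add: w_def field_simps)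
      also have "\<dots> \<longleftrightarrow> \<lceil>2^m * v i\<rceil> \<le> \<lfloor>2^m * r t\<rfloor>" by (rule ceiling_le_iff[symmetric])
      also have "\<dots> \<longleftrightarrow> \<lceil>2^m * v i\<rceil> \<le> 2^m * r t" by (rule le_floor_iff)
      also have "\<dots> \<longleftrightarrow> ceil_grid m (v i) \<le> r t" by (simp add: ceil_grid_def field_simps)
      also have "\<dots> \<longleftrightarrow> r (v i) \<le> r t" using rv[OF i True] by simp
      also have "\<dots> \<longleftrightarrow> v i \<le> t" using less mono by (meson not_le)
      finally show ?thesis ..
    qed
    then have "(\<Sum>i\<in>I. ind (v i \<le> t)) = (\<Sum>i\<in>I. ind (v i \<le> w))" by (intro sum.cong) auto
    then show ?thesis unfolding step_eq[OF rt01] w_def[symmetric] by (simp add: count_path_def algebra_simps)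
  qed
  show ?thesis
  proof (rule skorokhod_dist_le[OF rt])
    fix t :: real assume t: "t \<in> {0..1}"
    have e0: "0 \<le> (real (card D) + 1) / 2^m" by simp
    have "\<bar>r t - t\<bar> \<le> (real (card D) + 1) / 2^m" using near[of t] by (rule order_trans) (simp add: divide_right_mono)
    also have "\<dots> \<le> (1 + \<bar>b\<bar>) * ((real (card D) + 1) / 2^m)" using mult_right_mono[OF _ e0, of 1 "1 + \<bar>b\<bar>"] by simp
    finally show "\<bar>r t - t\<bar> \<le> (1 + \<bar>b\<bar>) * ((real (card D) + 1) / 2^m)" .
    have "\<bar>\<lfloor>2^m * r t\<rfloor> - 2^m * r t\<bar> \<le> 1" by linarith
    then have "\<bar>\<lfloor>2^m * r t\<rfloor> - 2^m * r t\<bar> / 2^m \<le> 1 / 2^m" by (intro divide_right_mono) simp_all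
    moreover have "\<lfloor>2^m * r t\<rfloor> / 2^m - r t = (\<lfloor>2^m * r t\<rfloor> - 2^m * r t) / 2^m" by (simp add: diff_divide_distrib)
    ultimately have "\<bar>\<lfloor>2^m * r t\<rfloor> / 2^m - r t\<bar> \<le> 1 / 2^m" by simp
    then have "\<bar>\<lfloor>2^m * r t\<rfloor> / 2^m - t\<bar> \<le> (real (card D) + 1) / 2^m"
      using near[of t] by (simp add: add_divide_distrib)
    then have "\<bar>b\<bar> * \<bar>\<lfloor>2^m * r t\<rfloor> / 2^m - t\<bar> \<le> (1 + \<bar>b\<bar>) * ((real (card D) + 1) / 2^m)"
      by (intro mult_mono) auto
    then show "\<bar>count_path a b I v t - step m (count_path a b I v) (r t)\<bar> \<le> (1 + \<bar>b\<bar>) * ((real (card D) + 1) / 2^m)"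
      unfolding dsq[OF t] abs_mult .
  qed
qed

lemma count_path_step_tendsto:
  fixes v :: "'i \<Rightarrow> real"
  assumes I: "finite I" and h: "skorokhod_continuous h" and c: "cadlag01 (count_path a b I v)"
  shows "(\<lambda>m. h (step m (count_path a b I v))) \<longlonglongrightarrow> h (count_path a b I v)"
proof (rule LIMSEQ_I)
  fix e :: real assume e: "0 < e"
  obtain \<eta> where \<eta>: "\<eta> > 0" "\<And>g. cadlag01 g \<Longrightarrow> skorokhod_dist (count_path a b I v) g < \<eta> \<Longrightarrow> \<bar>h g - h (count_path a b I v)\<bar> < e"
    using h c e unfolding skorokhod_continuous_def by blast
  define D where "D = v ` I \<inter> {0<..<1}"
  have fD: "finite D" using I by (simp add: D_def)
  obtain \<delta> where \<delta>: "\<delta> > 0" "\<And>u. u \<in> D \<Longrightarrow> \<delta> \<le> u" "\<And>u. u \<in> D \<Longrightarrow> \<delta> \<le> 1 - u"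
      "\<And>u w. u \<in> D \<Longrightarrow> w \<in> D \<Longrightarrow> u \<noteq> w \<Longrightarrow> \<delta> \<le> \<bar>u - w\<bar>"
    using finite_separation[OF fD] unfolding D_def by blast
  have lim: "(\<lambda>m. c / 2^m) \<longlonglongrightarrow> 0" for c :: real
    using LIMSEQ_inverse_realpow_zero[of 2] tendsto_mult_right_zero[of "\<lambda>m. inverse (2^m)" sequentially c]
    by (simp add: divide_inverse)
  have "\<forall>\<^sub>F m in sequentially. real (card D) / 2^m < \<delta>" using lim \<delta>(1) by (rule order_tendstoD)
  moreover have "\<forall>\<^sub>F m in sequentially. ((1 + \<bar>b\<bar>) * (real (card D) + 1)) / 2^m < \<eta>" using lim \<eta>(1) by (rule order_tendstoD)
  ultimately have "\<forall>\<^sub>F m in sequentially. norm (h (step m (count_path a b I v)) - h (count_path a b I v)) < e"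
  proof eventually_elim
    case (elim m)
    have "skorokhod_dist (count_path a b I v) (step m (count_path a b I v)) \<le> (1 + \<bar>b\<bar>) * ((real (card D) + 1) / 2^m)"
      by (rule count_path_step_close[OF D_def I \<delta> elim(1)])
    then show ?case using elim(2) \<eta>(2)[OF cadlag_step] by simp
  qed
  then show "\<exists>no. \<forall>m\<ge>no. norm (h (step m (count_path a b I v)) - h (count_path a b I v)) < e"
    by (simp add: eventually_sequentially)
qed

lemma cadlag_count_path:
  fixes v :: "'i \<Rightarrow> real"
  assumes I: "finite I" shows "cadlag01 (count_path a b I v)"
proof -
  have r: "((\<lambda>x. ind (u \<le> x)) \<longlongrightarrow> ind (u \<le> t)) (at_right t)" for u t :: real
  proof (cases "u \<le> t")
    case True
    have "\<forall>\<^sub>F x in at_right t. ind (u \<le> x) = ind (u \<le> t)"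
      using True by (auto simp: eventually_at_filter)
    then show ?thesis by (rule tendsto_eventually)
  next
    case False
    then have "\<forall>\<^sub>F x in at_right t. x \<in> {t<..<u}" by (intro eventually_at_right_real) simp
    then have "\<forall>\<^sub>F x in at_right t. ind (u \<le> x) = ind (u \<le> t)" by eventually_elim (use False in auto)
    then show ?thesis by (rule tendsto_eventually)
  qed
  have l: "((\<lambda>x. ind (u \<le> x)) \<longlongrightarrow> ind (u < t)) (at_left t)" for u t :: real
  proof (cases "u < t")
    case True
    then have "\<forall>\<^sub>F x in at_left t. x \<in> {u<..<t}" by (rule eventually_at_left_real)
    then have "\<forall>\<^sub>F x in at_left t. ind (u \<le> x) = ind (u < t)" by eventually_elim (use True in auto)
    then show ?thesis by (rule tendsto_eventually)
  next
    case False
    then have "\<forall>\<^sub>F x in at_left t. ind (u \<le> x) = ind (u < t)"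
      by (auto simp: eventually_at_filter)
    then show ?thesis by (rule tendsto_eventually)
  qed
  show ?thesis unfolding cadlag01_def count_path_def[abs_def]
  proof (intro conjI ballI exI)
    show "((\<lambda>x. a * (\<Sum>i\<in>I. ind (v i \<le> x)) - b * x) \<longlongrightarrow> a * (\<Sum>i\<in>I. ind (v i \<le> t)) - b * t) (at_right t)" for t
      by (intro tendsto_intros r)
    show "((\<lambda>x. a * (\<Sum>i\<in>I. ind (v i \<le> x)) - b * x) \<longlongrightarrow> a * (\<Sum>i\<in>I. ind (v i < t)) - b * t) (at_left t)" for t
      by (intro tendsto_intros l)
  qed
qed

lemma cadlag_cong:
  assumes "cadlag01 f" and e: "\<And>x. x \<in> {0..1} \<Longrightarrow> f x = g x" shows "cadlag01 g"
  unfolding cadlag01_def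
proof (intro conjI ballI)
  fix t :: real assume t: "t \<in> {0..<1}"
  have "\<forall>\<^sub>F x in at_right t. x \<in> {t<..<1}" using t by (intro eventually_at_right_real) auto
  then have "\<forall>\<^sub>F x in at_right t. f x = g x" by eventually_elim (use t e in auto)
  moreover have "(f \<longlongrightarrow> f t) (at_right t)" using assms t by (auto simp: cadlag01_def)
  ultimately show "(g \<longlongrightarrow> g t) (at_right t)" using e[of t] t tendsto_cong by fastforce
next
  fix t :: real assume t: "t \<in> {0<..1}"
  have "\<forall>\<^sub>F x in at_left t. x \<in> {0<..<t}" using t by (intro eventually_at_left_real) auto
  then have "\<forall>\<^sub>F x in at_left t. f x = g x" by eventually_elim (use t e in auto)
  moreover from assms(1) t obtain l where "(f \<longlongrightarrow> l) (at_left t)" unfolding cadlag01_def by blast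
  ultimately show "\<exists>l. (g \<longlongrightarrow> l) (at_left t)" using tendsto_cong by fast
qed

lemma count_path_measurable:
  assumes h: "skorokhod_continuous h" and I: "finite I" and X: "\<And>i. i \<in> I \<Longrightarrow> X i \<in> borel_measurable M"
  shows "(\<lambda>\<omega>. h (count_path a b I (\<lambda>i. X i \<omega>))) \<in> borel_measurable M"
proof (rule borel_measurable_LIMSEQ_real[OF count_path_step_tendsto[OF I h cadlag_count_path[OF I]]])
  fix m
  show "(\<lambda>\<omega>. h (step m (count_path a b I (\<lambda>i. X i \<omega>)))) \<in> borel_measurable M"
    by (rule step_measurable[OF h]) (use X in \<open>auto simp: count_path_def intro!: borel_measurable_sum borel_measurable_diff borel_measurable_times ind_measurable\<close>)
qed

section \<open>Increments of the empirical process\<close>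

text \<open>The indices on either side of i contribute a partial sum of the same convergent series.
  The term j = i contributes nothing, since 0 powr (-p) = 0.\<close>

lemma powr_sum_bound:
  assumes p: "p > 1"
  obtains W :: real where "W \<ge> 0" "\<And>i J. finite J \<Longrightarrow> (\<Sum>j\<in>J. real_of_int \<bar>i - j\<bar> powr (-p)) \<le> W"
proof -
  define f where "f n = real n powr (-p)" for n
  have s: "summable f" unfolding f_def using p by (simp add: summable_real_powr_iff)
  have f0: "f n \<ge> 0" for n by (simp add: f_def)
  define w where "w = suminf f"
  have part: "(\<Sum>j\<in>J. f (\<pi> j)) \<le> w" if "finite J" "inj_on \<pi> J" for J and \<pi> :: "int \<Rightarrow> nat"
  proof -
    have "(\<Sum>j\<in>J. f (\<pi> j)) = sum f (\<pi> ` J)" using that by (simp add: sum.reindex)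
    also have "\<dots> \<le> w" unfolding w_def using that s f0 by (intro sum_le_suminf) auto
    finally show ?thesis .
  qed
  have w0: "w \<ge> 0" using part[of "{}"] by simp
  show thesis
  proof (rule that[of "2 * w"])
    fix i :: int and J :: "int set" assume J: "finite J"
    have "(\<Sum>j\<in>J. real_of_int \<bar>i - j\<bar> powr (-p)) = (\<Sum>j\<in>{j\<in>J. j \<ge> i}. real_of_int \<bar>i - j\<bar> powr (-p)) + (\<Sum>j\<in>{j\<in>J. j < i}. real_of_int \<bar>i - j\<bar> powr (-p))"
      using J by (subst sum.union_disjoint[symmetric]) (auto intro!: sum.cong)
    also have "(\<Sum>j\<in>{j\<in>J. j \<ge> i}. real_of_int \<bar>i - j\<bar> powr (-p)) = (\<Sum>j\<in>{j\<in>J. j \<ge> i}. f (nat (j - i)))"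
      by (intro sum.cong) (auto simp: f_def)
    also have "\<dots> \<le> w" using J by (intro part) (auto simp: inj_on_def)
    also have "(\<Sum>j\<in>{j\<in>J. j < i}. real_of_int \<bar>i - j\<bar> powr (-p)) = (\<Sum>j\<in>{j\<in>J. j < i}. f (nat (i - j)))"
      by (intro sum.cong) (auto simp: f_def)
    also have "\<dots> \<le> w" using J by (intro part) (auto simp: inj_on_def)
    finally show "(\<Sum>j\<in>J. real_of_int \<bar>i - j\<bar> powr (-p)) \<le> 2 * w" by simp
  qed (use w0 in simp)
qed

lemma sum_square_expand:
  fixes U :: "nat \<Rightarrow> real"
  shows "(\<Sum>b<k. U b)\<^sup>2 = (\<Sum>b<k. (U b)\<^sup>2) + 2 * (\<Sum>c<k. \<Sum>b<c. U b * U c)"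
  by (induction k) (simp_all add: power2_sum sum_distrib_right)

section \<open>Linear combinations of centred indicators\<close>

definition lin :: "real set \<Rightarrow> (real \<Rightarrow> real) \<Rightarrow> real \<Rightarrow> real" where
  "lin S c u = (\<Sum>x\<in>S. c x * (ind (u \<le> x) - x))"

text \<open>The nonincreasing majorant of \<open>lin\<close> in the sense of
  \<open>dominated\<close>. It is left uncentred, as constants do not affect covariances.\<close>

definition linabs :: "real set \<Rightarrow> (real \<Rightarrow> real) \<Rightarrow> real \<Rightarrow> real" where
  "linabs S c u = (\<Sum>x\<in>S. \<bar>c x\<bar> * ind (u \<le> x))"

lemma lin_measurable [measurable]: "lin S c \<in> borel_measurable borel" "linabs S c \<in> borel_measurable borel"
  unfolding lin_def[abs_def] linabs_def[abs_def] by measurable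

lemma abs_lin_le: "S \<subseteq> {0..1} \<Longrightarrow> \<bar>lin S c u\<bar> \<le> (\<Sum>x\<in>S. \<bar>c x\<bar>)"
  unfolding lin_def
proof (rule order_trans[OF sum_abs], rule sum_mono)
  fix x assume "S \<subseteq> {0..1}" "x \<in> S"
  then have "\<bar>ind (u \<le> x) - x\<bar> \<le> 1" by (auto simp: ind_def)
  then show "\<bar>c x * (ind (u \<le> x) - x)\<bar> \<le> \<bar>c x\<bar>" unfolding abs_mult by (intro mult_left_le) auto
qed

lemma abs_linabs_le: "\<bar>linabs S c u\<bar> \<le> (\<Sum>x\<in>S. \<bar>c x\<bar>)"
  unfolding linabs_def by (rule order_trans[OF sum_abs], rule sum_mono) (auto simp: abs_mult intro: mult_left_le)

lemma dominated_lin: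
  assumes "S \<subseteq> {0..1}" shows "dominated (lin S c) (linabs S c)"
  unfolding dominated_def bounded_range_real
proof (intro conjI allI impI exI)
  show "\<bar>lin S c x\<bar> \<le> (\<Sum>x\<in>S. \<bar>c x\<bar>)" for x by (rule abs_lin_le[OF assms])
  show "\<bar>linabs S c x\<bar> \<le> (\<Sum>x\<in>S. \<bar>c x\<bar>)" for x by (rule abs_linabs_le)
  fix u v :: real assume uv: "u \<le> v"
  have "\<bar>lin S c u - lin S c v\<bar> = \<bar>\<Sum>x\<in>S. c x * (ind (u \<le> x) - ind (v \<le> x))\<bar>"
    unfolding lin_def sum_subtractf[symmetric] by (simp add: algebra_simps)
  also have "\<dots> \<le> (\<Sum>x\<in>S. \<bar>c x * (ind (u \<le> x) - ind (v \<le> x))\<bar>)" by (rule sum_abs)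
  also have "\<dots> = (\<Sum>x\<in>S. \<bar>c x\<bar> * (ind (u \<le> x) - ind (v \<le> x)))"
    using uv by (intro sum.cong refl) (auto simp: abs_mult ind_def)
  also have "\<dots> = linabs S c u - linabs S c v" by (simp add: linabs_def right_diff_distrib sum_subtractf)
  finally show "\<bar>lin S c u - lin S c v\<bar> \<le> linabs S c u - linabs S c v" .
qed measurable

lemma lin_scale: "lin S (\<lambda>x. a * c x) u = a * lin S c u"
  by (simp add: lin_def sum_distrib_left mult.assoc)

locale uniform_process = assoc_process +
  fixes C \<alpha> :: real
  assumes uniform: "\<And>k. distr M borel (X k) = uniform_measure lborel {0..1}"
    and stationary: "strictly_stationary M X"
    and SI: "\<And>k l. k \<noteq> l \<Longrightarrow> stoch_increasing M (X k) (X l)"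
    and C: "C > 0"
    and decay: "\<And>k::nat. k \<ge> 1 \<Longrightarrow> cov M (X 0) (X (int k)) \<le> C * real k powr (- \<alpha>)"
begin

lemma cov_shift:
  assumes [measurable]: "f \<in> borel_measurable borel" "g \<in> borel_measurable borel"
  shows "cov M (\<lambda>\<omega>. f (X (i + h) \<omega>)) (\<lambda>\<omega>. g (X (j + h) \<omega>)) = cov M (\<lambda>\<omega>. f (X i \<omega>)) (\<lambda>\<omega>. g (X j \<omega>))"
proof -
  let ?P = "Pi\<^sub>M {i,j} (\<lambda>_. borel) :: (int \<Rightarrow> real) measure"
  have meas: "(\<lambda>\<omega>. \<lambda>k\<in>{i,j}. X (k + h) \<omega>) \<in> measurable M ?P" for h by measurable
  have eq: "distr M ?P (\<lambda>\<omega>. \<lambda>k\<in>{i,j}. X (k + h) \<omega>) = distr M ?P (\<lambda>\<omega>. \<lambda>k\<in>{i,j}. X k \<omega>)"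
    using stationary[unfolded strictly_stationary_def, rule_format, of "{i,j}" h] by simp
  have int: "(\<integral>\<omega>. F (\<lambda>k\<in>{i,j}. X (k + h) \<omega>) \<partial>M) = (\<integral>\<omega>. F (\<lambda>k\<in>{i,j}. X k \<omega>) \<partial>M)"
    if F: "F \<in> borel_measurable ?P" for F :: "(int \<Rightarrow> real) \<Rightarrow> real"
    using integral_distr[OF meas[of h] F] integral_distr[OF meas[of 0] F] eq by simp
  have c [measurable]: "(\<lambda>x. x i) \<in> borel_measurable ?P" "(\<lambda>x. x j) \<in> borel_measurable ?P"
    by (auto intro!: measurable_component_singleton)
  have "(\<lambda>x. f (x i) * g (x j)) \<in> borel_measurable ?P" "(\<lambda>x. f (x i)) \<in> borel_measurable ?P" "(\<lambda>x. g (x j)) \<in> borel_measurable ?P"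
    by measurable
  from this[THEN int] show ?thesis unfolding cov_def by simp
qed

lemma cov_X_le: assumes "i \<noteq> j" shows "cov M (X i) (X j) \<le> C * real_of_int \<bar>i - j\<bar> powr (- \<alpha>)"
proof -
  have *: "cov M (X i) (X j) \<le> C * real_of_int \<bar>i - j\<bar> powr (- \<alpha>)" if "i < j" for i j
  proof -
    have "cov M (X i) (X j) = cov M (X 0) (X (j - i))" using cov_shift[of "\<lambda>x. x" "\<lambda>x. x" 0 i "j - i"] by simp
    also have "\<dots> \<le> C * real (nat (j - i)) powr (- \<alpha>)" using decay[of "nat (j - i)"] that by simp
    also have "real (nat (j - i)) = real_of_int \<bar>i - j\<bar>" using that by simp
    finally show ?thesis .
  qed
  show ?thesis
  proof (cases "i < j")
    case False
    then have "j < i" using assms by simp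
    from *[OF this] show ?thesis by (simp add: cov_commute abs_minus_commute)
  qed (rule *)
qed

lemma brv_indX [simp]: "brv M (\<lambda>\<omega>. ind (X i \<omega> \<le> x))" by (rule brv_ind) measurable

text \<open>Indicators of X \<le> x are nonincreasing in X, so association is applied to their
  negatives; the two signs cancel in the covariance.\<close>

lemma cov_ind_nonneg: "0 \<le> cov M (\<lambda>\<omega>. ind (X i \<omega> \<le> x)) (\<lambda>\<omega>. ind (X j \<omega> \<le> y))"
proof -
  define f where "f i x z = - ind (z i \<le> x)" for i :: int and x :: real and z :: "int \<Rightarrow> real"
  have f: "f i x \<in> borel_measurable (Pi\<^sub>M {i} (\<lambda>_. borel))" "bounded (range (f i x))" "coord_mono {i} (f i x)" for i x
  proof -
    have [measurable]: "(\<lambda>z. z i) \<in> borel_measurable (Pi\<^sub>M {i} (\<lambda>_. borel))"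
      by (auto intro!: measurable_component_singleton)
    show "f i x \<in> borel_measurable (Pi\<^sub>M {i} (\<lambda>_. borel))" unfolding f_def by measurable
    show "bounded (range (f i x))" unfolding bounded_range_real f_def by (auto intro!: exI[of _ 1])
    show "coord_mono {i} (f i x)" by (auto simp: coord_mono_def ind_def f_def)
  qed
  have "0 \<le> cov M (\<lambda>\<omega>. f i x (\<lambda>i\<in>{i}. X i \<omega>)) (\<lambda>\<omega>. f j y (\<lambda>j\<in>{j}. X j \<omega>))"
    by (rule assoc[unfolded associated_def, rule_format]) (auto intro: f)
  then show ?thesis by (simp add: f_def cov_minus_left cov_minus_right)
qed

lemma cov_ind_le:
  assumes "i \<noteq> j" "x \<in> {0..1}" "y \<in> {0..1}"
  shows "cov M (\<lambda>\<omega>. ind (X i \<omega> \<le> x)) (\<lambda>\<omega>. ind (X j \<omega> \<le> y)) \<le> 4 * C * real_of_int \<bar>i - j\<bar> powr (- \<alpha>)"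
proof -
  have "cov M (\<lambda>\<omega>. ind (X i \<omega> \<le> x)) (\<lambda>\<omega>. ind (X j \<omega> \<le> y)) \<le> 4 * cov M (X i) (X j)"
    using assms by (intro cov_indicator_le uniform SI X_measurable) auto
  then show ?thesis using cov_X_le[OF assms(1)] by simp
qed

lemma expectation_ind: assumes "x \<in> {0..1}" shows "(\<integral>\<omega>. ind (X i \<omega> \<le> x) \<partial>M) = x"
proof -
  have "AE \<omega> in M. X i \<omega> \<noteq> 0"
  proof -
    have "AE x in uniform_measure lborel {0..1::real}. x \<noteq> 0"
      by (intro AE_uniform_measureI) (use AE_lborel_singleton[of 0] in \<open>auto elim!: AE_mp\<close>)
    then show ?thesis unfolding uniform[symmetric, of i] by (subst (asm) AE_distr_iff) auto
  qed
  moreover have "AE \<omega> in M. X i \<omega> \<in> {0..1}" by (rule uniform_AE[OF X_measurable uniform])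
  ultimately have "AE \<omega> in M. ind (X i \<omega> \<le> x) = ind (X i \<omega> \<in> {0<..x})"
    by eventually_elim (auto simp: ind_def)
  then have "(\<integral>\<omega>. ind (X i \<omega> \<le> x) \<partial>M) = (\<integral>\<omega>. ind (X i \<omega> \<in> {0<..x}) \<partial>M)"
    by (intro integral_cong_AE) auto
  then show ?thesis using uniform_integral_interval(1)[OF X_measurable uniform, of 0 x] assms by simp
qed

lemma brv_lin [simp]: "S \<subseteq> {0..1} \<Longrightarrow> brv M (\<lambda>\<omega>. lin S c (X i \<omega>))"
  by (rule brv_dominated(1)[OF dominated_lin])

lemma expectation_lin: assumes "S \<subseteq> {0..1}" shows "(\<integral>\<omega>. lin S c (X i \<omega>) \<partial>M) = 0"
proof -
  have "(\<integral>\<omega>. c x * (ind (X i \<omega> \<le> x) - x) \<partial>M) = 0" if "x \<in> S" for x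
    using expectation_ind[of x i] assms that by (auto simp: brv_integrable prob_space)
  moreover have "(\<integral>\<omega>. lin S c (X i \<omega>) \<partial>M) = (\<Sum>x\<in>S. \<integral>\<omega>. c x * (ind (X i \<omega> \<le> x) - x) \<partial>M)"
    unfolding lin_def by (rule Bochner_Integration.integral_sum) (auto intro!: brv_integrable brv_intros)
  ultimately show ?thesis by (simp only: sum.neutral_const cong: sum.cong)
qed

lemma cov_lin: "cov M (\<lambda>\<omega>. lin S c (X i \<omega>)) (\<lambda>\<omega>. lin S c (X j \<omega>)) =
  (\<Sum>x\<in>S. \<Sum>y\<in>S. c x * c y * cov M (\<lambda>\<omega>. ind (X i \<omega> \<le> x)) (\<lambda>\<omega>. ind (X j \<omega> \<le> y)))"
proof -
  have "cov M (\<lambda>\<omega>. c x * (ind (X i \<omega> \<le> x) - x)) (\<lambda>\<omega>. c y * (ind (X j \<omega> \<le> y) - y)) =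
     c x * c y * cov M (\<lambda>\<omega>. ind (X i \<omega> \<le> x)) (\<lambda>\<omega>. ind (X j \<omega> \<le> y))" for x y
    by (simp add: cov_cmult_left cov_cmult_right cov_diff_left cov_diff_right brv_intros)
  then show ?thesis unfolding lin_def by (subst cov_sum_sum) (auto intro!: brv_intros)
qed

lemma cov_linabs_le:
  assumes "i \<noteq> j" "S \<subseteq> {0..1}"
  shows "cov M (\<lambda>\<omega>. linabs S c (X i \<omega>)) (\<lambda>\<omega>. linabs S c (X j \<omega>)) \<le> 4 * C * (\<Sum>x\<in>S. \<bar>c x\<bar>)\<^sup>2 * real_of_int \<bar>i - j\<bar> powr (- \<alpha>)"
proof -
  have "cov M (\<lambda>\<omega>. linabs S c (X i \<omega>)) (\<lambda>\<omega>. linabs S c (X j \<omega>)) =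
      (\<Sum>x\<in>S. \<Sum>y\<in>S. \<bar>c x\<bar> * \<bar>c y\<bar> * cov M (\<lambda>\<omega>. ind (X i \<omega> \<le> x)) (\<lambda>\<omega>. ind (X j \<omega> \<le> y)))"
    unfolding linabs_def by (subst cov_sum_sum) (auto intro!: brv_intros simp: cov_cmult_left cov_cmult_right mult.assoc)
  also have "\<dots> \<le> (\<Sum>x\<in>S. \<Sum>y\<in>S. \<bar>c x\<bar> * \<bar>c y\<bar> * (4 * C * real_of_int \<bar>i - j\<bar> powr (- \<alpha>)))"
    using assms by (intro sum_mono mult_left_mono cov_ind_le) auto
  also have "\<dots> = 4 * C * (\<Sum>x\<in>S. \<bar>c x\<bar>)\<^sup>2 * real_of_int \<bar>i - j\<bar> powr (- \<alpha>)"
    by (simp add: power2_eq_square sum_product sum_distrib_right sum_distrib_left mult_ac)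
  finally show ?thesis .
qed

lemma cov_lin_le:
  assumes "i \<noteq> j" "S \<subseteq> {0..1}"
  shows "\<bar>cov M (\<lambda>\<omega>. lin S c (X i \<omega>)) (\<lambda>\<omega>. lin S c (X j \<omega>))\<bar> \<le> 4 * C * (\<Sum>x\<in>S. \<bar>c x\<bar>)\<^sup>2 * real_of_int \<bar>i - j\<bar> powr (- \<alpha>)"
  using cov_dominated[OF dominated_lin[OF assms(2)], of c i j] cov_linabs_le[OF assms, of c] by linarith

lemma expectation_lin_product:
  "S \<subseteq> {0..1} \<Longrightarrow> (\<integral>\<omega>. (\<Sum>i\<in>A. lin S c (X i \<omega>)) * (\<Sum>j\<in>B. lin S c (X j \<omega>)) \<partial>M) =
    (\<Sum>i\<in>A. \<Sum>j\<in>B. cov M (\<lambda>\<omega>. lin S c (X i \<omega>)) (\<lambda>\<omega>. lin S c (X j \<omega>)))"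
proof -
  assume S: "S \<subseteq> {0..1}"
  have "(\<integral>\<omega>. (\<Sum>i\<in>A. lin S c (X i \<omega>)) \<partial>M) = 0" for A
    by (subst Bochner_Integration.integral_sum) (use S in \<open>auto simp: expectation_lin brv_integrable\<close>)
  then have "(\<integral>\<omega>. (\<Sum>i\<in>A. lin S c (X i \<omega>)) * (\<Sum>j\<in>B. lin S c (X j \<omega>)) \<partial>M) =
     cov M (\<lambda>\<omega>. \<Sum>i\<in>A. lin S c (X i \<omega>)) (\<lambda>\<omega>. \<Sum>j\<in>B. lin S c (X j \<omega>))" by (simp add: cov_def)
  then show ?thesis using S by (simp add: cov_sum_sum)
qed

definition blocksum :: "real set \<Rightarrow> (real \<Rightarrow> real) \<Rightarrow> int set \<Rightarrow> 'a \<Rightarrow> real" where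
  "blocksum S c A \<omega> = (\<Sum>i\<in>A. lin S c (X i \<omega>))"

text \<open>The total covariance of the majorants across distinct blocks. This one quantity bounds
  both the failure of the characteristic function to factorise and the failure of the variances to
  add.\<close>

definition coupling :: "real set \<Rightarrow> (real \<Rightarrow> real) \<Rightarrow> (nat \<Rightarrow> int set) \<Rightarrow> nat \<Rightarrow> real" where
  "coupling S c Bl k = (\<Sum>d<k. \<Sum>b<d. \<Sum>i\<in>Bl b. \<Sum>j\<in>Bl d. cov M (\<lambda>\<omega>. linabs S c (X i \<omega>)) (\<lambda>\<omega>. linabs S c (X j \<omega>)))"

lemma brv_blocksum [simp]: "S \<subseteq> {0..1} \<Longrightarrow> brv M (blocksum S c A)"
  unfolding blocksum_def[abs_def] by (intro brv_sum brv_lin)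

lemma expectation_blocksum: "S \<subseteq> {0..1} \<Longrightarrow> (\<integral>\<omega>. blocksum S c A \<omega> \<partial>M) = 0"
  unfolding blocksum_def by (subst Bochner_Integration.integral_sum) (auto simp: expectation_lin brv_integrable)

lemma blocksum_variance_diff:
  assumes S: "S \<subseteq> {0..1}"
  shows "\<bar>(\<integral>\<omega>. (\<Sum>b<k. blocksum S c (Bl b) \<omega>)\<^sup>2 \<partial>M) - (\<Sum>b<k. \<integral>\<omega>. (blocksum S c (Bl b) \<omega>)\<^sup>2 \<partial>M)\<bar> \<le> 2 * coupling S c Bl k"
proof -
  let ?U = "\<lambda>b. blocksum S c (Bl b)"
  have i: "integrable M (\<lambda>\<omega>. (?U b \<omega>)\<^sup>2)" "integrable M (\<lambda>\<omega>. ?U b \<omega> * ?U d \<omega>)" for b d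
    using S by (auto intro!: brv_integrable brv_power brv_mult)
  have "(\<integral>\<omega>. (\<Sum>b<k. ?U b \<omega>)\<^sup>2 \<partial>M) = (\<Sum>b<k. \<integral>\<omega>. (?U b \<omega>)\<^sup>2 \<partial>M) + 2 * (\<Sum>d<k. \<Sum>b<d. \<integral>\<omega>. ?U b \<omega> * ?U d \<omega> \<partial>M)"
    unfolding sum_square_expand by (simp add: i)
  then have "\<bar>(\<integral>\<omega>. (\<Sum>b<k. ?U b \<omega>)\<^sup>2 \<partial>M) - (\<Sum>b<k. \<integral>\<omega>. (?U b \<omega>)\<^sup>2 \<partial>M)\<bar> = 2 * \<bar>\<Sum>d<k. \<Sum>b<d. \<integral>\<omega>. ?U b \<omega> * ?U d \<omega> \<partial>M\<bar>" by simp
  also have "\<bar>\<Sum>d<k. \<Sum>b<d. \<integral>\<omega>. ?U b \<omega> * ?U d \<omega> \<partial>M\<bar> \<le> coupling S c Bl k"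
    unfolding coupling_def blocksum_def expectation_lin_product[OF S]
    by (intro order_trans[OF sum_abs] sum_mono cov_dominated dominated_lin S)
  finally show ?thesis by simp
qed

lemma blocks_tail:
  assumes S: "S \<subseteq> {0..1}" and fin: "\<And>b. finite (Bl b)" and dis: "\<And>b c. b \<noteq> c \<Longrightarrow> Bl b \<inter> Bl c = {}"
    and \<beta>: "\<And>b \<omega>. \<bar>blocksum S c (Bl b) \<omega>\<bar> \<le> \<beta>" and V: "V = (\<Sum>b<k. \<integral>\<omega>. (blocksum S c (Bl b) \<omega>)\<^sup>2 \<partial>M)"
  shows "prob {\<omega>\<in>space M. \<bar>\<Sum>b<k. blocksum S c (Bl b) \<omega>\<bar> \<ge> 3} \<le> 10 * coupling S c Bl k + \<beta>\<^sup>2 * V + V\<^sup>2/4"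
proof (rule block_sum_tail[where U="\<lambda>b. blocksum S c (Bl b)", OF _ \<beta> expectation_blocksum[OF S] refl V])
  show "random_variable borel (blocksum S c (Bl b))" for b using S by (intro brv_measurable brv_blocksum)
  show "norm (cf (\<lambda>\<omega>. \<Sum>b<k. blocksum S c (Bl b) \<omega>) - (\<Prod>b<k. cf (blocksum S c (Bl b)))) \<le> 4 * coupling S c Bl k"
    unfolding blocksum_def[abs_def] coupling_def by (rule cf_blocks[OF dominated_lin[OF S] fin dis])
  show "(\<integral>\<omega>. (\<Sum>b<k. blocksum S c (Bl b) \<omega>)\<^sup>2 \<partial>M) \<le> V + 2 * coupling S c Bl k"
    using blocksum_variance_diff[OF S, where k=k and c=c and Bl=Bl] unfolding V by linarith
qed

lemma blocks_gauss:
  assumes S: "S \<subseteq> {0..1}" and fin: "\<And>b. finite (Bl b)" and dis: "\<And>b c. b \<noteq> c \<Longrightarrow> Bl b \<inter> Bl c = {}"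
    and \<beta>: "\<And>b \<omega>. \<bar>blocksum S c (Bl b) \<omega>\<bar> \<le> \<beta>" "\<beta> \<le> 1" and V: "V = (\<Sum>b<k. \<integral>\<omega>. (blocksum S c (Bl b) \<omega>)\<^sup>2 \<partial>M)"
    and v: "v = (\<integral>\<omega>. (\<Sum>b<k. blocksum S c (Bl b) \<omega>)\<^sup>2 \<partial>M)"
  shows "norm (cf (\<lambda>\<omega>. \<Sum>b<k. blocksum S c (Bl b) \<omega>) - exp (- v/2)) \<le> 5 * coupling S c Bl k + \<beta> * V"
proof (rule block_sum_gauss[where U="\<lambda>b. blocksum S c (Bl b)", OF _ \<beta> expectation_blocksum[OF S] V])
  show "random_variable borel (blocksum S c (Bl b))" for b using S by (intro brv_measurable brv_blocksum)
  show "norm (cf (\<lambda>\<omega>. \<Sum>b<k. blocksum S c (Bl b) \<omega>) - (\<Prod>b<k. cf (blocksum S c (Bl b)))) \<le> 4 * coupling S c Bl k"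
    unfolding blocksum_def[abs_def] coupling_def by (rule cf_blocks[OF dominated_lin[OF S] fin dis])
  show "\<bar>v - V\<bar> \<le> 2 * coupling S c Bl k"
    using blocksum_variance_diff[OF S, where k=k and c=c and Bl=Bl] unfolding V v by linarith
  show "0 \<le> v" unfolding v by simp
qed

text \<open>The decay is split as \<alpha> = p + q: the factor with q is summed over all indices of
  earlier blocks and costs W, the factor with p is bounded through a lower bound
  \<open>R d j\<close> for the distance from j to them. Letting R depend on d and j covers blocks
  with gaps and adjacent blocks alike.\<close>

lemma coupling_le:
  assumes S: "S \<subseteq> {0..1}" and fin: "\<And>b. finite (Bl b)" and dis: "\<And>b c. b \<noteq> c \<Longrightarrow> Bl b \<inter> Bl c = {}"
    and W: "W \<ge> 0" "\<And>i J. finite J \<Longrightarrow> (\<Sum>j\<in>J. real_of_int \<bar>i - j\<bar> powr (-q)) \<le> W"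
    and p: "p \<ge> 0" "\<alpha> = p + q"
    and R: "\<And>b d i j. b < d \<Longrightarrow> d < k \<Longrightarrow> i \<in> Bl b \<Longrightarrow> j \<in> Bl d \<Longrightarrow> 0 < R d j \<and> R d j \<le> real_of_int \<bar>j - i\<bar>"
  shows "coupling S c Bl k \<le> 4 * C * (\<Sum>x\<in>S. \<bar>c x\<bar>)\<^sup>2 * W * (\<Sum>d<k. \<Sum>j\<in>Bl d. R d j powr (-p))"
proof -
  define D where "D = 4 * C * (\<Sum>x\<in>S. \<bar>c x\<bar>)\<^sup>2"
  have D: "D \<ge> 0" using C by (simp add: D_def)
  have "(\<Sum>b<d. \<Sum>i\<in>Bl b. \<Sum>j\<in>Bl d. cov M (\<lambda>\<omega>. linabs S c (X i \<omega>)) (\<lambda>\<omega>. linabs S c (X j \<omega>)))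
      \<le> (\<Sum>j\<in>Bl d. D * (R d j powr (-p)) * W)" if d: "d < k" for d
  proof -
    have "(\<Sum>b<d. \<Sum>i\<in>Bl b. \<Sum>j\<in>Bl d. cov M (\<lambda>\<omega>. linabs S c (X i \<omega>)) (\<lambda>\<omega>. linabs S c (X j \<omega>)))
      \<le> (\<Sum>b<d. \<Sum>i\<in>Bl b. \<Sum>j\<in>Bl d. D * (R d j powr (-p)) * real_of_int \<bar>j - i\<bar> powr (-q))"
    proof (intro sum_mono)
      fix b i j assume b: "b \<in> {..<d}" and ij: "i \<in> Bl b" "j \<in> Bl d"
      have r: "0 < R d j" "R d j \<le> real_of_int \<bar>j - i\<bar>" using R[of b d i j] b d ij by auto
      have ne: "i \<noteq> j" using dis[of b d] b ij by auto
      have "real_of_int \<bar>i - j\<bar> powr (-\<alpha>) = real_of_int \<bar>j - i\<bar> powr (-p) * real_of_int \<bar>j - i\<bar> powr (-q)"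
        by (simp add: p(2) abs_minus_commute flip: powr_add)
      also have "\<dots> \<le> R d j powr (-p) * real_of_int \<bar>j - i\<bar> powr (-q)"
        using r p(1) by (intro mult_right_mono powr_mono2') auto
      finally have "D * real_of_int \<bar>i - j\<bar> powr (-\<alpha>) \<le> D * (R d j powr (-p) * real_of_int \<bar>j - i\<bar> powr (-q))"
        using D by (intro mult_left_mono) auto
      then show "cov M (\<lambda>\<omega>. linabs S c (X i \<omega>)) (\<lambda>\<omega>. linabs S c (X j \<omega>)) \<le> D * (R d j powr (-p)) * real_of_int \<bar>j - i\<bar> powr (-q)"
        using cov_linabs_le[OF ne S, of c] unfolding D_def by (simp add: mult.assoc)
    qed
    also have "\<dots> = (\<Sum>i\<in>(\<Union>b<d. Bl b). \<Sum>j\<in>Bl d. D * (R d j powr (-p)) * real_of_int \<bar>j - i\<bar> powr (-q))"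
      using fin dis by (subst sum.UNION_disjoint) auto
    also have "\<dots> = (\<Sum>j\<in>Bl d. D * (R d j powr (-p)) * (\<Sum>i\<in>(\<Union>b<d. Bl b). real_of_int \<bar>j - i\<bar> powr (-q)))"
      by (subst sum.swap) (simp add: sum_distrib_left)
    also have "\<dots> \<le> (\<Sum>j\<in>Bl d. D * (R d j powr (-p)) * W)"
      using fin D by (intro sum_mono mult_left_mono W(2)) auto
    finally show ?thesis .
  qed
  then have "coupling S c Bl k \<le> (\<Sum>d<k. \<Sum>j\<in>Bl d. D * (R d j powr (-p)) * W)"
    unfolding coupling_def by (intro sum_mono) auto
  also have "\<dots> = D * W * (\<Sum>d<k. \<Sum>j\<in>Bl d. R d j powr (-p))"
    by (simp add: sum_distrib_left mult_ac)
  finally show ?thesis unfolding D_def by simp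
qed

end

section \<open>Chaining over dyadic levels\<close>

text \<open>Halving the mesh either leaves the grid point below x unchanged or moves it by one fine
  cell, so only a single increment of the new level enters.\<close>

lemma step_Suc_diff:
  assumes x: "x \<in> {0..1}" and d: "\<And>j. j \<in> {1..2^Suc l} \<Longrightarrow> \<bar>f (real j / 2^Suc l) - f ((real j - 1) / 2^Suc l)\<bar> \<le> e" and e: "0 \<le> e"
  shows "\<bar>step (Suc l) f x - step l f x\<bar> \<le> e"
proof -
  define k where "k = \<lfloor>2^l * x\<rfloor>"
  define k' where "k' = \<lfloor>2^Suc l * x\<rfloor>"
  have "k \<le> 2^l * x" "2^l * x < k + 1" unfolding k_def by linarith+
  then have "k' = 2 * k \<or> k' = 2 * k + 1" unfolding k'_def by (simp add: floor_eq_iff) linarith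
  then show ?thesis
  proof
    assume "k' = 2 * k"
    then have "k' / 2^Suc l = k / 2^l" by simp
    then show ?thesis unfolding step_eq[OF x] k_def[symmetric] k'_def[symmetric] using e by simp
  next
    assume k': "k' = 2 * k + 1"
    have k0: "0 \<le> k" unfolding k_def using x by simp
    have le: "nat k' \<le> 2^Suc l" unfolding k'_def by (rule nat_floor_le[OF x])
    have r: "real (nat k') = k'" using k0 k' by simp
    have "real (nat k') - 1 = 2 * k" using r k' by simp
    then have "k / 2^l = (real (nat k') - 1) / 2^Suc l" by simp
    moreover have "\<bar>f (real (nat k') / 2^Suc l) - f ((real (nat k') - 1) / 2^Suc l)\<bar> \<le> e"
      by (rule d) (use le k' k0 in auto)
    ultimately show ?thesis unfolding step_eq[OF x] k_def[symmetric] k'_def[symmetric] r by simp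
  qed
qed

lemma step_chain:
  assumes x: "x \<in> {0..1}" and m: "m0 \<le> M"
    and d: "\<And>l j. m0 < l \<Longrightarrow> l \<le> M \<Longrightarrow> j \<in> {1..2^l} \<Longrightarrow> \<bar>f (real j / 2^l) - f ((real j - 1) / 2^l)\<bar> \<le> e l"
    and e: "\<And>l. 0 \<le> e l"
  shows "\<bar>step M f x - step m0 f x\<bar> \<le> (\<Sum>l\<in>{m0<..M}. e l)"
  using m d
proof (induction M rule: dec_induct)
  case (step M)
  have "\<bar>step (Suc M) f x - step M f x\<bar> \<le> e (Suc M)"
    by (rule step_Suc_diff[OF x _ e], rule step.prems) (use step.hyps in auto)
  moreover have "\<bar>step M f x - step m0 f x\<bar> \<le> (\<Sum>l\<in>{m0<..M}. e l)" using step by auto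
  moreover have "{m0<..Suc M} = insert (Suc M) {m0<..M}" using step by auto
  ultimately show ?case by simp
qed simp

context uniform_process
begin

section \<open>Variance of increments\<close>

definition incr :: "real \<Rightarrow> real \<Rightarrow> real \<Rightarrow> real \<Rightarrow> real" where
  "incr a s t x = (if x = t then a else - a)"

lemma lin_incr: "s \<noteq> t \<Longrightarrow> lin {s,t} (incr a s t) u = a * ((ind (u \<le> t) - t) - (ind (u \<le> s) - s))"
  by (simp add: lin_def incr_def algebra_simps)

lemma sum_abs_incr: "s \<noteq> t \<Longrightarrow> 0 \<le> a \<Longrightarrow> (\<Sum>x\<in>{s,t}. \<bar>incr a s t x\<bar>) = 2 * a"
  by (simp add: incr_def)

lemma cov_incr_le:
  assumes st: "0 \<le> s" "s < t" "t \<le> 1"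
  shows "\<bar>cov M (\<lambda>\<omega>. lin {s,t} (incr a s t) (X i \<omega>)) (\<lambda>\<omega>. lin {s,t} (incr a s t) (X j \<omega>))\<bar> \<le> a\<^sup>2 * (t - s)"
proof -
  define h where "h i \<omega> = ind (X i \<omega> \<le> t) - ind (X i \<omega> \<le> s)" for i \<omega>
  have bh: "brv M (h i)" for i unfolding h_def[abs_def] by (intro brv_intros brv_indX)
  have h01: "0 \<le> h i \<omega>" "h i \<omega> \<le> 1" for i \<omega> using st by (auto simp: h_def ind_def)
  have Eh: "(\<integral>\<omega>. h i \<omega> \<partial>M) = t - s" for i
    unfolding h_def using st by (simp add: brv_integrable expectation_ind)
  have "lin {s,t} (incr a s t) (X i \<omega>) = a * (h i \<omega> - (t - s))" for i \<omega>
    using st by (simp add: lin_incr h_def)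
  then have "cov M (\<lambda>\<omega>. lin {s,t} (incr a s t) (X i \<omega>)) (\<lambda>\<omega>. lin {s,t} (incr a s t) (X j \<omega>)) = a\<^sup>2 * cov M (h i) (h j)"
    by (simp add: cov_cmult_left cov_cmult_right cov_diff_left cov_diff_right bh brv_intros power2_eq_square)
  moreover have "\<bar>cov M (h i) (h j)\<bar> \<le> t - s"
  proof -
    have "(\<integral>\<omega>. h i \<omega> * h j \<omega> \<partial>M) \<le> (\<integral>\<omega>. h i \<omega> \<partial>M)"
      by (intro integral_mono brv_integrable brv_mult bh mult_left_le h01)
    moreover have "0 \<le> (\<integral>\<omega>. h i \<omega> * h j \<omega> \<partial>M)" using h01 by (intro integral_nonneg_AE) auto
    moreover have "(t - s) * (t - s) \<le> t - s" using st by (intro mult_left_le) auto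
    moreover have "0 \<le> (t - s) * (t - s)" by simp
    ultimately show ?thesis unfolding cov_def Eh by linarith
  qed
  ultimately show ?thesis by (simp add: abs_mult mult_left_mono)
qed

text \<open>A covariance of unit increments at distance k is at most t - s and at most 16 C k powr
  (-\<alpha>), where 16 = 4 * 2^2 because the coefficients have absolute sum 2. The weighted
  geometric mean retains (t - s) powr \<theta> and decays like k powr (-(\<alpha> (1 - \<theta>))),
  whose sums W bounds.\<close>

lemma incr_variance:
  assumes \<theta>: "0 < \<theta>" "\<theta> < 1"
    and W: "W \<ge> 0" "\<And>i J. finite J \<Longrightarrow> (\<Sum>j\<in>J. real_of_int \<bar>i - j\<bar> powr (- (\<alpha> * (1 - \<theta>)))) \<le> W"
    and st: "0 \<le> s" "s < t" "t \<le> 1" and J: "finite J"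
  shows "(\<integral>\<omega>. (blocksum {s,t} (incr a s t) J \<omega>)\<^sup>2 \<partial>M) \<le> real (card J) * (a\<^sup>2 * (t - s) powr \<theta> * (1 + (16 * C) powr (1 - \<theta>) * W))"
proof -
  let ?c = "\<lambda>i j. cov M (\<lambda>\<omega>. lin {s,t} (incr a s t) (X i \<omega>)) (\<lambda>\<omega>. lin {s,t} (incr a s t) (X j \<omega>))"
  let ?T = "(t - s) powr \<theta>"
  have S: "{s,t} \<subseteq> {0..1}" using st by auto
  have ne: "s \<noteq> t" using st by simp
  have T: "t - s \<le> ?T" using powr_mono'[of \<theta> 1 "t - s"] st \<theta> by simp
  have off: "?c i j \<le> a\<^sup>2 * ?T * (16 * C) powr (1 - \<theta>) * real_of_int \<bar>i - j\<bar> powr (- (\<alpha> * (1 - \<theta>)))" if ij: "i \<noteq> j" for i j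
  proof -
    define x where "x = \<bar>cov M (\<lambda>\<omega>. lin {s,t} (incr 1 s t) (X i \<omega>)) (\<lambda>\<omega>. lin {s,t} (incr 1 s t) (X j \<omega>))\<bar>"
    have sc: "?c i j = a\<^sup>2 * cov M (\<lambda>\<omega>. lin {s,t} (incr 1 s t) (X i \<omega>)) (\<lambda>\<omega>. lin {s,t} (incr 1 s t) (X j \<omega>))"
      using st by (simp add: lin_incr cov_cmult_left cov_cmult_right power2_eq_square)
    have x1: "x \<le> t - s" using cov_incr_le[OF st, of 1 i j] by (simp add: x_def)
    have x2: "x \<le> 16 * C * real_of_int \<bar>i - j\<bar> powr (- \<alpha>)"
      using cov_lin_le[OF ij S, of "incr 1 s t"] unfolding sum_abs_incr[OF ne zero_le_one] by (simp add: x_def)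
    have "x \<le> ?T * ((16 * C) powr (1 - \<theta>) * real_of_int \<bar>i - j\<bar> powr (- (\<alpha> * (1 - \<theta>))))"
    proof (cases "x = 0")
      case False
      then have x0: "0 < x" by (simp add: x_def)
      have "x = x powr \<theta> * x powr (1 - \<theta>)" using x0 by (simp flip: powr_add)
      also have "\<dots> \<le> ?T * (16 * C * real_of_int \<bar>i - j\<bar> powr (- \<alpha>)) powr (1 - \<theta>)"
        using x0 x1 x2 \<theta> by (intro mult_mono powr_mono2) auto
      also have "(16 * C * real_of_int \<bar>i - j\<bar> powr (- \<alpha>)) powr (1 - \<theta>) = (16 * C) powr (1 - \<theta>) * real_of_int \<bar>i - j\<bar> powr (- (\<alpha> * (1 - \<theta>)))"
        using C by (simp add: powr_mult powr_powr)
      finally show ?thesis .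
    qed (use st in simp)
    then have "a\<^sup>2 * x \<le> a\<^sup>2 * (?T * ((16 * C) powr (1 - \<theta>) * real_of_int \<bar>i - j\<bar> powr (- (\<alpha> * (1 - \<theta>)))))"
      by (intro mult_left_mono) auto
    moreover have "?c i j \<le> a\<^sup>2 * x" unfolding sc x_def by (intro mult_left_mono) auto
    ultimately show ?thesis by (simp add: mult.assoc)
  qed
  have row: "(\<Sum>j\<in>J. ?c i j) \<le> a\<^sup>2 * ?T * (1 + (16 * C) powr (1 - \<theta>) * W)" if i: "i \<in> J" for i
  proof -
    have "(\<Sum>j\<in>J. ?c i j) = ?c i i + (\<Sum>j\<in>J-{i}. ?c i j)" using J i by (rule sum.remove)
    also have "?c i i \<le> a\<^sup>2 * ?T"
      using cov_incr_le[OF st, of a i i] mult_left_mono[OF T, of "a\<^sup>2"] by (simp add: abs_le_iff)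
    also have "(\<Sum>j\<in>J-{i}. ?c i j) \<le> (\<Sum>j\<in>J-{i}. a\<^sup>2 * ?T * (16 * C) powr (1 - \<theta>) * real_of_int \<bar>i - j\<bar> powr (- (\<alpha> * (1 - \<theta>))))"
      by (intro sum_mono off) auto
    also have "\<dots> = a\<^sup>2 * ?T * (16 * C) powr (1 - \<theta>) * (\<Sum>j\<in>J-{i}. real_of_int \<bar>i - j\<bar> powr (- (\<alpha> * (1 - \<theta>))))"
      by (simp add: sum_distrib_left)
    also have "\<dots> \<le> a\<^sup>2 * ?T * (16 * C) powr (1 - \<theta>) * W" using J by (intro mult_left_mono W(2)) auto
    finally show ?thesis by (simp add: algebra_simps)
  qed
  have "(\<integral>\<omega>. (blocksum {s,t} (incr a s t) J \<omega>)\<^sup>2 \<partial>M) = (\<Sum>i\<in>J. \<Sum>j\<in>J. ?c i j)"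
    unfolding blocksum_def power2_eq_square by (rule expectation_lin_product[OF S])
  also have "\<dots> \<le> (\<Sum>i\<in>J. a\<^sup>2 * ?T * (1 + (16 * C) powr (1 - \<theta>) * W))" by (intro sum_mono row)
  finally show ?thesis by simp
qed

section \<open>Blocks separated by gaps\<close>

text \<open>The parameter p is a parity. Two blocks of one parity are separated by a whole block of
  length m of the other, so their indices differ by at least m.\<close>

definition gap_block :: "nat \<Rightarrow> nat \<Rightarrow> int \<Rightarrow> nat \<Rightarrow> int set" where
  "gap_block n m p b = {i\<in>{1..int n}. i div int m = 2 * int b + p}"

lemma finite_gap_block [simp]: "finite (gap_block n m p b)"
  by (rule finite_subset[of _ "{1..int n}"]) (auto simp: gap_block_def)

lemma gap_block_disjoint: "b \<noteq> c \<Longrightarrow> gap_block n m p b \<inter> gap_block n m p c = {}"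
  by (auto simp: gap_block_def)

lemma card_gap_block: assumes "m \<ge> 1" shows "card (gap_block n m p b) \<le> m"
proof -
  define q where "q = 2 * int b + p"
  have "gap_block n m p b \<subseteq> {q * int m..<(q + 1) * int m}"
  proof
    fix i assume "i \<in> gap_block n m p b"
    then have "i div int m = q" by (simp add: gap_block_def q_def)
    then have "i = int m * q + i mod int m" by (metis mult_div_mod_eq)
    moreover have "0 \<le> i mod int m" "i mod int m < int m" using assms by auto
    ultimately show "i \<in> {q * int m..<(q + 1) * int m}" by (auto simp: algebra_simps)
  qed
  then have "card (gap_block n m p b) \<le> card {q * int m..<(q + 1) * int m}" by (intro card_mono) auto
  also have "\<dots> = m" by (simp add: algebra_simps)
  finally show ?thesis .
qed

lemma sum_card_gap_block: "(\<Sum>b<k. card (gap_block n m p b)) \<le> n"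
proof -
  have "(\<Sum>b<k. card (gap_block n m p b)) = card (\<Union>b<k. gap_block n m p b)"
    using gap_block_disjoint by (intro card_UN_disjoint[symmetric]) auto
  also have "\<dots> \<le> card {1..int n}" by (intro card_mono) (auto simp: gap_block_def)
  finally show ?thesis by simp
qed

text \<open>Block numbers up to n suffice because i div m \<le> i \<le> n; surplus blocks are empty
  and cost nothing.\<close>

lemma sum_gap_blocks:
  assumes m: "m \<ge> 1"
  shows "(\<Sum>i\<in>{1..int n}. f i) = (\<Sum>b<Suc n. \<Sum>i\<in>gap_block n m 0 b. f i) + (\<Sum>b<Suc n. \<Sum>i\<in>gap_block n m 1 b. (f i :: real))"
proof -
  let ?E = "\<lambda>p. \<Union>b<Suc n. gap_block n m p b"
  have "{1..int n} = ?E 0 \<union> ?E 1"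
  proof
    show "{1..int n} \<subseteq> ?E 0 \<union> ?E 1"
    proof
      fix i assume i: "i \<in> {1..int n}"
      define q where "q = i div int m"
      have q: "0 \<le> q" "q \<le> int n"
      proof -
        show "0 \<le> q" unfolding q_def using i m by (simp add: pos_imp_zdiv_nonneg_iff)
        have "q \<le> i" unfolding q_def using i m zdiv_mono2[of i 1 "int m"] by simp
        then show "q \<le> int n" using i by simp
      qed
      define b where "b = nat (q div 2)"
      have "q = 2 * int b + q mod 2" using q by (simp add: b_def)
      moreover have "q mod 2 = 0 \<or> q mod 2 = 1" by auto
      moreover have "b < Suc n" using q unfolding b_def by linarith
      ultimately show "i \<in> ?E 0 \<union> ?E 1" using i unfolding gap_block_def q_def[symmetric]
        by (cases "q mod 2 = 0") (auto simp: q_def)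
    qed
  qed (auto simp: gap_block_def)
  moreover have "?E 0 \<inter> ?E 1 = {}"
  proof -
    have "gap_block n m 0 b \<inter> gap_block n m 1 c = {}" for b c
    proof -
      have "2 * int b \<noteq> 2 * int c + 1" by presburger
      then show ?thesis by (auto simp: gap_block_def)
    qed
    then show ?thesis by blast
  qed
  ultimately have "(\<Sum>i\<in>{1..int n}. f i) = (\<Sum>i\<in>?E 0. f i) + (\<Sum>i\<in>?E 1. f i)"
    by (simp only:) (rule sum.union_disjoint, auto)
  moreover have "(\<Sum>i\<in>?E p. f i) = (\<Sum>b<Suc n. \<Sum>i\<in>gap_block n m p b. f i)" for p
    using gap_block_disjoint by (intro sum.UNION_disjoint) auto
  ultimately show ?thesis by simp
qed

lemma gap_block_dist:
  assumes m: "m \<ge> 1" and bd: "b < d" and i: "i \<in> gap_block n m p b" and j: "j \<in> gap_block n m p d"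
  shows "real m \<le> real_of_int \<bar>j - i\<bar>"
proof -
  have e: "i = int m * (2 * int b + p) + i mod int m" "j = int m * (2 * int d + p) + j mod int m"
    using i j mult_div_mod_eq[of "int m" i] mult_div_mod_eq[of "int m" j] by (auto simp: gap_block_def)
  have "int m * (2 * int b + p) + 2 * int m \<le> int m * (2 * int d + p)"
  proof -
    have "int m * (2 * int b + p + 2) \<le> int m * (2 * int d + p)" using bd by (intro mult_left_mono) auto
    then show ?thesis by (simp add: algebra_simps)
  qed
  moreover have "0 \<le> j mod int m" "i mod int m < int m" using m by auto
  ultimately have "int m \<le> j - i" using e by linarith
  then show ?thesis by linarith
qed

text \<open>\<open>\<beta>\<^sup>2 V\<close> below bounds the fourth moments of the blocks crudely by (block length)\<open>\<^sup>2\<close> times their variance.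
  This is the place where the exponent \<open>(5 + sqrt 17) / 4\<close> comes from.\<close>

lemma increment_tail:
  assumes \<theta>: "0 < \<theta>" "\<theta> < 1" "\<alpha> * (1 - \<theta>) > 1" and pq: "p \<ge> 0" "q > 1" "\<alpha> = p + q"
  obtains K where "K \<ge> 0"
    "\<And>n m s t \<epsilon>. n \<ge> 1 \<Longrightarrow> m \<ge> 1 \<Longrightarrow> 0 \<le> s \<Longrightarrow> s < t \<Longrightarrow> t \<le> 1 \<Longrightarrow> 0 < \<epsilon> \<Longrightarrow> \<epsilon> \<le> 1 \<Longrightarrow>
      prob {\<omega>\<in>space M. \<bar>blocksum {s,t} (incr 1 s t) {1..int n} \<omega>\<bar> \<ge> \<epsilon> * sqrt n}
      \<le> K / \<epsilon>^4 * (real m powr (-p) + (real m)\<^sup>2 / real n * (t - s) powr \<theta> + (t - s) powr (2 * \<theta>))"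
proof -
  obtain W where W: "W \<ge> 0" "\<And>i J. finite J \<Longrightarrow> (\<Sum>j\<in>J. real_of_int \<bar>i - j\<bar> powr (-q)) \<le> W"
    using powr_sum_bound[OF pq(2)] by blast
  obtain W' where W': "W' \<ge> 0" "\<And>i J. finite J \<Longrightarrow> (\<Sum>j\<in>J. real_of_int \<bar>i - j\<bar> powr (- (\<alpha> * (1 - \<theta>)))) \<le> W'"
    using powr_sum_bound[OF \<theta>(3)] by blast
  define v where "v = 1 + (16 * C) powr (1 - \<theta>) * W'"
  have v0: "v \<ge> 0" unfolding v_def using W' by simp
  \<comment> \<open>The coefficients come from the three estimates \<open>c\<close>,
    \<open>b\<close> and \<open>V2\<close> below: 5760 = 10 * 16 * 36, 5184 = 144 * 36 and 324 =
    36^2 / 4, where 36 stems from the square of the scale a.\<close>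
  define K where "K = 5760 * C * W + 5184 * v + 324 * v\<^sup>2"
  have K0: "K \<ge> 0" unfolding K_def using C W v0 by simp
  show thesis
  proof (rule that[of "2 * K"])
    fix n m :: nat and s t \<epsilon> :: real
    assume n: "n \<ge> 1" and m: "m \<ge> 1" and st: "0 \<le> s" "s < t" "t \<le> 1" and \<epsilon>: "0 < \<epsilon>" "\<epsilon> \<le> 1"
    have S: "{s,t} \<subseteq> {0..1}" and ne: "s \<noteq> t" using st by auto
    define T where "T = (t - s) powr \<theta>"
    have T0: "T \<ge> 0" by (simp add: T_def)
    have TT: "(t - s) powr (2 * \<theta>) = T\<^sup>2" using st by (simp add: T_def power2_eq_square flip: powr_add)
    \<comment> \<open>Scaled so that an increment of size \<epsilon> sqrt n becomes 6: then one of
      the two parity classes has a sum of at least 3, the threshold in \<open>blocks_tail\<close>.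
      The two classes account for the factor 2 in front of K.\<close>
    define a where "a = 6 / (\<epsilon> * sqrt n)"
    have a0: "a > 0" using n \<epsilon> by (simp add: a_def)
    define E where "E = 1 / \<epsilon>\<^sup>2"
    have a2: "a\<^sup>2 * n = 36 * E" using n \<epsilon> by (simp add: a_def E_def power_divide power_mult_distrib)
    have E2: "1 / \<epsilon>^4 = E * E" by (simp add: E_def power4_eq_xxxx power2_eq_square)
    define Q where "Q = real m powr (-p) + (real m)\<^sup>2 / real n * T + T\<^sup>2"
    \<comment> \<open>The coupling term carries only \<epsilon>^(-2); \<epsilon> \<le> 1 raises it
      to the common factor \<epsilon>^(-4).\<close>
    have \<epsilon>42: "E \<le> E * E" unfolding E2[symmetric] using \<epsilon> unfolding E_def by (intro divide_left_mono power_decreasing) auto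
    have lin_le: "\<bar>lin {s,t} (incr a s t) u\<bar> \<le> 2 * a" for u
      using abs_lin_le[OF S, of "incr a s t" u] unfolding sum_abs_incr[OF ne less_imp_le[OF a0]] .
    let ?U = "\<lambda>r b. blocksum {s,t} (incr a s t) (gap_block n m r b)"
    have main: "prob {\<omega>\<in>space M. \<bar>\<Sum>b<Suc n. ?U r b \<omega>\<bar> \<ge> 3} \<le> K / \<epsilon>^4 * Q" for r
    proof -
      define V where "V = (\<Sum>b<Suc n. \<integral>\<omega>. (?U r b \<omega>)\<^sup>2 \<partial>M)"
      define \<beta> where "\<beta> = 2 * a * m"
      have \<beta>: "\<bar>?U r b \<omega>\<bar> \<le> \<beta>" for b \<omega>
      proof -
        have "\<bar>?U r b \<omega>\<bar> \<le> (\<Sum>i\<in>gap_block n m r b. 2 * a)"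
          unfolding blocksum_def
          by (intro order_trans[OF sum_abs] sum_mono lin_le)
        also have "\<dots> = real (card (gap_block n m r b)) * (2 * a)" by simp
        also have "\<dots> \<le> real m * (2 * a)" using card_gap_block[OF m, of n r b] a0 by (intro mult_right_mono) auto
        finally show ?thesis by (simp add: \<beta>_def mult_ac)
      qed
      have sc: "(\<Sum>b<Suc n. real (card (gap_block n m r b))) \<le> real n"
        using sum_card_gap_block[of n m r "Suc n"] by (metis of_nat_le_iff of_nat_sum)
      have "V \<le> (\<Sum>b<Suc n. real (card (gap_block n m r b)) * (a\<^sup>2 * T * v))"
        unfolding V_def T_def v_def by (intro sum_mono incr_variance[OF \<theta>(1,2) W' st]) auto
      also have "\<dots> = (\<Sum>b<Suc n. real (card (gap_block n m r b))) * (a\<^sup>2 * T * v)" by (rule sum_distrib_right[symmetric])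
      also have "\<dots> \<le> real n * (a\<^sup>2 * T * v)" using T0 v0 by (intro mult_right_mono sc) auto
      also have "\<dots> = 36 * E * (T * v)" using a2 by (simp add: mult_ac)
      finally have V: "V \<le> 36 * E * (T * v)" .
      have V0: "0 \<le> V" unfolding V_def by (intro sum_nonneg) simp
      have "coupling {s,t} (incr a s t) (gap_block n m r) (Suc n) \<le>
        4 * C * (\<Sum>x\<in>{s,t}. \<bar>incr a s t x\<bar>)\<^sup>2 * W * (\<Sum>d<Suc n. \<Sum>j\<in>gap_block n m r d. real m powr (-p))"
        by (rule coupling_le[OF S _ _ W pq(1,3)]) (use gap_block_disjoint gap_block_dist[OF m] m in auto)
      also have "\<dots> = 16 * C * a\<^sup>2 * W * ((\<Sum>b<Suc n. real (card (gap_block n m r b))) * real m powr (-p))"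
        unfolding sum_abs_incr[OF ne less_imp_le[OF a0]] by (simp add: sum_distrib_right del: sum.lessThan_Suc)
      also have "\<dots> \<le> 16 * C * a\<^sup>2 * W * (real n * real m powr (-p))"
        using C W by (intro mult_left_mono mult_right_mono sc) auto
      also have "\<dots> = 16 * C * W * (a\<^sup>2 * real n) * real m powr (-p)" by (simp only: mult_ac)
      also have "\<dots> = 576 * C * W * (E * real m powr (-p))" unfolding a2 by simp
      also have "\<dots> \<le> 576 * C * W * (E * E * real m powr (-p))"
        using C W \<epsilon>42 by (intro mult_left_mono mult_right_mono) auto
      finally have c: "10 * coupling {s,t} (incr a s t) (gap_block n m r) (Suc n) \<le> (5760 * C * W) * (E * E * real m powr (-p))"
        by (simp add: mult_ac)
      have "\<beta>\<^sup>2 * V \<le> \<beta>\<^sup>2 * (36 * E * (T * v))" using V by (intro mult_left_mono) auto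
      also have "\<dots> = (5184 * v) * (E * E * ((real m)\<^sup>2 / n * T))"
      proof -
        have "a\<^sup>2 = 36 * E / n" using a2 n by (simp add: field_simps)
        then have "\<beta>\<^sup>2 = 144 * E * ((real m)\<^sup>2 / n)" by (simp add: \<beta>_def power_mult_distrib)
        then show ?thesis by simp
      qed
      finally have b: "\<beta>\<^sup>2 * V \<le> (5184 * v) * (E * E * ((real m)\<^sup>2 / n * T))" .
      have "V\<^sup>2 / 4 \<le> (36 * E * (T * v))\<^sup>2 / 4" using V V0 by (intro divide_right_mono power_mono) auto
      also have "\<dots> = (324 * v\<^sup>2) * (E * E * T\<^sup>2)" by (simp add: power2_eq_square)
      finally have V2: "V\<^sup>2 / 4 \<le> (324 * v\<^sup>2) * (E * E * T\<^sup>2)" .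
      have "prob {\<omega>\<in>space M. \<bar>\<Sum>b<Suc n. ?U r b \<omega>\<bar> \<ge> 3} \<le> 10 * coupling {s,t} (incr a s t) (gap_block n m r) (Suc n) + \<beta>\<^sup>2 * V + V\<^sup>2/4"
        by (rule blocks_tail[OF S _ _ \<beta> V_def]) (use gap_block_disjoint in auto)
      also have "\<dots> \<le> K * (E * E * real m powr (-p)) + K * (E * E * ((real m)\<^sup>2 / n * T)) + K * (E * E * T\<^sup>2)"
      proof (intro add_mono)
        have k: "5760 * C * W \<le> K" "5184 * v \<le> K" "324 * v\<^sup>2 \<le> K" unfolding K_def using C W v0 by auto
        show "10 * coupling {s,t} (incr a s t) (gap_block n m r) (Suc n) \<le> K * (E * E * real m powr (-p))"
          by (rule order_trans[OF c]) (intro mult_right_mono k, simp add: E_def)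
        show "\<beta>\<^sup>2 * V \<le> K * (E * E * ((real m)\<^sup>2 / n * T))"
          by (rule order_trans[OF b]) (intro mult_right_mono k, use T0 in \<open>simp add: E_def\<close>)
        show "V\<^sup>2/4 \<le> K * (E * E * T\<^sup>2)"
          by (rule order_trans[OF V2]) (intro mult_right_mono k, simp add: E_def)
      qed
      also have "\<dots> = K * (E * E) * Q" by (simp only: Q_def distrib_left mult.assoc)
      also have "\<dots> = K / \<epsilon>^4 * Q" unfolding E2[symmetric] by simp
      finally show ?thesis .
    qed
    have meas [measurable]: "(\<lambda>\<omega>. \<Sum>b<Suc n. ?U r b \<omega>) \<in> borel_measurable M" for r
      using S by (intro borel_measurable_sum brv_measurable brv_blocksum)
    have "{\<omega>\<in>space M. \<bar>blocksum {s,t} (incr 1 s t) {1..int n} \<omega>\<bar> \<ge> \<epsilon> * sqrt n} \<subseteq>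
      {\<omega>\<in>space M. \<bar>\<Sum>b<Suc n. ?U 0 b \<omega>\<bar> \<ge> 3} \<union> {\<omega>\<in>space M. \<bar>\<Sum>b<Suc n. ?U 1 b \<omega>\<bar> \<ge> 3}"
    proof safe
      fix \<omega> assume \<omega>: "\<omega> \<in> space M" and ge: "\<epsilon> * sqrt n \<le> \<bar>blocksum {s,t} (incr 1 s t) {1..int n} \<omega>\<bar>"
        and n3: "\<not> 3 \<le> \<bar>\<Sum>b<Suc n. ?U 1 b \<omega>\<bar>"
      have "blocksum {s,t} (incr a s t) {1..int n} \<omega> = a * blocksum {s,t} (incr 1 s t) {1..int n} \<omega>"
        using st unfolding blocksum_def by (simp add: lin_incr sum_distrib_left)
      then have "\<bar>blocksum {s,t} (incr a s t) {1..int n} \<omega>\<bar> = a * \<bar>blocksum {s,t} (incr 1 s t) {1..int n} \<omega>\<bar>"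
        using a0 by (simp add: abs_mult)
      also have "\<dots> \<ge> a * (\<epsilon> * sqrt n)" using ge a0 by (intro mult_left_mono) auto
      also have "a * (\<epsilon> * sqrt n) = 6" using n \<epsilon> by (simp add: a_def)
      finally have "6 \<le> \<bar>blocksum {s,t} (incr a s t) {1..int n} \<omega>\<bar>" .
      moreover have "blocksum {s,t} (incr a s t) {1..int n} \<omega> = (\<Sum>b<Suc n. ?U 0 b \<omega>) + (\<Sum>b<Suc n. ?U 1 b \<omega>)"
        unfolding blocksum_def by (rule sum_gap_blocks[OF m])
      ultimately show "3 \<le> \<bar>\<Sum>b<Suc n. ?U 0 b \<omega>\<bar>" using n3 by linarith
    qed
    then have "prob {\<omega>\<in>space M. \<bar>blocksum {s,t} (incr 1 s t) {1..int n} \<omega>\<bar> \<ge> \<epsilon> * sqrt n} \<le>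
      prob ({\<omega>\<in>space M. \<bar>\<Sum>b<Suc n. ?U 0 b \<omega>\<bar> \<ge> 3} \<union> {\<omega>\<in>space M. \<bar>\<Sum>b<Suc n. ?U 1 b \<omega>\<bar> \<ge> 3})"
      by (rule finite_measure_mono) measurable
    also have "\<dots> \<le> prob {\<omega>\<in>space M. \<bar>\<Sum>b<Suc n. ?U 0 b \<omega>\<bar> \<ge> 3} + prob {\<omega>\<in>space M. \<bar>\<Sum>b<Suc n. ?U 1 b \<omega>\<bar> \<ge> 3}"
      by (rule measure_Un_le) measurable
    also have "\<dots> \<le> 2 * (K / \<epsilon>^4 * Q)" using main[of 0] main[of 1] by linarith
    finally show "prob {\<omega>\<in>space M. \<bar>blocksum {s,t} (incr 1 s t) {1..int n} \<omega>\<bar> \<ge> \<epsilon> * sqrt n}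
      \<le> 2 * K / \<epsilon>^4 * (real m powr (-p) + (real m)\<^sup>2 / real n * (t - s) powr \<theta> + (t - s) powr (2 * \<theta>))"
      unfolding Q_def TT T_def by (simp add: mult.assoc)
  qed (use K0 in simp)
qed

end

section \<open>Admissible exponents and auxiliary estimates for chaining\<close>

text \<open>All conditions are strict inequalities that hold in the limit p = \<alpha> - 1, \<theta>
  = 1 - 1/\<alpha>, \<kappa> = 0. A small e moves p and \<theta> off these endpoints, and \<kappa>
  pays for thresholds that shrink from level to level.\<close>

lemma exponent_choice:
  fixes \<alpha> :: real assumes "\<alpha> > (5 + sqrt 17) / 4"
  obtains p q \<theta> b \<kappa> :: real where "p > 1" "q > 1" "\<alpha> = p + q" "1/2 < \<theta>" "\<theta> < 1" "\<alpha> * (1 - \<theta>) > 1" "b > 0"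
    "\<kappa> > 0" "(1 + 4 * \<kappa>) / 2 < b * p" "(1 + 4 * \<kappa> - \<theta>) / 2 + 2 * b - 1 < 0" "1 + 4 * \<kappa> - 2 * \<theta> < 0"
proof -
  \<comment> \<open>This rational bound gives \<alpha> > 57/25, enough for p > 1 and \<theta> > 1/2
    whenever e \<le> 1/20.\<close>
  have s: "sqrt 17 > 103/25" by (rule real_less_rsqrt) (simp add: power2_eq_square)
  have a: "\<alpha> > 57/25" using assms s by simp
  have "(sqrt 17)\<^sup>2 < (4 * \<alpha> - 5)\<^sup>2" using assms by (intro power_strict_mono) auto
  then have quad: "2 * \<alpha>\<^sup>2 - 5 * \<alpha> + 1 > 0" by (simp add: power2_eq_square algebra_simps)
  define ii where "ii = 1 / \<alpha>"
  have ai: "\<alpha> * ii = 1" using a by (simp add: ii_def)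
  have ii: "0 < ii" "ii < 1 / (57/25)" using a unfolding ii_def by (simp, intro divide_strict_left_mono) auto
  \<comment> \<open>The value of p (1 + \<theta>) at the endpoints; multiplied by \<alpha>, the
    inequality L > 2 is the quadratic condition.\<close>
  define L where "L = (\<alpha> - 1) * (2 - ii)"
  have L: "L > 2"
  proof -
    have "\<alpha> * L = (\<alpha> - 1) * (2 * \<alpha> - \<alpha> * ii)" by (simp add: L_def algebra_simps)
    also have "\<dots> > \<alpha> * 2" unfolding ai using quad by (simp add: power2_eq_square algebra_simps)
    finally show ?thesis using a by simp
  qed
  define d where "d = \<alpha> + 1"
  have d: "d > 0" using a by (simp add: d_def)
  \<comment> \<open>Lowering p and \<theta> by e lowers p (1 + \<theta>) to first order by e
    (\<alpha> + 1), which may use up half of the margin L - 2.\<close>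
  define e where "e = min (1/20) ((L - 2) / (2 * d))"
  have e0: "0 < e" using L d by (simp add: e_def)
  have e1: "e \<le> 1/20" unfolding e_def by (rule min.cobounded1)
  have "e * d \<le> (L - 2) / (2 * d) * d" using d unfolding e_def by (intro mult_right_mono min.cobounded2) auto
  also have "\<dots> = (L - 2) / 2" using d by simp
  finally have eL: "e * d \<le> (L - 2) / 2" .
  define p where "p = \<alpha> - 1 - e"
  define \<theta> where "\<theta> = 1 - ii - e"
  have p: "p > 1" using a e1 unfolding p_def by linarith
  have \<theta>: "1/2 < \<theta>" "\<theta> < 1" using ii e0 e1 unfolding \<theta>_def by simp_all
  have pt: "p * (1 + \<theta>) > 2"
  proof -
    have "p * (1 + \<theta>) = L - e * d + (e * ii + e * e)"
      by (simp add: p_def \<theta>_def L_def d_def algebra_simps)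
    moreover have "0 \<le> e * ii + e * e" using e0 ii by simp
    moreover have "2 < x" if "x = L - y + z" "0 \<le> z" "y \<le> (L - 2) / 2" for x y z using that L by argo
    ultimately show ?thesis using eL by blast
  qed
  define b where "b = (1 / (2 * p) + (1 + \<theta>) / 4) / 2"
  have lt: "1 / (2 * p) < (1 + \<theta>) / 4" using pt p by (simp add: field_simps)
  have b: "1 / (2 * p) < b" "b < (1 + \<theta>) / 4" 
  proof -
    have "x < (x + y) / 2" "(x + y) / 2 < y" if "x < y" for x y :: real using that by simp_all
    from this[OF lt] show "1 / (2 * p) < b" "b < (1 + \<theta>) / 4" unfolding b_def .
  qed
  have bp: "b * p > 1/2" using b(1) p by (simp add: field_simps)
  have "0 < 1 / (2 * p)" using p by simp
  then have b0: "b > 0" using b(1) by linarith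
  \<comment> \<open>At most half of the margin in each of the three final inequalities is given to
    \<kappa>.\<close>
  define \<kappa> where "\<kappa> = min ((b * p - 1/2) / 4) (min (((1 + \<theta>) / 4 - b) / 4) ((2 * \<theta> - 1) / 8))"
  have k0: "\<kappa> > 0" using bp b \<theta> unfolding \<kappa>_def by auto
  have k: "\<kappa> \<le> (b * p - 1/2) / 4" "\<kappa> \<le> ((1 + \<theta>) / 4 - b) / 4" "\<kappa> \<le> (2 * \<theta> - 1) / 8"
    unfolding \<kappa>_def by (rule min.cobounded1, rule min.coboundedI2, rule min.cobounded1, rule min.coboundedI2, rule min.cobounded2)
  show thesis
  proof (rule that[of p "1 + e" \<theta> b \<kappa>])
    have "\<alpha> * (1 - \<theta>) = \<alpha> * ii + \<alpha> * e" by (simp add: \<theta>_def algebra_simps)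
    then show "\<alpha> * (1 - \<theta>) > 1" using a e0 unfolding ai by simp
    show "(1 + 4 * \<kappa>) / 2 < b * p" using k(1) bp by argo
    show "(1 + 4 * \<kappa> - \<theta>) / 2 + 2 * b - 1 < 0" using k(2) b by argo
    show "1 + 4 * \<kappa> - 2 * \<theta> < 0" using k(3) \<theta> by argo
  qed (use p \<theta> e0 b0 k0 in \<open>auto simp: p_def\<close>)
qed

text \<open>Both the count and the drift are monotone. The increment over the cell bounds the growth
  of the count up to the drift, so values inside the cell are controlled by the endpoints; no union
  bound over finer levels is needed once the drift is small.\<close>

lemma count_path_cell:
  assumes "a \<ge> 0" "b \<ge> 0" "d \<le> x" "x \<le> d'"
  shows "\<bar>count_path a b I v x - count_path a b I v d\<bar> \<le> \<bar>count_path a b I v d' - count_path a b I v d\<bar> + b * (d' - d)"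
proof -
  define N where "N x = a * (\<Sum>i\<in>I. ind (v i \<le> x))" for x
  have N: "N y \<le> N z" if "y \<le> z" for y z
    unfolding N_def using that assms(1) by (intro mult_left_mono sum_mono) (auto simp: ind_def)
  have c: "count_path a b I v y = N y - b * y" for y by (simp add: count_path_def N_def)
  have "N d \<le> N x" "N x \<le> N d'" using assms by (auto intro: N)
  moreover have "b * d \<le> b * x" "b * x \<le> b * d'" using assms by (auto intro: mult_left_mono)
  ultimately show ?thesis unfolding c right_diff_distrib by linarith
qed

lemma sum_geometric_le:
  fixes A :: real assumes "A > 1" shows "(\<Sum>l\<in>{m<..M}. A ^ l) \<le> A / (A - 1) * A ^ M"
proof -
  have "(\<Sum>l\<in>{m<..M}. A ^ l) \<le> (\<Sum>l\<in>{..M}. A ^ l)" using assms by (intro sum_mono2) auto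
  also have "\<dots> = (A ^ Suc M - 1) / (A - 1)" using assms by (subst lessThan_Suc_atMost[symmetric], subst geometric_sum) auto
  also have "\<dots> \<le> A ^ Suc M / (A - 1)" using assms by (intro divide_right_mono) auto
  finally show ?thesis by simp
qed

lemma sum_geometric_tail_le:
  fixes r :: real assumes r: "0 \<le> r" "r < 1" shows "(\<Sum>l\<in>{m<..M}. r ^ l) \<le> r ^ m / (1 - r)"
proof -
  have s: "summable (\<lambda>l. r ^ (l + m))" using r by (intro summable_ignore_initial_segment summable_geometric) auto
  have "(\<Sum>l\<in>{m<..M}. r ^ l) \<le> (\<Sum>l\<in>(\<lambda>l. l + m) ` {..M}. r ^ l)"
  proof (rule sum_mono2)
    show "{m<..M} \<subseteq> (\<lambda>l. l + m) ` {..M}"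
    proof
      fix l assume "l \<in> {m<..M}"
      then show "l \<in> (\<lambda>l. l + m) ` {..M}" by (intro image_eqI[of _ _ "l - m"]) auto
    qed
  qed (use r in auto)
  also have "\<dots> = (\<Sum>l\<in>{..M}. r ^ (l + m))" by (subst sum.reindex) auto
  also have "\<dots> \<le> (\<Sum>l. r ^ (l + m))" using s r by (intro sum_le_suminf) auto
  also have "\<dots> = r ^ m / (1 - r)" using r by (simp add: power_add suminf_mult2[symmetric] summable_geometric suminf_geometric)
  finally show ?thesis .
qed

context uniform_process
begin

section \<open>Paths and asymptotic equicontinuity of the empirical process\<close>

abbreviation Z :: "nat \<Rightarrow> 'a \<Rightarrow> real \<Rightarrow> real" where "Z n \<equiv> emp_proc M X n"

lemma prob_X_le: "x \<in> {0..1} \<Longrightarrow> prob {\<omega>\<in>space M. X i \<omega> \<le> x} = x"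
proof -
  assume x: "x \<in> {0..1}"
  have "prob {\<omega>\<in>space M. X i \<omega> \<le> x} = (\<integral>\<omega>. indicator {\<omega>\<in>space M. X i \<omega> \<le> x} \<omega> \<partial>M)" by simp
  also have "\<dots> = (\<integral>\<omega>. ind (X i \<omega> \<le> x) \<partial>M)"
    by (intro Bochner_Integration.integral_cong) (auto simp: ind_def indicator_def)
  finally show ?thesis using expectation_ind[OF x] by simp
qed

lemma emp_count_path:
  assumes x: "x \<in> {0..1}"
  shows "Z n \<omega> x = count_path (1 / sqrt n) (sqrt n) {1..n} (\<lambda>i. X (int i) \<omega>) x"
proof -
  have "Z n \<omega> x = (1 / sqrt n) * ((\<Sum>i\<in>{1..n}. ind (X (int i) \<omega> \<le> x)) - real n * x)"
    unfolding emp_proc_def by (simp add: prob_X_le[OF x] sum_subtractf)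
  also have "\<dots> = (1 / sqrt n) * (\<Sum>i\<in>{1..n}. ind (X (int i) \<omega> \<le> x)) - (real n / sqrt n) * x"
    by (simp add: right_diff_distrib)
  also have "real n / sqrt n = sqrt n" by (rule real_div_sqrt) simp
  also have "(1 / sqrt n) * (\<Sum>i\<in>{1..n}. ind (X (int i) \<omega> \<le> x)) - sqrt n * x = count_path (1 / sqrt n) (sqrt n) {1..n} (\<lambda>i. X (int i) \<omega>) x"
    by (simp add: count_path_def)
  finally show ?thesis .
qed

lemma emp_linear:
  assumes "S \<subseteq> {0..1}"
  shows "(\<Sum>x\<in>S. c x * Z n \<omega> x) = blocksum S c {1..int n} \<omega> / sqrt n"
proof -
  have "(\<Sum>x\<in>S. c x * Z n \<omega> x) = (\<Sum>x\<in>S. \<Sum>i=1..n. c x * (ind (X (int i) \<omega> \<le> x) - x)) / sqrt n"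
    unfolding sum_divide_distrib emp_proc_def using assms
    by (intro sum.cong refl) (auto simp: prob_X_le subset_iff sum_distrib_left)
  also have "(\<Sum>x\<in>S. \<Sum>i=1..n. c x * (ind (X (int i) \<omega> \<le> x) - x)) = (\<Sum>i=1..n. lin S c (X (int i) \<omega>))"
    unfolding lin_def by (rule sum.swap)
  also have "\<dots> = (\<Sum>i\<in>int ` {1..n}. lin S c (X i \<omega>))" by (subst sum.reindex) auto
  also have "int ` {1..n} = {1..int n}"
    using image_int_atLeastAtMost[of 1 n] by simp
  finally show ?thesis unfolding blocksum_def .
qed

lemma emp_diff:
  assumes "s \<in> {0..1}" "t \<in> {0..1}" "s \<noteq> t"
  shows "Z n \<omega> t - Z n \<omega> s = blocksum {s,t} (incr 1 s t) {1..int n} \<omega> / sqrt n"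
  using emp_linear[of "{s,t}" "incr 1 s t" n \<omega>] assms by (simp add: incr_def)

lemma emp_measurable: "x \<in> {0..1} \<Longrightarrow> (\<lambda>\<omega>. Z n \<omega> x) \<in> borel_measurable M"
  unfolding emp_proc_def by measurable

lemma cadlag_emp: "cadlag01 (Z n \<omega>)"
  by (rule cadlag_cong[OF cadlag_count_path[of "{1..n}" "1 / sqrt n" "sqrt n" "\<lambda>i. X (int i) \<omega>"]]) (simp_all add: emp_count_path)

lemma emp_functional_measurable:
  assumes h: "skorokhod_continuous h" shows "(\<lambda>\<omega>. h (Z n \<omega>)) \<in> borel_measurable M"
proof -
  have "h (Z n \<omega>) = h (count_path (1 / sqrt n) (sqrt n) {1..n} (\<lambda>i. X (int i) \<omega>))" for \<omega>
    by (rule skorokhod_continuous_cong[OF h cadlag_emp cadlag_count_path]) (simp_all add: emp_count_path)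
  then show ?thesis using count_path_measurable[OF h, of "{1..n}" "\<lambda>i. X (int i)" M "1 / sqrt n" "sqrt n"] by simp
qed

text \<open>The process is chained from level m to a level \<open>lev n\<close> at which the drift
  over a cell is at most e/4; below that level monotonicity of the count takes over. Failure at
  level l means that one of the 2^l increments exceeds \<open>el l\<close>, and
  \<open>increment_tail\<close> with block length of order n powr b bounds each of these
  events.\<close>

lemma emp_equicontinuous:
  assumes \<alpha>: "\<alpha> > (5 + sqrt 17) / 4" and \<epsilon>: "\<epsilon> > 0"
  shows "\<exists>m0. \<forall>m\<ge>m0. \<exists>n0. \<forall>n\<ge>n0. \<exists>A\<in>sets M. measure M A \<le> \<epsilon> \<and>
        (\<forall>\<omega>\<in>space M - A. \<forall>x\<in>{0..1}. \<bar>Z n \<omega> x - step m (Z n \<omega>) x\<bar> \<le> \<epsilon>)"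
proof -
  obtain p q \<theta> b \<kappa> where pq: "p > 1" "q > 1" "\<alpha> = p + q" and \<theta>: "1/2 < \<theta>" "\<theta> < 1" "\<alpha> * (1 - \<theta>) > 1" and b: "b > 0"
    and \<kappa>: "\<kappa> > 0" "(1 + 4 * \<kappa>) / 2 < b * p" "(1 + 4 * \<kappa> - \<theta>) / 2 + 2 * b - 1 < 0" "1 + 4 * \<kappa> - 2 * \<theta> < 0"
    using exponent_choice[OF \<alpha>] by metis
  have \<theta>0: "0 < \<theta>" and p0: "p \<ge> 0" using \<theta> pq by auto
  obtain K where K: "K \<ge> 0" "\<And>n m s t \<epsilon>. n \<ge> 1 \<Longrightarrow> m \<ge> 1 \<Longrightarrow> 0 \<le> s \<Longrightarrow> s < t \<Longrightarrow> t \<le> 1 \<Longrightarrow> 0 < \<epsilon> \<Longrightarrow> \<epsilon> \<le> 1 \<Longrightarrow>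
      prob {\<omega>\<in>space M. \<bar>blocksum {s,t} (incr 1 s t) {1..int n} \<omega>\<bar> \<ge> \<epsilon> * sqrt n}
      \<le> K / \<epsilon>^4 * (real m powr (-p) + (real m)\<^sup>2 / real n * (t - s) powr \<theta> + (t - s) powr (2 * \<theta>))"
    using increment_tail[OF \<theta>0 \<theta>(2,3) p0 pq(2,3)] by blast
  define r where "r = 2 powr (- \<kappa>)"
  have r: "0 < r" "r < 1" using \<kappa>(1) powr_less_mono[of "-\<kappa>" 0 2] by (auto simp: r_def)
  define e where "e = min 1 \<epsilon>"
  have e: "0 < e" "e \<le> 1" "e \<le> \<epsilon>" using \<epsilon> by (auto simp: e_def)
  \<comment> \<open>The thresholds c r^l then sum to at most e/4, by the geometric series.\<close>
  define c where "c = e * (1 - r) / 4"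
  have c0: "0 < c" using e r by (simp add: c_def)
  have ce: "c \<le> e / 4" using e r mult_left_mono[of "1 - r" 1 e] by (simp add: c_def)
  have c: "0 < c" "c \<le> e / 4" "c \<le> 1" using c0 ce e by auto
  define el where "el l = c * r ^ l" for l :: nat
  have el: "0 < el l" "el l \<le> c" "el l \<le> 1" for l
  proof -
    show "0 < el l" using c r by (simp add: el_def)
    show "el l \<le> c" using c r by (simp add: el_def mult_left_le power_le_one)
    then show "el l \<le> 1" using c by linarith
  qed
  \<comment> \<open>The growth per level of the three error terms k = 0, 1, 2: a factor 2 for the
    number of increments, 2^(4 \<kappa>) for the fourth power of the thresholds, 2^(-k \<theta>) for
    the power of the interval length. The first two grow, so the last level decides; the third
    decays.\<close>
  define A where "A k = 2 powr (1 + 4 * \<kappa> - k * \<theta>)" for k :: real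
  have A0: "A 0 > 1" using \<kappa> powr_less_mono[of 0 "1 + 4 * \<kappa>" 2] by (simp add: A_def)
  have A1: "A 1 > 1" using \<kappa> \<theta> powr_less_mono[of 0 "1 + 4 * \<kappa> - \<theta>" 2] by (simp add: A_def)
  have A2: "A 2 < 1" "0 \<le> A 2" using \<kappa> powr_less_mono[of "1 + 4 * \<kappa> - 2 * \<theta>" 0 2] by (simp_all add: A_def)
  have Apow: "2 ^ l / el l ^ 4 * (1 / 2 ^ l) powr (k * \<theta>) = 1 / c^4 * A k ^ l" for l k
  proof -
    have "2 ^ l / el l ^ 4 * (1 / 2 ^ l) powr (k * \<theta>) = 1 / c^4 * (2 ^ l * (1 / (r^l)^4) * (1 / 2 ^ l) powr (k * \<theta>))"
      by (simp add: el_def power_mult_distrib)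
    also have "2 ^ l * (1 / (r^l)^4) * (1 / 2 ^ l) powr (k * \<theta>) = A k ^ l"
    proof -
      have "2 ^ l = 2 powr real l" by (simp add: powr_realpow)
      moreover have "1 / (r^l)^4 = 2 powr (4 * \<kappa> * real l)"
      proof -
        have "(r^l)^4 = r powr (real l * 4)" using r by (simp add: powr_realpow[symmetric] powr_powr flip: power_mult)
        then have "1 / (r^l)^4 = r powr (- (real l * 4))" by (simp add: powr_minus_divide)
        also have "\<dots> = 2 powr (4 * \<kappa> * real l)" unfolding r_def powr_powr by (simp add: mult_ac)
        finally show ?thesis .
      qed
      moreover have "(1 / 2 ^ l) powr (k * \<theta>) = 2 powr (- (k * \<theta> * real l))"
        by (simp add: powr_divide powr_minus_divide powr_powr mult_ac flip: powr_realpow)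
      moreover have "A k ^ l = 2 powr ((1 + 4 * \<kappa> - k * \<theta>) * real l)"
        by (simp add: A_def powr_powr flip: powr_realpow)
      ultimately show ?thesis by (simp add: algebra_simps flip: powr_add)
    qed
    finally show ?thesis .
  qed
  define bad where "bad n l = {\<omega>\<in>space M. \<exists>j\<in>{1..2^l}. el l \<le> \<bar>Z n \<omega> (real j / 2^l) - Z n \<omega> ((real j - 1) / 2^l)\<bar>}" for n l
  have grid: "real j / 2^l \<in> {0..1}" "(real j - 1) / 2^l \<in> {0..1}" "(real j - 1) / 2^l < real j / 2^l" "real j / 2^l - (real j - 1) / 2^l = 1 / 2^l"
    if "j \<in> {1..2^l}" for j l :: nat
  proof -
    have "real j \<le> 2^l" "1 \<le> real j" using that by auto
    moreover from this have "real j - 1 \<le> 2^l" by linarith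
    ultimately show "real j / 2^l \<in> {0..1}" "(real j - 1) / 2^l \<in> {0..1}" "(real j - 1) / 2^l < real j / 2^l" "real j / 2^l - (real j - 1) / 2^l = 1 / 2^l"
      by (auto simp: divide_le_eq divide_strict_right_mono simp flip: diff_divide_distrib)
  qed
  have bad_meas [measurable]: "bad n l \<in> sets M" for n l
  proof -
    have "bad n l = (\<Union>j\<in>{1..2^l}. {\<omega>\<in>space M. el l \<le> \<bar>Z n \<omega> (real j / 2^l) - Z n \<omega> ((real j - 1) / 2^l)\<bar>})"
      by (auto simp: bad_def)
    also have "\<dots> \<in> sets M"
    proof (rule sets.finite_UN)
      fix j assume j: "j \<in> {1..2^l::nat}"
      note [measurable] = emp_measurable[OF grid(1)[OF j]] emp_measurable[OF grid(2)[OF j]]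
      show "{\<omega>\<in>space M. el l \<le> \<bar>Z n \<omega> (real j / 2^l) - Z n \<omega> ((real j - 1) / 2^l)\<bar>} \<in> sets M" by measurable
    qed simp
    finally show ?thesis .
  qed
  have pbad: "prob (bad n l) \<le> K / c^4 * (real m powr (-p) * A 0 ^ l + (real m)\<^sup>2 / real n * A 1 ^ l + A 2 ^ l)"
    if n: "n \<ge> 1" and m: "m \<ge> 1" for n m l
  proof -
    let ?G = "real m powr (-p) + (real m)\<^sup>2 / real n * (1 / 2^l) powr \<theta> + (1 / 2^l) powr (2 * \<theta>)"
    have "bad n l = (\<Union>j\<in>{1..2^l}. {\<omega>\<in>space M. el l \<le> \<bar>Z n \<omega> (real j / 2^l) - Z n \<omega> ((real j - 1) / 2^l)\<bar>})"
      by (auto simp: bad_def)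
    also have "prob \<dots> \<le> (\<Sum>j\<in>{1..2^l}. prob {\<omega>\<in>space M. el l \<le> \<bar>Z n \<omega> (real j / 2^l) - Z n \<omega> ((real j - 1) / 2^l)\<bar>})"
    proof (rule finite_measure_subadditive_finite)
      show "(\<lambda>j. {\<omega>\<in>space M. el l \<le> \<bar>Z n \<omega> (real j / 2^l) - Z n \<omega> ((real j - 1) / 2^l)\<bar>}) ` {1..2^l} \<subseteq> sets M"
      proof (rule image_subsetI)
        fix j assume j: "j \<in> {1..2^l::nat}"
        note [measurable] = emp_measurable[OF grid(1)[OF j]] emp_measurable[OF grid(2)[OF j]]
        show "{\<omega>\<in>space M. el l \<le> \<bar>Z n \<omega> (real j / 2^l) - Z n \<omega> ((real j - 1) / 2^l)\<bar>} \<in> sets M" by measurable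
      qed
    qed simp
    also have "\<dots> \<le> (\<Sum>j\<in>{1..2^l::nat}. K / el l^4 * ?G)"
    proof (rule sum_mono)
      fix j assume j: "j \<in> {1..2^l::nat}"
      note g = grid[OF j]
      have "{\<omega>\<in>space M. el l \<le> \<bar>Z n \<omega> (real j / 2^l) - Z n \<omega> ((real j - 1) / 2^l)\<bar>} =
        {\<omega>\<in>space M. \<bar>blocksum {(real j - 1) / 2^l, real j / 2^l} (incr 1 ((real j - 1) / 2^l) (real j / 2^l)) {1..int n} \<omega>\<bar> \<ge> el l * sqrt n}"
        using n g by (intro Collect_cong conj_cong refl) (simp add: emp_diff pos_le_divide_eq)
      then show "prob {\<omega>\<in>space M. el l \<le> \<bar>Z n \<omega> (real j / 2^l) - Z n \<omega> ((real j - 1) / 2^l)\<bar>} \<le> K / el l^4 * ?G"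
        using K(2)[OF n m _ g(3) _ el(1,3)[of l]] g unfolding g(4) by simp
    qed
    also have "\<dots> = K * (real m powr (-p) * (2^l / el l^4 * (1 / 2^l) powr (0 * \<theta>)) + (real m)\<^sup>2 / real n * (2^l / el l^4 * (1 / 2^l) powr (1 * \<theta>)) + 2^l / el l^4 * (1 / 2^l) powr (2 * \<theta>))"
      by (simp add: distrib_left mult_ac)
    also have "\<dots> = K / c^4 * (real m powr (-p) * A 0 ^ l + (real m)\<^sup>2 / real n * A 1 ^ l + A 2 ^ l)"
      unfolding Apow by (simp add: distrib_left mult_ac add_divide_distrib)
    finally show ?thesis .
  qed
  define mm where "mm n = nat \<lceil>real n powr b\<rceil>" for n :: nat
  have mm: "mm n \<ge> 1" "real n powr b \<le> real (mm n)" "real (mm n) \<le> 2 * real n powr b" if n: "n \<ge> 1" for n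
  proof -
    have n1: "1 \<le> real n powr b" using n b by (simp add: ge_one_powr_ge_zero)
    show "mm n \<ge> 1" "real n powr b \<le> real (mm n)" "real (mm n) \<le> 2 * real n powr b"
      unfolding mm_def using n1 by linarith+
  qed
  \<comment> \<open>The first level at which the drift sqrt n / 2^l over a cell is at most e/4; 2^l
    is then of order sqrt n, and powers of 2^l turn into half powers of n.\<close>
  define lev where "lev n = nat \<lceil>log 2 (4 * sqrt n / e)\<rceil>" for n :: nat
  have lev: "4 * sqrt n / e \<le> 2 ^ lev n" "2 ^ lev n \<le> 8 * sqrt n / e" if n: "n \<ge> 1" for n
  proof -
    define y where "y = 4 * sqrt n / e"
    have y: "y \<ge> 1"
    proof -
      have "1 \<le> sqrt n" using n by simp
      then have "e \<le> 4 * sqrt n" using e by linarith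
      then show ?thesis using e by (simp add: y_def)
    qed
    have L: "log 2 y \<le> real (lev n)" "real (lev n) \<le> log 2 y + 1"
      using y unfolding lev_def y_def[symmetric] by (auto simp: zero_le_log_cancel_iff ceiling_le_iff)
    have "y = 2 powr (log 2 y)" using y by simp
    also have "\<dots> \<le> 2 powr real (lev n)" using L by (intro powr_mono) auto
    finally show "4 * sqrt n / e \<le> 2 ^ lev n" by (simp add: powr_realpow y_def)
    have "2 powr real (lev n) \<le> 2 powr (log 2 y + 1)" using L by (intro powr_mono) auto
    also have "\<dots> = 2 * y" using y by (simp add: powr_add)
    finally show "2 ^ lev n \<le> 8 * sqrt n / e" by (simp add: powr_realpow y_def)
  qed
  have Alev: "A k ^ lev n \<le> (8 / e) powr (1 + 4 * \<kappa> - k * \<theta>) * real n powr ((1 + 4 * \<kappa> - k * \<theta>) / 2)"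
    if n: "n \<ge> 1" and k: "0 \<le> 1 + 4 * \<kappa> - k * \<theta>" for k n
  proof -
    have "A k ^ lev n = (2 ^ lev n) powr (1 + 4 * \<kappa> - k * \<theta>)"
      by (simp add: A_def powr_powr mult.commute flip: powr_realpow)
    also have "\<dots> \<le> (8 * sqrt n / e) powr (1 + 4 * \<kappa> - k * \<theta>)" using lev[OF n] k by (intro powr_mono2) auto
    also have "8 * sqrt n / e = (8 / e) * real n powr (1/2)" by (simp add: powr_half_sqrt)
    also have "\<dots> powr (1 + 4 * \<kappa> - k * \<theta>) = (8 / e) powr (1 + 4 * \<kappa> - k * \<theta>) * real n powr ((1 + 4 * \<kappa> - k * \<theta>) / 2)"
      using e by (subst powr_mult) (auto simp: powr_powr)
    finally show ?thesis .
  qed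
  define B0 where "B0 = A 0 / (A 0 - 1) * (8 / e) powr (1 + 4 * \<kappa> - 0 * \<theta>)"
  define B1 where "B1 = 4 * (A 1 / (A 1 - 1) * (8 / e) powr (1 + 4 * \<kappa> - 1 * \<theta>))"
  define s0 where "s0 = (1 + 4 * \<kappa>) / 2 - b * p"
  define s1 where "s1 = (1 + 4 * \<kappa> - \<theta>) / 2 + 2 * b - 1"
  have s: "s0 < 0" "s1 < 0" using \<kappa> by (auto simp: s0_def s1_def)
  \<comment> \<open>The first two terms tend to 0 in n, as s0 and s1 are negative. The third does
    not depend on n and is made small by m. Hence m is fixed before n.\<close>
  define Q where "Q n m = K / c^4 * (B0 * real n powr s0 + B1 * real n powr s1 + A 2 ^ m / (1 - A 2))" for n m
  have pQ: "(\<Sum>l\<in>{m<..lev n}. prob (bad n l)) \<le> Q n m" if n: "n \<ge> 1" for n m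
  proof -
    have "(\<Sum>l\<in>{m<..lev n}. prob (bad n l)) \<le> (\<Sum>l\<in>{m<..lev n}. K / c^4 * (real (mm n) powr (-p) * A 0 ^ l + (real (mm n))\<^sup>2 / real n * A 1 ^ l + A 2 ^ l))"
      by (intro sum_mono pbad n mm)
    also have "\<dots> = K / c^4 * (real (mm n) powr (-p) * (\<Sum>l\<in>{m<..lev n}. A 0 ^ l) + (real (mm n))\<^sup>2 / real n * (\<Sum>l\<in>{m<..lev n}. A 1 ^ l) + (\<Sum>l\<in>{m<..lev n}. A 2 ^ l))"
      by (simp only: sum_distrib_left sum.distrib[symmetric])
    also have "\<dots> \<le> Q n m"
      unfolding Q_def
    proof (intro mult_left_mono add_mono)
      have "real (mm n) powr (-p) * (\<Sum>l\<in>{m<..lev n}. A 0 ^ l) \<le> (real n powr b) powr (-p) * (A 0 / (A 0 - 1) * A 0 ^ lev n)"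
        using mm[OF n] n p0 A0 by (intro mult_mono powr_mono2' sum_geometric_le sum_nonneg) auto
      also have "\<dots> \<le> (real n powr b) powr (-p) * (A 0 / (A 0 - 1) * ((8 / e) powr (1 + 4 * \<kappa> - 0 * \<theta>) * real n powr ((1 + 4 * \<kappa> - 0 * \<theta>) / 2)))"
        using A0 \<kappa> by (intro mult_left_mono Alev[OF n]) auto
      also have "\<dots> = B0 * real n powr s0"
        by (simp add: B0_def s0_def powr_powr powr_diff powr_minus_divide mult_ac)
      finally show "real (mm n) powr (-p) * (\<Sum>l\<in>{m<..lev n}. A 0 ^ l) \<le> B0 * real n powr s0" .
      have "(real (mm n))\<^sup>2 / real n \<le> (2 * real n powr b)\<^sup>2 / real n"
        using mm[OF n] by (intro divide_right_mono power_mono) auto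
      also have "\<dots> = 4 * real n powr (2 * b - 1)"
        using n by (simp add: power_mult_distrib powr_diff power2_eq_square flip: powr_add)
      finally have "(real (mm n))\<^sup>2 / real n * (\<Sum>l\<in>{m<..lev n}. A 1 ^ l) \<le> 4 * real n powr (2 * b - 1) * (A 1 / (A 1 - 1) * A 1 ^ lev n)"
        using A1 by (intro mult_mono sum_geometric_le sum_nonneg) auto
      also have "\<dots> \<le> 4 * real n powr (2 * b - 1) * (A 1 / (A 1 - 1) * ((8 / e) powr (1 + 4 * \<kappa> - 1 * \<theta>) * real n powr ((1 + 4 * \<kappa> - 1 * \<theta>) / 2)))"
        using A1 \<kappa> \<theta> by (intro mult_left_mono Alev[OF n]) auto
      also have "\<dots> = B1 * (real n powr (2 * b - 1) * real n powr ((1 + 4 * \<kappa> - 1 * \<theta>) / 2))"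
        by (simp add: B1_def)
      also have "real n powr (2 * b - 1) * real n powr ((1 + 4 * \<kappa> - 1 * \<theta>) / 2) = real n powr s1"
        unfolding powr_add[symmetric] by (simp add: s1_def algebra_simps)
      finally show "(real (mm n))\<^sup>2 / real n * (\<Sum>l\<in>{m<..lev n}. A 1 ^ l) \<le> B1 * real n powr s1" .
      show "(\<Sum>l\<in>{m<..lev n}. A 2 ^ l) \<le> A 2 ^ m / (1 - A 2)" by (rule sum_geometric_tail_le[OF A2(2,1)])
    qed (use K c in simp)
    finally show ?thesis .
  qed
  have "(\<lambda>m. K / c^4 * (A 2 ^ m / (1 - A 2))) \<longlonglongrightarrow> K / c^4 * (0 / (1 - A 2))"
    using A2 by (intro tendsto_intros LIMSEQ_realpow_zero) auto
  then have "\<forall>\<^sub>F m in sequentially. K / c^4 * (A 2 ^ m / (1 - A 2)) < \<epsilon> / 2"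
    using \<epsilon> by (intro order_tendstoD) auto
  then obtain m0 where m0: "\<And>m. m \<ge> m0 \<Longrightarrow> K / c^4 * (A 2 ^ m / (1 - A 2)) < \<epsilon> / 2" by (auto simp: eventually_sequentially)
  show ?thesis
  proof (rule exI[of _ m0], intro allI impI)
    fix m assume m: "m0 \<le> m"
    have pw: "(\<lambda>n. real n powr s) \<longlonglongrightarrow> 0" if "s < 0" for s
      using tendsto_neg_powr[OF that filterlim_real_sequentially] .
    have "(\<lambda>n. K / c^4 * (B0 * real n powr s0 + B1 * real n powr s1)) \<longlonglongrightarrow> K / c^4 * (B0 * 0 + B1 * 0)"
      using s by (intro tendsto_intros pw)
    then have "\<forall>\<^sub>F n in sequentially. K / c^4 * (B0 * real n powr s0 + B1 * real n powr s1) < \<epsilon> / 2"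
      using \<epsilon> by (intro order_tendstoD) auto
    moreover have "\<forall>\<^sub>F n in sequentially. (2::real)^m \<le> sqrt n"
    proof -
      have "filterlim (\<lambda>n. sqrt (real n)) at_top sequentially"
        by (rule filterlim_compose[OF sqrt_at_top filterlim_real_sequentially])
      then show ?thesis by (simp add: filterlim_at_top)
    qed
    moreover have "\<forall>\<^sub>F n in sequentially. n \<ge> 1" by (rule eventually_ge_at_top)
    ultimately have "\<forall>\<^sub>F n in sequentially. \<exists>A\<in>sets M. measure M A \<le> \<epsilon> \<and>
        (\<forall>\<omega>\<in>space M - A. \<forall>x\<in>{0..1}. \<bar>Z n \<omega> x - step m (Z n \<omega>) x\<bar> \<le> \<epsilon>)"
    proof eventually_elim
      case (elim n)
      have mlev: "m < lev n"
      proof -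
        have "4 * sqrt n / e \<ge> 4 * sqrt n" using e by (simp add: le_divide_eq mult_left_le)
        then have "(2::real)^m < 2 ^ lev n" using elim(2) lev(1)[OF elim(3)] elim(3) by (smt (verit) real_sqrt_ge_1_iff of_nat_1 of_nat_mono)
        then show ?thesis by simp
      qed
      define Bad where "Bad = (\<Union>l\<in>{m<..lev n}. bad n l)"
      have "measure M Bad \<le> (\<Sum>l\<in>{m<..lev n}. prob (bad n l))"
        unfolding Bad_def by (rule finite_measure_subadditive_finite) auto
      also have "\<dots> \<le> Q n m" by (rule pQ[OF elim(3)])
      also have "\<dots> \<le> \<epsilon>" using elim(1) m0[OF m] unfolding Q_def distrib_left by linarith
      finally have pB: "measure M Bad \<le> \<epsilon>" .
      have "\<bar>Z n \<omega> x - step m (Z n \<omega>) x\<bar> \<le> \<epsilon>" if \<omega>: "\<omega> \<in> space M - Bad" and x: "x \<in> {0..1}" for \<omega> x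
      proof -
        have small: "\<bar>Z n \<omega> (real j / 2^l) - Z n \<omega> ((real j - 1) / 2^l)\<bar> \<le> el l" if "m < l" "l \<le> lev n" "j \<in> {1..2^l}" for l j
        proof -
          have "\<omega> \<notin> bad n l" using \<omega> that unfolding Bad_def by auto
          then have "\<not> el l \<le> \<bar>Z n \<omega> (real j / 2^l) - Z n \<omega> ((real j - 1) / 2^l)\<bar>"
            using \<omega> that(3) unfolding bad_def by blast
          then show ?thesis by simp
        qed
        have "\<bar>step (lev n) (Z n \<omega>) x - step m (Z n \<omega>) x\<bar> \<le> (\<Sum>l\<in>{m<..lev n}. el l)"
          by (rule step_chain[OF x _ small]) (use mlev el in \<open>auto intro: less_imp_le\<close>)
        also have "\<dots> = c * (\<Sum>l\<in>{m<..lev n}. r ^ l)" by (simp add: el_def sum_distrib_left)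
        also have "\<dots> \<le> c * (r ^ m / (1 - r))" using c r by (intro mult_left_mono sum_geometric_tail_le) auto
        also have "\<dots> \<le> c * (1 / (1 - r))" using c r by (intro mult_left_mono divide_right_mono power_le_one) auto
        also have "\<dots> = e / 4"
        proof -
          have "e * u / 4 * (1 / u) = e / 4" if "u \<noteq> 0" for u using that by simp
          from this[of "1 - r"] r show ?thesis unfolding c_def by simp
        qed
        finally have 1: "\<bar>step (lev n) (Z n \<omega>) x - step m (Z n \<omega>) x\<bar> \<le> e / 4" .
        define k where "k = \<lfloor>2 ^ lev n * x\<rfloor>"
        have k: "0 \<le> k" "k \<le> 2 ^ lev n * x" "2 ^ lev n * x < k + 1" using x unfolding k_def by (auto simp: floor_less_iff)
        have 2: "\<bar>Z n \<omega> x - step (lev n) (Z n \<omega>) x\<bar> \<le> e / 2"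
        proof (cases "x = 1")
          \<comment> \<open>The point 1 has no cell to its right, but it is a grid point of every
            level, so the step takes the exact value there.\<close>
          case True
          then have "k / 2 ^ lev n = x" by (simp add: k_def)
          then show ?thesis using e unfolding step_eq[OF x] k_def[symmetric] by simp
        next
          case False
          have "2 ^ lev n * x < 2 ^ lev n" using False x by simp
          then have "real_of_int k < 2 ^ lev n" using k by linarith
          then have k2: "k < 2 ^ lev n" by simp
          define j where "j = nat (k + 1)"
          have "int j \<le> int (2 ^ lev n)" using k k2 by (simp add: j_def)
          then have j: "j \<in> {1..2 ^ lev n}" using k by (simp add: j_def nat_le_iff)
          have jr: "real j = k + 1" using k by (simp add: j_def)
          note g = grid[OF j]
          let ?f = "count_path (1 / sqrt n) (sqrt n) {1..n} (\<lambda>i. X (int i) \<omega>)"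
          have "(real j - 1) / 2 ^ lev n \<le> x" "x \<le> real j / 2 ^ lev n"
            using k unfolding jr by (auto simp: field_simps)
          then have "\<bar>?f x - ?f ((real j - 1) / 2 ^ lev n)\<bar> \<le>
             \<bar>?f (real j / 2 ^ lev n) - ?f ((real j - 1) / 2 ^ lev n)\<bar> + sqrt n * (real j / 2 ^ lev n - (real j - 1) / 2 ^ lev n)"
            by (intro count_path_cell) auto
          then have "\<bar>Z n \<omega> x - Z n \<omega> ((real j - 1) / 2 ^ lev n)\<bar> \<le>
             \<bar>Z n \<omega> (real j / 2 ^ lev n) - Z n \<omega> ((real j - 1) / 2 ^ lev n)\<bar> + sqrt n * (1 / 2 ^ lev n)"
            unfolding emp_count_path[OF x] emp_count_path[OF g(1)] emp_count_path[OF g(2)] g(4) .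
          also have "\<bar>Z n \<omega> (real j / 2 ^ lev n) - Z n \<omega> ((real j - 1) / 2 ^ lev n)\<bar> \<le> el (lev n)"
            using mlev j by (intro small) auto
          also have "el (lev n) \<le> e / 4" using el(2)[of "lev n"] c by linarith
          also have "sqrt n * (1 / 2 ^ lev n) \<le> e / 4"
            using lev(1)[OF elim(3)] e by (simp add: field_simps)
          finally show ?thesis unfolding step_eq[OF x] k_def[symmetric] using jr by simp
        qed
        show ?thesis using 1 2 e by linarith
      qed
      then show ?case using pB by (intro bexI[of _ Bad]) (auto simp: Bad_def)
    qed
    then show "\<exists>n0. \<forall>n\<ge>n0. \<exists>A\<in>sets M. measure M A \<le> \<epsilon> \<and>
        (\<forall>\<omega>\<in>space M - A. \<forall>x\<in>{0..1}. \<bar>Z n \<omega> x - step m (Z n \<omega>) x\<bar> \<le> \<epsilon>)" by (simp add: eventually_sequentially)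
  qed
qed

end

section \<open>The central limit theorem for linear combinations\<close>

lemma has_sum_finite_sum:
  fixes f :: "'i \<Rightarrow> 'k \<Rightarrow> real"
  assumes "\<And>x. x \<in> S \<Longrightarrow> (f x has_sum a x) A"
  shows "((\<lambda>k. \<Sum>x\<in>S. f x k) has_sum (\<Sum>x\<in>S. a x)) A"
  using assms by (induction S rule: infinite_finite_induct) (auto intro: has_sum_add)

lemma abs_has_sum_le:
  fixes f :: "'k \<Rightarrow> real"
  assumes "(f has_sum s) A" "\<And>F. finite F \<Longrightarrow> F \<subseteq> A \<Longrightarrow> \<bar>sum f F\<bar> \<le> B"
  shows "\<bar>s\<bar> \<le> B"
proof -
  have "s \<le> B" using assms(1) by (rule has_sum_le_finite_sums) (use assms(2) in fastforce)
  moreover have "((\<lambda>x. - f x) has_sum - s) A" using has_sum_cmult_right[OF assms(1), of "-1"] by simp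
  then have "- s \<le> B"
  proof (rule has_sum_le_finite_sums)
    show "(\<Sum>x\<in>F. - f x) \<le> B" if "finite F" "F \<subseteq> A" for F
      using assms(2)[OF that] by (simp add: sum_negf)
  qed
  ultimately show ?thesis by simp
qed

text \<open>For i at distance more than f from both ends, the inner sum runs over a window
  containing \<open>F0\<close> and is within r/2 of \<Gamma>. The at most 2 f remaining rows are
  bounded by E each and disappear after division by n.\<close>

lemma cesaro_int:
  fixes \<gamma> :: "int \<Rightarrow> real"
  assumes hs: "(\<gamma> has_sum \<Gamma>) UNIV" and B: "\<And>F. finite F \<Longrightarrow> \<bar>sum \<gamma> F\<bar> \<le> B"
  shows "(\<lambda>n. (\<Sum>i\<in>{1..int n}. \<Sum>j\<in>{1..int n}. \<gamma> (j - i)) / real n) \<longlonglongrightarrow> \<Gamma>"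
proof (rule LIMSEQ_I)
  fix r :: real assume r: "0 < r"
  have "\<forall>\<^sub>F F in finite_subsets_at_top UNIV. dist (sum \<gamma> F) \<Gamma> < r / 2"
    using hs r unfolding has_sum_def by (intro tendstoD) auto
  then obtain F0 where F0: "finite F0" "\<And>F. finite F \<Longrightarrow> F0 \<subseteq> F \<Longrightarrow> \<bar>sum \<gamma> F - \<Gamma>\<bar> < r / 2"
    unfolding eventually_finite_subsets_at_top by (auto simp: dist_real_def)
  obtain f :: nat where f: "F0 \<subseteq> {- int f..int f}"
  proof -
    define N where "N = Max (insert 0 (abs ` F0))"
    have N: "\<bar>d\<bar> \<le> N" if "d \<in> F0" for d unfolding N_def using F0(1) that by (intro Max_ge) auto
    have "F0 \<subseteq> {- int (nat N)..int (nat N)}"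
    proof
      fix d assume "d \<in> F0"
      from N[OF this] show "d \<in> {- int (nat N)..int (nat N)}" by auto
    qed
    then show thesis by (rule that)
  qed
  have B0: "0 \<le> B" using B[of "{}"] by simp
  define E where "E = B + \<bar>\<Gamma>\<bar>"
  have E0: "0 \<le> E" using B0 by (simp add: E_def)
  have bnd: "\<bar>(\<Sum>i\<in>{1..int n}. \<Sum>j\<in>{1..int n}. \<gamma> (j - i)) - real n * \<Gamma>\<bar> \<le> real n * (r / 2) + 2 * real f * E" for n
  proof -
    define inner where "inner i = (\<Sum>j\<in>{1..int n}. \<gamma> (j - i))" for i
    have inner: "inner i = sum \<gamma> {1 - i..int n - i}" for i
    proof -
      have "inner i = sum \<gamma> ((\<lambda>j. j - i) ` {1..int n})" unfolding inner_def by (subst sum.reindex) (auto simp: inj_on_def)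
      also have "(\<lambda>j. j - i) ` {1..int n} = {1 - i..int n - i}"
        by (auto simp: image_iff intro: bexI[of _ "_ + i"])
      finally show ?thesis .
    qed
    define Bd where "Bd = {1..int f} \<union> {int n - int f + 1..int n}"
    have cB: "card Bd \<le> 2 * f" unfolding Bd_def by (rule order_trans[OF card_Un_le]) simp
    have ptw: "\<bar>inner i - \<Gamma>\<bar> \<le> r / 2 + (if i \<in> Bd then E else 0)" if "i \<in> {1..int n}" for i
    proof (cases "i \<in> Bd")
      case True
      have "\<bar>inner i\<bar> \<le> B" unfolding inner by (rule B) simp
      then show ?thesis using True r by (auto simp: E_def)
    next
      case False
      then have "F0 \<subseteq> {1 - i..int n - i}" using f that by (auto simp: Bd_def)
      from F0(2)[OF _ this] show ?thesis unfolding inner using False by simp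
    qed
    have "(\<Sum>i\<in>{1..int n}. inner i) - real n * \<Gamma> = (\<Sum>i\<in>{1..int n}. inner i - \<Gamma>)" by (simp add: sum_subtractf)
    also have "\<bar>\<dots>\<bar> \<le> (\<Sum>i\<in>{1..int n}. \<bar>inner i - \<Gamma>\<bar>)" by (rule sum_abs)
    also have "\<dots> \<le> (\<Sum>i\<in>{1..int n}. r / 2 + (if i \<in> Bd then E else 0))" by (rule sum_mono[OF ptw])
    also have "\<dots> = real n * (r / 2) + (\<Sum>i\<in>{1..int n} \<inter> Bd. E)"
    proof -
      have "(\<Sum>i\<in>{1..int n} \<inter> Bd. E) = (\<Sum>i\<in>{1..int n}. if i \<in> Bd then E else 0)" by (rule sum.inter_restrict) simp
      then show ?thesis by (simp only: sum.distrib) simp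
    qed
    also have "(\<Sum>i\<in>{1..int n} \<inter> Bd. E) \<le> (\<Sum>i\<in>Bd. E)" using E0 by (intro sum_mono2) (auto simp: Bd_def)
    also have "\<dots> = real (card Bd) * E" by simp
    also have "\<dots> \<le> real (2 * f) * E" using cB E0 by (intro mult_right_mono) (simp_all only: of_nat_le_iff)
    finally show ?thesis unfolding inner_def by simp
  qed
  have "(\<lambda>n. 2 * real f * E / real n) \<longlonglongrightarrow> 0" by (rule lim_const_over_n)
  then have "\<forall>\<^sub>F n in sequentially. 2 * real f * E / real n < r / 2" using r by (intro order_tendstoD) auto
  moreover have "\<forall>\<^sub>F n in sequentially. n \<ge> 1" by (rule eventually_ge_at_top)
  ultimately have "\<forall>\<^sub>F n in sequentially. norm ((\<Sum>i\<in>{1..int n}. \<Sum>j\<in>{1..int n}. \<gamma> (j - i)) / real n - \<Gamma>) < r"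
  proof eventually_elim
    case (elim n)
    have "(\<Sum>i\<in>{1..int n}. \<Sum>j\<in>{1..int n}. \<gamma> (j - i)) / real n - \<Gamma> = ((\<Sum>i\<in>{1..int n}. \<Sum>j\<in>{1..int n}. \<gamma> (j - i)) - real n * \<Gamma>) / real n"
      using elim by (simp add: diff_divide_distrib)
    also have "\<bar>\<dots>\<bar> \<le> (real n * (r / 2) + 2 * real f * E) / real n"
      unfolding abs_divide using bnd[of n] by (simp add: divide_right_mono)
    also have "\<dots> = r / 2 + 2 * real f * E / real n" using elim by (simp add: add_divide_distrib)
    finally show ?case using elim by simp
  qed
  then show "\<exists>no. \<forall>n\<ge>no. norm ((\<Sum>i\<in>{1..int n}. \<Sum>j\<in>{1..int n}. \<gamma> (j - i)) / real n - \<Gamma>) < r"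
    by (simp add: eventually_sequentially)
qed

context uniform_process
begin

section \<open>The limiting covariance\<close>

definition Kcov :: "real \<Rightarrow> real \<Rightarrow> real" where
  "Kcov x y = (\<Sum>\<^sub>\<infinity>k::int. cov M (\<lambda>\<omega>. ind (X 0 \<omega> \<le> x)) (\<lambda>\<omega>. ind (X k \<omega> \<le> y)))"

lemma cov_ind_le_1: "cov M (\<lambda>\<omega>. ind (X i \<omega> \<le> x)) (\<lambda>\<omega>. ind (X j \<omega> \<le> y)) \<le> 1"
proof -
  have "(\<integral>\<omega>. ind (X i \<omega> \<le> x) * ind (X j \<omega> \<le> y) \<partial>M) \<le> (\<integral>\<omega>. 1 \<partial>M)"
    by (intro integral_mono brv_integrable brv_mult brv_indX brv_const mult_le_one) auto
  moreover have "0 \<le> (\<integral>\<omega>. ind (X i \<omega> \<le> x) \<partial>M) * (\<integral>\<omega>. ind (X j \<omega> \<le> y) \<partial>M)"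
    by (intro mult_nonneg_nonneg integral_nonneg_AE) auto
  moreover have "(\<integral>\<omega>. 1 \<partial>M) = (1::real)" by (simp add: prob_space)
  ultimately show ?thesis unfolding cov_def by linarith
qed

lemma cov_ind_sum_bound:
  assumes \<alpha>: "\<alpha> > 1"
  obtains B where "\<And>F x y. finite F \<Longrightarrow> x \<in> {0..1} \<Longrightarrow> y \<in> {0..1} \<Longrightarrow>
    (\<Sum>k\<in>F. cov M (\<lambda>\<omega>. ind (X 0 \<omega> \<le> x)) (\<lambda>\<omega>. ind (X k \<omega> \<le> y))) \<le> B"
proof -
  obtain W where W: "W \<ge> 0" "\<And>i J. finite J \<Longrightarrow> (\<Sum>j\<in>J. real_of_int \<bar>i - j\<bar> powr (-\<alpha>)) \<le> W"
    using powr_sum_bound[OF \<alpha>] by blast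
  show thesis
  proof (rule that[of "1 + 4 * C * W"])
    fix F :: "int set" and x y :: real assume F: "finite F" and xy: "x \<in> {0..1}" "y \<in> {0..1}"
    let ?c = "\<lambda>k. cov M (\<lambda>\<omega>. ind (X 0 \<omega> \<le> x)) (\<lambda>\<omega>. ind (X k \<omega> \<le> y))"
    have "(\<Sum>k\<in>F. ?c k) \<le> (\<Sum>k\<in>insert 0 F. ?c k)" using F by (intro sum_mono2 cov_ind_nonneg) auto
    also have "\<dots> = ?c 0 + (\<Sum>k\<in>F-{0}. ?c k)" using F by (rule sum.insert_remove)
    also have "\<dots> \<le> 1 + (\<Sum>k\<in>F-{0}. 4 * C * real_of_int \<bar>0 - k\<bar> powr (-\<alpha>))"
      using xy by (intro add_mono cov_ind_le_1 sum_mono cov_ind_le) auto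
    also have "(\<Sum>k\<in>F-{0}. 4 * C * real_of_int \<bar>0 - k\<bar> powr (-\<alpha>)) = 4 * C * (\<Sum>k\<in>F-{0}. real_of_int \<bar>0 - k\<bar> powr (-\<alpha>))"
      by (simp add: sum_distrib_left)
    also have "\<dots> \<le> 4 * C * W" using F C by (intro mult_left_mono W(2)) auto
    finally show "(\<Sum>k\<in>F. ?c k) \<le> 1 + 4 * C * W" by simp
  qed
qed

lemma summable_cov_ind:
  assumes "\<alpha> > 1" "x \<in> {0..1}" "y \<in> {0..1}"
  shows "(\<lambda>k. cov M (\<lambda>\<omega>. ind (X 0 \<omega> \<le> x)) (\<lambda>\<omega>. ind (X k \<omega> \<le> y))) summable_on UNIV"
proof -
  obtain B where B: "\<And>F x y. finite F \<Longrightarrow> x \<in> {0..1} \<Longrightarrow> y \<in> {0..1} \<Longrightarrow>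
    (\<Sum>k\<in>F. cov M (\<lambda>\<omega>. ind (X 0 \<omega> \<le> x)) (\<lambda>\<omega>. ind (X k \<omega> \<le> y))) \<le> B"
    using cov_ind_sum_bound[OF assms(1)] by metis
  show ?thesis
    by (rule nonneg_bdd_above_summable_on) (use B assms in \<open>auto intro!: cov_ind_nonneg bdd_aboveI[of _ B]\<close>)
qed

lemma has_sum_Kcov:
  assumes "\<alpha> > 1" "x \<in> {0..1}" "y \<in> {0..1}"
  shows "((\<lambda>k. cov M (\<lambda>\<omega>. ind (X 0 \<omega> \<le> x)) (\<lambda>\<omega>. ind (X k \<omega> \<le> y))) has_sum Kcov x y) UNIV"
  unfolding Kcov_def using summable_cov_ind[OF assms] by simp

text \<open>Stationarity shifts the pair (0, -k) to (k, 0), so exchanging x and y amounts to the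
  reflection k to -k of the index.\<close>

lemma Kcov_sym:
  assumes "\<alpha> > 1" "x \<in> {0..1}" "y \<in> {0..1}" shows "Kcov x y = Kcov y x"
proof -
  have "cov M (\<lambda>\<omega>. ind (X 0 \<omega> \<le> x)) (\<lambda>\<omega>. ind (X (- k) \<omega> \<le> y)) = cov M (\<lambda>\<omega>. ind (X 0 \<omega> \<le> y)) (\<lambda>\<omega>. ind (X k \<omega> \<le> x))" for k
    using cov_shift[of "\<lambda>u. ind (u \<le> y)" "\<lambda>u. ind (u \<le> x)" "-k" k 0] by (simp add: cov_commute)
  then have "Kcov y x = (\<Sum>\<^sub>\<infinity>k::int. cov M (\<lambda>\<omega>. ind (X 0 \<omega> \<le> x)) (\<lambda>\<omega>. ind (X (- k) \<omega> \<le> y)))"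
    unfolding Kcov_def by simp
  also have "\<dots> = Kcov x y" unfolding Kcov_def
    by (rule infsum_reindex_bij_betw[where g=uminus]) (rule bij_uminus)
  finally show ?thesis ..
qed

text \<open>The same interpolation as for \<open>incr_variance\<close>, term by term: a summand
  changes by at most 2 (x - x') and by at most the decay bound, and the geometric mean is summable
  because \<alpha> (1 - \<theta>) > 1. The summand k = 0 has only the first bound.\<close>

lemma Kcov_holder:
  assumes \<theta>: "0 < \<theta>" "\<theta> < 1" "\<alpha> * (1 - \<theta>) > 1" and \<alpha>: "\<alpha> > 1"
  obtains H where "H \<ge> 0" "\<And>x x' y. x \<in> {0..1} \<Longrightarrow> x' \<in> {0..1} \<Longrightarrow> y \<in> {0..1} \<Longrightarrow> \<bar>Kcov x y - Kcov x' y\<bar> \<le> H * \<bar>x - x'\<bar> powr \<theta>"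
proof -
  obtain W where W: "W \<ge> 0" "\<And>i J. finite J \<Longrightarrow> (\<Sum>j\<in>J. real_of_int \<bar>i - j\<bar> powr (- (\<alpha> * (1 - \<theta>)))) \<le> W"
    using powr_sum_bound[OF \<theta>(3)] by blast
  define H where "H = 2 + 2 * ((4 * C) powr (1 - \<theta>) * W)"
  have H0: "H \<ge> 0" using W by (simp add: H_def)
  have main: "\<bar>Kcov x y - Kcov x' y\<bar> \<le> H * (x - x') powr \<theta>" if x: "x \<in> {0..1}" "x' \<in> {0..1}" "y \<in> {0..1}" "x' < x" for x x' y
  proof -
    let ?c = "\<lambda>x k. cov M (\<lambda>\<omega>. ind (X 0 \<omega> \<le> x)) (\<lambda>\<omega>. ind (X k \<omega> \<le> y))"
    define d where "d k = ?c x k - ?c x' k" for k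
    define T where "T = (x - x') powr \<theta>"
    have T: "x - x' \<le> T" unfolding T_def using powr_mono'[of \<theta> 1 "x - x'"] x \<theta> by simp
    have hs: "(d has_sum (Kcov x y - Kcov x' y)) UNIV"
      using has_sum_add[OF has_sum_Kcov[OF \<alpha> x(1,3)] has_sum_cmult_right[OF has_sum_Kcov[OF \<alpha> x(2,3)], of "-1"]]
      unfolding d_def by simp
    have d1: "\<bar>d k\<bar> \<le> 2 * (x - x')" for k
    proof -
      have "d k = cov M (\<lambda>\<omega>. ind (X 0 \<omega> \<le> x) - ind (X 0 \<omega> \<le> x')) (\<lambda>\<omega>. ind (X k \<omega> \<le> y))"
        unfolding d_def by (rule cov_diff_left[symmetric]) simp_all
      also have "\<bar>\<dots>\<bar> \<le> 2 * 1 * (\<integral>\<omega>. \<bar>ind (X 0 \<omega> \<le> x) - ind (X 0 \<omega> \<le> x')\<bar> \<partial>M)"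
        by (rule abs_cov_le) (auto intro!: brv_intros)
      also have "(\<integral>\<omega>. \<bar>ind (X 0 \<omega> \<le> x) - ind (X 0 \<omega> \<le> x')\<bar> \<partial>M) = (\<integral>\<omega>. ind (X 0 \<omega> \<le> x) - ind (X 0 \<omega> \<le> x') \<partial>M)"
        using x by (intro Bochner_Integration.integral_cong) (auto simp: ind_def)
      also have "\<dots> = x - x'" using x by (simp add: brv_integrable expectation_ind)
      finally show ?thesis by simp
    qed
    \<comment> \<open>Both covariances lie between 0 and the decay bound, hence so does the absolute
      value of their difference.\<close>
    have d2: "\<bar>d k\<bar> \<le> 4 * C * real_of_int \<bar>0 - k\<bar> powr (-\<alpha>)" if k: "k \<noteq> 0" for k
    proof -
      have "?c x k \<le> 4 * C * real_of_int \<bar>0 - k\<bar> powr (-\<alpha>)" "?c x' k \<le> 4 * C * real_of_int \<bar>0 - k\<bar> powr (-\<alpha>)"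
        using cov_ind_le[of 0 k x y] cov_ind_le[of 0 k x' y] k x by auto
      moreover have "0 \<le> ?c x k" "0 \<le> ?c x' k" by (rule cov_ind_nonneg)+
      ultimately show ?thesis unfolding d_def by linarith
    qed
    have d3: "\<bar>d k\<bar> \<le> 2 * T * (4 * C) powr (1 - \<theta>) * real_of_int \<bar>0 - k\<bar> powr (- (\<alpha> * (1 - \<theta>)))" if k: "k \<noteq> 0" for k
    proof (cases "d k = 0")
      case False
      then have "\<bar>d k\<bar> = \<bar>d k\<bar> powr \<theta> * \<bar>d k\<bar> powr (1 - \<theta>)" by (simp flip: powr_add)
      also have "\<dots> \<le> (2 * (x - x')) powr \<theta> * (4 * C * real_of_int \<bar>0 - k\<bar> powr (-\<alpha>)) powr (1 - \<theta>)"
        using d1[of k] d2[OF k] \<theta> by (intro mult_mono powr_mono2) auto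
      also have "(4 * C * real_of_int \<bar>0 - k\<bar> powr (-\<alpha>)) powr (1 - \<theta>) = (4 * C) powr (1 - \<theta>) * real_of_int \<bar>0 - k\<bar> powr (- (\<alpha> * (1 - \<theta>)))"
        using C by (simp add: powr_mult powr_powr)
      also have "(2 * (x - x')) powr \<theta> \<le> 2 * T"
      proof -
        have "2 powr \<theta> \<le> (2::real) powr 1" using \<theta> by (intro powr_mono) auto
        then have "2 powr \<theta> * T \<le> 2 * T" by (intro mult_right_mono) (auto simp: T_def)
        moreover have "(2 * (x - x')) powr \<theta> = 2 powr \<theta> * T" unfolding T_def by (rule powr_mult)
        ultimately show ?thesis by simp
      qed
      finally show ?thesis using C by (simp add: mult.assoc mult_right_mono)
    qed (simp add: T_def)
    have "\<bar>sum d F\<bar> \<le> H * T" if F: "finite F" for F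
    proof -
      have "\<bar>sum d F\<bar> \<le> (\<Sum>k\<in>F. \<bar>d k\<bar>)" by (rule sum_abs)
      also have "\<dots> \<le> (\<Sum>k\<in>insert 0 F. \<bar>d k\<bar>)" using F by (intro sum_mono2) auto
      also have "\<dots> = \<bar>d 0\<bar> + (\<Sum>k\<in>F-{0}. \<bar>d k\<bar>)" using F by (rule sum.insert_remove)
      also have "\<dots> \<le> 2 * T + (\<Sum>k\<in>F-{0}. 2 * T * (4 * C) powr (1 - \<theta>) * real_of_int \<bar>0 - k\<bar> powr (- (\<alpha> * (1 - \<theta>))))"
        using d1[of 0] T by (intro add_mono sum_mono d3) auto
      also have "\<dots> = 2 * T + 2 * T * (4 * C) powr (1 - \<theta>) * (\<Sum>k\<in>F-{0}. real_of_int \<bar>0 - k\<bar> powr (- (\<alpha> * (1 - \<theta>))))"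
        by (simp add: sum_distrib_left)
      also have "\<dots> \<le> 2 * T + 2 * T * (4 * C) powr (1 - \<theta>) * W"
        using F by (intro add_mono mult_left_mono W(2)) (auto simp: T_def)
      also have "\<dots> = H * T" by (simp add: H_def algebra_simps)
      finally show ?thesis .
    qed
    then show ?thesis unfolding T_def by (intro abs_has_sum_le[OF hs]) auto
  qed
  show thesis
  proof (rule that[OF H0])
    fix x x' y :: real assume x: "x \<in> {0..1}" "x' \<in> {0..1}" "y \<in> {0..1}"
    consider "x = x'" | "x' < x" | "x < x'" by linarith
    then show "\<bar>Kcov x y - Kcov x' y\<bar> \<le> H * \<bar>x - x'\<bar> powr \<theta>"
      using main[OF x] main[OF x(2,1,3)] by cases (auto simp: abs_minus_commute)
  qed
qed

definition Kvar :: "real set \<Rightarrow> (real \<Rightarrow> real) \<Rightarrow> real" where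
  "Kvar S c = (\<Sum>x\<in>S. \<Sum>y\<in>S. c x * c y * Kcov x y)"

lemma variance_tendsto:
  assumes \<alpha>: "\<alpha> > 1" and S: "S \<subseteq> {0..1}"
  shows "(\<lambda>n. (\<integral>\<omega>. (blocksum S c {1..int n} \<omega>)\<^sup>2 \<partial>M) / real n) \<longlonglongrightarrow> Kvar S c"
proof -
  define \<gamma> where "\<gamma> d = cov M (\<lambda>\<omega>. lin S c (X 0 \<omega>)) (\<lambda>\<omega>. lin S c (X d \<omega>))" for d
  have \<gamma>: "cov M (\<lambda>\<omega>. lin S c (X i \<omega>)) (\<lambda>\<omega>. lin S c (X j \<omega>)) = \<gamma> (j - i)" for i j
    unfolding \<gamma>_def using cov_shift[of "lin S c" "lin S c" 0 i "j - i"] by simp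
  have \<gamma>e: "\<gamma> = (\<lambda>d. \<Sum>x\<in>S. \<Sum>y\<in>S. c x * c y * cov M (\<lambda>\<omega>. ind (X 0 \<omega> \<le> x)) (\<lambda>\<omega>. ind (X d \<omega> \<le> y)))"
    unfolding \<gamma>_def cov_lin ..
  have hs: "(\<gamma> has_sum Kvar S c) UNIV"
    unfolding \<gamma>e Kvar_def using S
    by (intro has_sum_finite_sum has_sum_cmult_right has_sum_Kcov \<alpha>) auto
  obtain B where B: "\<And>F x y. finite F \<Longrightarrow> x \<in> {0..1} \<Longrightarrow> y \<in> {0..1} \<Longrightarrow>
    (\<Sum>k\<in>F. cov M (\<lambda>\<omega>. ind (X 0 \<omega> \<le> x)) (\<lambda>\<omega>. ind (X k \<omega> \<le> y))) \<le> B"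
    using cov_ind_sum_bound[OF \<alpha>] by metis
  have "\<bar>sum \<gamma> F\<bar> \<le> (\<Sum>x\<in>S. \<Sum>y\<in>S. \<bar>c x * c y\<bar> * B)" if F: "finite F" for F
  proof -
    have "sum \<gamma> F = (\<Sum>x\<in>S. \<Sum>y\<in>S. c x * c y * (\<Sum>k\<in>F. cov M (\<lambda>\<omega>. ind (X 0 \<omega> \<le> x)) (\<lambda>\<omega>. ind (X k \<omega> \<le> y))))"
      unfolding \<gamma>e sum_distrib_left by (subst sum.swap, intro sum.cong refl sum.swap)
    also have "\<bar>\<dots>\<bar> \<le> (\<Sum>x\<in>S. \<Sum>y\<in>S. \<bar>c x * c y\<bar> * B)"
    proof (intro order_trans[OF sum_abs] sum_mono)
      fix x y assume "x \<in> S" "y \<in> S"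
      then have xy: "x \<in> {0..1}" "y \<in> {0..1}" using S by auto
      have "0 \<le> (\<Sum>k\<in>F. cov M (\<lambda>\<omega>. ind (X 0 \<omega> \<le> x)) (\<lambda>\<omega>. ind (X k \<omega> \<le> y)))" "(\<Sum>k\<in>F. cov M (\<lambda>\<omega>. ind (X 0 \<omega> \<le> x)) (\<lambda>\<omega>. ind (X k \<omega> \<le> y))) \<le> B"
        by (intro sum_nonneg cov_ind_nonneg) (rule B[OF F xy])
      then show "\<bar>c x * c y * (\<Sum>k\<in>F. cov M (\<lambda>\<omega>. ind (X 0 \<omega> \<le> x)) (\<lambda>\<omega>. ind (X k \<omega> \<le> y)))\<bar> \<le> \<bar>c x * c y\<bar> * B"
        unfolding abs_mult[of "c x * c y"] by (intro mult_left_mono) auto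
    qed
    finally show ?thesis .
  qed
  from cesaro_int[OF hs this]
  have "(\<lambda>n. (\<Sum>i\<in>{1..int n}. \<Sum>j\<in>{1..int n}. \<gamma> (j - i)) / real n) \<longlonglongrightarrow> Kvar S c" .
  moreover have "(\<integral>\<omega>. (blocksum S c {1..int n} \<omega>)\<^sup>2 \<partial>M) = (\<Sum>i\<in>{1..int n}. \<Sum>j\<in>{1..int n}. \<gamma> (j - i))" for n
    unfolding blocksum_def power2_eq_square expectation_lin_product[OF S] \<gamma> ..
  ultimately show ?thesis by simp
qed

text \<open>A limit of normalised variances. This is how positive semidefiniteness of
  \<open>Kcov\<close> is obtained, on which the construction of the Gaussian process rests.\<close>

lemma Kvar_nonneg: assumes "\<alpha> > 1" "S \<subseteq> {0..1}" shows "0 \<le> Kvar S c"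
  by (rule LIMSEQ_le_const[OF variance_tendsto[OF assms]]) auto

section \<open>Adjacent blocks and the central limit theorem\<close>

text \<open>Blocks without gaps: the central limit theorem needs the law of the whole sum, whereas
  for a tail bound the two parities could be estimated separately.\<close>

definition adj_block :: "nat \<Rightarrow> nat \<Rightarrow> nat \<Rightarrow> int set" where
  "adj_block n m b = {i\<in>{1..int n}. i div int m = int b}"

lemma finite_adj_block [simp]: "finite (adj_block n m b)"
  by (rule finite_subset[of _ "{1..int n}"]) (auto simp: adj_block_def)

lemma adj_block_disjoint: "b \<noteq> c \<Longrightarrow> adj_block n m b \<inter> adj_block n m c = {}"
  by (auto simp: adj_block_def)

lemma adj_block_subset: assumes "m \<ge> 1" shows "adj_block n m b \<subseteq> {int b * int m..<(int b + 1) * int m}"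
proof
  fix i assume "i \<in> adj_block n m b"
  then have "i div int m = int b" by (simp add: adj_block_def)
  then have "i = int m * int b + i mod int m" by (metis mult_div_mod_eq)
  moreover have "0 \<le> i mod int m" "i mod int m < int m" using assms by auto
  ultimately show "i \<in> {int b * int m..<(int b + 1) * int m}" by (auto simp: algebra_simps)
qed

lemma card_adj_block: assumes "m \<ge> 1" shows "card (adj_block n m b) \<le> m"
proof -
  have "card (adj_block n m b) \<le> card {int b * int m..<(int b + 1) * int m}"
    using adj_block_subset[OF assms] by (intro card_mono) auto
  also have "\<dots> = m" by (simp add: algebra_simps)
  finally show ?thesis .
qed

lemma UN_adj_block: assumes m: "m \<ge> 1" shows "(\<Union>b<Suc n. adj_block n m b) = {1..int n}"
proof
  show "{1..int n} \<subseteq> (\<Union>b<Suc n. adj_block n m b)"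
  proof
    fix i assume i: "i \<in> {1..int n}"
    have "0 \<le> i div int m" using i m by (simp add: pos_imp_zdiv_nonneg_iff)
    moreover have "i div int m \<le> i" using i m zdiv_mono2[of i 1 "int m"] by simp
    ultimately have "i \<in> adj_block n m (nat (i div int m))" "nat (i div int m) < Suc n"
      using i by (auto simp: adj_block_def nat_less_iff)
    then show "i \<in> (\<Union>b<Suc n. adj_block n m b)" by blast
  qed
qed (auto simp: adj_block_def)

text \<open>Without gaps the distance to earlier blocks may be as small as 1, but it grows as j
  moves into its block. Summing \<open>R d j powr (-p)\<close> over a block stays below W' because p
  > 1, and at most n/m + 1 blocks are nonempty.\<close>

lemma adj_coupling_le:
  assumes S: "S \<subseteq> {0..1}" and m: "m \<ge> 1" and pq: "p > 1" "q > 1" "\<alpha> = p + q"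
    and W: "W \<ge> 0" "\<And>i J. finite J \<Longrightarrow> (\<Sum>j\<in>J. real_of_int \<bar>i - j\<bar> powr (-q)) \<le> W"
    and W': "W' \<ge> 0" "\<And>i J. finite J \<Longrightarrow> (\<Sum>j\<in>J. real_of_int \<bar>i - j\<bar> powr (-p)) \<le> W'"
  shows "coupling S c (adj_block n m) (Suc n) \<le> 4 * C * (\<Sum>x\<in>S. \<bar>c x\<bar>)\<^sup>2 * W * (W' * (real n / real m + 1))"
proof -
  \<comment> \<open>Distance to d m - 1, the last index that may belong to an earlier block. The
    offset keeps R positive at the left end j = d m.\<close>
  define R where "R d j = real_of_int \<bar>(int d * int m - 1) - j\<bar>" for d :: nat and j :: int
  have "coupling S c (adj_block n m) (Suc n) \<le> 4 * C * (\<Sum>x\<in>S. \<bar>c x\<bar>)\<^sup>2 * W * (\<Sum>d<Suc n. \<Sum>j\<in>adj_block n m d. R d j powr (-p))"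
  proof (rule coupling_le[OF S _ _ W _ pq(3)])
    fix b d :: nat and i j assume bd: "b < d" and i: "i \<in> adj_block n m b" and j: "j \<in> adj_block n m d"
    have "i < (int b + 1) * int m" "int d * int m \<le> j" using adj_block_subset[OF m] i j by fastforce+
    moreover have "(int b + 1) * int m \<le> int d * int m" using bd by (intro mult_right_mono) auto
    ultimately show "0 < R d j \<and> R d j \<le> real_of_int \<bar>j - i\<bar>" unfolding R_def by linarith
  qed (use adj_block_disjoint pq in auto)
  also have "(\<Sum>d<Suc n. \<Sum>j\<in>adj_block n m d. R d j powr (-p)) \<le> W' * (real n / real m + 1)"
  proof -
    have "(\<Sum>j\<in>adj_block n m d. R d j powr (-p)) \<le> (if d \<le> n div m then W' else 0)" for d
    proof (cases "d \<le> n div m")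
      case True
      then show ?thesis unfolding R_def using W'(2)[of "adj_block n m d" "int d * int m - 1", OF finite_adj_block]
        by (simp only: if_True)
    next
      case False
      have "adj_block n m d = {}"
      proof (rule ccontr)
        assume "adj_block n m d \<noteq> {}"
        then obtain i where "1 \<le> i" "i \<le> int n" "i div int m = int d" by (auto simp: adj_block_def)
        then have "int d \<le> int n div int m" using m by (metis zdiv_mono1 of_nat_0_less_iff zero_less_one less_le_trans)
        then show False using False by (simp flip: of_nat_div)
      qed
      then show ?thesis using False by simp
    qed
    then have "(\<Sum>d<Suc n. \<Sum>j\<in>adj_block n m d. R d j powr (-p)) \<le> (\<Sum>d<Suc n. if d \<le> n div m then W' else 0)"
      by (intro sum_mono)
    also have "\<dots> \<le> real (n div m + 1) * W'"
    proof -
      have "(\<Sum>d<Suc n. if d \<le> n div m then W' else 0) = (\<Sum>d\<in>{..<Suc n} \<inter> {..n div m}. W')"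
        by (subst sum.inter_restrict) auto
      also have "\<dots> \<le> (\<Sum>d\<in>{..n div m}. W')" using W' by (intro sum_mono2) auto
      finally show ?thesis by simp
    qed
    also have "\<dots> \<le> (real n / real m + 1) * W'"
    proof -
      have "real (n div m + 1) \<le> real n / real m + 1" using of_nat_div_le_of_nat[of n m, where ?'a=real] by simp
      then show ?thesis using W'(1) by (rule mult_right_mono)
    qed
    finally show ?thesis by (simp add: mult.commute)
  qed
  finally show ?thesis using C W by (simp add: mult_left_mono)
qed

lemma blocksum_scale: "blocksum S (\<lambda>x. a * c x) A \<omega> = a * blocksum S c A \<omega>"
  unfolding blocksum_def lin_scale by (simp add: sum_distrib_left)

text \<open>With blocks of length m the coupling is of order 1/m + 1/n and a normalised block has
  size of order m / sqrt n. The exponent 1/4 balances 1/m against m / sqrt n, so both are of order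
  \<rho> n = n powr (-1/4).\<close>

lemma clt_linear:
  assumes pq: "p > 1" "q > 1" "\<alpha> = p + q" and S: "S \<subseteq> {0..1}"
  shows "(\<lambda>n. cf (\<lambda>\<omega>. blocksum S c {1..int n} \<omega> / sqrt n)) \<longlonglongrightarrow> complex_of_real (exp (- Kvar S c / 2))"
proof -
  have \<alpha>: "\<alpha> > 1" using pq by simp
  obtain W where W: "W \<ge> 0" "\<And>i J. finite J \<Longrightarrow> (\<Sum>j\<in>J. real_of_int \<bar>i - j\<bar> powr (-q)) \<le> W" using powr_sum_bound[OF pq(2)] by blast
  obtain W' where W': "W' \<ge> 0" "\<And>i J. finite J \<Longrightarrow> (\<Sum>j\<in>J. real_of_int \<bar>i - j\<bar> powr (-p)) \<le> W'" using powr_sum_bound[OF pq(1)] by blast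
  define L where "L = (\<Sum>x\<in>S. \<bar>c x\<bar>)"
  have L0: "L \<ge> 0" unfolding L_def by (intro sum_nonneg) auto
  define mm where "mm n = nat \<lceil>real n powr (1/4)\<rceil>" for n :: nat
  define v where "v n = (\<integral>\<omega>. (blocksum S c {1..int n} \<omega>)\<^sup>2 \<partial>M) / real n" for n
  have vlim: "v \<longlonglongrightarrow> Kvar S c" unfolding v_def using variance_tendsto[OF \<alpha> S] .
  define \<rho> where "\<rho> n = real n powr (-1/4)" for n :: nat
  have \<rho>: "\<rho> \<longlonglongrightarrow> 0" unfolding \<rho>_def using tendsto_neg_powr[OF _ filterlim_real_sequentially, of "-1/4"] by simp
  define D where "D = 4 * C * L\<^sup>2 * W * W'"
  have D0: "D \<ge> 0" using C W W' by (simp add: D_def)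
  have main: "norm (cf (\<lambda>\<omega>. blocksum S c {1..int n} \<omega> / sqrt n) - exp (- v n / 2)) \<le> 5 * (2 * D * \<rho> n) + 2 * L * \<rho> n * (v n + 4 * D * \<rho> n)"
    if n: "n \<ge> 1" and small: "2 * L * \<rho> n \<le> 1" for n
  proof -
    define m where "m = mm n"
    have n1: "1 \<le> real n powr (1/4)" using n by (simp add: ge_one_powr_ge_zero)
    have m: "m \<ge> 1" "real n powr (1/4) \<le> real m" "real m \<le> 2 * real n powr (1/4)" unfolding m_def mm_def using n1 by linarith+
    define a where "a = 1 / sqrt n"
    have a0: "a > 0" and a2: "a\<^sup>2 = 1 / real n" using n by (auto simp: a_def power_divide)
    define c' where "c' x = a * c x" for x
    have L': "(\<Sum>x\<in>S. \<bar>c' x\<bar>) = a * L" unfolding c'_def L_def using a0 by (simp add: abs_mult sum_distrib_left)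
    have inv: "1 / real m \<le> \<rho> n"
    proof -
      have "1 / real m \<le> 1 / real n powr (1/4)" 
      proof (rule divide_left_mono)
        have "0 < real m" "0 < real n powr (1/4)" using m(1) n1 by linarith+
        then show "0 < real m * real n powr (1/4)" by simp
      qed (use m in auto)
      then show ?thesis by (simp add: \<rho>_def powr_minus_divide)
    qed
    have inv1: "1 / real n \<le> \<rho> n"
    proof -
      have "real n powr (-1) \<le> real n powr (-1/4)" using n by (intro powr_mono) auto
      then show ?thesis using n by (simp add: \<rho>_def powr_minus_divide)
    qed
    have \<rho>0: "\<rho> n \<ge> 0" by (simp add: \<rho>_def)
    let ?Bl = "adj_block n m"
    define K where "K = coupling S c' ?Bl (Suc n)"
    have K: "K \<le> 2 * D * \<rho> n"
    proof -
      have "K \<le> 4 * C * (a * L)\<^sup>2 * W * (W' * (real n / real m + 1))"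
        unfolding K_def using adj_coupling_le[OF S m(1) pq W W', of c' n] unfolding L' .
      also have "\<dots> = D * (1 / real m + 1 / real n)"
        using n m by (simp add: D_def power_mult_distrib a2 field_simps)
      also have "\<dots> \<le> D * (\<rho> n + \<rho> n)" using inv inv1 D0 by (intro mult_left_mono add_mono) auto
      finally show ?thesis by simp
    qed
    define \<beta> where "\<beta> = 2 * L * \<rho> n"
    have \<beta>: "\<bar>blocksum S c' (?Bl b) \<omega>\<bar> \<le> \<beta>" for b \<omega>
    proof -
      have "\<bar>blocksum S c' (?Bl b) \<omega>\<bar> \<le> (\<Sum>i\<in>?Bl b. a * L)"
        unfolding blocksum_def using abs_lin_le[OF S, of c'] unfolding L' by (intro order_trans[OF sum_abs] sum_mono) auto
      also have "\<dots> = real (card (?Bl b)) * (a * L)" by simp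
      also have "\<dots> \<le> (2 * real n powr (1/4)) * (a * L)"
        using card_adj_block[OF m(1), of n b] m(3) a0 L0 by (intro mult_right_mono) auto
      also have "\<dots> = 2 * L * (real n powr (1/4) * a)" by simp
      also have "real n powr (1/4) * a = \<rho> n"
      proof -
        have "a = real n powr (-1/2)" using n by (simp add: a_def powr_half_sqrt[symmetric] powr_minus_divide)
        then show ?thesis unfolding \<rho>_def by (simp flip: powr_add)
      qed
      finally show ?thesis by (simp add: \<beta>_def)
    qed
    have sum_eq: "(\<Sum>b<Suc n. blocksum S c' (?Bl b) \<omega>) = blocksum S c {1..int n} \<omega> / sqrt n" for \<omega>
    proof -
      have "(\<Sum>b<Suc n. blocksum S c' (?Bl b) \<omega>) = (\<Sum>i\<in>(\<Union>b<Suc n. ?Bl b). lin S c' (X i \<omega>))"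
        unfolding blocksum_def using adj_block_disjoint by (intro sum.UNION_disjoint[symmetric]) auto
      also have "\<dots> = blocksum S c' {1..int n} \<omega>" unfolding UN_adj_block[OF m(1)] blocksum_def ..
      also have "\<dots> = a * blocksum S c {1..int n} \<omega>" unfolding c'_def by (rule blocksum_scale)
      finally show ?thesis by (simp add: a_def)
    qed
    define V where "V = (\<Sum>b<Suc n. \<integral>\<omega>. (blocksum S c' (?Bl b) \<omega>)\<^sup>2 \<partial>M)"
    have vn: "v n = (\<integral>\<omega>. (\<Sum>b<Suc n. blocksum S c' (?Bl b) \<omega>)\<^sup>2 \<partial>M)"
      unfolding sum_eq v_def by (simp add: power_divide)
    have g: "norm (cf (\<lambda>\<omega>. \<Sum>b<Suc n. blocksum S c' (?Bl b) \<omega>) - exp (- v n / 2)) \<le> 5 * K + \<beta> * V"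
      unfolding K_def by (rule blocks_gauss[OF S _ _ \<beta> _ V_def vn]) (use adj_block_disjoint small in \<open>auto simp: \<beta>_def\<close>)
    have "V \<le> v n + 2 * K"
      using blocksum_variance_diff[OF S, where k="Suc n" and c=c' and Bl="?Bl"] unfolding V_def vn K_def by linarith
    then have V: "V \<le> v n + 4 * D * \<rho> n" using K by linarith
    have "\<beta> * V \<le> \<beta> * (v n + 4 * D * \<rho> n)" using V L0 \<rho>0 by (intro mult_left_mono) (auto simp: \<beta>_def)
    then show ?thesis using g K unfolding sum_eq \<beta>_def by linarith
  qed
  have lim0: "(\<lambda>n. 5 * (2 * D * \<rho> n) + 2 * L * \<rho> n * (v n + 4 * D * \<rho> n)) \<longlonglongrightarrow> 5 * (2 * D * 0) + 2 * L * 0 * (Kvar S c + 4 * D * 0)"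
    by (intro tendsto_intros \<rho> vlim)
  have "\<forall>\<^sub>F n in sequentially. 2 * L * \<rho> n < 1"
  proof -
    have "(\<lambda>n. 2 * L * \<rho> n) \<longlonglongrightarrow> 2 * L * 0" by (intro tendsto_intros \<rho>)
    then show ?thesis by (intro order_tendstoD) auto
  qed
  moreover have "\<forall>\<^sub>F n in sequentially. n \<ge> 1" by (rule eventually_ge_at_top)
  ultimately have "\<forall>\<^sub>F n in sequentially. norm (cf (\<lambda>\<omega>. blocksum S c {1..int n} \<omega> / sqrt n) - exp (- v n / 2)) \<le>
      5 * (2 * D * \<rho> n) + 2 * L * \<rho> n * (v n + 4 * D * \<rho> n)"
    by eventually_elim (rule main, auto)
  from Lim_null_comparison[OF this] lim0
  have "(\<lambda>n. cf (\<lambda>\<omega>. blocksum S c {1..int n} \<omega> / sqrt n) - complex_of_real (exp (- v n / 2))) \<longlonglongrightarrow> 0" by simp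
  moreover have "(\<lambda>n. complex_of_real (exp (- v n / 2))) \<longlonglongrightarrow> complex_of_real (exp (- Kvar S c / 2))"
    by (intro tendsto_intros vlim) auto
  ultimately have "(\<lambda>n. (cf (\<lambda>\<omega>. blocksum S c {1..int n} \<omega> / sqrt n) - complex_of_real (exp (- v n / 2))) + complex_of_real (exp (- v n / 2)))
     \<longlonglongrightarrow> 0 + complex_of_real (exp (- Kvar S c / 2))" by (rule tendsto_add)
  then show ?thesis by simp
qed

lemma emp_tight:
  assumes \<alpha>: "\<alpha> > 1" and x: "x \<in> {0..1}" and \<delta>: "\<delta> > 0"
  obtains A0 where "A0 > 0" "\<And>A n. A \<ge> A0 \<Longrightarrow> prob {\<omega>\<in>space M. \<bar>Z n \<omega> x\<bar> > A} \<le> \<delta>"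
proof -
  have S: "{x} \<subseteq> {0..1}" using x by simp
  have e: "Z n \<omega> x = blocksum {x} (\<lambda>_. 1) {1..int n} \<omega> / sqrt n" for n \<omega>
    using emp_linear[OF S, of "\<lambda>_. 1" n \<omega>] by simp
  have bZ: "brv M (\<lambda>\<omega>. Z n \<omega> x)" for n
    unfolding e by (intro brv_divide brv_blocksum S)
  have e2: "(\<integral>\<omega>. (Z n \<omega> x)\<^sup>2 \<partial>M) = (\<integral>\<omega>. (blocksum {x} (\<lambda>_. 1) {1..int n} \<omega>)\<^sup>2 \<partial>M) / real n" for n
    unfolding e by (simp add: power_divide)
  have "Bseq (\<lambda>n. \<integral>\<omega>. (Z n \<omega> x)\<^sup>2 \<partial>M)"
    unfolding e2 using variance_tendsto[OF \<alpha> S] by (intro convergent_imp_Bseq convergentI)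
  then obtain v where v: "v > 0" "\<And>n. \<bar>\<integral>\<omega>. (Z n \<omega> x)\<^sup>2 \<partial>M\<bar> \<le> v" unfolding Bseq_def by auto
  define A0 where "A0 = sqrt (v / \<delta>)"
  have A0: "A0 > 0" using v \<delta> by (simp add: A0_def)
  show thesis
  proof (rule that[OF A0])
    fix A n assume A: "A0 \<le> A"
    have Apos: "A > 0" using A A0 by simp
    have A2: "v / \<delta> \<le> A\<^sup>2"
    proof -
      have "v / \<delta> = A0\<^sup>2" using v \<delta> by (simp add: A0_def)
      also have "\<dots> \<le> A\<^sup>2" using A A0 by (intro power_mono) auto
      finally show ?thesis .
    qed
    have [measurable]: "(\<lambda>\<omega>. Z n \<omega> x) \<in> borel_measurable M" using bZ by (rule brv_measurable)
    have "prob {\<omega>\<in>space M. \<bar>Z n \<omega> x\<bar> > A} \<le> prob {\<omega>\<in>space M. (Z n \<omega> x)\<^sup>2 \<ge> A\<^sup>2}"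
    proof (rule finite_measure_mono)
      show "{\<omega>\<in>space M. \<bar>Z n \<omega> x\<bar> > A} \<subseteq> {\<omega>\<in>space M. (Z n \<omega> x)\<^sup>2 \<ge> A\<^sup>2}"
        using Apos by (auto simp flip: abs_le_square_iff)
    qed measurable
    also have "\<dots> \<le> (\<integral>\<omega>. (Z n \<omega> x)\<^sup>2 \<partial>M) / A\<^sup>2"
      using Apos by (intro integral_Markov_inequality_measure[where A="{}"] brv_integrable brv_power bZ) auto
    also have "\<dots> \<le> v / A\<^sup>2" using v(2)[of n] by (intro divide_right_mono) auto
    also have "\<dots> \<le> \<delta>" using A2 Apos \<delta> by (simp add: field_simps)
    finally show "prob {\<omega>\<in>space M. \<bar>Z n \<omega> x\<bar> > A} \<le> \<delta>" .
  qed
qed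

end

section \<open>Gaussian processes\<close>

text \<open>Gram-Schmidt in covariance form: subtracting the contribution of the pivot \<open>k\<close> (a Schur
  complement) clears row \<open>k\<close> and keeps the form positive semidefinite; \<open>x / 0 = 0\<close> makes degenerate
  pivots harmless.\<close>

definition schur_step :: "nat \<Rightarrow> (nat \<Rightarrow> nat \<Rightarrow> real) \<Rightarrow> nat \<Rightarrow> nat \<Rightarrow> real" where
  "schur_step k Q i j = Q i j - Q i k * Q j k / Q k k"

primrec schur :: "(nat \<Rightarrow> nat \<Rightarrow> real) \<Rightarrow> nat \<Rightarrow> (nat \<Rightarrow> nat \<Rightarrow> real)" where
  "schur K 0 = K"
| "schur K (Suc k) = schur_step k (schur K k)"

text \<open>The k-th column of a Cholesky factor: the pivot column of the k-th Schur complement,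
  normalised by the root of the pivot.\<close>

definition chol :: "(nat \<Rightarrow> nat \<Rightarrow> real) \<Rightarrow> nat \<Rightarrow> nat \<Rightarrow> real" where
  "chol K i k = schur K k i k / sqrt (schur K k k k)"

definition psd :: "(nat \<Rightarrow> nat \<Rightarrow> real) \<Rightarrow> bool" where
  "psd K \<longleftrightarrow> (\<forall>i j. K i j = K j i) \<and> (\<forall>A c. finite A \<longrightarrow> 0 \<le> (\<Sum>i\<in>A. \<Sum>j\<in>A. c i * c j * K i j))"

lemma psdD: "psd K \<Longrightarrow> finite A \<Longrightarrow> 0 \<le> (\<Sum>i\<in>A. \<Sum>j\<in>A. c i * c j * K i j)"
  by (simp add: psd_def)

lemma psd_diag: "psd K \<Longrightarrow> 0 \<le> K i i"
  using psdD[of K "{i}" "\<lambda>_. 1"] by simp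

text \<open>With a vanishing diagonal entry the form is linear in the coefficient t at k. A nonzero
  entry K i k would allow a t that makes it equal to -1.\<close>

lemma psd_zero_diag:
  assumes K: "psd K" and z: "K k k = 0" shows "K i k = 0"
proof (rule ccontr)
  assume n: "K i k \<noteq> 0"
  then have ik: "i \<noteq> k" using z by auto
  define t where "t = - (K i i + 1) / (2 * K i k)"
  have "0 \<le> (\<Sum>a\<in>{i,k}. \<Sum>b\<in>{i,k}. (if a = k then t else 1) * (if b = k then t else 1) * K a b)"
    using psdD[OF K, of "{i,k}" "\<lambda>a. if a = k then t else 1"] by simp
  also have "\<dots> = K i i + 2 * t * K i k" using K z ik by (auto simp: psd_def)
  also have "2 * t * K i k = - (K i i + 1)" using n by (simp add: t_def)
  finally show False by simp
qed

text \<open>Completing the square: the Schur complement evaluated at c is the original form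
  evaluated at c with its k-th coefficient lowered by s / K k k. Since k may lie outside A, the
  coefficients are first extended by 0 to \<open>insert k A\<close>.\<close>

lemma psd_schur_step:
  assumes K: "psd K" shows "psd (schur_step k K)"
proof -
  have sym: "K i j = K j i" for i j using K by (simp add: psd_def)
  have "0 \<le> (\<Sum>i\<in>A. \<Sum>j\<in>A. c i * c j * (K i j - K i k * K j k / K k k))" if A: "finite A" for A c
  proof (cases "K k k = 0")
    case True
    then show ?thesis using K A by (simp add: psd_def)
  next
    case False
    define s where "s = (\<Sum>i\<in>A. c i * K i k)"
    define B where "B = insert k A"
    define c' where "c' i = (if i \<in> A then c i else 0)" for i
    define e where "e i = c' i + (if i = k then - s / K k k else 0)" for i
    have fB: "finite B" using A by (simp add: B_def)
    have res: "(\<Sum>i\<in>B. c' i * f i) = (\<Sum>i\<in>A. c i * f i)" for f :: "nat \<Rightarrow> real"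
      unfolding B_def c'_def by (rule sum.mono_neutral_cong_right) (use A in auto)
    have e1: "(\<Sum>i\<in>B. e i * f i) = (\<Sum>i\<in>A. c i * f i) - s / K k k * f k" for f
    proof -
      have "(\<Sum>i\<in>B. e i * f i) = (\<Sum>i\<in>B. c' i * f i) + (\<Sum>i\<in>B. (if i = k then - s / K k k * f k else 0))"
        unfolding sum.distrib[symmetric] by (intro sum.cong) (auto simp: e_def algebra_simps)
      then show ?thesis unfolding res using fB by (simp add: B_def)
    qed
    have "0 \<le> (\<Sum>i\<in>B. \<Sum>j\<in>B. e i * e j * K i j)" using K fB by (simp add: psd_def)
    also have "\<dots> = (\<Sum>i\<in>B. e i * (\<Sum>j\<in>B. e j * K i j))" by (simp add: sum_distrib_left mult.assoc)
    also have "\<dots> = (\<Sum>i\<in>A. c i * ((\<Sum>j\<in>A. c j * K i j) - s / K k k * K i k)) - s / K k k * ((\<Sum>j\<in>A. c j * K k j) - s / K k k * K k k)"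
      unfolding e1 ..
    also have "(\<Sum>j\<in>A. c j * K k j) = s" unfolding s_def by (simp add: sym[of k])
    also have "(\<Sum>i\<in>A. c i * ((\<Sum>j\<in>A. c j * K i j) - s / K k k * K i k)) = (\<Sum>i\<in>A. \<Sum>j\<in>A. c i * c j * K i j) - s / K k k * s"
    proof -
      have lin: "(\<Sum>i\<in>A. c i * (f i - q * K i k)) = (\<Sum>i\<in>A. c i * f i) - q * s" for f q
        unfolding s_def by (simp add: right_diff_distrib sum_subtractf sum_distrib_left mult_ac)
      show ?thesis unfolding lin by (simp add: sum_distrib_left mult.assoc)
    qed
    also have "\<dots> - s / K k k * (s - s / K k k * K k k) = (\<Sum>i\<in>A. \<Sum>j\<in>A. c i * c j * K i j) - s * s / K k k"
      using False by simp
    also have "s * s / K k k = (\<Sum>i\<in>A. \<Sum>j\<in>A. c i * c j * (K i k * K j k / K k k))"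
      unfolding s_def sum_product sum_divide_distrib by (intro sum.cong refl) simp
    finally show ?thesis by (simp only: right_diff_distrib sum_subtractf)
  qed
  then show ?thesis unfolding psd_def schur_step_def using sym by (simp add: mult.commute)
qed

lemma psd_schur: "psd K \<Longrightarrow> psd (schur K k)"
proof (induction k)
  case (Suc k)
  then show ?case using psd_schur_step[of "schur K k" k] by simp
qed simp

lemma schur_zero: "psd K \<Longrightarrow> i < k \<Longrightarrow> schur K k i j = 0 \<and> schur K k j i = 0"
proof (induction k arbitrary: i j)
  case (Suc k)
  note p = psd_schur[OF Suc.prems(1), of k]
  show ?case
  proof (cases "i = k")
    case True
    have sym: "schur K k a b = schur K k b a" for a b using p by (simp add: psd_def)
    show ?thesis
    proof (cases "schur K k k k = 0")
      case z: True
      have "schur K k a k = 0" "schur K k k a = 0" for a using psd_zero_diag[OF p z] sym by auto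
      then show ?thesis using True by (simp add: schur_step_def)
    next
      case False then show ?thesis using True sym by (simp add: schur_step_def)
    qed
  next
    case False
    then show ?thesis using Suc by (simp add: schur_step_def)
  qed
qed simp

text \<open>Step m subtracts exactly \<open>chol K i m * chol K j m\<close> from the form, so the
  sum telescopes; after n > i steps row i has been cleared.\<close>

lemma chol_correct:
  assumes K: "psd K" and n: "i < n" "j < n"
  shows "K i j = (\<Sum>k<n. chol K i k * chol K j k)"
proof -
  have "K i j = schur K m i j + (\<Sum>k<m. chol K i k * chol K j k)" for m
  proof (induction m)
    case (Suc m)
    have "chol K i m * chol K j m = schur K m i m * schur K m j m / schur K m m m"
      using psd_diag[OF psd_schur[OF K], of m m] by (simp add: chol_def)
    then show ?case using Suc by (simp add: schur_step_def)
  qed simp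
  from this[of n] show ?thesis using schur_zero[OF K n(1)] by simp
qed

lemma chol_zero: "psd K \<Longrightarrow> i < k \<Longrightarrow> chol K i k = 0"
  unfolding chol_def using schur_zero[of K i k] by simp

section \<open>Gaussian sequences with a prescribed covariance\<close>

text \<open>Indexed by the reals so that sample points have the type real \<Rightarrow> real fixed
  in the theorem. The processes read only the coordinates at natural numbers.\<close>

definition gauss_space :: "(real \<Rightarrow> real) measure" where
  "gauss_space = Pi\<^sub>M UNIV (\<lambda>_. std_normal_distribution)"

lemma prob_space_gauss: "prob_space gauss_space"
  unfolding gauss_space_def by (intro prob_space_PiM prob_space_normal_density) simp

definition gauss_proc :: "(nat \<Rightarrow> nat \<Rightarrow> real) \<Rightarrow> nat \<Rightarrow> (real \<Rightarrow> real) \<Rightarrow> real" where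
  "gauss_proc K i \<omega> = (\<Sum>k\<le>i. chol K i k * \<omega> (real k))"

lemma coord_measurable_gauss: "(\<lambda>\<omega>. \<omega> x) \<in> borel_measurable gauss_space"
proof -
  have "(\<lambda>\<omega>. \<omega> x) \<in> measurable gauss_space std_normal_distribution"
    unfolding gauss_space_def by (rule measurable_component_singleton) simp
  then show ?thesis by simp
qed

lemma gauss_proc_measurable [measurable]: "gauss_proc K i \<in> borel_measurable gauss_space"
  unfolding gauss_proc_def[abs_def] by (intro borel_measurable_sum borel_measurable_times coord_measurable_gauss) auto

lemma indep_gauss:
  "prob_space.indep_vars gauss_space (\<lambda>_. std_normal_distribution) (\<lambda>k \<omega>. \<omega> (real k)) (UNIV :: nat set)"
proof -
  interpret G: prob_space gauss_space by (rule prob_space_gauss)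
  let ?N = "std_normal_distribution"
  have p: "prob_space ?N" by (rule prob_space_normal_density) simp
  have m: "(\<lambda>\<omega>. \<omega> (real k)) \<in> measurable gauss_space ?N" for k
    unfolding gauss_space_def by (rule measurable_component_singleton) simp
  have "distr gauss_space (Pi\<^sub>M UNIV (\<lambda>_::nat. ?N)) (\<lambda>\<omega>. \<lambda>k\<in>UNIV. \<omega> (real k)) = Pi\<^sub>M UNIV (\<lambda>_::nat. ?N)"
    unfolding gauss_space_def by (rule distr_PiM_reindex) (auto simp: p inj_on_def)
  moreover have "distr gauss_space ?N (\<lambda>\<omega>. \<omega> (real k)) = ?N" for k
    unfolding gauss_space_def by (rule distr_PiM_component) (auto simp: p)
  ultimately show ?thesis by (subst G.indep_vars_iff_distr_eq_PiM'[OF _ m]) auto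
qed

lemma char_gauss_linear:
  "prob_space.cf gauss_space (\<lambda>\<omega>. \<Sum>k<n. a k * \<omega> (real k)) = exp (- (\<Sum>k<n. (a k)\<^sup>2) / 2)"
proof -
  interpret G: prob_space gauss_space by (rule prob_space_gauss)
  note [measurable] = coord_measurable_gauss
  have d: "distr gauss_space borel (\<lambda>\<omega>. \<omega> x) = std_normal_distribution" for x
  proof -
    have "distr gauss_space borel (\<lambda>\<omega>. \<omega> x) = distr gauss_space std_normal_distribution (\<lambda>\<omega>. \<omega> x)"
      by (rule distr_cong) auto
    also have "\<dots> = std_normal_distribution"
      unfolding gauss_space_def by (rule distr_PiM_component) (auto intro: prob_space_normal_density)
    finally show ?thesis .
  qed
  have "G.cf (\<lambda>\<omega>. \<Sum>k<n. a k * \<omega> (real k)) = char (distr gauss_space borel (\<lambda>\<omega>. \<Sum>k<n. a k * \<omega> (real k))) 1"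
    by (subst G.cf_char) auto
  also have "\<dots> = (\<Prod>k<n. char (distr gauss_space borel (\<lambda>\<omega>. a k * \<omega> (real k))) 1)"
    by (rule G.char_distr_sum)
      (rule G.indep_vars_compose2[OF G.indep_vars_subset[OF indep_gauss], where Y="\<lambda>k x. a k * x"], auto)
  also have "\<dots> = (\<Prod>k<n. complex_of_real (exp (- (a k)\<^sup>2 / 2)))"
  proof (rule prod.cong[OF refl])
    fix k
    have "char (distr gauss_space borel (\<lambda>\<omega>. a k * \<omega> (real k))) 1 = char (distr gauss_space borel (\<lambda>\<omega>. \<omega> (real k))) (a k)"
      by (subst (1 2) G.cf_char) auto
    then show "char (distr gauss_space borel (\<lambda>\<omega>. a k * \<omega> (real k))) 1 = complex_of_real (exp (- (a k)\<^sup>2 / 2))"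
      unfolding d by (simp add: char_std_normal_distribution)
  qed
  also have "\<dots> = exp (- (\<Sum>k<n. (a k)\<^sup>2) / 2)"
    by (simp add: exp_sum sum_divide_distrib flip: sum_negf of_real_prod)
  finally show ?thesis .
qed

text \<open>The map \<iota> need not be injective: later, distinct points may be replaced by the
  same dyadic approximation. The linear combination is rewritten in the independent coordinates, and
  the squared coefficients recombine to K by \<open>chol_correct\<close>.\<close>

lemma cf_gauss_proc:
  assumes K: "psd K" and A: "finite A"
  shows "prob_space.cf gauss_space (\<lambda>\<omega>. \<Sum>i\<in>A. c i * gauss_proc K (\<iota> i) \<omega>) = exp (- (\<Sum>i\<in>A. \<Sum>j\<in>A. c i * c j * K (\<iota> i) (\<iota> j)) / 2)"
proof -
  obtain n where "\<forall>i\<in>\<iota> ` A. i < n" using A finite_nat_set_iff_bounded[of "\<iota> ` A"] by auto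
  then have n: "\<And>i. i \<in> A \<Longrightarrow> \<iota> i < n" by auto
  have g: "gauss_proc K (\<iota> i) \<omega> = (\<Sum>k<n. chol K (\<iota> i) k * \<omega> (real k))" if "i \<in> A" for i \<omega>
    unfolding gauss_proc_def by (rule sum.mono_neutral_left) (use n[OF that] chol_zero[OF K] in auto)
  have "(\<Sum>i\<in>A. c i * gauss_proc K (\<iota> i) \<omega>) = (\<Sum>k<n. (\<Sum>i\<in>A. c i * chol K (\<iota> i) k) * \<omega> (real k))" for \<omega>
  proof -
    have "(\<Sum>i\<in>A. c i * gauss_proc K (\<iota> i) \<omega>) = (\<Sum>i\<in>A. \<Sum>k<n. c i * chol K (\<iota> i) k * \<omega> (real k))"
      by (simp add: g sum_distrib_left mult.assoc)
    also have "\<dots> = (\<Sum>k<n. (\<Sum>i\<in>A. c i * chol K (\<iota> i) k) * \<omega> (real k))"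
      by (subst sum.swap) (simp add: sum_distrib_right)
    finally show ?thesis .
  qed
  moreover have "(\<Sum>k<n. (\<Sum>i\<in>A. c i * chol K (\<iota> i) k)\<^sup>2) = (\<Sum>i\<in>A. \<Sum>j\<in>A. c i * c j * K (\<iota> i) (\<iota> j))"
  proof -
    have "(\<Sum>k<n. (\<Sum>i\<in>A. c i * chol K (\<iota> i) k)\<^sup>2) = (\<Sum>k<n. \<Sum>i\<in>A. \<Sum>j\<in>A. c i * c j * (chol K (\<iota> i) k * chol K (\<iota> j) k))"
      by (simp add: power2_eq_square sum_product mult_ac)
    also have "\<dots> = (\<Sum>i\<in>A. \<Sum>k<n. \<Sum>j\<in>A. c i * c j * (chol K (\<iota> i) k * chol K (\<iota> j) k))" by (rule sum.swap)
    also have "\<dots> = (\<Sum>i\<in>A. \<Sum>j\<in>A. \<Sum>k<n. c i * c j * (chol K (\<iota> i) k * chol K (\<iota> j) k))"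
      by (intro sum.cong refl sum.swap)
    also have "\<dots> = (\<Sum>i\<in>A. \<Sum>j\<in>A. c i * c j * K (\<iota> i) (\<iota> j))"
      using chol_correct[OF K n n] by (simp add: sum_distrib_left)
    finally show ?thesis .
  qed
  ultimately show ?thesis by (simp add: char_gauss_linear)
qed

text \<open>Levy's uniqueness theorem identifies the law of Y with that of sqrt v times a standard
  normal variable, also for v = 0. Its fourth moment is 3 v^2, and Markov's inequality for fourth
  powers applies.\<close>

lemma (in prob_space) gaussian_tail:
  fixes Y :: "'a \<Rightarrow> real"
  assumes [measurable]: "Y \<in> borel_measurable M" and ch: "\<And>t. cf (\<lambda>\<omega>. t * Y \<omega>) = exp (- (t\<^sup>2 * v) / 2)" and v: "0 \<le> v" and e: "e > 0"
  shows "prob {\<omega>\<in>space M. e \<le> \<bar>Y \<omega>\<bar>} \<le> 3 * v\<^sup>2 / e^4"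
proof -
  interpret S: real_distribution std_normal_distribution by (rule real_dist_normal_dist)
  have [measurable]: "(\<lambda>x. sqrt v * x) \<in> borel_measurable std_normal_distribution" by measurable
  have eq: "distr M borel Y = distr std_normal_distribution borel (\<lambda>x. sqrt v * x)"
  proof (rule Levy_uniqueness)
    show "real_distribution (distr M borel Y)" by (rule real_distribution_distr) simp
    show "real_distribution (distr std_normal_distribution borel (\<lambda>x. sqrt v * x))" by (rule S.real_distribution_distr) simp
    show "char (distr M borel Y) = char (distr std_normal_distribution borel (\<lambda>x. sqrt v * x))"
    proof
      fix t
      have "char (distr std_normal_distribution borel (\<lambda>x. sqrt v * x)) t = S.cf (\<lambda>x. t * (sqrt v * x))"
        by (rule S.cf_char) simp
      also have "\<dots> = S.cf (\<lambda>x. (t * sqrt v) * x)" by (simp only: mult.assoc)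
      also have "\<dots> = char (distr std_normal_distribution borel (\<lambda>x. x)) (t * sqrt v)"
        by (rule S.cf_char[symmetric]) simp
      also have "distr std_normal_distribution borel (\<lambda>x. x) = std_normal_distribution"
        by (subst distr_cong[where L=std_normal_distribution and g="\<lambda>x. x"]) (auto simp: distr_id2)
      finally show "char (distr M borel Y) t = char (distr std_normal_distribution borel (\<lambda>x. sqrt v * x)) t"
        using v by (simp add: cf_char ch char_std_normal_distribution power_mult_distrib)
    qed
  qed
  have "prob {\<omega>\<in>space M. e \<le> \<bar>Y \<omega>\<bar>} = measure (distr M borel Y) {y. e \<le> \<bar>y\<bar>}"
    by (subst measure_distr) (auto intro!: arg_cong[where f=prob])
  also have "\<dots> = S.prob {x\<in>space std_normal_distribution. e^4 \<le> v\<^sup>2 * x^4}"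
  proof -
    have "e \<le> \<bar>sqrt v * x\<bar> \<longleftrightarrow> e^4 \<le> v\<^sup>2 * x^4" for x
    proof -
      have "e \<le> \<bar>sqrt v * x\<bar> \<longleftrightarrow> e^4 \<le> \<bar>sqrt v * x\<bar>^4"
        using e by (intro power_mono_iff[symmetric]) auto
      also have "\<bar>sqrt v * x\<bar>^4 = (sqrt v)^4 * x^4" by (simp add: power_mult_distrib)
      also have "(sqrt v)^4 = v\<^sup>2" using v by (simp add: power4_eq_xxxx power2_eq_square)
      finally show ?thesis .
    qed
    then show ?thesis unfolding eq by (subst measure_distr) (auto intro!: arg_cong[where f=S.prob])
  qed
  also have "\<dots> \<le> (\<integral>x. v\<^sup>2 * x^4 \<partial>std_normal_distribution) / e^4"
    using e by (intro integral_Markov_inequality_measure[where A="{}"] ) (auto intro!: integrable_std_normal_distribution_moment)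
  also have "(\<integral>x. v\<^sup>2 * x^4 \<partial>std_normal_distribution) = v\<^sup>2 * 3"
    using std_normal_distribution_even_moments(1)[of 2] by (simp add: fact_numeral)
  finally show ?thesis by (simp add: mult.commute)
qed

section \<open>Dyadic points and continuous Gaussian paths\<close>

definition dyadics :: "real set" where "dyadics = (\<Union>l. (\<lambda>j. real j / 2^l) ` {..2^l})"

lemma dyadic_in: "j \<le> 2^l \<Longrightarrow> real j / 2^l \<in> dyadics"
  unfolding dyadics_def by blast

lemma dyadics_unit: "dyadics \<subseteq> {0..1}"
  by (auto simp: dyadics_def divide_le_eq)

lemma countable_dyadics: "countable dyadics"
  unfolding dyadics_def by auto

lemma infinite_dyadics: "infinite dyadics"
proof
  assume "finite dyadics"
  moreover have "range (\<lambda>l. 1 / 2^l :: real) \<subseteq> dyadics" using dyadic_in[of 1] by auto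
  ultimately have "finite (range (\<lambda>l. 1 / 2^l :: real))" by (rule finite_subset[rotated])
  moreover have "inj (\<lambda>l. 1 / 2^l :: real)" by (auto simp: inj_def)
  ultimately show False using finite_imageD infinite_UNIV_nat by blast
qed

lemma floor_dyadic:
  assumes "x \<in> {0..1}" shows "\<lfloor>2^m * x\<rfloor> / 2^m \<in> dyadics" "\<bar>x - \<lfloor>2^m * x\<rfloor> / 2^m\<bar> \<le> 1 / 2^m"
proof -
  have "real (nat \<lfloor>2^m * x\<rfloor>) = \<lfloor>2^m * x\<rfloor>" using assms by simp
  then show "\<lfloor>2^m * x\<rfloor> / 2^m \<in> dyadics" using dyadic_in[OF nat_floor_le[OF assms, of m]] by simp
  have "\<bar>2^m * x - \<lfloor>2^m * x\<rfloor>\<bar> \<le> 1" by linarith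
  then have "\<bar>2^m * x - \<lfloor>2^m * x\<rfloor>\<bar> / 2^m \<le> 1 / 2^m" by (intro divide_right_mono) simp_all
  moreover have "x - \<lfloor>2^m * x\<rfloor> / 2^m = (2^m * x - \<lfloor>2^m * x\<rfloor>) / 2^m" by (simp add: diff_divide_distrib)
  ultimately show "\<bar>x - \<lfloor>2^m * x\<rfloor> / 2^m\<bar> \<le> 1 / 2^m" by simp
qed

lemma step_at_dyadic:
  assumes "d \<in> dyadics" obtains l where "\<And>m. m \<ge> l \<Longrightarrow> step m f d = f d"
proof -
  obtain j l where d: "d = real j / 2^l" "j \<le> 2^l" using assms by (auto simp: dyadics_def)
  have d01: "d \<in> {0..1}" using assms dyadics_unit by auto
  show thesis
  proof (rule that[of l])
    fix m assume "l \<le> m"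
    then obtain k where k: "m = l + k" by (auto simp: le_iff_add)
    have "2^m * d = real_of_int (int (2^k * j))" by (simp add: d k power_add)
    then have "\<lfloor>2^m * d\<rfloor> = int (2^k * j)" by (simp only: floor_of_int)
    then have "\<lfloor>2^m * d\<rfloor> / 2^m = d" by (simp add: d k power_add)
    then show "step m f d = f d" unfolding step_eq[OF d01] by simp
  qed
qed

text \<open>Points closer than the mesh lie in the same cell or in adjacent cells, so at most one
  increment of level m separates the two values.\<close>

lemma step_diff_cell:
  assumes x: "x \<in> {0..1}" and y: "y \<in> {0..1}" and xy: "x \<le> y" "y - x < 1 / 2^m"
    and d: "\<And>j. j \<in> {1..2^m} \<Longrightarrow> \<bar>f (real j / 2^m) - f ((real j - 1) / 2^m)\<bar> \<le> e" and e: "0 \<le> e"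
  shows "\<bar>step m f y - step m f x\<bar> \<le> e"
proof -
  define k where "k = \<lfloor>2^m * x\<rfloor>"
  define k' where "k' = \<lfloor>2^m * y\<rfloor>"
  have "2^m * y < 2^m * x + 1" using xy(2) by (simp add: field_simps)
  moreover have "2^m * x \<le> 2^m * y" using xy(1) by simp
  ultimately have "k' = k \<or> k' = k + 1" unfolding k_def k'_def by linarith
  then show ?thesis
  proof
    assume "k' = k"
    then show ?thesis unfolding step_eq[OF x] step_eq[OF y] k_def[symmetric] k'_def[symmetric] using e by simp
  next
    assume k': "k' = k + 1"
    have k0: "0 \<le> k" unfolding k_def using x by simp
    have le: "nat k' \<le> 2^m" unfolding k'_def by (rule nat_floor_le[OF y])
    have r: "real (nat k') = k'" "real_of_int k' - 1 = k" using k0 k' by auto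
    have "\<bar>f (real (nat k') / 2^m) - f ((real (nat k') - 1) / 2^m)\<bar> \<le> e"
      by (rule d) (use le k' k0 in auto)
    then show ?thesis unfolding step_eq[OF x] step_eq[OF y] k_def[symmetric] k'_def[symmetric] r .
  qed
qed

text \<open>An infinite countable set is in bijection with the naturals. The covariance is
  transported along the enumeration, and injectivity turns its positivity on subsets of D into
  positivity of the transported matrix.\<close>

lemma gaussian_on_countable:
  fixes K :: "real \<Rightarrow> real \<Rightarrow> real"
  assumes D: "countable D" "infinite D"
    and sym: "\<And>x y. x \<in> D \<Longrightarrow> y \<in> D \<Longrightarrow> K x y = K y x"
    and psd: "\<And>S c. finite S \<Longrightarrow> S \<subseteq> D \<Longrightarrow> 0 \<le> (\<Sum>x\<in>S. \<Sum>y\<in>S. c x * c y * K x y)"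
  obtains Y :: "real \<Rightarrow> (real \<Rightarrow> real) \<Rightarrow> real" where "\<And>d. Y d \<in> borel_measurable gauss_space"
    "\<And>(S :: real set) c \<phi>. finite S \<Longrightarrow> (\<And>x. x \<in> S \<Longrightarrow> \<phi> x \<in> D) \<Longrightarrow>
      prob_space.cf gauss_space (\<lambda>\<omega>. \<Sum>x\<in>S. c x * Y (\<phi> x) \<omega>) = exp (- (\<Sum>x\<in>S. \<Sum>y\<in>S. c x * c y * K (\<phi> x) (\<phi> y)) / 2)"
proof -
  define e where "e = from_nat_into D"
  define \<iota> where "\<iota> = to_nat_on D"
  have eD: "e i \<in> D" for i unfolding e_def using D by (intro from_nat_into) auto
  have e\<iota>: "e (\<iota> d) = d" if "d \<in> D" for d unfolding e_def \<iota>_def using D(1) that by simp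
  have \<iota>e: "\<iota> (e i) = i" for i unfolding e_def \<iota>_def using D by simp
  define K' where "K' i j = K (e i) (e j)" for i j
  have psdK: "psd K'"
    unfolding psd_def
  proof (intro conjI allI impI)
    show "K' i j = K' j i" for i j unfolding K'_def by (intro sym eD)
    fix A :: "nat set" and c :: "nat \<Rightarrow> real" assume A: "finite A"
    have inj: "inj_on e A" by (metis \<iota>e inj_onI)
    have "0 \<le> (\<Sum>x\<in>e ` A. \<Sum>y\<in>e ` A. c (\<iota> x) * c (\<iota> y) * K x y)" using A eD by (intro psd) auto
    also have "\<dots> = (\<Sum>i\<in>A. \<Sum>j\<in>A. c i * c j * K' i j)"
      using inj by (simp add: sum.reindex \<iota>e K'_def)
    finally show "0 \<le> (\<Sum>i\<in>A. \<Sum>j\<in>A. c i * c j * K' i j)" .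
  qed
  show thesis
  proof (rule that[of "\<lambda>d. gauss_proc K' (\<iota> d)"])
    show "gauss_proc K' (\<iota> d) \<in> borel_measurable gauss_space" for d by measurable
    fix S :: "real set" and c \<phi> assume S: "finite S" and \<phi>: "\<And>x. x \<in> S \<Longrightarrow> \<phi> x \<in> D"
    have "(\<Sum>x\<in>S. \<Sum>y\<in>S. c x * c y * K' (\<iota> (\<phi> x)) (\<iota> (\<phi> y))) = (\<Sum>x\<in>S. \<Sum>y\<in>S. c x * c y * K (\<phi> x) (\<phi> y))"
      unfolding K'_def using \<phi> by (intro sum.cong refl) (simp add: e\<iota>)
    then show "prob_space.cf gauss_space (\<lambda>\<omega>. \<Sum>x\<in>S. c x * gauss_proc K' (\<iota> (\<phi> x)) \<omega>) = exp (- (\<Sum>x\<in>S. \<Sum>y\<in>S. c x * c y * K (\<phi> x) (\<phi> y)) / 2)"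
      using cf_gauss_proc[OF psdK S, of c "\<lambda>x. \<iota> (\<phi> x)"] by simp
  qed
qed

lemma (in prob_space) cf_tendsto:
  assumes [measurable]: "\<And>m. U m \<in> borel_measurable M" "V \<in> borel_measurable M" and lim: "AE \<omega> in M. (\<lambda>m. U m \<omega>) \<longlonglongrightarrow> V \<omega>"
  shows "(\<lambda>m. cf (U m)) \<longlonglongrightarrow> cf V"
proof -
  have c: "(\<lambda>m. \<integral>\<omega>. cos (U m \<omega>) \<partial>M) \<longlonglongrightarrow> (\<integral>\<omega>. cos (V \<omega>) \<partial>M)"
  proof (rule integral_dominated_convergence[where w="\<lambda>_. 1"])
    show "AE \<omega> in M. (\<lambda>m. cos (U m \<omega>)) \<longlonglongrightarrow> cos (V \<omega>)"
      using lim by eventually_elim (rule tendsto_cos)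
  qed auto
  have s: "(\<lambda>m. \<integral>\<omega>. sin (U m \<omega>) \<partial>M) \<longlonglongrightarrow> (\<integral>\<omega>. sin (V \<omega>) \<partial>M)"
  proof (rule integral_dominated_convergence[where w="\<lambda>_. 1"])
    show "AE \<omega> in M. (\<lambda>m. sin (U m \<omega>)) \<longlonglongrightarrow> sin (V \<omega>)"
      using lim by eventually_elim (rule tendsto_sin)
  qed auto
  show ?thesis unfolding cf_def by (intro tendsto_Complex c s)
qed

text \<open>A Gaussian process on the dyadics whose covariance is Hoelder continuous of order \<open>\<theta> > 1/2\<close>
  extends to \<open>[0, 1]\<close>: fourth moments of increments are \<open>O(|t - s| powr (2 \<theta>))\<close> with \<open>2 \<theta> > 1\<close>.\<close>

lemma gaussian_process_exists:
  fixes K :: "real \<Rightarrow> real \<Rightarrow> real"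
  assumes \<theta>: "1/2 < \<theta>"
    and sym: "\<And>x y. x \<in> {0..1} \<Longrightarrow> y \<in> {0..1} \<Longrightarrow> K x y = K y x"
    and psd: "\<And>S c. finite S \<Longrightarrow> S \<subseteq> {0..1} \<Longrightarrow> 0 \<le> (\<Sum>x\<in>S. \<Sum>y\<in>S. c x * c y * K x y)"
    and H: "H \<ge> 0" "\<And>x x' y. x \<in> {0..1} \<Longrightarrow> x' \<in> {0..1} \<Longrightarrow> y \<in> {0..1} \<Longrightarrow> \<bar>K x y - K x' y\<bar> \<le> H * \<bar>x - x'\<bar> powr \<theta>"
  obtains G :: "(real \<Rightarrow> real) \<Rightarrow> real \<Rightarrow> real" where "\<And>\<omega>. cadlag01 (G \<omega>)"
    "\<And>x. x \<in> {0..1} \<Longrightarrow> (\<lambda>\<omega>. G \<omega> x) \<in> borel_measurable gauss_space"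
    "\<And>S c. finite S \<Longrightarrow> S \<subseteq> {0..1} \<Longrightarrow> prob_space.cf gauss_space (\<lambda>\<omega>. \<Sum>x\<in>S. c x * G \<omega> x) = exp (- (\<Sum>x\<in>S. \<Sum>y\<in>S. c x * c y * K x y) / 2)"
    "\<And>\<omega> e :: real. e > 0 \<Longrightarrow> \<exists>m0. \<forall>m\<ge>m0. \<forall>x\<in>{0..1}. \<bar>G \<omega> x - step m (G \<omega>) x\<bar> \<le> e"
proof -
  interpret N: prob_space gauss_space by (rule prob_space_gauss)
  obtain Y :: "real \<Rightarrow> (real \<Rightarrow> real) \<Rightarrow> real" where Ym [measurable]: "\<And>d. Y d \<in> borel_measurable gauss_space"
    and Ycf: "\<And>(S :: real set) c \<phi>. finite S \<Longrightarrow> (\<And>x. x \<in> S \<Longrightarrow> \<phi> x \<in> dyadics) \<Longrightarrow>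
      N.cf (\<lambda>\<omega>. \<Sum>x\<in>S. c x * Y (\<phi> x) \<omega>) = exp (- (\<Sum>x\<in>S. \<Sum>y\<in>S. c x * c y * K (\<phi> x) (\<phi> y)) / 2)"
  proof (rule gaussian_on_countable[OF countable_dyadics infinite_dyadics, of K])
    show "K x y = K y x" if "x \<in> dyadics" "y \<in> dyadics" for x y
      using that dyadics_unit by (intro sym) auto
    show "0 \<le> (\<Sum>x\<in>S. \<Sum>y\<in>S. c x * c y * K x y)" if "finite S" "S \<subseteq> dyadics" for S c
      using that dyadics_unit by (intro psd) auto
  qed blast
  \<comment> \<open>With this choice 1 + 4 \<kappa> - 2 \<theta> = 1/2 - \<theta> < 0, so the union
    bounds over the levels are summable although the thresholds r^l tend to 0.\<close>
  define \<kappa> where "\<kappa> = (2 * \<theta> - 1) / 8"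
  have \<kappa>: "\<kappa> > 0" "1 + 4 * \<kappa> - 2 * \<theta> < 0" using \<theta> by (auto simp: \<kappa>_def field_simps)
  define r where "r = 2 powr (- \<kappa>)"
  have r: "0 < r" "r < 1" using \<kappa>(1) powr_less_mono[of "-\<kappa>" 0 2] by (auto simp: r_def)
  define A where "A = 2 powr (1 + 4 * \<kappa> - 2 * \<theta>)"
  have A: "0 \<le> A" "A < 1" using \<kappa> powr_less_mono[of "1 + 4 * \<kappa> - 2 * \<theta>" 0 2] by (auto simp: A_def)
  have tailY: "N.prob {\<omega>\<in>space gauss_space. e \<le> \<bar>Y t \<omega> - Y s \<omega>\<bar>} \<le> 12 * H\<^sup>2 * ((t - s) powr \<theta>)\<^sup>2 / e^4"
    if st: "s \<in> dyadics" "t \<in> dyadics" "s < t" and e: "e > 0" for s t e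
  proof -
    have u: "s \<in> {0..1}" "t \<in> {0..1}" using st dyadics_unit by auto
    define v where "v = K t t - 2 * K s t + K s s"
    have cfv: "N.cf (\<lambda>\<omega>. \<tau> * (Y t \<omega> - Y s \<omega>)) = exp (- (\<tau>\<^sup>2 * v) / 2)" for \<tau>
    proof -
      have "N.cf (\<lambda>\<omega>. \<Sum>x\<in>{s,t}. (if x = t then \<tau> else - \<tau>) * Y x \<omega>) =
        exp (- (\<Sum>x\<in>{s,t}. \<Sum>y\<in>{s,t}. (if x = t then \<tau> else - \<tau>) * (if y = t then \<tau> else - \<tau>) * K x y) / 2)"
        by (rule Ycf[of _ "\<lambda>x. x"]) (use st in auto)
      moreover have "(\<Sum>x\<in>{s,t}. (if x = t then \<tau> else - \<tau>) * Y x \<omega>) = \<tau> * (Y t \<omega> - Y s \<omega>)" for \<omega>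
        using st by (simp add: algebra_simps)
      moreover have "(\<Sum>x\<in>{s,t}. \<Sum>y\<in>{s,t}. (if x = t then \<tau> else - \<tau>) * (if y = t then \<tau> else - \<tau>) * K x y) = \<tau>\<^sup>2 * v"
        using st sym[OF u] by (simp add: v_def power2_eq_square algebra_simps)
      ultimately show ?thesis by simp
    qed
    have v0: "0 \<le> v"
    proof -
      have "0 \<le> (\<Sum>x\<in>{s,t}. \<Sum>y\<in>{s,t}. (if x = t then 1 else - 1) * (if y = t then 1 else - 1) * K x y)"
        by (rule psd) (use u in auto)
      then show ?thesis using st sym[OF u] by (simp add: v_def)
    qed
    \<comment> \<open>The variance of the increment is (K t t - K s t) + (K s s - K t s), two
      differences in the first argument.\<close>
    have "v \<le> 2 * (H * (t - s) powr \<theta>)"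
    proof -
      have "\<bar>K t t - K s t\<bar> \<le> H * \<bar>t - s\<bar> powr \<theta>" "\<bar>K s s - K t s\<bar> \<le> H * \<bar>s - t\<bar> powr \<theta>" by (intro H(2) u)+
      moreover have "K t s = K s t" by (rule sym[OF u(2,1)])
      moreover have "\<bar>t - s\<bar> = t - s" "\<bar>s - t\<bar> = t - s" using st by auto
      ultimately show ?thesis unfolding v_def by simp
    qed
    then have "v\<^sup>2 \<le> (2 * (H * (t - s) powr \<theta>))\<^sup>2" using v0 by (intro power_mono)
    then have "3 * v\<^sup>2 / e^4 \<le> 3 * (2 * (H * (t - s) powr \<theta>))\<^sup>2 / e^4" using e by (intro divide_right_mono) auto
    moreover have "N.prob {\<omega>\<in>space gauss_space. e \<le> \<bar>Y t \<omega> - Y s \<omega>\<bar>} \<le> 3 * v\<^sup>2 / e^4"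
      by (rule N.gaussian_tail[OF _ cfv v0 e]) measurable
    ultimately show ?thesis by (simp add: power_mult_distrib)
  qed
  have grid: "real j / 2^l \<in> dyadics" "(real j - 1) / 2^l \<in> dyadics" "(real j - 1) / 2^l < real j / 2^l" "real j / 2^l - (real j - 1) / 2^l = 1 / 2^l"
    if j: "j \<in> {1..2^l}" for j l :: nat
  proof -
    show "real j / 2^l \<in> dyadics" using j by (intro dyadic_in) auto
    have "real (j - 1) / 2^l \<in> dyadics" using j by (intro dyadic_in) auto
    then show "(real j - 1) / 2^l \<in> dyadics" using j by (simp add: of_nat_diff)
    show "(real j - 1) / 2^l < real j / 2^l" "real j / 2^l - (real j - 1) / 2^l = 1 / 2^l"
      by (auto simp: divide_strict_right_mono simp flip: diff_divide_distrib)
  qed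
  define bad where "bad l = {\<omega>\<in>space gauss_space. \<exists>j\<in>{1..2^l}. r^l \<le> \<bar>Y (real j / 2^l) \<omega> - Y ((real j - 1) / 2^l) \<omega>\<bar>}" for l
  have bad_meas [measurable]: "bad l \<in> sets gauss_space" for l unfolding bad_def by measurable
  have pbad: "N.prob (bad l) \<le> 12 * H\<^sup>2 * A ^ l" for l
  proof -
    define E where "E j = {\<omega>\<in>space gauss_space. r^l \<le> \<bar>Y (real j / 2^l) \<omega> - Y ((real j - 1) / 2^l) \<omega>\<bar>}" for j :: nat
    have Em: "E j \<in> sets gauss_space" for j unfolding E_def by measurable
    have "bad l = (\<Union>j\<in>{1..2^l}. E j)" by (auto simp: bad_def E_def)
    then have "N.prob (bad l) \<le> (\<Sum>j\<in>{1..2^l}. N.prob (E j))"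
      using N.finite_measure_subadditive_finite[of "{1..2^l}" E] Em by auto
    also have "\<dots> \<le> (\<Sum>j\<in>{1..2^l::nat}. 12 * H\<^sup>2 * ((1 / 2^l) powr \<theta>)\<^sup>2 / (r^l)^4)"
    proof (rule sum_mono)
      fix j assume "j \<in> {1..2^l::nat}"
      note g = grid[OF this]
      have rl: "r^l > 0" using r(1) by simp
      show "N.prob (E j) \<le> 12 * H\<^sup>2 * ((1 / 2^l) powr \<theta>)\<^sup>2 / (r^l)^4"
        using tailY[OF g(2,1,3) rl] unfolding g(4) E_def .
    qed
    also have "\<dots> = 12 * H\<^sup>2 * (2^l * ((1 / 2^l) powr \<theta>)\<^sup>2 * (1 / (r^l)^4))" by simp
    also have "2^l * ((1 / 2^l) powr \<theta>)\<^sup>2 * (1 / (r^l)^4) = A ^ l"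
    proof -
      have "(2::real) ^ l = 2 powr real l" by (simp add: powr_realpow)
      moreover have "1 / (r^l)^4 = 2 powr (4 * \<kappa> * real l)"
      proof -
        have "(r^l)^4 = r powr (real l * 4)" using r by (simp add: powr_realpow[symmetric] powr_powr flip: power_mult)
        then have "1 / (r^l)^4 = r powr (- (real l * 4))" by (simp add: powr_minus_divide)
        also have "\<dots> = 2 powr (4 * \<kappa> * real l)" unfolding r_def powr_powr by (simp add: mult_ac)
        finally show ?thesis .
      qed
      moreover have "((1 / 2 ^ l) powr \<theta>)\<^sup>2 = 2 powr (- (2 * \<theta> * real l))"
      proof -
        have "(1 / 2 ^ l) powr \<theta> = 2 powr (- (\<theta> * real l))"
          by (simp add: powr_divide powr_minus_divide powr_powr mult_ac flip: powr_realpow)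
        then show ?thesis by (simp add: power2_eq_square mult.assoc flip: powr_add)
      qed
      moreover have "A ^ l = 2 powr ((1 + 4 * \<kappa> - 2 * \<theta>) * real l)"
        by (simp add: A_def powr_powr flip: powr_realpow)
      ultimately show ?thesis by (simp add: algebra_simps flip: powr_add)
    qed
    finally show ?thesis .
  qed
  define reg where "reg \<omega> \<longleftrightarrow> (\<exists>m0. \<forall>l\<in>{m0..}. \<forall>j\<in>{1..2^l}. \<bar>Y (real j / 2^l) \<omega> - Y ((real j - 1) / 2^l) \<omega>\<bar> \<le> r^l)" for \<omega>
  have reg_meas [measurable]: "Measurable.pred gauss_space reg" unfolding reg_def[abs_def] by measurable
  have "AE \<omega> in gauss_space. \<forall>\<^sub>F l in sequentially. \<omega> \<in> space gauss_space - bad l"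
  proof (rule borel_cantelli_AE1)
    show "summable (\<lambda>l. N.prob (bad l))"
    proof (rule summable_comparison_test[of _ "\<lambda>l. 12 * H\<^sup>2 * A ^ l"])
      show "\<exists>N. \<forall>n\<ge>N. norm (N.prob (bad n)) \<le> 12 * H\<^sup>2 * A ^ n" using pbad by simp
      show "summable (\<lambda>l. 12 * H\<^sup>2 * A ^ l)" using A by (intro summable_mult summable_geometric) auto
    qed
  qed (auto simp: N.emeasure_eq_measure)
  then have AEreg: "AE \<omega> in gauss_space. reg \<omega>"
  proof (rule AE_mp, intro AE_I2 impI)
    fix \<omega> assume \<omega>: "\<omega> \<in> space gauss_space" and "\<forall>\<^sub>F l in sequentially. \<omega> \<in> space gauss_space - bad l"
    then obtain m0 where m0: "\<And>l. l \<ge> m0 \<Longrightarrow> \<omega> \<notin> bad l" by (auto simp: eventually_sequentially)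
    have "\<bar>Y (real j / 2^l) \<omega> - Y ((real j - 1) / 2^l) \<omega>\<bar> \<le> r^l" if "l \<ge> m0" "j \<in> {1..2^l}" for l j
    proof -
      have "\<not> r^l \<le> \<bar>Y (real j / 2^l) \<omega> - Y ((real j - 1) / 2^l) \<omega>\<bar>"
        using m0[OF that(1)] \<omega> that(2) unfolding bad_def by blast
      then show ?thesis by simp
    qed
    then show "reg \<omega>" unfolding reg_def by blast
  qed
  let ?f = "\<lambda>\<omega> d. Y d \<omega>"
  \<comment> \<open>On \<open>reg\<close>, an event of full measure, the steps converge. Elsewhere
    the zero path is used, so that all paths are cadlag and not merely almost all.\<close>
  define G where "G \<omega> x = (if reg \<omega> then lim (\<lambda>m. step m (?f \<omega>) x) else 0)" for \<omega> x
  define b where "b m = r ^ m / (1 - r)" for m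
  have b: "b \<longlonglongrightarrow> 0"
  proof -
    have "(\<lambda>m. r ^ m / (1 - r)) \<longlonglongrightarrow> 0 / (1 - r)" using r by (intro tendsto_intros LIMSEQ_realpow_zero) auto
    then show ?thesis by (simp add: b_def[abs_def])
  qed
  have b0: "b m \<ge> 0" for m using r by (simp add: b_def)
  have chain: "\<bar>step M (?f \<omega>) x - step m (?f \<omega>) x\<bar> \<le> b m"
    if m0: "\<And>l j. m0 \<le> l \<Longrightarrow> j \<in> {1..2^l} \<Longrightarrow> \<bar>Y (real j / 2^l) \<omega> - Y ((real j - 1) / 2^l) \<omega>\<bar> \<le> r^l"
      and m: "m0 \<le> m" "m \<le> M" and x: "x \<in> {0..1}" for \<omega> m0 m M x
  proof -
    have "\<bar>step M (?f \<omega>) x - step m (?f \<omega>) x\<bar> \<le> (\<Sum>l\<in>{m<..M}. r ^ l)"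
      by (rule step_chain[OF x m(2)]) (use m m0 r in auto)
    also have "\<dots> \<le> b m" unfolding b_def using r by (intro sum_geometric_tail_le) auto
    finally show ?thesis .
  qed
  have conv: "(\<lambda>m. step m (?f \<omega>) x) \<longlonglongrightarrow> G \<omega> x" if \<omega>: "reg \<omega>" and x: "x \<in> {0..1}" for \<omega> x
  proof -
    obtain m0 where m0: "\<And>l j. m0 \<le> l \<Longrightarrow> j \<in> {1..2^l} \<Longrightarrow> \<bar>Y (real j / 2^l) \<omega> - Y ((real j - 1) / 2^l) \<omega>\<bar> \<le> r^l"
      using \<omega> unfolding reg_def by blast
    have "Cauchy (\<lambda>m. step m (?f \<omega>) x)"
    proof (rule CauchyI')
      fix e :: real assume "0 < e"
      then have "\<forall>\<^sub>F m in sequentially. b m < e" using b by (intro order_tendstoD)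
      then obtain m1 where m1: "\<And>m. m \<ge> m1 \<Longrightarrow> b m < e" by (auto simp: eventually_sequentially)
      show "\<exists>M. \<forall>m\<ge>M. \<forall>n>m. dist (step m (?f \<omega>) x) (step n (?f \<omega>) x) < e"
      proof (intro exI[of _ "max m0 m1"] allI impI)
        fix m n assume mn: "max m0 m1 \<le> m" "m < n"
        have "\<bar>step n (?f \<omega>) x - step m (?f \<omega>) x\<bar> \<le> b m" by (rule chain[OF m0 _ _ x]) (use mn in auto)
        then show "dist (step m (?f \<omega>) x) (step n (?f \<omega>) x) < e" using m1[of m] mn by (simp add: dist_real_def abs_minus_commute)
      qed
    qed
    then have "convergent (\<lambda>m. step m (?f \<omega>) x)" by (rule Cauchy_convergent)
    then show ?thesis using \<omega> by (simp add: G_def convergent_LIMSEQ_iff)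
  qed
  have Gd: "G \<omega> d = Y d \<omega>" if \<omega>: "reg \<omega>" and d: "d \<in> dyadics" for \<omega> d
  proof -
    obtain l where l: "\<And>m. m \<ge> l \<Longrightarrow> step m (?f \<omega>) d = Y d \<omega>" using step_at_dyadic[OF d, of "?f \<omega>"] by blast
    have "(\<lambda>m. step m (?f \<omega>) d) \<longlonglongrightarrow> Y d \<omega>"
      by (rule tendsto_eventually) (auto simp: eventually_sequentially intro!: exI[of _ l] l)
    moreover have "d \<in> {0..1}" using d dyadics_unit by auto
    ultimately show ?thesis using LIMSEQ_unique conv[OF \<omega>] by blast
  qed
  have sG: "step m (G \<omega>) x = step m (?f \<omega>) x" if "reg \<omega>" "x \<in> {0..1}" for \<omega> m x
    unfolding step_eq[OF that(2)] by (rule Gd[OF that(1) floor_dyadic(1)[OF that(2)]])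
  have close: "\<bar>G \<omega> x - step m (?f \<omega>) x\<bar> \<le> b m"
    if m0: "\<And>l j. m0 \<le> l \<Longrightarrow> j \<in> {1..2^l} \<Longrightarrow> \<bar>Y (real j / 2^l) \<omega> - Y ((real j - 1) / 2^l) \<omega>\<bar> \<le> r^l"
      and m: "m0 \<le> m" and x: "x \<in> {0..1}" for \<omega> m0 m x
  proof -
    have reg: "reg \<omega>" unfolding reg_def using m0 by blast
    have "(\<lambda>M. \<bar>step M (?f \<omega>) x - step m (?f \<omega>) x\<bar>) \<longlonglongrightarrow> \<bar>G \<omega> x - step m (?f \<omega>) x\<bar>"
      by (intro tendsto_intros conv reg x)
    then show ?thesis
      by (rule LIMSEQ_le_const2) (intro exI[of _ m] allI impI chain[OF m0 m _ x])
  qed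
  show thesis
  proof (rule that[of G])
    show unif: "\<exists>m0. \<forall>m\<ge>m0. \<forall>x\<in>{0..1}. \<bar>G \<omega> x - step m (G \<omega>) x\<bar> \<le> e" if e: "e > 0" for \<omega> and e :: real
    proof (cases "reg \<omega>")
      case True
      then obtain m0 where m0: "\<And>l j. m0 \<le> l \<Longrightarrow> j \<in> {1..2^l} \<Longrightarrow> \<bar>Y (real j / 2^l) \<omega> - Y ((real j - 1) / 2^l) \<omega>\<bar> \<le> r^l"
        unfolding reg_def by blast
      have "\<forall>\<^sub>F m in sequentially. b m < e" using b e by (intro order_tendstoD)
      then obtain m1 where m1: "\<And>m. m \<ge> m1 \<Longrightarrow> b m < e" by (auto simp: eventually_sequentially)
      show ?thesis
      proof (intro exI[of _ "max m0 m1"] allI impI ballI)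
        fix m x assume m: "max m0 m1 \<le> m" and x: "x \<in> {0..1::real}"
        have "\<bar>G \<omega> x - step m (?f \<omega>) x\<bar> \<le> b m" by (rule close[OF m0 _ x]) (use m in auto)
        then show "\<bar>G \<omega> x - step m (G \<omega>) x\<bar> \<le> e" unfolding sG[OF True x] using m1[of m] m by simp
      qed
    next
      case False
      then show ?thesis using e by (auto simp: G_def step_def gridfun_def sample_def)
    qed
    show "cadlag01 (G \<omega>)" for \<omega>
    proof (cases "reg \<omega>")
      case False
      then have "G \<omega> = (\<lambda>_. 0)" by (auto simp: G_def)
      then show ?thesis by (auto simp: cadlag01_def)
    next
      case True
      then obtain m0 where m0: "\<And>l j. m0 \<le> l \<Longrightarrow> j \<in> {1..2^l} \<Longrightarrow> \<bar>Y (real j / 2^l) \<omega> - Y ((real j - 1) / 2^l) \<omega>\<bar> \<le> r^l"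
        unfolding reg_def by blast
      have mod: "\<bar>G \<omega> y - G \<omega> x\<bar> \<le> 2 * b m + r ^ m" if m: "m0 \<le> m" and x: "x \<in> {0..1}" and y: "y \<in> {0..1}" and xy: "x \<le> y" "y - x < 1 / 2^m" for x y m
      proof -
        have "\<bar>step m (?f \<omega>) y - step m (?f \<omega>) x\<bar> \<le> r ^ m"
          by (rule step_diff_cell[OF x y xy]) (use m0[OF m] r in auto)
        moreover have "\<bar>G \<omega> x - step m (?f \<omega>) x\<bar> \<le> b m" "\<bar>G \<omega> y - step m (?f \<omega>) y\<bar> \<le> b m"
          using close[OF m0 m x] close[OF m0 m y] by auto
        ultimately show ?thesis by linarith
      qed
      have lim0: "(\<lambda>m. 2 * b m + r ^ m) \<longlonglongrightarrow> 0"
      proof -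
        have "(\<lambda>m. 2 * b m + r ^ m) \<longlonglongrightarrow> 2 * 0 + 0" using r by (intro tendsto_intros b LIMSEQ_realpow_zero) auto
        then show ?thesis by simp
      qed
      have ex: "\<exists>m\<ge>m0. 2 * b m + r ^ m < e" if "e > 0" for e
      proof -
        have "\<forall>\<^sub>F m in sequentially. 2 * b m + r ^ m < e \<and> m \<ge> m0"
          using order_tendstoD(2)[OF lim0 that] eventually_ge_at_top[of m0] by eventually_elim simp
        then show ?thesis using eventually_happens[of _ sequentially] by force
      qed
      show ?thesis unfolding cadlag01_def
      proof (intro conjI ballI exI)
        fix t :: real assume t: "t \<in> {0..<1}"
        show "(G \<omega> \<longlongrightarrow> G \<omega> t) (at_right t)"
        proof (rule tendstoI)
          fix e :: real assume "0 < e"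
          then obtain m where m: "m \<ge> m0" "2 * b m + r ^ m < e" using ex by blast
          have "\<forall>\<^sub>F y in at_right t. y \<in> {t<..<min 1 (t + 1 / 2^m)}" using t by (intro eventually_at_right_real) auto
          then show "\<forall>\<^sub>F y in at_right t. dist (G \<omega> y) (G \<omega> t) < e"
          proof eventually_elim
            case (elim y)
            then have "\<bar>G \<omega> y - G \<omega> t\<bar> \<le> 2 * b m + r ^ m" using t by (intro mod[OF m(1)]) auto
            then show ?case using m(2) by (simp add: dist_real_def)
          qed
        qed
      next
        fix t :: real assume t: "t \<in> {0<..1}"
        show "(G \<omega> \<longlongrightarrow> G \<omega> t) (at_left t)"
        proof (rule tendstoI)
          fix e :: real assume "0 < e"
          then obtain m where m: "m \<ge> m0" "2 * b m + r ^ m < e" using ex by blast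
          have "\<forall>\<^sub>F y in at_left t. y \<in> {max 0 (t - 1 / 2^m)<..<t}" using t by (intro eventually_at_left_real) auto
          then show "\<forall>\<^sub>F y in at_left t. dist (G \<omega> y) (G \<omega> t) < e"
          proof eventually_elim
            case (elim y)
            then have "\<bar>G \<omega> t - G \<omega> y\<bar> \<le> 2 * b m + r ^ m" using t by (intro mod[OF m(1)]) auto
            then show ?case using m(2) by (simp add: dist_real_def abs_minus_commute)
          qed
        qed
      qed
    qed
    show Gm: "(\<lambda>\<omega>. G \<omega> x) \<in> borel_measurable gauss_space" if x: "x \<in> {0..1}" for x
    proof (rule borel_measurable_LIMSEQ_real)
      show "(\<lambda>m. if reg \<omega> then step m (?f \<omega>) x else 0) \<longlonglongrightarrow> G \<omega> x" for \<omega>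
        using conv[OF _ x, of \<omega>] by (cases "reg \<omega>") (simp_all only: if_True if_False, simp add: G_def)
      show "(\<lambda>\<omega>. if reg \<omega> then step m (?f \<omega>) x else 0) \<in> borel_measurable gauss_space" for m
        unfolding step_eq[OF x] by measurable
    qed
    fix S :: "real set" and c assume S: "finite S" "S \<subseteq> {0..1}"
    \<comment> \<open>The dyadic point at which \<open>step m\<close> evaluates. The joint
      characteristic functions of G are limits of those of Y at these points, and Hoelder continuity
      takes the covariances to the limit.\<close>
    define \<phi> where "\<phi> m x = \<lfloor>2^m * x\<rfloor> / 2^m" for m :: nat and x :: real
    have \<phi>d: "\<phi> m x \<in> dyadics" "\<bar>x - \<phi> m x\<bar> \<le> 1 / 2^m" if "x \<in> S" for m x
      unfolding \<phi>_def using floor_dyadic[of x m] that S by auto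
    have "(\<lambda>m. N.cf (\<lambda>\<omega>. \<Sum>x\<in>S. c x * Y (\<phi> m x) \<omega>)) \<longlonglongrightarrow> N.cf (\<lambda>\<omega>. \<Sum>x\<in>S. c x * G \<omega> x)"
    proof (rule N.cf_tendsto)
      show "(\<lambda>\<omega>. \<Sum>x\<in>S. c x * G \<omega> x) \<in> borel_measurable gauss_space"
        using S Gm by (intro borel_measurable_sum borel_measurable_times) auto
      show "AE \<omega> in gauss_space. (\<lambda>m. \<Sum>x\<in>S. c x * Y (\<phi> m x) \<omega>) \<longlonglongrightarrow> (\<Sum>x\<in>S. c x * G \<omega> x)"
        using AEreg
      proof (rule AE_mp, intro AE_I2 impI)
        fix \<omega> assume reg: "reg \<omega>"
        have "(\<lambda>m. Y (\<phi> m x) \<omega>) \<longlonglongrightarrow> G \<omega> x" if "x \<in> S" for x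
        proof -
          have x: "x \<in> {0..1}" using that S by auto
          show ?thesis using conv[OF reg x] unfolding step_eq[OF x] \<phi>_def .
        qed
        then show "(\<lambda>m. \<Sum>x\<in>S. c x * Y (\<phi> m x) \<omega>) \<longlonglongrightarrow> (\<Sum>x\<in>S. c x * G \<omega> x)" by (intro tendsto_intros)
      qed
    qed measurable
    moreover have "(\<lambda>m. N.cf (\<lambda>\<omega>. \<Sum>x\<in>S. c x * Y (\<phi> m x) \<omega>)) \<longlonglongrightarrow> complex_of_real (exp (- (\<Sum>x\<in>S. \<Sum>y\<in>S. c x * c y * K x y) / 2))"
    proof -
      have KT: "(\<lambda>m. K (\<phi> m x) (\<phi> m y)) \<longlonglongrightarrow> K x y" if xy: "x \<in> S" "y \<in> S" for x y
      proof (rule LIM_zero_cancel, rule Lim_null_comparison)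
        define B where "B m = H * (1 / 2^m) powr \<theta> + H * (1 / 2^m) powr \<theta>" for m :: nat
        show "\<forall>\<^sub>F m in sequentially. norm (K (\<phi> m x) (\<phi> m y) - K x y) \<le> B m"
        proof (rule always_eventually, rule allI)
          fix m
          have u: "x \<in> {0..1}" "y \<in> {0..1}" "\<phi> m x \<in> {0..1}" "\<phi> m y \<in> {0..1}" using xy S \<phi>d dyadics_unit by blast+
          have p: "\<bar>\<phi> m z - z\<bar> powr \<theta> \<le> (1 / 2^m) powr \<theta>" if "z \<in> S" for z
            using \<phi>d(2)[OF that, of m] \<theta> by (intro powr_mono2) (auto simp: abs_minus_commute)
          have "\<bar>K (\<phi> m x) (\<phi> m y) - K x (\<phi> m y)\<bar> \<le> H * \<bar>\<phi> m x - x\<bar> powr \<theta>" by (intro H(2) u)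
          also have "\<dots> \<le> H * (1 / 2^m) powr \<theta>" using p[OF xy(1)] H(1) by (rule mult_left_mono)
          finally have 1: "\<bar>K (\<phi> m x) (\<phi> m y) - K x (\<phi> m y)\<bar> \<le> H * (1 / 2^m) powr \<theta>" .
          have "\<bar>K (\<phi> m y) x - K y x\<bar> \<le> H * \<bar>\<phi> m y - y\<bar> powr \<theta>" by (intro H(2) u)
          also have "\<dots> \<le> H * (1 / 2^m) powr \<theta>" using p[OF xy(2)] H(1) by (rule mult_left_mono)
          finally have 2: "\<bar>K x (\<phi> m y) - K x y\<bar> \<le> H * (1 / 2^m) powr \<theta>" unfolding sym[OF u(1,4)] sym[OF u(1,2)] .
          show "norm (K (\<phi> m x) (\<phi> m y) - K x y) \<le> B m" using 1 2 unfolding B_def real_norm_def by linarith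
        qed
        have "(\<lambda>m. (1 / 2^m) powr \<theta>) = (\<lambda>m. ((1/2) powr \<theta>) ^ m)"
          by (rule ext) (simp add: powr_divide power_divide powr_powr mult.commute flip: powr_realpow)
        moreover have "(\<lambda>m. ((1/2) powr \<theta>) ^ m) \<longlonglongrightarrow> 0"
        proof (rule LIMSEQ_realpow_zero)
          have "(2::real) powr (- \<theta>) < 2 powr 0" using \<theta> by (intro powr_less_mono) auto
          then show "(1 / 2) powr \<theta> < 1" by (simp add: powr_divide powr_minus_divide)
        qed simp
        ultimately have "(\<lambda>m. (1 / 2^m) powr \<theta>) \<longlonglongrightarrow> 0" by simp
        then have "B \<longlonglongrightarrow> H * 0 + H * 0" unfolding B_def by (intro tendsto_intros)
        then show "B \<longlonglongrightarrow> 0" by simp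
      qed
      have "N.cf (\<lambda>\<omega>. \<Sum>x\<in>S. c x * Y (\<phi> m x) \<omega>) = complex_of_real (exp (- (\<Sum>x\<in>S. \<Sum>y\<in>S. c x * c y * K (\<phi> m x) (\<phi> m y)) / 2))" for m
        by (rule Ycf[OF S(1) \<phi>d(1)])
      moreover have "(\<lambda>m. complex_of_real (exp (- (\<Sum>x\<in>S. \<Sum>y\<in>S. c x * c y * K (\<phi> m x) (\<phi> m y)) / 2))) \<longlonglongrightarrow>
          complex_of_real (exp (- (\<Sum>x\<in>S. \<Sum>y\<in>S. c x * c y * K x y) / 2))"
        by (intro tendsto_intros KT) auto
      ultimately show ?thesis by simp
    qed
    ultimately show "N.cf (\<lambda>\<omega>. \<Sum>x\<in>S. c x * G \<omega> x) = exp (- (\<Sum>x\<in>S. \<Sum>y\<in>S. c x * c y * K x y) / 2)"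
      by (rule LIMSEQ_unique)
  qed
qed

section \<open>Convergence of the empirical process\<close>

lemma grid_sum:
  fixes f :: "real \<Rightarrow> real" and m :: nat
  defines "S \<equiv> (\<lambda>i. real i / 2^m) ` {..<Suc (2^m)}"
  shows "S \<subseteq> {0..1}" "finite S"
    "(\<Sum>i<Suc (2^m). c i * f (real i / 2^m)) = (\<Sum>x\<in>S. c (nat \<lfloor>2^m * x\<rfloor>) * f x)"
proof -
  show "finite S" unfolding S_def by simp
  show "S \<subseteq> {0..1}" unfolding S_def by (auto simp: divide_le_eq less_Suc_eq_le)
  have "inj_on (\<lambda>i. real i / 2^m) {..<Suc (2^m)}" by (auto simp: inj_on_def)
  then show "(\<Sum>i<Suc (2^m). c i * f (real i / 2^m)) = (\<Sum>x\<in>S. c (nat \<lfloor>2^m * x\<rfloor>) * f x)"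
    unfolding S_def by (simp add: sum.reindex)
qed

context uniform_process
begin

lemma emp_fidi_tendsto:
  assumes pq: "p > 1" "q > 1" "\<alpha> = p + q" and N: "prob_space N"
    and G: "\<And>S c. finite S \<Longrightarrow> S \<subseteq> {0..1} \<Longrightarrow> prob_space.cf N (\<lambda>\<omega>. \<Sum>x\<in>S. c x * G \<omega> x) = exp (- Kvar S c / 2)"
  shows "(\<lambda>n. cf (\<lambda>\<omega>. \<Sum>i<Suc (2^m). c i * Z n \<omega> (real i / 2^m)))
    \<longlonglongrightarrow> prob_space.cf N (\<lambda>\<omega>. \<Sum>i<Suc (2^m). c i * G \<omega> (real i / 2^m))"
proof -
  define S where "S = (\<lambda>i. real i / 2^m) ` {..<Suc (2^m)}"
  define c' where "c' x = c (nat \<lfloor>2^m * x\<rfloor>)" for x :: real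
  note S = grid_sum(1,2)[where m=m, folded S_def] grid_sum(3)[where m=m and c=c, folded S_def c'_def]
  show ?thesis
    unfolding S(3) emp_linear[OF S(1)] G[OF S(2,1)] by (rule clt_linear[OF pq S(1)])
qed

lemma emp_weak_conv:
  assumes \<alpha>: "\<alpha> > (5 + sqrt 17) / 4"
  shows "\<exists>(N :: (real \<Rightarrow> real) measure) G. prob_space N \<and> (\<forall>\<omega>. cadlag01 (G \<omega>)) \<and>
    centered_gaussian_process N G Kcov \<and> weak_conv_D M (emp_proc M X) N G"
proof -
  obtain p q \<theta> b \<kappa> where pq: "p > 1" "q > 1" "\<alpha> = p + q" and \<theta>: "1/2 < \<theta>" "\<theta> < 1" "\<alpha> * (1 - \<theta>) > 1"
    using exponent_choice[OF \<alpha>] by metis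
  have \<alpha>1: "\<alpha> > 1" and \<theta>0: "0 < \<theta>" using pq \<theta> by auto
  obtain H where H: "H \<ge> 0"
    "\<And>x x' y. x \<in> {0..1} \<Longrightarrow> x' \<in> {0..1} \<Longrightarrow> y \<in> {0..1} \<Longrightarrow> \<bar>Kcov x y - Kcov x' y\<bar> \<le> H * \<bar>x - x'\<bar> powr \<theta>"
    using Kcov_holder[OF \<theta>0 \<theta>(2,3) \<alpha>1] by blast
  have psd: "0 \<le> (\<Sum>x\<in>S. \<Sum>y\<in>S. c x * c y * Kcov x y)" if "finite S" "S \<subseteq> {0..1}" for S c
    using Kvar_nonneg[OF \<alpha>1 that(2)] unfolding Kvar_def .
  obtain G :: "(real \<Rightarrow> real) \<Rightarrow> real \<Rightarrow> real" where G: "\<And>\<omega>. cadlag01 (G \<omega>)"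
    "\<And>x. x \<in> {0..1} \<Longrightarrow> (\<lambda>\<omega>. G \<omega> x) \<in> borel_measurable gauss_space"
    "\<And>S c. finite S \<Longrightarrow> S \<subseteq> {0..1} \<Longrightarrow> prob_space.cf gauss_space (\<lambda>\<omega>. \<Sum>x\<in>S. c x * G \<omega> x) = exp (- (\<Sum>x\<in>S. \<Sum>y\<in>S. c x * c y * Kcov x y) / 2)"
    "\<And>\<omega> e :: real. e > 0 \<Longrightarrow> \<exists>m0. \<forall>m\<ge>m0. \<forall>x\<in>{0..1}. \<bar>G \<omega> x - step m (G \<omega>) x\<bar> \<le> e"
    using gaussian_process_exists[of \<theta> Kcov H, OF \<theta>(1) Kcov_sym[OF \<alpha>1] psd H] by blast
  interpret N: prob_space gauss_space by (rule prob_space_gauss)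
  have Gcf: "N.cf (\<lambda>\<omega>. \<Sum>x\<in>S. c x * G \<omega> x) = exp (- Kvar S c / 2)" if "finite S" "S \<subseteq> {0..1}" for S c
    unfolding Kvar_def by (rule G(3)[OF that])
  have "centered_gaussian_process gauss_space G Kcov"
    unfolding centered_gaussian_process_def
  proof (intro conjI ballI allI impI)
    fix S :: "real set" and c t assume S: "finite S" "S \<subseteq> {0..1}"
    have "(\<lambda>\<omega>. \<Sum>x\<in>S. c x * G \<omega> x) \<in> borel_measurable gauss_space"
      using S G(2) by (intro borel_measurable_sum borel_measurable_times) auto
    then have "char (distr gauss_space borel (\<lambda>\<omega>. \<Sum>x\<in>S. c x * G \<omega> x)) t = N.cf (\<lambda>\<omega>. t * (\<Sum>x\<in>S. c x * G \<omega> x))"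
      by (rule N.cf_char)
    also have "(\<lambda>\<omega>. t * (\<Sum>x\<in>S. c x * G \<omega> x)) = (\<lambda>\<omega>. \<Sum>x\<in>S. t * c x * G \<omega> x)"
      by (simp add: sum_distrib_left mult.assoc)
    also have "N.cf \<dots> = exp (- Kvar S (\<lambda>x. t * c x) / 2)" by (rule Gcf[OF S])
    also have "Kvar S (\<lambda>x. t * c x) = t\<^sup>2 * (\<Sum>x\<in>S. \<Sum>y\<in>S. c x * c y * Kcov x y)"
      by (simp add: Kvar_def sum_distrib_left power2_eq_square mult_ac)
    finally show "char (distr gauss_space borel (\<lambda>\<omega>. \<Sum>x\<in>S. c x * G \<omega> x)) t
        = complex_of_real (exp (- (t\<^sup>2 / 2) * (\<Sum>x\<in>S. \<Sum>y\<in>S. c x * c y * Kcov x y)))" by simp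
  qed (rule G(2))
  moreover have "weak_conv_D M (emp_proc M X) gauss_space G"
  proof (rule weak_conv_D_criterion)
    fix x \<delta> :: real assume x: "x \<in> {0..1}" and \<delta>: "\<delta> > 0"
    obtain A0 where A0: "A0 > 0" "\<And>A n. A \<ge> A0 \<Longrightarrow> prob {\<omega>\<in>space M. \<bar>Z n \<omega> x\<bar> > A} \<le> \<delta>"
      using emp_tight[OF \<alpha>1 x \<delta>] by blast
    define v where "v = Kvar {x} (\<lambda>_. 1)"
    have v: "v \<ge> 0" unfolding v_def using x by (intro Kvar_nonneg \<alpha>1) auto
    have ch: "N.cf (\<lambda>\<omega>. t * G \<omega> x) = exp (- (t\<^sup>2 * v) / 2)" for t
      using Gcf[of "{x}" "\<lambda>_. t"] x by (simp add: v_def Kvar_def power2_eq_square)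
    \<comment> \<open>A \<ge> 1 replaces the fourth power in the Gaussian tail by A, so A \<ge> 3
      v^2 / \<delta> suffices for the limit; A \<ge> A0 serves the empirical process.\<close>
    define A where "A = max A0 (max 1 (3 * v\<^sup>2 / \<delta>))"
    have A: "A \<ge> A0" "A \<ge> 1" "A \<ge> 3 * v\<^sup>2 / \<delta>" by (auto simp: A_def)
    have Gx: "(\<lambda>\<omega>. G \<omega> x) \<in> borel_measurable gauss_space" by (rule G(2)[OF x])
    have "N.prob {\<omega>\<in>space gauss_space. \<bar>G \<omega> x\<bar> > A} \<le> N.prob {\<omega>\<in>space gauss_space. A \<le> \<bar>G \<omega> x\<bar>}"
      using Gx by (intro N.finite_measure_mono) auto
    also have "\<dots> \<le> 3 * v\<^sup>2 / A^4" using A by (intro N.gaussian_tail[OF Gx ch v]) auto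
    also have "\<dots> \<le> \<delta>"
    proof -
      have "3 * v\<^sup>2 \<le> \<delta> * A" using A(3) \<delta> by (simp add: field_simps)
      also have "\<dots> \<le> \<delta> * A^4" using A(2) \<delta> self_le_power[of A 4] by simp
      finally show ?thesis using A(2) by (simp add: divide_le_eq)
    qed
    finally show "\<exists>A>0. (\<forall>n. prob {\<omega>\<in>space M. \<bar>Z n \<omega> x\<bar> > A} \<le> \<delta>) \<and> N.prob {\<omega>\<in>space gauss_space. \<bar>G \<omega> x\<bar> > A} \<le> \<delta>"
      using A0(2)[OF A(1)] A(2) by (intro exI[of _ A]) auto
  next
    fix \<epsilon> :: real assume "\<epsilon> > 0"
    then show "\<exists>m0. \<forall>m\<ge>m0. \<exists>n0. \<forall>n\<ge>n0. \<exists>A\<in>sets M. measure M A \<le> \<epsilon> \<and>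
        (\<forall>\<omega>\<in>space M - A. \<forall>x\<in>{0..1}. \<bar>Z n \<omega> x - step m (Z n \<omega>) x\<bar> \<le> \<epsilon>)"
      by (rule emp_equicontinuous[OF \<alpha>])
  next
    fix \<omega> and e :: real assume "e > 0"
    then show "\<exists>m0. \<forall>m\<ge>m0. \<forall>x\<in>{0..1}. \<bar>G \<omega> x - step m (G \<omega>) x\<bar> \<le> e" by (rule G(4))
  next
    show "(\<lambda>n. cf (\<lambda>\<omega>. \<Sum>i<Suc (2^m). c i * Z n \<omega> (real i / 2^m)))
        \<longlonglongrightarrow> N.cf (\<lambda>\<omega>. \<Sum>i<Suc (2^m). c i * G \<omega> (real i / 2^m))" for m c
      by (rule emp_fidi_tendsto[OF pq N.prob_space_axioms Gcf])
  qed (fact prob_space_axioms N.prob_space_axioms cadlag_emp G(1,2) emp_measurable emp_functional_measurable)+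
  ultimately show ?thesis using N.prob_space_axioms G(1) by blast
qed

end

theorem theorem1:
  fixes M :: "'a measure" and X :: "int \<Rightarrow> 'a \<Rightarrow> real" and C \<alpha> :: real
  assumes "prob_space M"
    and "\<And>k. X k \<in> borel_measurable M"
    and "\<And>k. distr M borel (X k) = uniform_measure lborel {0..1}"
    and "strictly_stationary M X"
    and "associated M X"
    and SI: "\<And>k l. k \<noteq> l \<Longrightarrow> stoch_increasing M (X k) (X l)"
    and "C > 0" and "\<alpha> > (5 + sqrt 17) / 4"
    and "\<And>k::nat. k \<ge> 1 \<Longrightarrow> cov M (X 0) (X (int k)) \<le> C * real k powr (- \<alpha>)"
  shows "\<exists>(N :: (real \<Rightarrow> real) measure) G.
     prob_space N \<and> (\<forall>\<omega>. cadlag01 (G \<omega>)) \<and>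
     (\<forall>x\<in>{0..1}. \<forall>y\<in>{0..1}.
        (\<lambda>k. cov M (\<lambda>\<omega>. ind (X 0 \<omega> \<le> x)) (\<lambda>\<omega>. ind (X k \<omega> \<le> y))) summable_on UNIV) \<and>
     centered_gaussian_process N G
       (\<lambda>x y. \<Sum>\<^sub>\<infinity>k::int. cov M (\<lambda>\<omega>. ind (X 0 \<omega> \<le> x)) (\<lambda>\<omega>. ind (X k \<omega> \<le> y))) \<and>
     weak_conv_D M (emp_proc M X) N G"
proof -
  interpret prob_space M by fact
  interpret uniform_process M X C \<alpha> by unfold_locales fact+
  have \<alpha>: "\<alpha> > 1" using assms(8) real_sqrt_ge_zero[of 17] by argo
  obtain N :: "(real \<Rightarrow> real) measure" and G where "prob_space N" "\<forall>\<omega>. cadlag01 (G \<omega>)"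
    "centered_gaussian_process N G Kcov" "weak_conv_D M (emp_proc M X) N G"
    using emp_weak_conv[OF assms(8)] by blast
  then show ?thesis
    using summable_cov_ind[OF \<alpha>] unfolding Kcov_def[abs_def] by (intro exI[of _ N] exI[of _ G] conjI ballI) auto
qed

end
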